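(* Let $m,n\ge 1$ and $1\le k\le m$ be integers, and let $\Delta\subset\mathbb{R}^m$ be the unit simplex. Define $$F_n:\mathbb{R}^m\to\mathbb{R},\qquad F_n(\rho)=\int_{\Delta^n}\max_{j=1,\dots,n}\Bigl[\langle\rho,\lambda^j\rangle-\bigl\langle\widehat{\lambda^j},\log\widehat{\lambda^j}\bigr\rangle\Bigr]\,d\lambda^1\cdots d\lambda^n .$$ Then $F_n\in\mathcal{C}^2(\mathbb{R}^m)$, and thus, regarding $F_n$ as a function of $z\in(\mathbb{C}^* )^m$ through $\rho=\rho(z)$, the distribution (current) on $(\mathbb{C}^* )^m$ $$\left(\frac{i}{2\pi}\partial\bar\partial F_n\right)^k$$ is a $(k,k)$-form with continuous coefficients. In particular, when $k=m$, this distribution is given by $$m!\,\det\left(\frac{1}{2\pi}\frac{\partial^2F_n}{\partial\rho_i\partial\rho_j}\right)_{1\le i,j\le m}\,d\rho\,d\theta,$$ which has a continuous density with respect to Lebesgue measure on $(\mathbb{C}^* )^m$.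
   Context: $\Delta=\{\lambda\in\mathbb{R}^m: \lambda_1,\dots,\lambda_m\ge 0,\ |\lambda|\le 1\}$, where $|\lambda|=\lambda_1+\dots+\lambda_m$. For $\lambda\in\Delta$, $\hat\lambda=(1-|\lambda|,\lambda_1,\dots,\lambda_m)\in\mathbb{R}^{m+1}$ and $\log\hat\lambda=(\log(1-|\lambda|),\log\lambda_1,\dots,\log\lambda_m)$, so $\langle\hat\lambda,\log\hat\lambda\rangle=(1-|\lambda|)\log(1-|\lambda|)+\sum_{i=1}^m\lambda_i\log\lambda_i$, with the convention $0\log 0=0$. The measure on $\Delta$ is the probability measure $d\lambda=m!\,d\lambda_1\cdots d\lambda_m$ (normalized Lebesgue measure); a point of $\Delta^n$ is written $(\lambda^1,\dots,\lambda^n)$ with $\lambda^j\in\Delta$. Points $z\in(\mathbb{C}^* )^m$ are written $z=(e^{\rho_1/2+i\theta_1},\dots,e^{\rho_m/2+i\theta_m})$ with $\rho_j=\log|z_j|^2\in\mathbb{R}$ and $\theta_j\in\mathbb{R}/2\pi\mathbb{Z}$; $d\rho\,d\theta=\prod_{j=1}^m d\rho_j\,d\theta_j$, i.e. the volume form $d\rho_1\wedge d\theta_1\wedge\dots\wedge d\rho_m\wedge d\theta_m$. *)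

theory Defs
  imports "HOL-Analysis.Analysis"
begin

definition unit_simplex :: "(real ^ 'm) set" where
  "unit_simplex = {l. (\<forall>i. 0 \<le> l $ i) \<and> (\<Sum>i\<in>UNIV. l $ i) \<le> 1}"

definition hat :: "real ^ 'm \<Rightarrow> real ^ ('m option)" where
  "hat l = (\<chi> i. case i of None \<Rightarrow> 1 - (\<Sum>j\<in>UNIV. l $ j) | Some j \<Rightarrow> l $ j)"

text \<open>The convention \<open>0 log 0 = 0\<close> needs no case distinction, these logarithms only occur as factors in
  \<open>x * ln x\<close>.\<close>

definition log_vec :: "real ^ 'i \<Rightarrow> real ^ 'i" where
  "log_vec x = (\<chi> i. ln (x $ i))"

definition simplex_measure :: "(real ^ 'm) measure" where
  "simplex_measure = density lborel (\<lambda>l. ennreal (fact CARD('m)) * indicator unit_simplex l)"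

definition F :: "nat \<Rightarrow> real ^ 'm \<Rightarrow> real" where
  "F n \<rho> = (LINT l | Pi\<^sub>M {1..n} (\<lambda>_. simplex_measure).
     Max ((\<lambda>j. \<rho> \<bullet> l j - hat (l j) \<bullet> log_vec (hat (l j))) ` {1..n}))"

text \<open>Meant for open \<open>S\<close>, where it is the usual notion of class \<open>C\<close> to the order \<open>k\<close>.\<close>

fun Ck_on :: "nat \<Rightarrow> 'a::euclidean_space set \<Rightarrow> ('a \<Rightarrow> 'b::real_normed_vector) \<Rightarrow> bool" where
  "Ck_on 0 S f \<longleftrightarrow> continuous_on S f"
| "Ck_on (Suc k) S f \<longleftrightarrow> (\<forall>x\<in>S. f differentiable (at x)) \<and>
     (\<forall>v. Ck_on k S (\<lambda>x. frechet_derivative f (at x) v))"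

definition smooth_on :: "'a::euclidean_space set \<Rightarrow> ('a \<Rightarrow> 'b::real_normed_vector) \<Rightarrow> bool" where
  "smooth_on S f \<longleftrightarrow> (\<forall>k. Ck_on k S f)"

definition partial :: "'m \<Rightarrow> (real ^ 'm \<Rightarrow> real) \<Rightarrow> real ^ 'm \<Rightarrow> real" where
  "partial i f x = frechet_derivative f (at x) (axis i 1)"

definition hessian :: "(real ^ 'm \<Rightarrow> real) \<Rightarrow> real ^ 'm \<Rightarrow> real ^ 'm ^ 'm" where
  "hessian f x = (\<chi> i j. partial i (partial j f) x)"

definition torus :: "(complex ^ 'm) set" where
  "torus = {z. \<forall>j. z $ j \<noteq> 0}"

definition rho :: "complex ^ 'm \<Rightarrow> real ^ 'm" where
  "rho z = (\<chi> j. ln ((cmod (z $ j))\<^sup>2))"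

definition torus_point :: "real ^ 'm \<Rightarrow> real ^ 'm \<Rightarrow> complex ^ 'm" where
  "torus_point \<rho> \<theta> = (\<chi> j. exp (complex_of_real (\<rho> $ j / 2) + \<i> * complex_of_real (\<theta> $ j)))"

text \<open>A fundamental domain for the angular coordinates in \<open>(\<real> / 2\<pi>\<int>)\<close> to the power \<open>m\<close>.\<close>

definition angle_domain :: "(real ^ 'm) set" where
  "angle_domain = {\<theta>. \<forall>j. 0 \<le> \<theta> $ j \<and> \<theta> $ j < 2 * pi}"

text \<open>
  The complexified exterior algebra of the dual of \<open>\<complex>\<close> to the power \<open>m\<close>. The generator
  \<open>(j, False)\<close> stands for \<open>dz\<^sub>j\<close> and \<open>(j, True)\<close> for its conjugate. An element is the family of
  its coefficients with respect to the monomials indexed by sets \<open>S\<close> of generators, where the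
  factors of a monomial are multiplied in increasing order for \<open>before\<close>. The top monomial is thus
  the product of all \<open>dz\<^sub>j \<and> d\<zeta>\<^sub>j\<close>, with \<open>\<zeta>\<^sub>j\<close> the conjugate of \<open>z\<^sub>j\<close>.
\<close>

type_synonym 'm covector = "('m \<times> bool) set \<Rightarrow> complex"
type_synonym 'm dform = "complex ^ 'm \<Rightarrow> 'm covector"

definition before :: "'m::linorder \<times> bool \<Rightarrow> 'm \<times> bool \<Rightarrow> bool" where
  "before a b \<longleftrightarrow> fst a < fst b \<or> fst a = fst b \<and> \<not> snd a \<and> snd b"

text \<open>The sign of the permutation that sorts the concatenation of the monomials \<open>A\<close> and \<open>B\<close>.\<close>

definition shuffle_sign :: "('m::{finite,linorder} \<times> bool) set \<Rightarrow> ('m \<times> bool) set \<Rightarrow> complex" where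
  "shuffle_sign A B = (-1) ^ card {(a, b). a \<in> A \<and> b \<in> B \<and> before b a}"

definition wedge :: "'m::{finite,linorder} covector \<Rightarrow> 'm covector \<Rightarrow> 'm covector" where
  "wedge \<alpha> \<beta> S = (\<Sum>A\<in>Pow S. shuffle_sign A (S - A) * \<alpha> A * \<beta> (S - A))"

definition scalar :: "complex \<Rightarrow> 'm covector" where
  "scalar c S = (if S = {} then c else 0)"

fun wedge_power :: "nat \<Rightarrow> 'm::{finite,linorder} covector \<Rightarrow> 'm covector" where
  "wedge_power 0 \<alpha> = scalar 1"
| "wedge_power (Suc k) \<alpha> = wedge \<alpha> (wedge_power k \<alpha>)"

definition dz :: "'m \<Rightarrow> 'm covector" where
  "dz j S = (if S = {(j, False)} then 1 else 0)"

definition dzbar :: "'m \<Rightarrow> 'm covector" where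
  "dzbar j S = (if S = {(j, True)} then 1 else 0)"

text \<open>Wirtinger derivatives; \<open>axis j 1\<close> and \<open>axis j \<i>\<close> are the real coordinate directions.\<close>

definition wirt :: "'m \<Rightarrow> (complex ^ 'm \<Rightarrow> complex) \<Rightarrow> complex ^ 'm \<Rightarrow> complex" where
  "wirt j f z = (frechet_derivative f (at z) (axis j 1)
     - \<i> * frechet_derivative f (at z) (axis j \<i>)) / 2"

definition wirt_bar :: "'m \<Rightarrow> (complex ^ 'm \<Rightarrow> complex) \<Rightarrow> complex ^ 'm \<Rightarrow> complex" where
  "wirt_bar j f z = (frechet_derivative f (at z) (axis j 1)
     + \<i> * frechet_derivative f (at z) (axis j \<i>)) / 2"

definition del :: "'m::{finite,linorder} dform \<Rightarrow> 'm dform" where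
  "del \<alpha> z S = (\<Sum>j\<in>UNIV. wedge (dz j) (\<lambda>A. wirt j (\<lambda>w. \<alpha> w A) z) S)"

definition delbar :: "'m::{finite,linorder} dform \<Rightarrow> 'm dform" where
  "delbar \<alpha> z S = (\<Sum>j\<in>UNIV. wedge (dzbar j) (\<lambda>A. wirt_bar j (\<lambda>w. \<alpha> w A) z) S)"

definition ddc :: "'m::{finite,linorder} dform \<Rightarrow> 'm dform" where
  "ddc \<alpha> z S = \<i> / (2 * complex_of_real pi) * del (delbar \<alpha>) z S"

definition function_form :: "(complex ^ 'm \<Rightarrow> real) \<Rightarrow> 'm dform" where
  "function_form u z = scalar (complex_of_real (u z))"

definition continuous_form_on :: "(complex ^ 'm) set \<Rightarrow> nat \<Rightarrow> nat \<Rightarrow> 'm dform \<Rightarrow> bool" where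
  "continuous_form_on U p q \<alpha> \<longleftrightarrow>
     (\<forall>S. continuous_on U (\<lambda>z. \<alpha> z S)) \<and>
     (\<forall>z\<in>U. \<forall>S. \<alpha> z S \<noteq> 0 \<longrightarrow> card {j. (j, False) \<in> S} = p \<and> card {j. (j, True) \<in> S} = q)"

text \<open>
  A current is a functional on test forms. Test forms of all degrees are admitted, a current of
  bidegree \<open>(k,k)\<close> being zero on those whose component of bidegree \<open>(m-k,m-k)\<close> vanishes.
\<close>

definition supported_in :: "(complex ^ 'm) set \<Rightarrow> 'm dform \<Rightarrow> bool" where
  "supported_in K \<phi> \<longleftrightarrow> (\<forall>z. z \<notin> K \<longrightarrow> (\<forall>S. \<phi> z S = 0))"

definition test_form :: "'m::finite dform \<Rightarrow> bool" where
  "test_form \<phi> \<longleftrightarrow> (\<forall>S. smooth_on torus (\<lambda>z. \<phi> z S)) \<and>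
     (\<exists>K. compact K \<and> K \<subseteq> torus \<and> supported_in K \<phi>)"

text \<open>
  The factor comes from \<open>dz\<^sub>j \<and> d\<zeta>\<^sub>j = -2\<i> dx\<^sub>j \<and> dy\<^sub>j\<close>, again with \<open>\<zeta>\<^sub>j\<close> the conjugate of \<open>z\<^sub>j\<close>, and
  the standard orientation. Only the component of top degree contributes.
\<close>

definition integral_form :: "'m::finite dform \<Rightarrow> complex" where
  "integral_form \<beta> = (-2 * \<i>) ^ CARD('m) * (LINT z : torus | lborel. \<beta> z UNIV)"

definition form_current :: "'m::{finite,linorder} dform \<Rightarrow> 'm dform \<Rightarrow> complex" where
  "form_current \<alpha> \<phi> = integral_form (\<lambda>z. wedge (\<alpha> z) (\<phi> z))"

text \<open>
  The extension of a current of order zero to forms with continuous, compactly supported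
  coefficients, by continuity along uniform limits with supports in a fixed compact set.
\<close>

definition order0_extension :: "('m::finite dform \<Rightarrow> complex) \<Rightarrow> 'm dform \<Rightarrow> complex" where
  "order0_extension T \<psi> = (THE c. \<forall>\<phi> K.
     (\<forall>i::nat. test_form (\<phi> i) \<and> supported_in K (\<phi> i)) \<and> compact K \<and> K \<subseteq> torus \<and>
     (\<forall>S. uniform_limit UNIV (\<lambda>i z. \<phi> i z S) (\<lambda>z. \<psi> z S) sequentially)
     \<longrightarrow> (\<lambda>i. T (\<phi> i)) \<longlonglongrightarrow> c)"

text \<open>
  The powers of the current \<open>ddc u\<close> for continuous plurisubharmonic \<open>u\<close>, after Bedford and
  Taylor: the \<open>(k+1)\<close>-st power is \<open>ddc (u T)\<close> in the sense of currents, \<open>T\<close> being the \<open>k\<close>-th power,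
  which has order zero. No sign occurs in the duality because \<open>T\<close> has even degree.
\<close>

fun ddc_power :: "(complex ^ 'm::{finite,linorder} \<Rightarrow> real) \<Rightarrow> nat \<Rightarrow> 'm dform \<Rightarrow> complex" where
  "ddc_power u 0 \<phi> = integral_form \<phi>"
| "ddc_power u (Suc k) \<phi> =
     order0_extension (ddc_power u k) (\<lambda>z S. complex_of_real (u z) * ddc \<phi> z S)"

end

theory Submission
  imports Defs "HOL-Probability.Probability"
begin

text \<open>
  Write \<open>potential \<rho> l\<close> for the expression under the maximum, that is for the linear function with slope
  \<open>\<rho>\<close> plus the entropy of \<open>l\<close>. This is a strictly concave function of \<open>l\<close>, and \<open>F n \<rho>\<close> is the expected
  maximum of its values at \<open>n\<close> independent uniform points of the simplex.

  The regularity of \<open>F n\<close> comes from the concavity. Almost surely the maximum is attained at one sample only, and its gradient in \<open>\<rho>\<close> is that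
  sample. A sample \<open>l\<close> wins if the other \<open>n - 1\<close> avoid the superlevel set of \<open>potential \<rho>\<close> through \<open>l\<close>. If
  \<open>upper_volume \<rho> l\<close> denotes the volume of this set, the gradient of \<open>F n\<close> is therefore \<open>n\<close> times the mean of
  \<open>(1 - upper_volume \<rho> l) ^ (n - 1) *\<^sub>R l\<close> (\<open>F_has_gradient\<close>), and one more derivative has to be found for the
  volume of a convex set that varies with \<open>\<rho>\<close>. In polar coordinates around \<open>l\<close> the superlevel set meets the ray
  in direction \<open>y\<close> in a chord that starts at \<open>l\<close>, and its length depends on \<open>\<rho>\<close> only through the number
  \<open>\<rho> \<bullet> y\<close>. Along each ray the second derivative of the entropy is at most \<open>- (norm y)\<^sup>2\<close> in the whole
  interior of the simplex. Hence the length of the chord is a Lipschitz function of \<open>\<rho> \<bullet> y\<close>, with one constant for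
  all \<open>y\<close> of norm at least \<open>1\<close>, and it is continuously differentiable except at two values: where the chord appears, and where it
  reaches the boundary (\<open>chord_length_C1\<close>). For a given \<open>\<rho>\<close> these values are met for almost no pair
  of \<open>l\<close> and \<open>y\<close> (\<open>AE_regular\<close>), since along a line a strictly concave function takes a value at most twice
  and a slope at most once. Dominated convergence, first over \<open>y\<close> and then over \<open>l\<close>, gives the second
  derivatives, their continuity, and global bounds for the first and the second derivatives (\<open>F_C2_data\<close>).

  For the powers of the current, let \<open>u z = f (rho z)\<close> with \<open>f\<close> of class \<open>C\<^sup>2\<close>. The form \<open>dd\<^sup>c u\<close> is
  \<open>curvature H\<close>, where \<open>H\<close> is the Hessian of \<open>f\<close>. The powers of the current are defined by duality, so they
  agree with the powers of this form if moving \<open>dd\<^sup>c\<close> from the test form to \<open>u\<close> does not change the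
  integral. If \<open>f\<close> is of class \<open>C\<^sup>3\<close> this is integration by parts, as the powers of \<open>curvature H\<close> are closed
  (\<open>curvature_power_closed\<close>). In general \<open>f\<close> is mollified. The identity contains \<open>f\<close> and its second
  derivatives only, so it survives the limit (\<open>parts_defect_integral\<close>). The extension of a current of order
  zero is evaluated by uniform approximation of \<open>u\<close> by polynomials (\<open>order0_extension_form_current\<close>).

  The formula for the top power is algebra and a change of variables. Even forms commute, and the \<open>m\<close>-th power of a combination of the products
  \<open>dz\<^sub>a \<and> d\<zeta>\<^sub>b\<close> is \<open>m!\<close> times the determinant of its coefficients times the volume form
  (\<open>pair_matrix_top_power\<close>). In the coordinates \<open>\<rho>\<close> and \<open>\<theta>\<close> the factors \<open>1 / \<bar>z\<^sub>j\<bar>\<^sup>2\<close> of the coefficients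
  cancel against the Jacobian determinant (\<open>integral_polar_coordinates\<close>, \<open>top_form_polar\<close>).
\<close>

section \<open>Chords of strongly concave functions on an interval\<close>

lemma downward_closed_measure:
  fixes P :: "real set"
  assumes P: "P \<subseteq> {0<..T}" and T: "0 \<le> T" and down: "\<And>a b. b \<in> P \<Longrightarrow> 0 < a \<Longrightarrow> a < b \<Longrightarrow> a \<in> P"
  shows "{0<..<measure lborel P} \<subseteq> P" "P \<subseteq> {0<..measure lborel P}" "P \<in> sets borel"
    "measure lborel P \<le> T"
proof -
  define R where "R = (if P = {} then 0 else Sup P)"
  have bdd: "bdd_above P" using P by (intro bdd_aboveI[of _ T]) auto
  have up: "P \<subseteq> {0<..R}"
  proof
    fix a assume a: "a \<in> P"
    then have "a \<le> R" using cSup_upper[OF a bdd] by (auto simp: R_def)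
    moreover have "0 < a" using P a by auto
    ultimately show "a \<in> {0<..R}" by simp
  qed
  have lo: "{0<..<R} \<subseteq> P"
  proof
    fix a assume a: "a \<in> {0<..<R}"
    then have "P \<noteq> {}" by (auto simp: R_def)
    with a obtain b where "b \<in> P" "a < b" using less_cSup_iff[OF _ bdd] by (auto simp: R_def)
    then show "a \<in> P" using a down by auto
  qed
  have "P = {0<..<R} \<or> P = {0<..R}"
  proof (cases "R \<in> P")
    case True
    with up lo have "P = {0<..R}" by (force simp: order.order_iff_strict)
    then show ?thesis ..
  next
    case False
    with up have "P \<subseteq> {0<..<R}" by (force simp: order.order_iff_strict)
    with lo show ?thesis by blast
  qed
  moreover have R0: "R \<ge> 0"
    using up by (cases "P = {}") (auto simp: R_def)
  ultimately have eq: "measure lborel P = R" and s: "P \<in> sets borel" by auto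
  show "{0<..<measure lborel P} \<subseteq> P" "P \<subseteq> {0<..measure lborel P}" "P \<in> sets borel"
    using eq s up lo by auto
  show "measure lborel P \<le> T" unfolding eq R_def using P T by (auto intro!: cSup_least)
qed

text \<open>The model for the entropy along a ray that leaves the simplex at time \<open>T\<close>, where the derivative of \<open>h\<close> may
  be infinite. All facts about the level sets are read off from the difference quotient \<open>slope\<close>: the function
  \<open>h\<close> tilted by \<open>s\<close> exceeds its initial value at \<open>r\<close> exactly if \<open>slope r > - s\<close>, and strong concavity makes
  \<open>slope\<close> decrease at rate at least \<open>1/2\<close>.\<close>

locale strongly_concave_interval =
  fixes T :: real and h h' :: "real \<Rightarrow> real"
  assumes T: "0 < T"
    and conc: "concave_on {0..T} (\<lambda>r. h r + r\<^sup>2 / 2)"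
    and cont: "continuous_on {0..T} h"
    and der: "\<And>r. 0 \<le> r \<Longrightarrow> r < T \<Longrightarrow> (h has_real_derivative h' r) (at r)"
    and cont': "continuous_on {0..<T} h'"
begin

definition slope :: "real \<Rightarrow> real" where "slope r = (h r - h 0) / r"

definition level :: "real \<Rightarrow> real set" where
  "level s = {r. 0 < r \<and> r \<le> T \<and> 0 < s * r + h r - h 0}"

definition len :: "real \<Rightarrow> real" where "len s = measure lborel (level s)"

definition dslope :: "real \<Rightarrow> real" where "dslope r = (h' r - slope r) / r"

lemma level_slope: "r \<in> level s \<longleftrightarrow> 0 < r \<and> r \<le> T \<and> - s < slope r"
  by (auto simp: level_def slope_def field_simps)

lemma slope_decreasing:
  assumes "0 < a" "a < b" "b \<le> T"
  shows "slope a - slope b \<ge> (b - a) / 2"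
proof -
  have "((1 - a/b) *\<^sub>R 0 + (a/b) *\<^sub>R b) = a" using assms by simp
  moreover have "(\<lambda>r. h r + r\<^sup>2 / 2) ((1 - a/b) *\<^sub>R 0 + (a/b) *\<^sub>R b) \<ge> (1 - a/b) * (h 0 + 0\<^sup>2/2) + (a/b) * (h b + b\<^sup>2 / 2)"
    using conc[unfolded concave_on_iff, THEN conjunct2, rule_format, of 0 b "1 - a/b" "a/b"] assms by simp
  ultimately have "h a + a\<^sup>2/2 \<ge> (1 - a/b) * h 0 + (a/b) * (h b + b\<^sup>2 / 2)" by simp
  then have "(h a + a\<^sup>2/2) / a \<ge> ((1 - a/b) * h 0 + (a/b) * (h b + b\<^sup>2 / 2)) / a"
    using assms by (intro divide_right_mono) auto
  moreover have "((1 - a/b) * h 0 + (a/b) * (h b + b\<^sup>2 / 2)) / a = h 0 / a + slope b + b / 2"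
    using assms by (simp add: slope_def field_simps power2_eq_square)
  moreover have "(h a + a\<^sup>2/2) / a = h 0 / a + slope a + a / 2"
    using assms by (simp add: slope_def field_simps power2_eq_square)
  ultimately show ?thesis by (simp add: diff_divide_distrib)
qed

lemma slope_strict: "0 < a \<Longrightarrow> a < b \<Longrightarrow> b \<le> T \<Longrightarrow> slope b < slope a"
  using slope_decreasing[of a b] by simp

lemma slope_tendsto: "(slope \<longlongrightarrow> h' 0) (at_right 0)"
  using der[of 0] T by (auto simp: has_field_derivative_iff slope_def[abs_def] intro: tendsto_mono[OF at_le])

lemma slope_le_initial:
  assumes "0 < a" "a \<le> T"
  shows "slope a \<le> h' 0 - a / 2"
proof -
  have "((\<lambda>e. slope e - (a - e) / 2) \<longlongrightarrow> h' 0 - (a - 0) / 2) (at_right 0)"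
    by (intro tendsto_intros slope_tendsto) auto
  moreover have "eventually (\<lambda>e. slope a \<le> slope e - (a - e) / 2) (at_right 0)"
    unfolding eventually_at_right_field
    using slope_decreasing[of _ a] assms by (intro exI[of _ a]) (auto simp: field_simps)
  ultimately have "slope a \<le> h' 0 - (a - 0)/2"
    by (intro tendsto_lowerbound) auto
  then show ?thesis by simp
qed

lemma slope_cont: "continuous_on {0<..T} slope"
  unfolding slope_def[abs_def]
  by (intro continuous_intros continuous_on_subset[OF cont]) auto

lemma dslope:
  assumes "0 < r" "r < T"
  shows "(slope has_real_derivative dslope r) (at r)" "dslope r \<le> - 1 / 2"
proof -
  show *: "(slope has_real_derivative dslope r) (at r)"
    unfolding slope_def[abs_def] dslope_def
    by (rule derivative_eq_intros der | use assms in \<open>simp add: field_simps\<close>)+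
  have "((\<lambda>x. (slope x - slope r) / (x - r)) \<longlongrightarrow> dslope r) (at_right r)"
    using * by (auto simp: has_field_derivative_iff intro: tendsto_mono[OF at_le])
  moreover have "eventually (\<lambda>x. (slope x - slope r) / (x - r) \<le> - 1/ 2) (at_right r)"
    unfolding eventually_at_right_field
    using slope_decreasing[of r] assms by (intro exI[of _ T]) (force simp: field_simps)
  ultimately show "dslope r \<le> - 1 / 2" by (rule tendsto_upperbound) auto
qed

lemma dslope_cont: "continuous_on {0<..<T} dslope"
  unfolding dslope_def[abs_def]
  by (intro continuous_intros continuous_on_subset[OF cont'] continuous_on_subset[OF slope_cont]) auto

lemma level_down: "b \<in> level s \<Longrightarrow> 0 < a \<Longrightarrow> a < b \<Longrightarrow> a \<in> level s"
  using slope_strict[of a b] by (auto simp: level_slope)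

lemma level_le: "level s \<subseteq> {0<..T}" by (auto simp: level_def)

lemma level_len:
  "{0<..<len s} \<subseteq> level s" "level s \<subseteq> {0<..len s}" "level s \<in> sets borel" "len s \<le> T"
  using downward_closed_measure[OF level_le[of s] less_imp_le[OF T]] level_down by (auto simp: len_def)

lemma len_bounds: "0 \<le> len s" "len s \<le> T"
  using level_len(4) by (auto simp: len_def)

lemma len_mono: "s \<le> s' \<Longrightarrow> len s \<le> len s'"
proof -
  assume "s \<le> s'"
  then have sub: "level s \<subseteq> level s'" by (auto simp: level_slope)
  have "level s' \<in> fmeasurable lborel"
    by (rule fmeasurableI2[of "{0<..T}"]) (use level_le[of s'] level_len(3)[of s'] T in \<open>simp_all add: fmeasurable_def\<close>)
  then show ?thesis
    unfolding len_def using sub level_len(3)[of s] by (intro measure_mono_fmeasurable) simp_all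
qed

text \<open>If the tilt grows by \<open>s' - s\<close>, the end of the level set moves by at most twice as much, since \<open>slope\<close> drops
  by at least half of the distance.\<close>

lemma len_Lipschitz': 
  assumes "s \<le> s'"
  shows "len s' - len s \<le> 2 * (s' - s)"
proof (rule ccontr)
  assume neg: "\<not> ?thesis"
  define r where "r = (len s' + (len s + 2 * (s' - s))) / 2"
  have r: "len s + 2 * (s' - s) < r" "r < len s'" using neg by (auto simp: r_def)
  then have "r \<in> level s'" using level_len(1)[of s'] len_bounds[of s] assms by auto
  have "r - 2 * (s' - s) \<in> level s"
  proof (cases "s = s'")
    case True then show ?thesis using \<open>r \<in> level s'\<close> by simp
  next
    case False
    then show ?thesis using \<open>r \<in> level s'\<close> r len_bounds[of s] assms slope_decreasing[of "r - 2 * (s' - s)" r]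
      by (auto simp: level_slope)
  qed
  then have "r - 2 * (s' - s) \<le> len s" using level_len(2)[of s] by auto
  then show False using r by auto
qed

lemma len_Lipschitz: "\<bar>len s - len s'\<bar> \<le> 2 * \<bar>s - s'\<bar>"
  using len_Lipschitz'[of s s'] len_Lipschitz'[of s' s] len_mono[of s s'] len_mono[of s' s]
  by (cases "s \<le> s'") auto

lemma isCont_len: "isCont len s"
proof -
  have "((\<lambda>x. 2 * \<bar>x - s\<bar>) \<longlongrightarrow> 2 * \<bar>s - s\<bar>) (at s)" by (intro tendsto_intros)
  then have "((\<lambda>x. len x - len s) \<longlongrightarrow> 0) (at s)"
    by (rule_tac Lim_null_comparison[where g = "\<lambda>x. 2 * \<bar>x - s\<bar>"]) (auto simp: len_Lipschitz)
  then show ?thesis by (simp add: isCont_def LIM_zero_iff)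
qed

lemma len_low: "s < - h' 0 \<Longrightarrow> len s = 0"
proof -
  assume s: "s < - h' 0"
  have "level s = {}" using slope_le_initial s by (force simp: level_slope)
  then show ?thesis by (simp add: len_def)
qed

lemma len_high: "s > - slope T \<Longrightarrow> len s = T"
proof -
  assume s: "s > - slope T"
  have "- s < slope r" if "0 < r" "r \<le> T" for r
    using slope_strict[of r T] s that by (cases "r = T") auto
  then have "level s = {0<..T}" by (auto simp: level_slope)
  then show ?thesis using T by (simp add: len_def)
qed

lemma len_mid:
  assumes "- h' 0 < s" "s < - slope T"
  shows "0 < len s" "len s < T" "slope (len s) = - s"
proof -
  have "eventually (\<lambda>e. slope e > - s) (at_right 0)"
    using slope_tendsto assms by (intro order_tendstoD) auto
  then have "eventually (\<lambda>e. slope e > - s \<and> 0 < e \<and> e < T) (at_right 0)"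
    using T by (intro eventually_conj) (auto simp: eventually_at_right_field)
  then obtain e where "slope e > -s" "0 < e" "e < T" 
    using eventually_happens[of _ "at_right (0::real)"] by auto
  then have "e \<in> level s" by (auto simp: level_slope)
  then show pos: "0 < len s" using level_len(2)[of s] by auto
  have "\<exists>r\<ge>e. r \<le> T \<and> slope r = - s"
    by (rule IVT2') (use \<open>0 < e\<close> \<open>e < T\<close> \<open>slope e > -s\<close> assms in \<open>auto intro: continuous_on_subset[OF slope_cont]\<close>)
  then obtain r where r: "0 < r" "r \<le> T" "slope r = - s" using \<open>0 < e\<close> by (meson less_le_trans)
  then have "r < T" using assms by (auto simp: order.order_iff_strict)
  have "a < r \<longleftrightarrow> - s < slope a" if "0 < a" "a \<le> T" for a
    using slope_strict[of a r] slope_strict[of r a] r that by (cases a r rule: linorder_cases) auto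
  then have "level s = {0<..<r}" using r unfolding level_slope set_eq_iff by fastforce
  then have "len s = r" using r by (simp add: len_def)
  then show "len s < T" "slope (len s) = - s" using r \<open>r < T\<close> by auto
qed

text \<open>The two excluded tilts are those at which the level set appears and at which it reaches the end of the interval.
  Below and above them the length is constant, between them it is the inverse function of \<open>- slope\<close>.\<close>

lemma len_C1:
  assumes "s \<noteq> - h' 0" "s \<noteq> - slope T"
  shows "\<exists>D. (\<forall>\<^sub>F t in nhds s. (len has_real_derivative D t) (at t)) \<and> isCont D s"
proof -
  consider "s < - h' 0" | "s > - slope T" | "- h' 0 < s" "s < - slope T" using assms by linarith
  then show ?thesis
  proof cases
    case 1
    have "(len has_real_derivative 0) (at t)" if "t < - h' 0" for t
      by (rule DERIV_cong_ev[THEN iffD2, of _ t _ "\<lambda>_. 0" _ 0])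
         (use that eventually_nhds_in_open[of "{..<- h' 0}" t] in \<open>auto elim!: eventually_mono simp: len_low\<close>)
    then show ?thesis
      by (intro exI[of _ "\<lambda>_. 0"]) (use 1 eventually_nhds_in_open[of "{..<- h' 0}" s] in \<open>auto elim!: eventually_mono\<close>)
  next
    case 2
    have "(len has_real_derivative 0) (at t)" if "t > - slope T" for t
      by (rule DERIV_cong_ev[THEN iffD2, of _ t _ "\<lambda>_. T" _ 0])
         (use that eventually_nhds_in_open[of "{- slope T<..}" t] in \<open>auto elim!: eventually_mono simp: len_high\<close>)
    then show ?thesis
      by (intro exI[of _ "\<lambda>_. 0"]) (use 2 eventually_nhds_in_open[of "{- slope T<..}" s] in \<open>auto elim!: eventually_mono\<close>)
  next
    case 3
    define D where "D t = inverse (- dslope (len t))" for t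
    have "(len has_real_derivative D t) (at t)" if t: "t \<in> {- h' 0<..<- slope T}" for t
      unfolding D_def
    proof (rule DERIV_inverse_function[where f = "\<lambda>r. - slope r" and a = "- h' 0" and b = "- slope T"])
      show "((\<lambda>r. - slope r) has_real_derivative - dslope (len t)) (at (len t))"
        using t by (intro DERIV_minus dslope len_mid) auto
      show "- dslope (len t) \<noteq> 0" using dslope(2)[of "len t"] t len_mid[of t] by auto
    qed (use t len_mid isCont_len in auto)
    moreover have "isCont dslope (len s)"
      using dslope_cont len_mid[OF 3] by (auto simp: continuous_on_eq_continuous_at)
    then have "isCont D s" unfolding D_def
      using dslope(2)[of "len s"] len_mid[OF 3]
      by (intro continuous_intros isCont_o2[OF isCont_len]) auto
    ultimately show ?thesis
      by (intro exI[of _ D]) (use 3 eventually_nhds_in_open[of "{- h' 0<..<- slope T}" s] in \<open>auto elim!: eventually_mono\<close>)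
  qed
qed

end

section \<open>Null sets, radial integration and differentiation under the integral\<close>

text \<open>Fubini's theorem for the lines of one direction, without a choice of coordinates: by translation invariance the measure
  of \<open>S\<close> is the average over \<open>t\<close> between \<open>0\<close> and \<open>1\<close> of the measures of its translates by \<open>- t *\<^sub>R y\<close>, and
  after exchanging the integrals only the intersections with lines occur.\<close>

lemma null_if_null_on_lines:
  fixes S :: "'a::euclidean_space set" and y :: 'a
  assumes [measurable]: "S \<in> sets borel"
    and lines: "\<And>x. {t::real. x + t *\<^sub>R y \<in> S} \<in> null_sets lborel"
  shows "S \<in> null_sets lborel"
proof -
  have shift: "(\<integral>\<^sup>+x. indicator S (x + t *\<^sub>R y) \<partial>lborel) = emeasure lborel S" for t :: real
  proof -
    have "emeasure lborel S = (\<integral>\<^sup>+x. indicator S x \<partial>distr lborel borel ((+) (t *\<^sub>R y)))"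
      by (simp add: lborel_distr_plus)
    also have "\<dots> = (\<integral>\<^sup>+x. indicator S (x + t *\<^sub>R y) \<partial>lborel)"
      by (subst nn_integral_distr) (auto simp: add.commute)
    finally show ?thesis ..
  qed
  have "emeasure lborel S = (\<integral>\<^sup>+t. indicator {0..1::real} t * emeasure lborel S \<partial>lborel)"
    by (simp add: nn_integral_multc)
  also have "\<dots> = (\<integral>\<^sup>+t. (\<integral>\<^sup>+x. indicator {0..1::real} t * indicator S (x + t *\<^sub>R y) \<partial>lborel) \<partial>lborel)"
    by (subst nn_integral_cmult) (auto simp: shift)
  also have "\<dots> = (\<integral>\<^sup>+x. (\<integral>\<^sup>+t. indicator {0..1::real} t * indicator S (x + t *\<^sub>R y) \<partial>lborel) \<partial>lborel)"
    by (rule lborel_pair.Fubini') measurable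
  also have "\<dots> = (\<integral>\<^sup>+(x::'a). 0 \<partial>lborel)"
  proof (rule nn_integral_cong)
    fix x :: 'a
    have "(\<integral>\<^sup>+t. indicator {0..1::real} t * indicator S (x + t *\<^sub>R y) \<partial>lborel)
        \<le> (\<integral>\<^sup>+t. indicator {t. x + t *\<^sub>R y \<in> S} t \<partial>lborel)"
      by (intro nn_integral_mono) (auto simp: indicator_def)
    also have "\<dots> = 0" using lines[of x] by (auto simp: null_sets_def)
    finally show "(\<integral>\<^sup>+t. indicator {0..1::real} t * indicator S (x + t *\<^sub>R y) \<partial>lborel) = 0" by simp
  qed
  finally show ?thesis by (auto simp: null_sets_def)
qed

lemma nn_integral_lborel_scaleR:
  fixes f :: "'a::euclidean_space \<Rightarrow> ennreal"
  assumes [measurable]: "f \<in> borel_measurable borel" and r: "r > 0"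
  shows "(\<integral>\<^sup>+x. f x \<partial>lborel) = ennreal (r ^ DIM('a)) * (\<integral>\<^sup>+y. f (r *\<^sub>R y) \<partial>lborel)"
proof -
  have "(\<integral>\<^sup>+x. f x \<partial>lborel) = (\<integral>\<^sup>+x. f x \<partial>density (distr lborel borel (\<lambda>x. 0 + r *\<^sub>R x)) (\<lambda>_. \<bar>r\<bar>^DIM('a)))"
    using r by (subst lborel_affine[of r 0]) auto
  also have "\<dots> = ennreal (r ^ DIM('a)) * (\<integral>\<^sup>+y. f (r *\<^sub>R y) \<partial>lborel)"
    using r by (subst nn_integral_density, simp, simp, subst nn_integral_distr) (auto simp: nn_integral_cmult)
  finally show ?thesis .
qed

text \<open>A shell replaces the unit sphere in polar coordinates, which avoids surface measure. Each ray from the origin meets it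
  in an interval whose ends have ratio \<open>2\<close>, this is where the factor \<open>ln 2\<close> below comes from.\<close>

definition annulus :: "'a::euclidean_space set" where
  "annulus = {y. 1 \<le> norm y \<and> norm y \<le> 2}"

lemma annulus_measurable [measurable]: "annulus \<in> sets borel"
  unfolding annulus_def by measurable

lemma nn_integral_inverse_octave:
  assumes "a > 0"
  shows "(\<integral>\<^sup>+r. indicator {a/2..a} r * ennreal (1 / r) \<partial>lborel) = ennreal (ln 2)"
proof -
  have "(\<integral>\<^sup>+r. ennreal (1 / r) * indicator {a/2..a} r \<partial>lborel) = ennreal (ln a - ln (a/2))"
    using assms by (intro nn_integral_FTC_Icc) (auto intro!: derivative_eq_intros simp: field_simps)
  then show ?thesis using assms by (simp add: mult.commute ln_div)
qed

text \<open>Substitute \<open>x = r *\<^sub>R y\<close> for fixed \<open>r\<close> and exchange the integrals. A point \<open>x\<close> is then counted for all \<open>r\<close>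
  between \<open>norm x / 2\<close> and \<open>norm x\<close>, with density \<open>1 / r\<close>.\<close>

lemma nn_integral_radial:
  fixes f :: "'a::euclidean_space \<Rightarrow> ennreal"
  assumes [measurable]: "f \<in> borel_measurable borel"
  shows "(\<integral>\<^sup>+x. f x \<partial>lborel) * ennreal (ln 2) =
    (\<integral>\<^sup>+y. indicator annulus y * (\<integral>\<^sup>+r. indicator {0<..} r * ennreal (r ^ (DIM('a) - 1)) * f (r *\<^sub>R y) \<partial>lborel) \<partial>lborel)"
proof -
  have "(\<integral>\<^sup>+y. indicator annulus y * (\<integral>\<^sup>+r. indicator {0<..} r * ennreal (r ^ (DIM('a) - 1)) * f (r *\<^sub>R y) \<partial>lborel) \<partial>lborel)
     = (\<integral>\<^sup>+y. \<integral>\<^sup>+r. indicator annulus y * (indicator {0<..} r * ennreal (r ^ (DIM('a) - 1)) * f (r *\<^sub>R y)) \<partial>lborel \<partial>lborel)"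
    by (subst nn_integral_cmult) auto
  also have "\<dots> = (\<integral>\<^sup>+r. \<integral>\<^sup>+y. indicator annulus (y::'a) * (indicator {0<..} r * ennreal (r ^ (DIM('a) - 1)) * f (r *\<^sub>R y)) \<partial>lborel \<partial>lborel)"
    by (rule lborel_pair.Fubini') measurable
  also have "\<dots> = (\<integral>\<^sup>+r. \<integral>\<^sup>+x. indicator {0<..} r * ennreal (1 / r) * indicator annulus ((1/r) *\<^sub>R x) * f x \<partial>lborel \<partial>lborel)"
  proof (rule nn_integral_cong)
    fix r :: real
    show "(\<integral>\<^sup>+y. indicator annulus (y::'a) * (indicator {0<..} r * ennreal (r ^ (DIM('a) - 1)) * f (r *\<^sub>R y)) \<partial>lborel)
      = (\<integral>\<^sup>+x. indicator {0<..} r * ennreal (1 / r) * indicator annulus ((1/r) *\<^sub>R x) * f x \<partial>lborel)"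
    proof (cases "r > 0")
      case True
      have *: "r ^ (DIM('a) - 1) = r ^ DIM('a) * (1 / r)"
        using True by (simp add: power_diff)
      have "(\<integral>\<^sup>+x. indicator {0<..} r * ennreal (1 / r) * indicator annulus ((1/r) *\<^sub>R x) * f x \<partial>lborel)
        = ennreal (r ^ DIM('a)) * (\<integral>\<^sup>+y. indicator {0<..} r * ennreal (1 / r) * indicator annulus ((1/r) *\<^sub>R (r *\<^sub>R (y::'a))) * f (r *\<^sub>R y) \<partial>lborel)"
        by (rule nn_integral_lborel_scaleR[OF _ True]) measurable
      also have "\<dots> = (\<integral>\<^sup>+y. ennreal (r ^ DIM('a)) * (indicator {0<..} r * ennreal (1 / r) * indicator annulus ((1/r) *\<^sub>R (r *\<^sub>R (y::'a))) * f (r *\<^sub>R y)) \<partial>lborel)"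
        by (subst nn_integral_cmult) auto
      also have "\<dots> = (\<integral>\<^sup>+y. indicator annulus (y::'a) * (indicator {0<..} r * ennreal (r ^ (DIM('a) - 1)) * f (r *\<^sub>R y)) \<partial>lborel)"
      proof (rule nn_integral_cong)
        fix y :: 'a
        have 1: "(1/r) *\<^sub>R (r *\<^sub>R y) = y" using True by simp
        have 2: "ennreal (r ^ (DIM('a) - 1)) = ennreal (r ^ DIM('a)) * ennreal (1 / r)"
          using True unfolding * by (intro ennreal_mult) auto
        show "ennreal (r ^ DIM('a)) * (indicator {0<..} r * ennreal (1 / r) * indicator annulus ((1/r) *\<^sub>R (r *\<^sub>R y)) * f (r *\<^sub>R y))
          = indicator annulus y * (indicator {0<..} r * ennreal (r ^ (DIM('a) - 1)) * f (r *\<^sub>R y))"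
          unfolding 1 2 by (simp only: mult_ac)
      qed
      finally show ?thesis ..
    qed auto
  qed
  also have "\<dots> = (\<integral>\<^sup>+x. \<integral>\<^sup>+r. indicator {0<..} r * ennreal (1 / r) * indicator annulus ((1/r) *\<^sub>R x) * f x \<partial>lborel \<partial>lborel)"
    by (rule lborel_pair.Fubini') measurable
  also have "\<dots> = (\<integral>\<^sup>+x. f x * ennreal (ln 2) \<partial>lborel)"
  proof (rule nn_integral_cong_AE)
    have "AE x in lborel. x \<noteq> (0::'a)" using AE_lborel_singleton[of "0::'a"] by simp
    then show "AE x in lborel. (\<integral>\<^sup>+r. indicator {0<..} r * ennreal (1 / r) * indicator annulus ((1/r) *\<^sub>R x) * f x \<partial>lborel) = f x * ennreal (ln 2)"
    proof eventually_elim
      case (elim x)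
      have "(\<integral>\<^sup>+r. indicator {0<..} r * ennreal (1 / r) * indicator annulus ((1/r) *\<^sub>R x) * f x \<partial>lborel)
        = (\<integral>\<^sup>+r. f x * (indicator {norm x / 2..norm x} r * ennreal (1 / r)) \<partial>lborel)"
        using elim by (intro nn_integral_cong) (auto simp: indicator_def annulus_def field_simps)
      also have "\<dots> = f x * ennreal (ln 2)"
        using elim by (subst nn_integral_cmult) (auto simp: nn_integral_inverse_octave)
      finally show ?case .
    qed
  qed
  also have "\<dots> = (\<integral>\<^sup>+x. f x \<partial>lborel) * ennreal (ln 2)"
    by (rule nn_integral_multc) measurable
  finally show ?thesis ..
qed

text \<open>Dominated convergence of the difference quotients at one point \<open>q\<close>. Differentiability is only required there and
  almost everywhere: the exceptional null sets of the applications depend on \<open>q\<close>.\<close>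

lemma has_derivative_integral_Lipschitz:
  fixes f :: "'p::euclidean_space \<Rightarrow> 'x \<Rightarrow> real" and g :: "'x \<Rightarrow> 'p"
  assumes int: "\<And>p. integrable M (f p)"
    and g: "g \<in> borel_measurable M" "AE x in M. norm (g x) \<le> L x"
    and L: "integrable M L"
    and r: "0 < r" and lip: "\<And>p. dist p q < r \<Longrightarrow> AE x in M. \<bar>f p x - f q x\<bar> \<le> L x * norm (p - q)"
    and der: "AE x in M. ((\<lambda>p. f p x) has_derivative (\<lambda>h. h \<bullet> g x)) (at q)"
  shows "((\<lambda>p. LINT x|M. f p x) has_derivative (\<lambda>h. h \<bullet> (LINT x|M. g x))) (at q)" "integrable M g"
proof -
  show g_int: "integrable M g"
  proof (rule Bochner_Integration.integrable_bound[OF L g(1)])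
    show "AE x in M. norm (g x) \<le> norm (L x)"
      using g(2) by eventually_elim simp
  qed
  define e where "e p x = (f p x - f q x - (p - q) \<bullet> g x) / norm (p - q)" for p x
  have e_int: "integrable M (e p)" for p
  proof -
    have "integrable M (\<lambda>x. (p - q) \<bullet> g x)" using g_int by simp
    then show ?thesis
      unfolding e_def by (intro integrable_divide Bochner_Integration.integrable_diff int)
  qed
  have "((\<lambda>p. LINT x|M. e p x) \<longlongrightarrow> 0) (at q)"
    unfolding tendsto_at_iff_sequentially o_def
  proof (intro allI impI)
    fix X :: "nat \<Rightarrow> 'p" assume X: "\<forall>i. X i \<in> UNIV - {q}" "X \<longlonglongrightarrow> q"
    \<comment> \<open>the Lipschitz bound holds near \<open>q\<close> only, so that an initial segment has to be dropped\<close>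
    obtain N where N: "\<And>i. i \<ge> N \<Longrightarrow> dist (X i) q < r"
      using X(2) r unfolding lim_sequentially by blast
    have "(\<lambda>i. LINT x|M. e (X (i + N)) x) \<longlonglongrightarrow> (LINT x|M. 0)"
    proof (rule integral_dominated_convergence[where w = "\<lambda>x. 2 * L x"])
      show "AE x in M. (\<lambda>i. e (X (i + N)) x) \<longlonglongrightarrow> 0"
        using der
      proof eventually_elim
        case (elim x)
        then have "((\<lambda>p. e p x) \<longlongrightarrow> 0) (at q)"
          unfolding has_derivative_iff_norm by (subst tendsto_rabs_zero_iff[symmetric]) (simp add: e_def)
        then have "(\<lambda>i. e (X i) x) \<longlonglongrightarrow> 0" using X by (auto simp: tendsto_at_iff_sequentially o_def)
        then show ?case by (rule LIMSEQ_ignore_initial_segment)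
      qed
      show "AE x in M. norm (e (X (i + N)) x) \<le> 2 * L x" for i
        using lip[OF N[OF le_add2[of N i]]] g(2)
      proof eventually_elim
        case (elim x)
        let ?p = "X (i + N)"
        have "\<bar>(?p - q) \<bullet> g x\<bar> \<le> norm (?p - q) * L x"
          using Cauchy_Schwarz_ineq2[of "?p - q" "g x"] elim(2) by (meson mult_left_mono norm_ge_zero order_trans)
        then have "\<bar>f ?p x - f q x - (?p - q) \<bullet> g x\<bar> \<le> 2 * L x * norm (?p - q)"
          using elim by (simp add: algebra_simps)
        then show ?case using X by (simp add: e_def divide_le_eq)
      qed
      show "integrable M (\<lambda>x. 2 * L x)" using L by simp
      show "e (X (i + N)) \<in> borel_measurable M" for i using e_int by auto
    qed auto
    then show "(\<lambda>i. LINT x|M. e (X i) x) \<longlonglongrightarrow> 0" by (simp add: LIMSEQ_ignore_initial_segment LIMSEQ_offset[of _ N])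
  qed
  moreover have "(LINT x|M. e p x) = ((LINT x|M. f p x) - (LINT x|M. f q x) - (p - q) \<bullet> (LINT x|M. g x)) / norm (p - q)" for p
    unfolding e_def using g_int int by (simp add: integral_inner_right)
  ultimately have lim: "((\<lambda>p. ((LINT x|M. f p x) - (LINT x|M. f q x) - (p - q) \<bullet> (LINT x|M. g x)) / norm (p - q)) \<longlongrightarrow> 0) (at q)"
    by simp
  show "((\<lambda>p. LINT x|M. f p x) has_derivative (\<lambda>h. h \<bullet> (LINT x|M. g x))) (at q)"
    unfolding has_derivative_iff_norm
    using tendsto_rabs_zero[OF lim] by (simp add: bounded_linear_inner_left)
qed

lemma isCont_integral_dominated:
  fixes f :: "'p::metric_space \<Rightarrow> 'x \<Rightarrow> 'b::{banach, second_countable_topology}"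
  assumes "\<And>p. f p \<in> borel_measurable M" "integrable M L"
    and "\<And>p. AE x in M. norm (f p x) \<le> L x"
    and "AE x in M. isCont (\<lambda>p. f p x) q"
  shows "isCont (\<lambda>p. LINT x|M. f p x) q"
  unfolding isCont_def tendsto_at_iff_sequentially o_def
proof (intro allI impI)
  fix X :: "nat \<Rightarrow> 'p" assume X: "\<forall>i. X i \<in> UNIV - {q}" "X \<longlonglongrightarrow> q"
  show "(\<lambda>i. LINT x|M. f (X i) x) \<longlonglongrightarrow> (LINT x|M. f q x)"
  proof (rule integral_dominated_convergence[where w = L])
    show "AE x in M. (\<lambda>i. f (X i) x) \<longlonglongrightarrow> f q x"
      using assms(4) by eventually_elim (use X in \<open>auto simp: isCont_def tendsto_at_iff_sequentially o_def\<close>)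
  qed (use assms in auto)
qed

section \<open>Entropy along lines in the simplex\<close>

definition entropy :: "real ^ 'm \<Rightarrow> real" where
  "entropy l = - (hat l \<bullet> log_vec (hat l))"

text \<open>The linear part of the affine map \<open>hat\<close>.\<close>

definition tangent :: "real ^ 'm \<Rightarrow> real ^ ('m option)" where
  "tangent y = (\<chi> i. case i of None \<Rightarrow> - (\<Sum>j\<in>UNIV. y $ j) | Some j \<Rightarrow> y $ j)"

definition open_simplex :: "(real ^ 'm) set" where
  "open_simplex = {l. \<forall>i. 0 < hat l $ i}"

lemma sum_UNIV_option: "(\<Sum>i\<in>UNIV. f i) = f None + (\<Sum>j\<in>UNIV. f (Some j))"
  for f :: "'m::finite option \<Rightarrow> real"
  by (simp add: UNIV_option_conv sum.reindex)

lemma all_option: "(\<forall>i::'m option. P i) \<longleftrightarrow> P None \<and> (\<forall>j. P (Some j))"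
  by (metis option.exhaust)

lemma hat_line: "hat (l + r *\<^sub>R y) $ i = hat l $ i + r * tangent y $ i"
  by (cases i) (simp_all add: hat_def tangent_def sum.distrib sum_distrib_left)

lemma unit_simplex_hat: "l \<in> unit_simplex \<longleftrightarrow> (\<forall>i. 0 \<le> hat l $ i)"
  by (auto simp: unit_simplex_def hat_def all_option)

lemma sum_hat: "(\<Sum>i\<in>UNIV. hat l $ i) = 1"
  by (simp add: sum_UNIV_option hat_def)

lemma sum_tangent: "(\<Sum>i\<in>UNIV. tangent y $ i) = 0"
  by (simp add: sum_UNIV_option tangent_def)

lemma tangent_square: "(norm y)\<^sup>2 \<le> (\<Sum>i\<in>UNIV. (tangent y $ i)\<^sup>2)"
  by (simp add: sum_UNIV_option tangent_def norm_vec_def L2_set_def sum_nonneg)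

lemma hat_le_1: "l \<in> unit_simplex \<Longrightarrow> hat l $ i \<le> 1"
  using member_le_sum[of i UNIV "\<lambda>i. hat l $ i"] by (simp add: unit_simplex_hat sum_hat)

lemma entropy_sum: "entropy l = - (\<Sum>i\<in>UNIV. hat l $ i * ln (hat l $ i))"
  by (simp add: entropy_def log_vec_def inner_vec_def)

lemma open_simplex_subset: "l \<in> open_simplex \<Longrightarrow> l \<in> unit_simplex"
  by (auto simp: open_simplex_def unit_simplex_hat less_imp_le)

lemma continuous_hat [continuous_intros]: "continuous_on S (\<lambda>l. hat l $ i)"
  by (cases i) (auto simp: hat_def intro!: continuous_intros)

lemma hat_measurable [measurable]: "(\<lambda>l. hat l $ i) \<in> borel_measurable borel"
  by (intro borel_measurable_continuous_onI continuous_hat)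

lemma entropy_measurable [measurable]: "entropy \<in> borel_measurable borel"
  unfolding entropy_sum[abs_def] by measurable

lemma closed_unit_simplex: "closed (unit_simplex :: (real ^ 'm) set)"
proof -
  have eq: "(unit_simplex :: (real ^ 'm) set) = (\<Inter>i. {l. 0 \<le> hat l $ i})" by (auto simp: unit_simplex_hat)
  show ?thesis unfolding eq by (intro closed_INT ballI closed_Collect_le continuous_intros)
qed

lemma open_open_simplex: "open (open_simplex :: (real ^ 'm) set)"
proof -
  have eq: "(open_simplex :: (real ^ 'm) set) = (\<Inter>i\<in>UNIV. {l. 0 < hat l $ i})" by (auto simp: open_simplex_def)
  show ?thesis unfolding eq by (intro open_INT ballI open_Collect_less continuous_intros) simp
qed

lemma simplex_sets [measurable]: "unit_simplex \<in> sets borel" "open_simplex \<in> sets borel"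
  by (auto intro: borel_closed closed_unit_simplex borel_open open_open_simplex)

lemma norm_unit_simplex:
  assumes "l \<in> unit_simplex" shows "norm l \<le> 1"
proof -
  have "norm l \<le> (\<Sum>i\<in>UNIV. \<bar>l $ i\<bar>)" by (rule norm_le_l1_cart)
  also have "\<dots> \<le> 1" using assms by (simp add: unit_simplex_def)
  finally show ?thesis .
qed

lemma compact_unit_simplex: "compact unit_simplex"
  unfolding compact_eq_bounded_closed
  using norm_unit_simplex closed_unit_simplex by (auto simp: bounded_iff)

lemma abs_x_ln_x_le:
  fixes x :: real
  assumes "0 \<le> x" "x \<le> 1"
  shows "\<bar>x * ln x\<bar> \<le> 2 * sqrt x"
proof (cases "x = 0")
  case False
  then have x: "x > 0" using assms by simp
  have "ln (1 / sqrt x) \<le> 1 / sqrt x - 1" using x by (intro ln_le_minus_one) auto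
  then have "- ln x \<le> 2 / sqrt x" using x by (simp add: ln_div ln_sqrt)
  then have "x * (- ln x) \<le> x * (2 / sqrt x)" using x by (intro mult_left_mono) auto
  also have "x * (2 / sqrt x) = 2 * sqrt x" using x by (simp add: field_simps)
  finally show ?thesis using x assms by (simp add: abs_mult)
qed auto

lemma continuous_on_x_ln_x: "continuous_on {0..1} (\<lambda>x::real. x * ln x)"
  unfolding continuous_on_eq_continuous_within
proof
  fix x :: real assume x: "x \<in> {0..1}"
  show "continuous (at x within {0..1}) (\<lambda>x. x * ln x)"
  proof (cases "x = 0")
    case True
    have "((\<lambda>x::real. x * ln x) \<longlongrightarrow> 0) (at 0 within {0..1})"
    proof (rule Lim_null_comparison)
      show "\<forall>\<^sub>F x::real in at 0 within {0..1}. norm (x * ln x) \<le> 2 * sqrt x"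
        unfolding eventually_at_filter using abs_x_ln_x_le by (auto intro: always_eventually)
      have "((\<lambda>x::real. 2 * sqrt x) \<longlongrightarrow> 2 * sqrt 0) (at 0 within {0..1})" by (intro tendsto_intros)
      then show "((\<lambda>x::real. 2 * sqrt x) \<longlongrightarrow> 0) (at 0 within {0..1})" by simp
    qed
    then show ?thesis using True by (simp add: continuous_within)
  next
    case False
    then show ?thesis using x by (intro continuous_intros) auto
  qed
qed

lemma continuous_entropy: "continuous_on unit_simplex entropy"
  unfolding entropy_sum[abs_def]
  by (intro continuous_intros continuous_on_compose2[OF continuous_on_x_ln_x, of _ "\<lambda>l. hat l $ _"])
     (auto simp: hat_le_1 unit_simplex_hat)

lemma bounded_entropy: obtains B where "\<And>l. l \<in> unit_simplex \<Longrightarrow> \<bar>entropy l\<bar> \<le> B"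
  using compact_imp_bounded[OF compact_continuous_image[OF continuous_entropy compact_unit_simplex]]
  by (auto simp: bounded_iff)

text \<open>The second derivative of \<open>x ln x\<close> is \<open>1/x \<ge> 1\<close> on the unit interval; this is the source of the
  strong concavity of the entropy up to the boundary of the simplex.\<close>

lemma convex_on_x_ln_x: "convex_on {0..1} (\<lambda>x::real. x * ln x - x\<^sup>2 / 2)" (is "convex_on _ ?f")
proof -
  have pos: "convex_on {0<..1} ?f"
  proof (rule convex_on_realI[where f' = "\<lambda>x. ln x + 1 - x"])
    fix x y :: real assume xy: "x \<in> {0<..1}" "y \<in> {0<..1}" "x \<le> y"
    have "ln (x / y) \<le> x / y - 1" using xy by (intro ln_le_minus_one) auto
    also have "x / y - 1 \<le> x - y"
      using xy mult_left_mono[of y 1 "y - x"] by (simp add: field_simps)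
    finally show "ln x + 1 - x \<le> ln y + 1 - y" using xy by (simp add: ln_div)
  qed (auto intro!: derivative_eq_intros)
  show ?thesis
  proof (rule convex_onI)
    fix t x y :: real assume t: "0 < t" "t < 1" and xy: "x \<in> {0..1}" "y \<in> {0..1}"
    have zero: "?f (u * z) \<le> u * ?f z" if u: "0 < u" "u < 1" and z: "0 \<le> z" "z \<le> 1" for u z :: real
    proof (cases "z = 0")
      case False
      then have z0: "z > 0" using z by simp
      have "ln u \<le> u - 1" using u by (intro ln_le_minus_one)
      moreover have "z * (1 - u) / 2 \<le> 1 - u" using z u mult_right_mono[of z 2 "1 - u"] by simp
      ultimately have "ln u + z * (1 - u) / 2 \<le> 0" by linarith
      then have "u * z * (ln u + z * (1 - u) / 2) \<le> 0" using u z0 by (intro mult_nonneg_nonpos) auto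
      moreover have "?f (u * z) - u * ?f z = u * z * (ln u + z * (1 - u) / 2)"
        using u z0 by (simp add: ln_mult field_simps power2_eq_square)
      ultimately show ?thesis by linarith
    qed simp
    show "?f ((1 - t) *\<^sub>R x + t *\<^sub>R y) \<le> (1 - t) * ?f x + t * ?f y"
    proof (cases "x = 0 \<or> y = 0")
      case True
      then show ?thesis using zero[of t y] zero[of "1 - t" x] t xy by auto
    next
      case False
      then show ?thesis using convex_onD[OF pos, of t x y] t xy by auto
    qed
  qed simp
qed

section \<open>Rays from a point of the open simplex\<close>

text \<open>A measure rather than a supremum, because then Fubini's theorem yields measurability in \<open>l\<close> and \<open>y\<close>.\<close>

definition exit_time :: "real ^ 'm \<Rightarrow> real ^ 'm \<Rightarrow> real" where
  "exit_time l y = measure lborel {r. 0 < r \<and> l + r *\<^sub>R y \<in> unit_simplex}"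

definition dentropy :: "real ^ 'm \<Rightarrow> real ^ 'm \<Rightarrow> real" where
  "dentropy l y = - (\<Sum>i\<in>UNIV. tangent y $ i * ln (hat l $ i))"

lemma exit_time:
  assumes l: "l \<in> open_simplex" and y: "1 \<le> norm y"
  shows "0 < exit_time l y" "0 \<le> r \<Longrightarrow> l + r *\<^sub>R y \<in> unit_simplex \<longleftrightarrow> r \<le> exit_time l y"
    "0 \<le> r \<Longrightarrow> r < exit_time l y \<Longrightarrow> l + r *\<^sub>R y \<in> open_simplex" "exit_time l y \<le> 2"
proof -
  define P where "P = {r. 0 < r \<and> l + r *\<^sub>R y \<in> unit_simplex}"
  have le2: "r \<le> 2" if "r \<in> P" for r
  proof -
    have "norm (r *\<^sub>R y) \<le> norm (l + r *\<^sub>R y) + norm l"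
      using norm_triangle_ineq4[of "l + r *\<^sub>R y" l] by simp
    also have "\<dots> \<le> 2" 
      using that norm_unit_simplex[of l] norm_unit_simplex[of "l + r *\<^sub>R y"] open_simplex_subset[OF l] by (auto simp: P_def)
    finally have "r * norm y \<le> 2" using that by (simp add: P_def)
    moreover have "r * 1 \<le> r * norm y" using y that by (intro mult_left_mono) (auto simp: P_def)
    ultimately show ?thesis by simp
  qed
  have conv: "\<forall>i. 0 < hat (l + a *\<^sub>R y) $ i" if "b \<in> P" "0 \<le> a" "a < b" for a b
  proof
    fix i
    have *: "hat (l + a *\<^sub>R y) $ i = (1 - a / b) * hat l $ i + (a / b) * hat (l + b *\<^sub>R y) $ i"
      using that by (simp add: hat_line field_simps)
    have "0 < (1 - a / b) * hat l $ i" using l that by (simp add: open_simplex_def)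
    moreover have "0 \<le> (a / b) * hat (l + b *\<^sub>R y) $ i" using that by (auto simp: P_def unit_simplex_hat)
    ultimately show "0 < hat (l + a *\<^sub>R y) $ i" unfolding * by linarith
  qed
  have down: "a \<in> P" if "b \<in> P" "0 < a" "a < b" for a b
    using conv[of b a] that by (auto simp: P_def unit_simplex_hat less_imp_le)
  have sub: "P \<subseteq> {0<..2}" using le2 by (auto simp: P_def)
  have D: "{0<..<measure lborel P} \<subseteq> P" "P \<subseteq> {0<..measure lborel P}" "measure lborel P \<le> 2"
    using downward_closed_measure[OF sub] down by auto
  have T: "exit_time l y = measure lborel P" by (simp add: exit_time_def P_def)
  show T2: "exit_time l y \<le> 2" using D(3) T by simp
  have "\<forall>\<^sub>F r in at_right 0. l + r *\<^sub>R y \<in> open_simplex"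
  proof -
    have "((\<lambda>r. l + r *\<^sub>R y) \<longlongrightarrow> l + 0 *\<^sub>R y) (at_right 0)" by (intro tendsto_intros)
    then show ?thesis using open_open_simplex l by (auto dest: topological_tendstoD)
  qed
  then have "\<forall>\<^sub>F r in at_right 0. r \<in> P"
    using eventually_at_right_less[of "0::real"] by eventually_elim (auto simp: P_def open_simplex_subset)
  then obtain r where "r \<in> P" using eventually_happens[of _ "at_right (0::real)"] by auto
  then show T0: "0 < exit_time l y" using D(2) T by (force simp: P_def)
  have "closed {r. l + r *\<^sub>R y \<in> unit_simplex}"
    using continuous_closed_vimage[OF closed_unit_simplex, of "\<lambda>r. l + r *\<^sub>R y"] by (auto simp: vimage_def)
  moreover have "exit_time l y \<in> closure {0<..<exit_time l y}" using T0 by simp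
  moreover have "{0<..<exit_time l y} \<subseteq> {r. l + r *\<^sub>R y \<in> unit_simplex}" using D(1) T by (auto simp: P_def)
  ultimately have TP: "exit_time l y \<in> P" using closure_minimal T0 unfolding P_def by blast
  show "l + r *\<^sub>R y \<in> unit_simplex \<longleftrightarrow> r \<le> exit_time l y" if "0 \<le> r" for r
  proof
    assume "l + r *\<^sub>R y \<in> unit_simplex"
    then have "r = 0 \<or> r \<in> P" using that by (auto simp: P_def)
    then show "r \<le> exit_time l y" using T0 D(2) T by auto
  next
    assume r: "r \<le> exit_time l y"
    then show "l + r *\<^sub>R y \<in> unit_simplex"
      using TP down[OF TP, of r] that l open_simplex_subset by (cases "r = 0"; cases "r = exit_time l y") (auto simp: P_def)
  qed
  show "l + r *\<^sub>R y \<in> open_simplex" if "0 \<le> r" "r < exit_time l y" for r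
    using conv[OF TP that] by (simp add: open_simplex_def)
qed

text \<open>Each barycentric coordinate is affine along the ray, so convexity of \<open>x ln x - x\<^sup>2 / 2\<close> makes the entropy plus half
  the sum of the squared coordinates concave. That sum is a quadratic polynomial in \<open>r\<close> with
  leading coefficient at least \<open>1\<close>, because \<open>norm y\<close> is at least \<open>1\<close>.\<close>

lemma strongly_concave_entropy:
  assumes l: "l \<in> open_simplex" and y: "1 \<le> norm y"
  shows "strongly_concave_interval (exit_time l y) (\<lambda>r. entropy (l + r *\<^sub>R y)) (\<lambda>r. dentropy (l + r *\<^sub>R y) y)"
proof
  note E = exit_time[OF l y]
  let ?T = "exit_time l y"
  show "0 < ?T" by (rule E)
  define fs where "fs i r = hat (l + r *\<^sub>R y) $ i * ln (hat (l + r *\<^sub>R y) $ i) - (hat (l + r *\<^sub>R y) $ i)\<^sup>2 / 2" for i r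
  have sum_convex: "convex_on {0..?T} (\<lambda>r. \<Sum>i\<in>A. fs i r)" if "\<And>i. convex_on {0..?T} (fs i)" "finite A" for A
    using that(2,1) by (induction A rule: finite_induct) (auto intro: convex_on_add simp: convex_on_const)
  have "convex_on {0..?T} (\<lambda>r. (\<Sum>i\<in>UNIV. hat (l + r *\<^sub>R y) $ i * ln (hat (l + r *\<^sub>R y) $ i) - (hat (l + r *\<^sub>R y) $ i)\<^sup>2 / 2)
      + ((\<Sum>i\<in>UNIV. (hat (l + r *\<^sub>R y) $ i)\<^sup>2) - r\<^sup>2) / 2)" (is "convex_on _ (\<lambda>r. ?A r + ?B r / 2)")
  proof (rule convex_on_add, unfold fs_def[symmetric], rule sum_convex)
    fix i :: "'a option"
    let ?g = "\<lambda>r. hat (l + r *\<^sub>R y) $ i"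
    let ?f = "\<lambda>x::real. x * ln x - x\<^sup>2 / 2"
    show "convex_on {0..?T} (fs i)"
      unfolding fs_def[abs_def]
    proof (rule convex_onI)
      fix t a b :: real assume t: "0 < t" "t < 1" and ab: "a \<in> {0..?T}" "b \<in> {0..?T}"
      have "l + a *\<^sub>R y \<in> unit_simplex" "l + b *\<^sub>R y \<in> unit_simplex" using ab E(2) by auto
      then have "?g a \<in> {0..1}" "?g b \<in> {0..1}" using hat_le_1 by (auto simp: unit_simplex_hat)
      moreover have "?g ((1 - t) *\<^sub>R a + t *\<^sub>R b) = (1 - t) *\<^sub>R ?g a + t *\<^sub>R ?g b"
        unfolding hat_line by (simp add: algebra_simps)
      ultimately show "?f (?g ((1 - t) *\<^sub>R a + t *\<^sub>R b)) \<le> (1 - t) * ?f (?g a) + t * ?f (?g b)"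
        using convex_onD[OF convex_on_x_ln_x, of t "?g a" "?g b"] t by simp
    qed simp
  next
    define c where "c = (\<Sum>i\<in>UNIV. (tangent y $ i)\<^sup>2)"
    define d where "d = (\<Sum>i\<in>UNIV. 2 * hat l $ i * tangent y $ i)"
    have B: "?B r = (c - 1) * r\<^sup>2 + d * r + (\<Sum>i\<in>UNIV. (hat l $ i)\<^sup>2)" for r
      unfolding c_def d_def hat_line
      by (simp add: power2_sum sum.distrib sum_distrib_left sum_distrib_right algebra_simps power_mult_distrib)
    have "1 \<le> (norm y)\<^sup>2" using y by simp
    then have "c \<ge> 1" using tangent_square[of y] by (simp add: c_def)
    then show "convex_on {0..?T} (\<lambda>r. ?B r / 2)"
      unfolding B
      by (intro convex_on_realI[where f' = "\<lambda>r. ((c - 1) * (2 * r) + d) / 2"])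
         (auto intro!: derivative_eq_intros mult_left_mono)
  qed auto
  moreover have "?A r + ?B r / 2 = - (entropy (l + r *\<^sub>R y) + r\<^sup>2 / 2)" for r
    by (simp add: entropy_sum sum_subtractf sum_divide_distrib diff_divide_distrib)
  ultimately show "concave_on {0..?T} (\<lambda>r. entropy (l + r *\<^sub>R y) + r\<^sup>2 / 2)"
    by (simp add: concave_on_def)
  show "continuous_on {0..?T} (\<lambda>r. entropy (l + r *\<^sub>R y))"
    by (rule continuous_on_compose2[OF continuous_entropy]) (use E(2) in \<open>auto intro!: continuous_intros\<close>)
  have pos: "0 < hat (l + r *\<^sub>R y) $ i" if "0 \<le> r" "r < ?T" for r i
    using E(3)[OF that] by (auto simp: open_simplex_def)
  show "((\<lambda>r. entropy (l + r *\<^sub>R y)) has_real_derivative dentropy (l + r *\<^sub>R y) y) (at r)"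
    if r: "0 \<le> r" "r < ?T" for r
  proof -
    have "((\<lambda>r. - (\<Sum>i\<in>UNIV. (hat l $ i + r * tangent y $ i) * ln (hat l $ i + r * tangent y $ i)))
      has_real_derivative - (\<Sum>i\<in>UNIV. tangent y $ i * ln (hat l $ i + r * tangent y $ i) + tangent y $ i)) (at r)"
      using pos[OF r] unfolding hat_line
      by (auto intro!: derivative_eq_intros sum.cong simp: less_imp_neq[THEN not_sym])
    moreover have "- (\<Sum>i\<in>UNIV. tangent y $ i * ln (hat l $ i + r * tangent y $ i) + tangent y $ i) = dentropy (l + r *\<^sub>R y) y"
      by (simp add: dentropy_def hat_line sum.distrib sum_tangent)
    ultimately show ?thesis by (simp add: entropy_sum hat_line)
  qed
  show "continuous_on {0..<?T} (\<lambda>r. dentropy (l + r *\<^sub>R y) y)"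
    unfolding dentropy_def hat_line
    using pos[unfolded hat_line] by (intro continuous_intros) (auto simp: less_imp_neq[THEN not_sym])
qed

section \<open>Superlevel sets in radial coordinates\<close>

definition potential :: "real ^ 'm \<Rightarrow> real ^ 'm \<Rightarrow> real" where
  "potential \<rho> l = \<rho> \<bullet> l + entropy l"

definition chord_length :: "real ^ 'm \<Rightarrow> real ^ 'm \<Rightarrow> real \<Rightarrow> real" where
  "chord_length l y s = measure lborel
     {r. 0 < r \<and> l + r *\<^sub>R y \<in> unit_simplex \<and> 0 < s * r + entropy (l + r *\<^sub>R y) - entropy l}"

text \<open>The derivative in \<open>s\<close>, expressed by a limit along a sequence to make it measurable in all arguments. The
  truncation only matters where the chord length is not differentiable, and provides a bound there.\<close>

definition dchord_length :: "real ^ 'm \<Rightarrow> real ^ 'm \<Rightarrow> real \<Rightarrow> real" where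
  "dchord_length l y s = max (- 2) (min 2
     (lim (\<lambda>k. (chord_length l y (s + 1 / real (Suc k)) - chord_length l y s) * real (Suc k))))"

text \<open>The slope is neither the one at which the chord in direction \<open>y\<close> appears, nor the one at which it reaches the
  boundary of the simplex.\<close>

definition regular :: "real ^ 'm \<Rightarrow> real ^ 'm \<Rightarrow> real ^ 'm \<Rightarrow> bool" where
  "regular \<rho> l y \<longleftrightarrow> \<rho> \<bullet> y \<noteq> - dentropy l y \<and>
     (\<rho> \<bullet> y) * exit_time l y + entropy (l + exit_time l y *\<^sub>R y) - entropy l \<noteq> 0"

lemma potential_measurable [measurable]: "potential \<rho> \<in> borel_measurable borel"
  unfolding potential_def[abs_def] by measurable

lemma potential_line:
  "potential \<rho> (l + r *\<^sub>R y) - potential \<rho> l = (\<rho> \<bullet> y) * r + entropy (l + r *\<^sub>R y) - entropy l"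
  by (simp add: potential_def algebra_simps)

lemma simplex_comp_measurable [measurable (raw)]:
  assumes "f \<in> N \<rightarrow>\<^sub>M borel"
  shows "(\<lambda>x. entropy (f x)) \<in> borel_measurable N"
  using measurable_compose[OF assms entropy_measurable] .

lemma dentropy_measurable [measurable (raw)]:
  assumes [measurable]: "f \<in> N \<rightarrow>\<^sub>M borel" "g \<in> N \<rightarrow>\<^sub>M borel"
  shows "(\<lambda>x. dentropy (f x) (g x)) \<in> borel_measurable N"
proof -
  have [measurable]: "(\<lambda>x. hat (f x) $ i) \<in> borel_measurable N" for i
    using measurable_compose[OF assms(1) hat_measurable] .
  have "(\<lambda>y. tangent y $ i) \<in> borel_measurable borel" for i :: "_ option"
    by (cases i) (auto simp: tangent_def intro!: borel_measurable_continuous_onI continuous_intros)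
  then have [measurable]: "(\<lambda>x. tangent (g x) $ i) \<in> borel_measurable N" for i
    using measurable_compose[OF assms(2)] by blast
  show ?thesis unfolding dentropy_def by measurable
qed

lemma measurable_measure_lborel:
  assumes P: "{x \<in> space (N \<Otimes>\<^sub>M lborel). P (fst x) (snd x)} \<in> sets (N \<Otimes>\<^sub>M (lborel :: real measure))"
  shows "(\<lambda>x. measure lborel {r. P x r}) \<in> borel_measurable N"
  unfolding measure_def
  by (intro borel_measurable_enn2real lborel.measurable_emeasure) (use P in auto)

lemma exit_time_measurable [measurable (raw)]:
  assumes [measurable]: "f \<in> N \<rightarrow>\<^sub>M borel" "g \<in> N \<rightarrow>\<^sub>M borel"
  shows "(\<lambda>x. exit_time (f x) (g x)) \<in> borel_measurable N"
  unfolding exit_time_def by (rule measurable_measure_lborel) measurable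

lemma chord_length_measurable [measurable (raw)]:
  assumes [measurable]: "f \<in> N \<rightarrow>\<^sub>M borel" "g \<in> N \<rightarrow>\<^sub>M borel" "s \<in> borel_measurable N"
  shows "(\<lambda>x. chord_length (f x) (g x) (s x)) \<in> borel_measurable N"
  unfolding chord_length_def by (rule measurable_measure_lborel) measurable

lemma dchord_length_measurable [measurable (raw)]:
  assumes [measurable]: "f \<in> N \<rightarrow>\<^sub>M borel" "g \<in> N \<rightarrow>\<^sub>M borel" "s \<in> borel_measurable N"
  shows "(\<lambda>x. dchord_length (f x) (g x) (s x)) \<in> borel_measurable N"
  unfolding dchord_length_def by measurable

lemma abs_dchord_length: "\<bar>dchord_length l y s\<bar> \<le> 2"
  by (auto simp: dchord_length_def)

context
  fixes l y :: "real ^ 'm"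
  assumes l: "l \<in> open_simplex" and y: "1 \<le> norm y"
begin

interpretation S: strongly_concave_interval "exit_time l y" "\<lambda>r. entropy (l + r *\<^sub>R y)" "\<lambda>r. dentropy (l + r *\<^sub>R y) y"
  by (rule strongly_concave_entropy[OF l y])

lemma chord_level: "{r. 0 < r \<and> l + r *\<^sub>R y \<in> unit_simplex \<and> 0 < s * r + entropy (l + r *\<^sub>R y) - entropy l} = S.level s"
  unfolding S.level_def using exit_time(2)[OF l y] by auto

lemma chord_len: "chord_length l y = S.len"
  unfolding chord_length_def[abs_def] S.len_def[abs_def] chord_level ..

lemma chord_length_bounds: "0 \<le> chord_length l y s" "chord_length l y s \<le> 2"
  using S.len_bounds[of s] exit_time(4)[OF l y] by (auto simp: chord_len)

lemma chord_length_Lipschitz: "\<bar>chord_length l y s - chord_length l y t\<bar> \<le> 2 * \<bar>s - t\<bar>"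
  using S.len_Lipschitz by (simp add: chord_len)

lemma chord_length_interval:
  "{0<..<chord_length l y s} \<subseteq> {r. 0 < r \<and> l + r *\<^sub>R y \<in> unit_simplex \<and> 0 < s * r + entropy (l + r *\<^sub>R y) - entropy l}"
  "{r. 0 < r \<and> l + r *\<^sub>R y \<in> unit_simplex \<and> 0 < s * r + entropy (l + r *\<^sub>R y) - entropy l} \<subseteq> {0<..chord_length l y s}"
  unfolding chord_level chord_len by (rule S.level_len(1), rule S.level_len(2))

text \<open>The potential returns to its initial value at \<open>b\<close> if the slope of the chord to \<open>b\<close> is \<open>- (\<rho> \<bullet> y)\<close>, and the chords
  to earlier points are steeper.\<close>

lemma chord_unique_return:
  assumes "0 < a" "a < b" "b \<le> exit_time l y"
    and "potential \<rho> (l + b *\<^sub>R y) = potential \<rho> l"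
  shows "potential \<rho> (l + a *\<^sub>R y) > potential \<rho> l"
proof -
  have "S.slope b < S.slope a" using assms by (intro S.slope_strict) auto
  moreover have "S.slope b = - (\<rho> \<bullet> y)"
    using assms potential_line[of \<rho> l b y] by (simp add: S.slope_def field_simps)
  ultimately have "a \<in> S.level (\<rho> \<bullet> y)" using assms by (simp add: S.level_slope)
  then have "0 < (\<rho> \<bullet> y) * a + entropy (l + a *\<^sub>R y) - entropy l" by (simp add: S.level_def)
  then show ?thesis using potential_line[of \<rho> l a y] by simp
qed

lemma chord_length_C1:
  assumes "regular \<rho> l y"
  shows "(chord_length l y has_real_derivative dchord_length l y (\<rho> \<bullet> y)) (at (\<rho> \<bullet> y))"
    "isCont (dchord_length l y) (\<rho> \<bullet> y)"
proof -
  let ?s = "\<rho> \<bullet> y"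
  let ?T = "exit_time l y"
  have "?s * ?T = - (entropy (l + ?T *\<^sub>R y) - entropy l)" if "?s = - S.slope ?T"
    using that exit_time(1)[OF l y] by (simp add: S.slope_def)
  then have 1: "?s \<noteq> - S.slope ?T" using assms by (auto simp: regular_def)
  have 2: "?s \<noteq> - dentropy (l + 0 *\<^sub>R y) y" using assms by (simp add: regular_def)
  obtain D where D: "\<forall>\<^sub>F t in nhds ?s. (S.len has_real_derivative D t) (at t)" "isCont D ?s"
    using S.len_C1[OF 2 1] by blast
  have eq: "dchord_length l y t = D t" if t: "(S.len has_real_derivative D t) (at t)" for t
  proof -
    have "((\<lambda>h. (S.len (t + h) - S.len t) / h) \<longlongrightarrow> D t) (at 0)"
      using t by (simp add: DERIV_def)
    moreover have "filterlim (\<lambda>k. 1 / real (Suc k)) (at 0) sequentially"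
      using LIMSEQ_inverse_real_of_nat by (simp add: filterlim_at inverse_eq_divide)
    ultimately have "(\<lambda>k. (S.len (t + 1 / real (Suc k)) - S.len t) / (1 / real (Suc k))) \<longlonglongrightarrow> D t"
      by (rule filterlim_compose)
    then have "lim (\<lambda>k. (S.len (t + 1 / real (Suc k)) - S.len t) * real (Suc k)) = D t"
      by (intro limI) simp
    moreover have "\<bar>D t\<bar> \<le> 2"
    proof (rule tendsto_upperbound)
      show "((\<lambda>x. \<bar>(S.len x - S.len t) / (x - t)\<bar>) \<longlongrightarrow> \<bar>D t\<bar>) (at t)"
        using t by (intro tendsto_rabs) (simp add: has_field_derivative_iff)
      show "\<forall>\<^sub>F x in at t. \<bar>(S.len x - S.len t) / (x - t)\<bar> \<le> 2"
        unfolding eventually_at_filter using S.len_Lipschitz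
        by (intro always_eventually) (auto simp: abs_divide divide_le_eq)
    qed simp
    ultimately show ?thesis by (simp add: dchord_length_def chord_len)
  qed
  have ev: "\<forall>\<^sub>F t in nhds ?s. dchord_length l y t = D t"
    using D(1) by eventually_elim (rule eq)
  show "isCont (dchord_length l y) ?s" using D(2) ev by (simp add: isCont_cong)
  show "(chord_length l y has_real_derivative dchord_length l y ?s) (at ?s)"
    using eventually_nhds_x_imp_x[OF D(1)] eventually_nhds_x_imp_x[OF ev] by (simp add: chord_len)
qed

end

section \<open>Null sets of exceptional points\<close>

lemma at_most_one_null:
  fixes A :: "real set"
  assumes "\<And>a b. a \<in> A \<Longrightarrow> b \<in> A \<Longrightarrow> a < b \<Longrightarrow> False"
  shows "A \<in> null_sets lborel"
proof -
  have "a = b" if "a \<in> A" "b \<in> A" for a b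
    using assms[OF that] assms[OF that(2,1)] by (cases a b rule: linorder_cases) auto
  then have "A = {} \<or> (\<exists>a. A = {a})" by blast
  then have "finite A" by auto
  then show ?thesis by (rule finite_imp_null_set_lborel)
qed

lemma at_most_two_null:
  fixes A :: "real set"
  assumes "\<And>a b c. a \<in> A \<Longrightarrow> b \<in> A \<Longrightarrow> c \<in> A \<Longrightarrow> a < b \<Longrightarrow> b < c \<Longrightarrow> False"
  shows "A \<in> null_sets lborel"
proof (cases "\<exists>a\<in>A. \<exists>b\<in>A. a < b")
  case False
  then show ?thesis by (intro at_most_one_null) auto
next
  case True
  then obtain a b where ab: "a \<in> A" "b \<in> A" "a < b" by auto
  have "A \<subseteq> {a, b}"
  proof
    fix c assume "c \<in> A"
    then show "c \<in> {a, b}" using assms[of a b c] assms[of a c b] assms[of c a b] ab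
      by (cases c a rule: linorder_cases; cases c b rule: linorder_cases) auto
  qed
  then have "finite A" by (rule finite_subset) simp
  then show ?thesis by (rule finite_imp_null_set_lborel)
qed

lemma line_shift: "x + b *\<^sub>R y = (x + a *\<^sub>R y) + (b - a) *\<^sub>R y" for x y :: "'a::real_vector"
  by (simp add: algebra_simps)

lemma boundary_null: "unit_simplex - open_simplex \<in> null_sets (lborel :: (real ^ 'm) measure)"
proof -
  have "{l::real ^ 'm. hat l $ i = 0} \<in> null_sets lborel" for i :: "'m option"
  proof -
    obtain y :: "real ^ 'm" where y: "tangent y $ i \<noteq> 0"
    proof (cases i)
      case None
      have "tangent (axis undefined 1 :: real ^ 'm) $ i \<noteq> 0" by (simp add: None tangent_def axis_def)
      then show ?thesis using that by blast
    next
      case (Some j)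
      have "tangent (axis j 1 :: real ^ 'm) $ i \<noteq> 0" by (simp add: Some tangent_def axis_def)
      then show ?thesis using that by blast
    qed
    show ?thesis
    proof (rule null_if_null_on_lines[of _ y])
      show "{l::real ^ 'm. hat l $ i = 0} \<in> sets borel" by measurable
      show "{t. x + t *\<^sub>R y \<in> {l. hat l $ i = 0}} \<in> null_sets lborel" for x
      proof (rule at_most_one_null, unfold mem_Collect_eq hat_line)
        fix a b :: real assume "hat x $ i + a * tangent y $ i = 0" "hat x $ i + b * tangent y $ i = 0" "a < b"
        moreover have "(b - a) * tangent y $ i = (hat x $ i + b * tangent y $ i) - (hat x $ i + a * tangent y $ i)"
          by (simp add: algebra_simps)
        ultimately have "(b - a) * tangent y $ i = 0" by linarith
        then show False using y \<open>a < b\<close> by simp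
      qed
    qed
  qed
  then have "(\<Union>i\<in>UNIV. {l::real ^ 'm. hat l $ i = 0}) \<in> null_sets lborel"
    by (intro null_sets_UN') (auto intro: countable_finite)
  then show ?thesis
    by (rule null_sets_subset) (auto simp: open_simplex_def unit_simplex_hat less_le)
qed

text \<open>On a line a strictly concave function takes each value at most twice.\<close>

lemma level_null: "{l \<in> open_simplex. potential \<rho> l = c} \<in> null_sets (lborel :: (real ^ 'm) measure)"
proof -
  define y :: "real ^ 'm" where "y = axis undefined 1"
  have y: "1 \<le> norm y" by (simp add: y_def norm_eq_sqrt_inner inner_axis_axis)
  show ?thesis
  proof (rule null_if_null_on_lines[of _ y])
    show "{l \<in> open_simplex. potential \<rho> l = c} \<in> sets borel" by measurable
    show "{t. x + t *\<^sub>R y \<in> {l \<in> open_simplex. potential \<rho> l = c}} \<in> null_sets lborel" for x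
    proof (rule at_most_two_null, unfold mem_Collect_eq)
      fix t1 t2 t3 :: real assume t: "t1 < t2" "t2 < t3"
        and 1: "x + t1 *\<^sub>R y \<in> open_simplex \<and> potential \<rho> (x + t1 *\<^sub>R y) = c"
        and 2: "x + t2 *\<^sub>R y \<in> open_simplex \<and> potential \<rho> (x + t2 *\<^sub>R y) = c"
        and 3: "x + t3 *\<^sub>R y \<in> open_simplex \<and> potential \<rho> (x + t3 *\<^sub>R y) = c"
      have "t3 - t1 \<le> exit_time (x + t1 *\<^sub>R y) y"
        using exit_time(2)[of "x + t1 *\<^sub>R y" y "t3 - t1"] 1 3 y t line_shift[of x t3 y t1] open_simplex_subset by auto
      then show False
        using chord_unique_return[of "x + t1 *\<^sub>R y" y "t2 - t1" "t3 - t1" \<rho>] 1 2 3 y t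
          line_shift[of x t3 y t1] line_shift[of x t2 y t1] by simp
    qed
  qed
qed

text \<open>On a line in direction \<open>y\<close> the derivative of the entropy in this direction is strictly decreasing, so it equals
  \<open>- (\<rho> \<bullet> y)\<close> at most once.\<close>

lemma critical_direction_null:
  assumes y: "1 \<le> norm y"
  shows "{l \<in> open_simplex. \<rho> \<bullet> y = - dentropy l y} \<in> null_sets (lborel :: (real ^ 'm) measure)"
proof (rule null_if_null_on_lines[of _ y])
  show "{l \<in> open_simplex. \<rho> \<bullet> y = - dentropy l y} \<in> sets borel" unfolding dentropy_def by measurable
  show "{t. x + t *\<^sub>R y \<in> {l \<in> open_simplex. \<rho> \<bullet> y = - dentropy l y}} \<in> null_sets lborel" for x
  proof (rule at_most_one_null, unfold mem_Collect_eq)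
    fix a b :: real assume ab: "a < b"
      and a: "x + a *\<^sub>R y \<in> open_simplex \<and> \<rho> \<bullet> y = - dentropy (x + a *\<^sub>R y) y"
      and b: "x + b *\<^sub>R y \<in> open_simplex \<and> \<rho> \<bullet> y = - dentropy (x + b *\<^sub>R y) y"
    have pos: "0 < hat x $ i + a * tangent y $ i" "0 < hat x $ i + b * tangent y $ i" for i
      using a b by (auto simp: open_simplex_def hat_line)
    let ?d = "\<lambda>i. tangent y $ i * ln (hat (x + b *\<^sub>R y) $ i) - tangent y $ i * ln (hat (x + a *\<^sub>R y) $ i)"
    have strict: "0 < ?d i" if i: "tangent y $ i \<noteq> 0" for i
    proof (cases "tangent y $ i > 0")
      case True
      then have "hat x $ i + a * tangent y $ i < hat x $ i + b * tangent y $ i" using ab by simp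
      then show ?thesis using True pos[of i] by (simp add: hat_line)
    next
      case False
      then have "hat x $ i + b * tangent y $ i < hat x $ i + a * tangent y $ i" using ab i by simp
      then show ?thesis using False i pos[of i] by (simp add: hat_line mult_less_cancel_left)
    qed
    have "0 < (norm y)\<^sup>2" using y by auto
    then have "0 < (\<Sum>i\<in>UNIV. (tangent y $ i)\<^sup>2)" using tangent_square[of y] by linarith
    then obtain i where i: "tangent y $ i \<noteq> 0" by (metis (mono_tags, lifting) less_irrefl power_zero_numeral sum.neutral)
    have "0 < (\<Sum>i\<in>UNIV. ?d i)"
    proof (rule sum_pos2)
      show "0 \<le> ?d i" for i using strict[of i] by (cases "tangent y $ i = 0") auto
    qed (use strict[OF i] in auto)
    then show False using a b by (simp add: dentropy_def sum_subtractf)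
  qed
qed

lemma exit_time_shift:
  assumes "l \<in> open_simplex" "l + d *\<^sub>R y \<in> open_simplex" "1 \<le> norm y" "0 < d"
  shows "d < exit_time l y" "exit_time (l + d *\<^sub>R y) y = exit_time l y - d"
proof -
  note E = exit_time[OF assms(1,3)] and E' = exit_time[OF assms(2,3)]
  have sh: "l + d *\<^sub>R y + r *\<^sub>R y = l + (d + r) *\<^sub>R y" for r by (simp add: algebra_simps)
  have "l + (d + exit_time (l + d *\<^sub>R y) y) *\<^sub>R y \<in> unit_simplex"
    using E'(2)[of "exit_time (l + d *\<^sub>R y) y"] E'(1) by (simp add: sh)
  then have 1: "d + exit_time (l + d *\<^sub>R y) y \<le> exit_time l y"
    using E(2)[of "d + exit_time (l + d *\<^sub>R y) y"] E'(1) assms(4) by simp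
  then show 2: "d < exit_time l y" using E'(1) by simp
  have "l + d *\<^sub>R y + (exit_time l y - d) *\<^sub>R y \<in> unit_simplex" using E(1) E(2)[of "exit_time l y"] by (simp add: sh)
  then show "exit_time (l + d *\<^sub>R y) y = exit_time l y - d"
    using E'(2)[of "exit_time l y - d"] 1 2 by simp
qed

text \<open>The points of a line in direction \<open>y\<close> share their exit point. If two of them had the potential of the exit point, the
  potential would take this value three times on the line.\<close>

lemma critical_exit_null:
  assumes y: "1 \<le> norm y"
  shows "{l \<in> open_simplex. (\<rho> \<bullet> y) * exit_time l y + entropy (l + exit_time l y *\<^sub>R y) - entropy l = 0}
    \<in> null_sets (lborel :: (real ^ 'm) measure)" (is "?S \<in> _")
proof (rule null_if_null_on_lines[of _ y])
  show "?S \<in> sets borel" by measurable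
  show "{t. x + t *\<^sub>R y \<in> ?S} \<in> null_sets lborel" for x
  proof (rule at_most_one_null, unfold mem_Collect_eq potential_line[symmetric])
    fix a b :: real assume ab: "a < b"
      and a: "x + a *\<^sub>R y \<in> open_simplex \<and> potential \<rho> (x + a *\<^sub>R y + exit_time (x + a *\<^sub>R y) y *\<^sub>R y) - potential \<rho> (x + a *\<^sub>R y) = 0"
      and b: "x + b *\<^sub>R y \<in> open_simplex \<and> potential \<rho> (x + b *\<^sub>R y + exit_time (x + b *\<^sub>R y) y *\<^sub>R y) - potential \<rho> (x + b *\<^sub>R y) = 0"
    define l where "l = x + a *\<^sub>R y"
    have lb: "x + b *\<^sub>R y = l + (b - a) *\<^sub>R y" unfolding l_def by (rule line_shift)
    note sh = exit_time_shift[of l "b - a" y]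
    have "b - a < exit_time l y" "exit_time (l + (b - a) *\<^sub>R y) y = exit_time l y - (b - a)"
      using sh a b ab y by (auto simp: lb[symmetric] l_def[symmetric])
    then have e: "x + b *\<^sub>R y + exit_time (x + b *\<^sub>R y) y *\<^sub>R y = l + exit_time l y *\<^sub>R y" and lt: "b - a < exit_time l y"
      unfolding lb by (simp_all add: add.assoc scaleR_add_left[symmetric])
    have "potential \<rho> (l + exit_time l y *\<^sub>R y) = potential \<rho> (x + b *\<^sub>R y)"
      "potential \<rho> (l + exit_time l y *\<^sub>R y) = potential \<rho> l"
      using a b unfolding e l_def[symmetric] by simp_all
    then show False
      using chord_unique_return[of l y "b - a" "exit_time l y" \<rho>] a y ab lt unfolding lb l_def[symmetric] by simp
  qed
qed

lemma AE_regular: "AE l in lborel. AE y in lborel. l \<in> open_simplex \<longrightarrow> 1 \<le> norm y \<longrightarrow> regular \<rho> l (y :: real ^ 'm)"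
proof -
  have "AE y in lborel. AE l in lborel. l \<in> open_simplex \<longrightarrow> 1 \<le> norm y \<longrightarrow> regular \<rho> l (y :: real ^ 'm)"
  proof (rule AE_I2)
    fix y :: "real ^ 'm"
    show "AE l in lborel. l \<in> open_simplex \<longrightarrow> 1 \<le> norm y \<longrightarrow> regular \<rho> l y"
    proof (cases "1 \<le> norm y")
      case True
      show ?thesis
        using AE_not_in[OF critical_direction_null[OF True, of \<rho>]] AE_not_in[OF critical_exit_null[OF True, of \<rho>]]
        by eventually_elim (auto simp: regular_def)
    qed auto
  qed
  moreover have "{x \<in> space (lborel \<Otimes>\<^sub>M lborel). fst x \<in> open_simplex \<longrightarrow> 1 \<le> norm (snd x) \<longrightarrow> regular \<rho> (fst x) (snd x :: real ^ 'm)}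
    \<in> sets (lborel \<Otimes>\<^sub>M lborel)"
  proof -
    have "{x \<in> space (borel \<Otimes>\<^sub>M borel). fst x \<in> open_simplex \<longrightarrow> 1 \<le> norm (snd x) \<longrightarrow> regular \<rho> (fst x) (snd x :: real ^ 'm)}
      \<in> sets (borel \<Otimes>\<^sub>M borel)"
      unfolding regular_def by measurable
    then show ?thesis by (simp add: space_pair_measure cong: sets_pair_measure_cong)
  qed
  ultimately show ?thesis by (subst lborel_pair.AE_commute) auto
qed

section \<open>The volume of a superlevel set as a function of the slope\<close>

lemma norm_integral_le_dominating:
  fixes f :: "'x \<Rightarrow> 'b::{banach, second_countable_topology}"
  assumes g: "integrable M g" and le: "AE x in M. norm (f x) \<le> g x"
  shows "norm (LINT x|M. f x) \<le> (LINT x|M. g x)"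
proof (cases "integrable M f")
  case True
  have "norm (LINT x|M. f x) \<le> (LINT x|M. norm (f x))" by (rule integral_norm_bound)
  also have "\<dots> \<le> (LINT x|M. g x)" using True g le by (intro integral_mono_AE) auto
  finally show ?thesis .
next
  case False
  have "AE x in M. 0 \<le> g x" using le by eventually_elim (rule order_trans[OF norm_ge_zero])
  then show ?thesis using False by (simp add: not_integrable_integral_eq integral_nonneg_AE)
qed

text \<open>The measure of a superlevel set in polar coordinates around \<open>l\<close>, see \<open>measure_upper_volume\<close>. In this form \<open>\<rho>\<close>
  occurs in the slopes of the rays only.\<close>

definition upper_volume :: "real ^ 'm \<Rightarrow> real ^ 'm \<Rightarrow> real" where
  "upper_volume \<rho> l = fact CARD('m) / (CARD('m) * ln 2) *
     (LINT y|lborel. indicator annulus y * chord_length l y (\<rho> \<bullet> y) ^ CARD('m))"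

definition upper_gradient :: "real ^ 'm \<Rightarrow> real ^ 'm \<Rightarrow> real ^ 'm" where
  "upper_gradient \<rho> l = (fact CARD('m) / (CARD('m) * ln 2)) *\<^sub>R
     (LINT y|lborel. (indicator annulus y * (CARD('m) * chord_length l y (\<rho> \<bullet> y) ^ (CARD('m) - 1)
        * dchord_length l y (\<rho> \<bullet> y))) *\<^sub>R y)"

definition generic :: "real ^ 'm \<Rightarrow> real ^ 'm \<Rightarrow> bool" where
  "generic \<rho> l \<longleftrightarrow> l \<in> open_simplex \<and> (AE y in lborel. 1 \<le> norm y \<longrightarrow> regular \<rho> l y)"

lemma AE_generic: "AE l in lborel. l \<in> open_simplex \<longrightarrow> generic \<rho> l"
  using AE_regular[of \<rho>] by eventually_elim (auto simp: generic_def elim: eventually_mono)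

lemma annulus_norm: "y \<in> annulus \<Longrightarrow> 1 \<le> norm y" "y \<in> annulus \<Longrightarrow> norm y \<le> 2"
  by (auto simp: annulus_def)

lemma integrable_annulus: "integrable lborel (\<lambda>y::'a::euclidean_space. c * indicator annulus y :: real)"
proof -
  have "emeasure lborel (annulus :: 'a set) < \<infinity>"
    by (intro emeasure_bounded_finite) (auto simp: bounded_iff annulus_def)
  then show ?thesis by (intro integrable_mult_right integrable_real_indicator) auto
qed

lemma abs_power_diff_le:
  fixes a b :: real
  assumes "0 \<le> a" "a \<le> B" "0 \<le> b" "b \<le> B"
  shows "\<bar>a ^ k - b ^ k\<bar> \<le> (real k * B ^ (k - 1)) * \<bar>a - b\<bar>"
proof -
  have "norm (a ^ k - b ^ k) \<le> (real k * B ^ (k - 1)) * norm (a - b)"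
  proof (rule differentiable_bound[of "{0..B}" "\<lambda>x. x ^ k" "\<lambda>x h. real k * x ^ (k - 1) * h"])
    fix x assume x: "x \<in> {0..B}"
    show "((\<lambda>x. x ^ k) has_derivative (\<lambda>h. real k * x ^ (k - 1) * h)) (at x within {0..B})"
      by (auto intro!: derivative_eq_intros)
    have "\<bar>real k * x ^ (k - 1) * h\<bar> \<le> real k * B ^ (k - 1) * \<bar>h\<bar>" for h
      using x by (auto simp: abs_mult intro!: mult_right_mono mult_left_mono power_mono)
    then show "onorm ((*) (real k * x ^ (k - 1))) \<le> real k * B ^ (k - 1)"
      by (intro onorm_bound) (use x in auto)
  qed (use assms in auto)
  then show ?thesis by simp
qed

text \<open>A Lipschitz constant of \<open>upper_volume\<close> in \<open>\<rho>\<close> that is the same for all \<open>l\<close>, as dominated convergence over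
  \<open>l\<close> needs it. Chords have length at most \<open>2\<close>, their derivatives and the points of the shell have norm at most \<open>2\<close>.\<close>

definition volume_bound :: "'m::finite itself \<Rightarrow> real" where
  "volume_bound _ = fact CARD('m) / (CARD('m) * ln 2) *
     (LINT y::real ^ 'm|lborel. (real CARD('m) * 2 ^ (CARD('m) - 1) * 4) * indicator annulus y)"

lemma volume_integrand_bound:
  assumes "l \<in> open_simplex"
  shows "norm ((indicator annulus y * (CARD('m) * chord_length l y (\<rho> \<bullet> y) ^ (CARD('m) - 1)
        * dchord_length l y (\<rho> \<bullet> y))) *\<^sub>R (y :: real ^ 'm)) \<le> (real CARD('m) * 2 ^ (CARD('m) - 1) * 4) * indicator annulus y"
proof (cases "y \<in> annulus")
  case True
  note b = chord_length_bounds[OF assms annulus_norm(1)[OF True]]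
  have "chord_length l y (\<rho> \<bullet> y) ^ (CARD('m) - 1) \<le> 2 ^ (CARD('m) - 1)"
    using b by (intro power_mono)
  then have "chord_length l y (\<rho> \<bullet> y) ^ (CARD('m) - 1) * \<bar>dchord_length l y (\<rho> \<bullet> y)\<bar> * norm y \<le> 2 ^ (CARD('m) - 1) * 2 * 2"
    using b abs_dchord_length annulus_norm(2)[OF True] by (intro mult_mono) auto
  then have "CARD('m) * (chord_length l y (\<rho> \<bullet> y) ^ (CARD('m) - 1) * \<bar>dchord_length l y (\<rho> \<bullet> y)\<bar> * norm y) \<le> real CARD('m) * (2 ^ (CARD('m) - 1) * 2 * 2)"
    by (intro mult_left_mono) auto
  then show ?thesis using True b by (simp add: abs_mult mult_ac)
qed auto

lemma norm_upper_gradient: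
  fixes l :: "real ^ 'm"
  assumes l: "l \<in> open_simplex"
  shows "norm (upper_gradient \<rho> l) \<le> volume_bound TYPE('m)"
proof -
  have "norm (LINT y|lborel. (indicator annulus y * (CARD('m) * chord_length l y (\<rho> \<bullet> y) ^ (CARD('m) - 1)
        * dchord_length l y (\<rho> \<bullet> y))) *\<^sub>R (y :: real ^ 'm))
    \<le> (LINT y::real ^ 'm|lborel. (real CARD('m) * 2 ^ (CARD('m) - 1) * 4) * indicator annulus y)"
    by (intro norm_integral_le_dominating integrable_annulus AE_I2 volume_integrand_bound[OF l])
  moreover have "0 \<le> fact CARD('m) / (real CARD('m) * ln 2)" by simp
  ultimately show ?thesis
    unfolding upper_gradient_def volume_bound_def norm_scaleR
    by (simp only: real_norm_def abs_of_nonneg mult_left_mono)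
qed

lemma upper_volume_measurable [measurable]: "(\<lambda>l. upper_volume \<rho> l) \<in> borel_measurable borel"
  unfolding upper_volume_def by measurable

lemma upper_gradient_measurable [measurable]: "(\<lambda>l. upper_gradient \<rho> l) \<in> borel_measurable borel"
  unfolding upper_gradient_def by measurable

lemma volume_integrand_integrable:
  fixes l :: "real ^ 'm"
  assumes l: "l \<in> open_simplex"
  shows "integrable lborel (\<lambda>y. indicator annulus y * chord_length l y (\<rho> \<bullet> y) ^ k)"
  by (rule Bochner_Integration.integrable_bound[OF integrable_annulus[of "2 ^ k"]])
     (use chord_length_bounds[OF l annulus_norm(1)] in \<open>auto intro!: AE_I2 power_mono simp: indicator_def power_abs\<close>)

lemma chord_power_Lipschitz:
  fixes l :: "real ^ 'm"
  assumes l: "l \<in> open_simplex"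
  shows "\<bar>indicator annulus y * chord_length l y (\<rho> \<bullet> y) ^ k - indicator annulus y * chord_length l y (\<sigma> \<bullet> y) ^ k\<bar>
    \<le> (real k * 2 ^ (k - 1) * 4) * indicator annulus y * norm (\<rho> - \<sigma>)"
proof (cases "y \<in> annulus")
  case True
  note b = chord_length_bounds[OF l annulus_norm(1)[OF True]]
  have "\<bar>chord_length l y (\<rho> \<bullet> y) ^ k - chord_length l y (\<sigma> \<bullet> y) ^ k\<bar>
    \<le> (real k * 2 ^ (k - 1)) * \<bar>chord_length l y (\<rho> \<bullet> y) - chord_length l y (\<sigma> \<bullet> y)\<bar>"
    using b by (intro abs_power_diff_le)
  also have "\<dots> \<le> (real k * 2 ^ (k - 1)) * (4 * norm (\<rho> - \<sigma>))"
  proof (intro mult_left_mono)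
    have "\<bar>chord_length l y (\<rho> \<bullet> y) - chord_length l y (\<sigma> \<bullet> y)\<bar> \<le> 2 * \<bar>(\<rho> - \<sigma>) \<bullet> y\<bar>"
      using chord_length_Lipschitz[OF l annulus_norm(1)[OF True]] by (simp add: inner_diff_left)
    also have "\<bar>(\<rho> - \<sigma>) \<bullet> y\<bar> \<le> norm (\<rho> - \<sigma>) * 2"
      using Cauchy_Schwarz_ineq2[of "\<rho> - \<sigma>" y] annulus_norm(2)[OF True]
      by (meson mult_left_mono norm_ge_zero order_trans)
    finally show "\<bar>chord_length l y (\<rho> \<bullet> y) - chord_length l y (\<sigma> \<bullet> y)\<bar> \<le> 4 * norm (\<rho> - \<sigma>)" by simp
  qed auto
  finally show ?thesis using True by (simp add: mult_ac)
qed auto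

lemma upper_volume_Lipschitz:
  fixes l :: "real ^ 'm"
  assumes l: "l \<in> open_simplex"
  shows "\<bar>upper_volume \<rho> l - upper_volume \<sigma> l\<bar> \<le> volume_bound TYPE('m) * norm (\<rho> - \<sigma>)"
proof -
  let ?f = "\<lambda>\<rho> y. indicator annulus y * chord_length l y (\<rho> \<bullet> y) ^ CARD('m)"
  note int = volume_integrand_integrable[OF l]
  have "\<bar>LINT y|lborel. ?f \<rho> y - ?f \<sigma> y\<bar> \<le> (LINT y::real ^ 'm|lborel. (real CARD('m) * 2 ^ (CARD('m) - 1) * 4) * indicator annulus y * norm (\<rho> - \<sigma>))"
    unfolding real_norm_def[symmetric]
    by (rule norm_integral_le_dominating)
       (use chord_power_Lipschitz[OF l] in \<open>simp_all only: real_norm_def integrable_mult_left[OF integrable_annulus] AE_I2\<close>)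
  moreover have "upper_volume \<rho> l - upper_volume \<sigma> l = fact CARD('m) / (CARD('m) * ln 2) * (LINT y|lborel. ?f \<rho> y - ?f \<sigma> y)"
    using int[of \<rho>] int[of \<sigma>] by (simp add: upper_volume_def right_diff_distrib)
  moreover have "0 \<le> fact CARD('m) / (real CARD('m) * ln 2)" by simp
  ultimately show ?thesis
    unfolding volume_bound_def mult.assoc integral_mult_left_zero[symmetric]
    by (simp only: abs_mult abs_of_nonneg mult_left_mono mult.assoc)
qed

text \<open>For generic \<open>l\<close> almost all rays are regular, so that differentiation under the radial integral is justified. The factor
  \<open>y\<close> in \<open>upper_gradient\<close> is the derivative of \<open>\<rho> \<bullet> y\<close>.\<close>

lemma upper_volume_C1:
  fixes l :: "real ^ 'm"
  assumes "generic \<rho> l"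
  shows "((\<lambda>\<rho>. upper_volume \<rho> l) has_derivative (\<lambda>h. h \<bullet> upper_gradient \<rho> l)) (at \<rho>)"
    "isCont (\<lambda>\<rho>. upper_gradient \<rho> l) \<rho>"
proof -
  have l: "l \<in> open_simplex" and reg: "AE y in lborel. 1 \<le> norm y \<longrightarrow> regular \<rho> l y"
    using assms by (auto simp: generic_def)
  let ?f = "\<lambda>\<rho> y. indicator annulus y * chord_length l y (\<rho> \<bullet> y) ^ CARD('m) :: real"
  let ?g = "\<lambda>\<rho> y. (indicator annulus y * (CARD('m) * chord_length l y (\<rho> \<bullet> y) ^ (CARD('m) - 1)
        * dchord_length l y (\<rho> \<bullet> y))) *\<^sub>R y"
  have inner: "((\<lambda>\<rho>. \<rho> \<bullet> y) has_derivative (\<lambda>h. h \<bullet> y)) (at \<rho>)" for y \<rho> :: "real ^ 'm"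
    by (rule bounded_linear_imp_has_derivative[OF bounded_linear_inner_left])
  have "((\<lambda>\<rho>. LINT y|lborel. ?f \<rho> y) has_derivative (\<lambda>h. h \<bullet> (LINT y|lborel. ?g \<rho> y))) (at \<rho>)"
  proof (rule has_derivative_integral_Lipschitz(1)[where r = 1 and L = "\<lambda>y. (real CARD('m) * 2 ^ (CARD('m) - 1) * 4) * indicator annulus y"])
    show "AE y in lborel. ((\<lambda>\<rho>. ?f \<rho> y) has_derivative (\<lambda>h. h \<bullet> ?g \<rho> y)) (at \<rho>)"
      using reg
    proof eventually_elim
      case (elim y)
      show ?case
      proof (cases "y \<in> annulus")
        case True
        note C = chord_length_C1(1)[OF l annulus_norm(1)[OF True]]
        have "(chord_length l y has_derivative (\<lambda>h. dchord_length l y (\<rho> \<bullet> y) * h)) (at (\<rho> \<bullet> y))"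
          using C elim annulus_norm(1)[OF True] by (simp add: has_field_derivative_def)
        note has_derivative_power[OF has_derivative_compose[OF inner this], of "CARD('m)"]
        then show ?thesis using True by (simp add: mult_ac)
      qed simp
    qed
  qed (use volume_integrand_integrable[OF l] volume_integrand_bound[OF l] chord_power_Lipschitz[OF l] integrable_annulus[of 1, simplified]
       in \<open>auto intro!: AE_I2\<close>)
  then have "((\<lambda>\<rho>. c * (LINT y|lborel. ?f \<rho> y)) has_derivative (\<lambda>h. c * (h \<bullet> (LINT y|lborel. ?g \<rho> y)))) (at \<rho>)" for c
    by (rule has_derivative_mult_right)
  then show "((\<lambda>\<rho>. upper_volume \<rho> l) has_derivative (\<lambda>h. h \<bullet> upper_gradient \<rho> l)) (at \<rho>)"
    unfolding upper_volume_def upper_gradient_def inner_scaleR_right .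
  have "isCont (\<lambda>\<rho>. LINT y|lborel. ?g \<rho> y) \<rho>"
  proof (rule isCont_integral_dominated[OF _ integrable_annulus])
    show "AE y in lborel. isCont (\<lambda>\<rho>. ?g \<rho> y) \<rho>"
      using reg
    proof eventually_elim
      case (elim y)
      show ?case
      proof (cases "y \<in> annulus")
        case True
        note y = annulus_norm(1)[OF True]
        have "isCont (chord_length l y) (\<rho> \<bullet> y)" "isCont (dchord_length l y) (\<rho> \<bullet> y)"
          using chord_length_C1[OF l y] elim y by (auto intro: DERIV_isCont)
        then have "isCont (\<lambda>\<rho>. chord_length l y (\<rho> \<bullet> y)) \<rho>" "isCont (\<lambda>\<rho>. dchord_length l y (\<rho> \<bullet> y)) \<rho>"
          by (auto intro!: isCont_o2[where f = "\<lambda>\<rho>. \<rho> \<bullet> y"] continuous_intros)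
        then show ?thesis by (intro continuous_intros)
      qed simp
    qed
    show "AE y in lborel. norm (?g \<rho> y) \<le> (real CARD('m) * 2 ^ (CARD('m) - 1) * 4) * indicator annulus y" for \<rho>
      using volume_integrand_bound[OF l] by (intro AE_I2)
  qed measurable
  then show "isCont (\<lambda>\<rho>. upper_gradient \<rho> l) \<rho>"
    unfolding upper_gradient_def by (intro continuous_intros)
qed

lemma nn_integral_chord:
  assumes l: "l \<in> open_simplex" and y: "1 \<le> norm y" and m: "m > 0"
  shows "(\<integral>\<^sup>+r. indicator {0<..} r * ennreal (r ^ (m - 1)) * indicator {x \<in> unit_simplex. potential \<rho> l < potential \<rho> x} (l + r *\<^sub>R y) \<partial>lborel)
    = ennreal (chord_length l y (\<rho> \<bullet> y) ^ m / m)"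
proof -
  let ?R = "chord_length l y (\<rho> \<bullet> y)"
  have R0: "0 \<le> ?R" by (rule chord_length_bounds[OF l y])
  have "(\<integral>\<^sup>+r. indicator {0<..} r * ennreal (r ^ (m - 1)) * indicator {x \<in> unit_simplex. potential \<rho> l < potential \<rho> x} (l + r *\<^sub>R y) \<partial>lborel)
    = (\<integral>\<^sup>+r. ennreal (r ^ (m - 1)) * indicator {0..?R} r \<partial>lborel)"
  proof (rule nn_integral_cong_AE)
    show "AE r in lborel. indicator {0<..} r * ennreal (r ^ (m - 1)) * indicator {x \<in> unit_simplex. potential \<rho> l < potential \<rho> x} (l + r *\<^sub>R y)
      = ennreal (r ^ (m - 1)) * indicator {0..?R} r"
      using AE_lborel_singleton[of 0] AE_lborel_singleton[of ?R]
    proof eventually_elim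
      case (elim r)
      have "r \<in> {r. 0 < r \<and> l + r *\<^sub>R y \<in> unit_simplex \<and> 0 < (\<rho> \<bullet> y) * r + entropy (l + r *\<^sub>R y) - entropy l} \<longleftrightarrow> r \<in> {0..?R}"
        (is "r \<in> ?A \<longleftrightarrow> _")
      proof
        assume "r \<in> ?A"
        then have "r \<in> {0<..?R}" using chord_length_interval(2)[OF l y] by (rule rev_subsetD)
        then show "r \<in> {0..?R}" by simp
      next
        assume "r \<in> {0..?R}"
        then have "r \<in> {0<..<?R}" using elim by simp
        then show "r \<in> ?A" using chord_length_interval(1)[OF l y] by (rule rev_subsetD)
      qed
      then have "0 < r \<and> l + r *\<^sub>R y \<in> {x \<in> unit_simplex. potential \<rho> l < potential \<rho> x} \<longleftrightarrow> r \<in> {0..?R}"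
        unfolding potential_line[symmetric] by simp
      then show ?case by (auto simp: indicator_def)
    qed
  qed
  also have "\<dots> = ennreal (?R ^ m / m - 0 ^ m / m)"
    using R0 m by (intro nn_integral_FTC_Icc) (auto intro!: derivative_eq_intros)
  finally show ?thesis using zero_power[OF m, where 'a = real] by simp
qed

lemma emeasure_simplex_measure:
  assumes [measurable]: "A \<in> sets borel"
  shows "emeasure (simplex_measure :: (real ^ 'm) measure) A = ennreal (fact CARD('m)) * (\<integral>\<^sup>+x. indicator (unit_simplex \<inter> A) x \<partial>lborel)"
proof -
  have "emeasure (simplex_measure :: (real ^ 'm) measure) A = (\<integral>\<^sup>+x. ennreal (fact CARD('m)) * indicator (unit_simplex \<inter> A) x \<partial>lborel)"
    unfolding simplex_measure_def
    by (subst emeasure_density) (auto intro!: nn_integral_cong simp: indicator_def)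
  then show ?thesis by (subst (asm) nn_integral_cmult) auto
qed

lemma measure_upper_volume:
  fixes l :: "real ^ 'm"
  assumes l: "l \<in> open_simplex"
  shows "measure simplex_measure {x. potential \<rho> l < potential \<rho> x} = upper_volume \<rho> l"
proof -
  let ?S = "{x \<in> unit_simplex. potential \<rho> l < potential \<rho> x}"
  let ?R = "\<lambda>y. chord_length l y (\<rho> \<bullet> y)"
  have dim: "DIM(real ^ 'm) = CARD('m)" by simp
  have [measurable]: "?S \<in> sets borel" by measurable
  define J where "J = (LINT y|lborel. indicator annulus y * ?R y ^ CARD('m))"
  have J0: "0 \<le> J" unfolding J_def
    by (intro integral_nonneg_AE AE_I2) (use chord_length_bounds[OF l annulus_norm(1)] in \<open>auto simp: indicator_def\<close>)
  have shift: "(\<integral>\<^sup>+x. indicator ?S x \<partial>lborel) = (\<integral>\<^sup>+x. indicator ?S (l + x) \<partial>lborel)"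
  proof -
    have "(\<integral>\<^sup>+x. indicator ?S x \<partial>lborel) = (\<integral>\<^sup>+x. indicator ?S x \<partial>distr lborel borel ((+) l))"
      by (simp add: lborel_distr_plus)
    then show ?thesis by (subst (asm) nn_integral_distr) auto
  qed
  have "(\<integral>\<^sup>+x. indicator ?S (l + x) \<partial>lborel) * ennreal (ln 2)
    = (\<integral>\<^sup>+y. indicator annulus y * (\<integral>\<^sup>+r. indicator {0<..} r * ennreal (r ^ (CARD('m) - 1)) * indicator ?S (l + r *\<^sub>R y) \<partial>lborel) \<partial>lborel)"
    by (subst nn_integral_radial) auto
  also have "\<dots> = (\<integral>\<^sup>+y. ennreal (indicator annulus y * ?R y ^ CARD('m) / CARD('m)) \<partial>lborel)"
  proof (rule nn_integral_cong)
    fix y :: "real ^ 'm"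
    show "indicator annulus y * (\<integral>\<^sup>+r. indicator {0<..} r * ennreal (r ^ (CARD('m) - 1)) * indicator ?S (l + r *\<^sub>R y) \<partial>lborel)
      = ennreal (indicator annulus y * ?R y ^ CARD('m) / CARD('m))"
    proof (cases "y \<in> annulus")
      case True
      then show ?thesis by (simp only: nn_integral_chord[OF l annulus_norm(1)[OF True] zero_less_card_finite] indicator_simps mult_1_left)
    qed simp
  qed
  also have "\<dots> = ennreal (J / CARD('m))"
    unfolding J_def
    by (subst nn_integral_eq_integral)
       (use volume_integrand_integrable[OF l] chord_length_bounds[OF l annulus_norm(1)] in \<open>auto intro!: AE_I2 simp: indicator_def\<close>)
  finally have *: "(\<integral>\<^sup>+x. indicator ?S x \<partial>lborel) * ennreal (ln 2) = ennreal (J / CARD('m))" by (simp add: shift)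
  have "(\<integral>\<^sup>+x. indicator ?S x \<partial>lborel) = (\<integral>\<^sup>+x. indicator ?S x \<partial>lborel) * ennreal (ln 2) * ennreal (1 / ln 2)"
    by (simp add: mult.assoc ennreal_mult[symmetric])
  also have "\<dots> = ennreal (J / (CARD('m) * ln 2))"
    unfolding * using J0 by (simp add: ennreal_mult[symmetric])
  finally have "emeasure simplex_measure {x. potential \<rho> l < potential \<rho> x} = ennreal (fact CARD('m)) * ennreal (J / (CARD('m) * ln 2))"
    by (subst emeasure_simplex_measure) (auto simp: Int_def)
  also have "\<dots> = ennreal (upper_volume \<rho> l)"
    using J0 by (simp add: ennreal_mult[symmetric] upper_volume_def J_def mult_ac)
  finally show ?thesis
    using J0 by (simp add: measure_def upper_volume_def J_def)
qed

lemma prob_space_simplex_measure: "prob_space (simplex_measure :: (real ^ 'm) measure)"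
proof
  have B: "(Basis :: (real ^ 'm) set) = (\<lambda>i. axis i 1) ` UNIV" by (auto simp: Basis_vec_def)
  have inj: "inj (\<lambda>i. axis i 1 :: real ^ 'm)" by (auto simp: inj_on_def axis_eq_axis)
  have "(unit_simplex :: (real ^ 'm) set) = {x. (\<forall>i\<in>Basis. 0 \<le> x \<bullet> i) \<and> (\<Sum>i\<in>Basis. x \<bullet> i) \<le> 1}"
    unfolding B sum.reindex[OF inj] by (auto simp: unit_simplex_def inner_axis)
  also have "\<dots> = convex hull (insert 0 Basis)" by (rule std_simplex[symmetric])
  finally have "emeasure lborel (unit_simplex :: (real ^ 'm) set) = ennreal (1 / fact CARD('m))"
    using emeasure_std_simplex[where 'a = "real ^ 'm"] by simp
  then have "emeasure (simplex_measure :: (real ^ 'm) measure) UNIV = ennreal (fact CARD('m)) * ennreal (1 / fact CARD('m))"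
    by (subst emeasure_simplex_measure) auto
  then show "emeasure (simplex_measure :: (real ^ 'm) measure) (space simplex_measure) = 1"
    by (simp add: simplex_measure_def ennreal_mult[symmetric])
qed

section \<open>The expected maximum is twice continuously differentiable\<close>

text \<open>If one sample has the greatest potential, it is the only one whose coefficient does not vanish. The expectation of a
  product over the other samples factors, which a definition by a maximizing index would hide.\<close>

definition winner :: "nat \<Rightarrow> real ^ 'm \<Rightarrow> (nat \<Rightarrow> real ^ 'm) \<Rightarrow> real ^ 'm" where
  "winner n \<rho> l = (\<Sum>j\<in>{1..n}. (\<Prod>k\<in>{1..n} - {j}. indicator {x. potential \<rho> x \<le> potential \<rho> (l j)} (l k)) *\<^sub>R l j)"

text \<open>Given \<open>l j = l\<close>, the other \<open>n - 1\<close> samples lie below \<open>l\<close> with probability \<open>(1 - upper_volume \<rho> l) ^ (n - 1)\<close>, and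
  each of the \<open>n\<close> samples contributes equally. This is the expectation of \<open>winner\<close>.\<close>

definition gradient :: "nat \<Rightarrow> real ^ 'm \<Rightarrow> real ^ 'm" where
  "gradient n \<rho> = real n *\<^sub>R (LINT l|simplex_measure. (1 - upper_volume \<rho> l) ^ (n - 1) *\<^sub>R l)"

lemma F_potential:
  "F n \<rho> = (LINT l | Pi\<^sub>M {1..n} (\<lambda>_. simplex_measure). Max ((\<lambda>j. potential \<rho> (l j)) ` {1..n}))"
  by (simp add: F_def potential_def entropy_def)

lemma sets_simplex_measure [simp, measurable_cong]: "sets simplex_measure = sets borel"
  by (simp add: simplex_measure_def)

lemma space_simplex_measure [simp]: "space simplex_measure = UNIV"
  by (simp add: simplex_measure_def)

lemma AE_simplex_measure: "AE l in lborel. l \<in> open_simplex \<longrightarrow> P l \<Longrightarrow> AE l in simplex_measure. P l"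
proof -
  assume "AE l in lborel. l \<in> open_simplex \<longrightarrow> P l"
  moreover have "AE l in lborel. l \<notin> unit_simplex - open_simplex" by (rule AE_not_in[OF boundary_null])
  ultimately have "AE l in lborel. 0 < ennreal (fact CARD('a)) * indicator unit_simplex l \<longrightarrow> P l"
    by eventually_elim (auto simp: indicator_def split: if_splits)
  then show ?thesis unfolding simplex_measure_def by (subst AE_density) auto
qed

lemma norm_open_simplex: "l \<in> open_simplex \<Longrightarrow> norm l \<le> 1"
  by (intro norm_unit_simplex open_simplex_subset)

lemma Max_differentiable:
  fixes X :: "'i \<Rightarrow> 'a::real_inner \<Rightarrow> real"
  assumes fin: "finite I" and j: "j \<in> I" and less: "\<And>k. k \<in> I \<Longrightarrow> k \<noteq> j \<Longrightarrow> X k p < X j p"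
    and cont: "\<And>k. k \<in> I \<Longrightarrow> isCont (X k) p" and der: "(X j has_derivative D) (at p)"
  shows "((\<lambda>q. Max ((\<lambda>k. X k q) ` I)) has_derivative D) (at p)"
proof -
  have "\<forall>\<^sub>F q in nhds p. \<forall>k\<in>I - {j}. X k q < X j q"
  proof (rule eventually_ball_finite)
    show "\<forall>k\<in>I - {j}. \<forall>\<^sub>F q in nhds p. X k q < X j q"
    proof
      fix k assume k: "k \<in> I - {j}"
      then have "isCont (\<lambda>q. X j q - X k q) p" "0 < X j p - X k p" using cont j less[of k] by (auto intro!: continuous_intros)
      then have "\<forall>\<^sub>F q in nhds p. 0 < X j q - X k q"
        unfolding isCont_def tendsto_at_iff_tendsto_nhds[of "\<lambda>q. X j q - X k q"] by (rule order_tendstoD(1))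
      then show "\<forall>\<^sub>F q in nhds p. X k q < X j q" by eventually_elim simp
    qed
  qed (use fin in auto)
  then have ev: "\<forall>\<^sub>F q in nhds p. X j q = Max ((\<lambda>k. X k q) ` I)"
  proof eventually_elim
    case (elim q)
    have "X k q \<le> X j q" if "k \<in> I" for k using elim that by (cases "k = j") (auto simp: less_imp_le)
    then show ?case using fin j by (intro Max_eqI[symmetric]) auto
  qed
  then show ?thesis
    using der eventually_nhds_x_imp_x[OF ev]
    by (intro has_derivative_transform_eventually[OF der]) (auto simp: eventually_at_filter elim: eventually_mono)
qed

lemma Max_Lipschitz:
  fixes f g :: "'i \<Rightarrow> real"
  assumes "finite I" "I \<noteq> {}" "\<And>k. k \<in> I \<Longrightarrow> \<bar>f k - g k\<bar> \<le> C"
  shows "\<bar>Max (f ` I) - Max (g ` I)\<bar> \<le> C"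
proof -
  have 1: "Max (f ` I) \<le> Max (g ` I) + C"
  proof (rule Max.boundedI)
    fix a assume "a \<in> f ` I"
    then obtain k where k: "k \<in> I" "a = f k" by auto
    have "g k \<le> Max (g ` I)" using assms k by auto
    then show "a \<le> Max (g ` I) + C" using assms(3)[OF k(1)] k by linarith
  qed (use assms in auto)
  have 2: "Max (g ` I) \<le> Max (f ` I) + C"
  proof (rule Max.boundedI)
    fix a assume "a \<in> g ` I"
    then obtain k where k: "k \<in> I" "a = g k" by auto
    have "f k \<le> Max (f ` I)" using assms k by auto
    then show "a \<le> Max (f ` I) + C" using assms(3)[OF k(1)] k by linarith
  qed (use assms in auto)
  show ?thesis using 1 2 by linarith
qed

context
  fixes n :: nat and ty :: "'m::finite itself"
  assumes n: "n \<ge> 1"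
begin

abbreviation (input) sm :: "(real ^ 'm) measure" where "sm \<equiv> simplex_measure"
abbreviation (input) pm :: "(nat \<Rightarrow> real ^ 'm) measure" where "pm \<equiv> Pi\<^sub>M {1..n} (\<lambda>_. simplex_measure)"

interpretation sm: prob_space sm by (rule prob_space_simplex_measure)
interpretation pm: prob_space pm by (intro prob_space_PiM prob_space_simplex_measure)
interpretation ps: product_sigma_finite "\<lambda>_::nat. sm"
  by unfold_locales

lemma AE_sm_open: "AE l in sm. l \<in> open_simplex"
  by (rule AE_simplex_measure) auto

lemma AE_sm_generic: "AE l in sm. generic \<rho> l"
  by (rule AE_simplex_measure[OF AE_generic])

lemma AE_sm_level: "AE x in sm. potential \<rho> x \<noteq> c"
  by (rule AE_simplex_measure) (use AE_not_in[OF level_null[of \<rho> c]] in \<open>auto elim!: eventually_mono\<close>)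

lemma AE_pm_open: "AE l in pm. \<forall>j\<in>{1..n}. l j \<in> open_simplex"
  by (intro eventually_ball_finite ballI AE_PiM_component prob_space_simplex_measure AE_sm_open) auto

text \<open>With sample \<open>j\<close> fixed, sample \<open>k\<close> almost surely avoids the level set through it.\<close>

lemma AE_pm_distinct:
  assumes jk: "j \<in> {1..n}" "k \<in> {1..n}" "j \<noteq> k"
  shows "AE l in pm. potential \<rho> (l k) \<noteq> potential \<rho> (l j)"
proof -
  have eq: "{1..n} = insert k ({1..n} - {k})" using jk by auto
  have [measurable]: "(\<lambda>l. l j) \<in> pm \<rightarrow>\<^sub>M borel" "(\<lambda>l. l k) \<in> pm \<rightarrow>\<^sub>M borel"
    using jk measurable_component_singleton[of _ "{1..n}" "\<lambda>_. sm"] by auto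
  have m: "{l \<in> space pm. potential \<rho> (l k) = potential \<rho> (l j)} \<in> sets pm" by measurable
  define f :: "(nat \<Rightarrow> real ^ 'm) \<Rightarrow> ennreal" where "f l = (if potential \<rho> (l k) = potential \<rho> (l j) then 1 else 0)" for l
  have f [measurable]: "f \<in> borel_measurable pm" unfolding f_def by measurable
  have "emeasure pm {l \<in> space pm. potential \<rho> (l k) = potential \<rho> (l j)}
    = (\<integral>\<^sup>+l. indicator {l \<in> space pm. potential \<rho> (l k) = potential \<rho> (l j)} l \<partial>pm)"
    using m by simp
  also have "\<dots> = integral\<^sup>N pm f"
    by (intro nn_integral_cong) (auto simp: indicator_def f_def)
  also have "\<dots> = integral\<^sup>N (Pi\<^sub>M (insert k ({1..n} - {k})) (\<lambda>_. sm)) f"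
    using eq by simp
  also have "\<dots> = (\<integral>\<^sup>+l. (\<integral>\<^sup>+x. f (l(k := x)) \<partial>sm) \<partial>Pi\<^sub>M ({1..n} - {k}) (\<lambda>_. sm))"
    using f eq by (intro ps.product_nn_integral_insert) auto
  also have "\<dots> = (\<integral>\<^sup>+(l :: nat \<Rightarrow> real ^ 'm). 0 \<partial>Pi\<^sub>M ({1..n} - {k}) (\<lambda>_. sm))"
  proof (rule nn_integral_cong)
    fix l :: "nat \<Rightarrow> real ^ 'm"
    have "AE x in sm. f (l(k := x)) = 0"
      using AE_sm_level[of \<rho> "potential \<rho> (l j)"] by eventually_elim (use jk in \<open>simp add: f_def\<close>)
    then have "(\<integral>\<^sup>+x. f (l(k := x)) \<partial>sm) = (\<integral>\<^sup>+x. 0 \<partial>sm)" by (rule nn_integral_cong_AE)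
    then show "(\<integral>\<^sup>+x. f (l(k := x)) \<partial>sm) = 0" by simp
  qed
  finally show ?thesis using m by (intro AE_I[OF _ _ m]) auto
qed

lemma winner_expectation: "(LINT l|pm. winner n \<rho> l) = gradient n \<rho>" "winner n \<rho> \<in> borel_measurable pm"
proof -
  have comp [measurable]: "(\<lambda>l. l j) \<in> pm \<rightarrow>\<^sub>M borel" if "j \<in> {1..n}" for j
    using that measurable_component_singleton[of _ "{1..n}" "\<lambda>_. sm"] by auto
  have ind_int: "integrable sm (indicator {z. potential \<rho> z \<le> c} :: _ \<Rightarrow> real)" for c
    by (rule integrable_real_indicator) (simp_all add: sm.emeasure_finite less_top[symmetric])
  let ?t = "\<lambda>j l. (\<Prod>k\<in>{1..n} - {j}. indicator {x. potential \<rho> x \<le> potential \<rho> (l j)} (l k) :: real) *\<^sub>R l j"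
  have meas: "?t j \<in> borel_measurable pm" if j: "j \<in> {1..n}" for j
  proof -
    have "(\<lambda>l. (indicator {x. potential \<rho> x \<le> potential \<rho> (l j)} (l k) :: real)) \<in> borel_measurable pm" if k: "k \<in> {1..n}" for k
    proof -
      have "(\<lambda>l. indicator {x. potential \<rho> x \<le> potential \<rho> (l j)} (l k) :: real) = (\<lambda>l. if potential \<rho> (l k) \<le> potential \<rho> (l j) then 1 else 0)"
        by (auto simp: fun_eq_iff)
      moreover have "\<dots> \<in> borel_measurable pm" using j k by measurable
      ultimately show ?thesis by simp
    qed
    then show ?thesis using comp[OF j] by (intro borel_measurable_scaleR borel_measurable_prod) auto
  qed
  then show "winner n \<rho> \<in> borel_measurable pm" unfolding winner_def[abs_def] by (intro borel_measurable_sum) auto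
  have int: "integrable pm (?t j)" if j: "j \<in> {1..n}" for j
  proof (rule pm.integrable_const_bound[OF _ meas[OF j]])
    show "AE l in pm. norm (?t j l) \<le> 1"
      using AE_pm_open
    proof eventually_elim
      case (elim l)
      have "norm (l j) \<le> 1" using elim j norm_open_simplex[of "l j"] by auto
      moreover have "\<bar>\<Prod>k\<in>{1..n} - {j}. indicator {x. potential \<rho> x \<le> potential \<rho> (l j)} (l k) :: real\<bar> \<le> 1"
        unfolding abs_prod by (intro prod_le_1) (auto simp: indicator_def)
      ultimately show ?case by (simp add: mult_le_one)
    qed
  qed
  have each: "(LINT l|pm. ?t j l) = (LINT l|sm. (1 - upper_volume \<rho> l) ^ (n - 1) *\<^sub>R l)" if j: "j \<in> {1..n}" for j
  proof -
    let ?J = "{1..n} - {j}"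
    have eq: "{1..n} = insert j ?J" using j by auto
    let ?g = "\<lambda>x. LINT l|Pi\<^sub>M ?J (\<lambda>_. sm). (\<Prod>k\<in>?J. indicator {z. potential \<rho> z \<le> potential \<rho> x} (l k) :: real) *\<^sub>R x"
    have g: "?g \<in> borel_measurable sm"
    proof (rule sigma_finite_measure.borel_measurable_lebesgue_integral)
      show "sigma_finite_measure (Pi\<^sub>M ?J (\<lambda>_. sm))" by (rule ps.sigma_finite) auto
      have "(\<lambda>(x, l). (\<Prod>k\<in>?J. if potential \<rho> (l k) \<le> potential \<rho> x then 1 else 0 :: real) *\<^sub>R x)
        \<in> borel_measurable (sm \<Otimes>\<^sub>M Pi\<^sub>M ?J (\<lambda>_. sm))"
        by measurable
      then show "(\<lambda>(x, l). (\<Prod>k\<in>?J. indicator {z. potential \<rho> z \<le> potential \<rho> x} (l k) :: real) *\<^sub>R x)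
        \<in> borel_measurable (sm \<Otimes>\<^sub>M Pi\<^sub>M ?J (\<lambda>_. sm))"
        unfolding indicator_def of_bool_def mem_Collect_eq .
    qed
    have "(LINT l|pm. ?t j l) = (LINT l|Pi\<^sub>M (insert j ?J) (\<lambda>_. sm). ?t j l)" using eq by simp
    also have "\<dots> = (LINT x|Pi\<^sub>M {j} (\<lambda>_. sm). (LINT l|Pi\<^sub>M ?J (\<lambda>_. sm). ?t j (merge {j} ?J (x, l))))"
      using ps.product_integral_fold[of "{j}" ?J "?t j"] int[OF j] eq by simp
    also have "\<dots> = (LINT x|Pi\<^sub>M {j} (\<lambda>_. sm). ?g (x j))"
      by (intro Bochner_Integration.integral_cong refl arg_cong2[where f = scaleR] prod.cong) (auto simp: merge_def)
    also have "\<dots> = (LINT x|sm. ?g x)"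
      by (rule ps.product_integral_singleton[OF g])
    also have "\<dots> = (LINT x|sm. (1 - upper_volume \<rho> x) ^ (n - 1) *\<^sub>R x)"
    proof (rule integral_cong_AE)
      show "AE x in sm. ?g x = (1 - upper_volume \<rho> x) ^ (n - 1) *\<^sub>R x"
        using AE_sm_open
      proof eventually_elim
        case (elim x)
        have "?g x = (LINT l|Pi\<^sub>M ?J (\<lambda>_. sm). (\<Prod>k\<in>?J. indicator {z. potential \<rho> z \<le> potential \<rho> x} (l k) :: real)) *\<^sub>R x"
          by (rule integral_scaleR_left) (intro ps.product_integrable_prod ind_int, simp)
        also have "(LINT l|Pi\<^sub>M ?J (\<lambda>_. sm). (\<Prod>k\<in>?J. indicator {z. potential \<rho> z \<le> potential \<rho> x} (l k) :: real))
          = (\<Prod>k\<in>?J. (LINT z|sm. indicator {z. potential \<rho> z \<le> potential \<rho> x} z))"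
          by (rule ps.product_integral_prod) (simp, rule ind_int)
        also have "(LINT z|sm. indicator {z. potential \<rho> z \<le> potential \<rho> x} z) = measure sm {z. potential \<rho> z \<le> potential \<rho> x}"
          by simp
        also have "\<dots> = 1 - measure sm {z. potential \<rho> x < potential \<rho> z}"
        proof -
          have "{z. potential \<rho> z \<le> potential \<rho> x} = space sm - {z. potential \<rho> x < potential \<rho> z}" by auto
          then show ?thesis by (simp only:) (rule sm.prob_compl, simp)
        qed
        also have "\<dots> = 1 - upper_volume \<rho> x" by (simp add: measure_upper_volume[OF elim])
        finally show ?case using j by simp
      qed
    qed (use g in \<open>auto intro!: borel_measurable_scaleR borel_measurable_power borel_measurable_diff simp: measurable_cong_sets[OF sets_simplex_measure refl]\<close>)
    finally show ?thesis .
  qed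
  show "(LINT l|pm. winner n \<rho> l) = gradient n \<rho>"
    unfolding winner_def
    by (subst Bochner_Integration.integral_sum) (use int each in \<open>auto simp: gradient_def sum_constant_scaleR simp del: sum_constant\<close>)
qed

lemma abs_Max_potential_diff:
  assumes "\<forall>j\<in>{1..n}. l j \<in> open_simplex"
  shows "\<bar>Max ((\<lambda>j. potential \<rho> (l j)) ` {1..n}) - Max ((\<lambda>j. potential \<sigma> (l j :: real ^ 'm)) ` {1..n})\<bar> \<le> norm (\<rho> - \<sigma>)"
proof (rule Max_Lipschitz)
  fix j assume j: "j \<in> {1..n}"
  have "\<bar>potential \<rho> (l j) - potential \<sigma> (l j)\<bar> = \<bar>(\<rho> - \<sigma>) \<bullet> l j\<bar>" by (simp add: potential_def inner_diff_left)
  also have "\<dots> \<le> norm (\<rho> - \<sigma>) * norm (l j)" by (rule Cauchy_Schwarz_ineq2)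
  also have "\<dots> \<le> norm (\<rho> - \<sigma>) * 1"
    using assms j norm_open_simplex[of "l j"] by (intro mult_left_mono) auto
  finally show "\<bar>potential \<rho> (l j) - potential \<sigma> (l j)\<bar> \<le> norm (\<rho> - \<sigma>)" by simp
qed (use n in auto)

lemma integrable_Max_potential: "integrable pm (\<lambda>l. Max ((\<lambda>j. potential \<rho> (l j)) ` {1..n}))"
proof -
  obtain B where B: "\<And>l :: real ^ 'm. l \<in> unit_simplex \<Longrightarrow> \<bar>entropy l\<bar> \<le> B" by (rule bounded_entropy, rule that)
  have comp: "(\<lambda>l. potential \<rho> (l j)) \<in> borel_measurable pm" if "j \<in> {1..n}" for j
    using that measurable_component_singleton[of _ "{1..n}" "\<lambda>_. sm"] by (intro measurable_compose[OF _ potential_measurable]) auto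
  show ?thesis
  proof (rule pm.integrable_const_bound)
    show "AE l in pm. norm (Max ((\<lambda>j. potential \<rho> (l j)) ` {1..n})) \<le> norm \<rho> + B"
      using AE_pm_open
    proof eventually_elim
      case (elim l)
      have "\<bar>Max ((\<lambda>j. potential \<rho> (l j)) ` {1..n}) - Max ((\<lambda>j. 0) ` {1..n})\<bar> \<le> norm \<rho> + B"
      proof (rule Max_Lipschitz)
        fix j assume j: "j \<in> {1..n}"
        have "\<bar>\<rho> \<bullet> l j\<bar> \<le> norm \<rho> * norm (l j)" by (rule Cauchy_Schwarz_ineq2)
        also have "\<dots> \<le> norm \<rho> * 1"
          using elim j norm_open_simplex[of "l j"] by (intro mult_left_mono) auto
        finally show "\<bar>potential \<rho> (l j) - 0\<bar> \<le> norm \<rho> + B"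
          using B[of "l j"] elim j open_simplex_subset[of "l j"] by (auto simp: potential_def)
      qed (use n in auto)
      moreover have "(\<lambda>j. 0::real) ` {1..n} = {0}" using n by auto
      ultimately show ?case by simp
    qed
    show "(\<lambda>l. Max ((\<lambda>j. potential \<rho> (l j)) ` {1..n})) \<in> borel_measurable pm"
      by (rule borel_measurable_Max) (use comp in simp_all)
  qed
qed

text \<open>Almost surely no two samples have the same potential. Then the maximum is locally the potential of the winner, a
  function that is affine in \<open>\<rho>\<close> with the winner as its gradient.\<close>

lemma F_has_gradient: "(F n has_derivative (\<lambda>h. h \<bullet> gradient n \<rho>)) (at (\<rho> :: real ^ 'm))"
proof -
  let ?f = "\<lambda>\<rho> l. Max ((\<lambda>j. potential \<rho> (l j :: real ^ 'm)) ` {1..n})"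
  have distinct: "AE l in pm. \<forall>j\<in>{1..n}. \<forall>k\<in>{1..n}. j \<noteq> k \<longrightarrow> potential \<rho> (l k) \<noteq> potential \<rho> (l j)"
  proof (intro eventually_ball_finite ballI)
    fix j k assume "j \<in> {1..n}" "k \<in> {1..n}"
    then show "AE l in pm. j \<noteq> k \<longrightarrow> potential \<rho> (l k) \<noteq> potential \<rho> (l j)"
      using AE_pm_distinct[of j k \<rho>] by (cases "j = k") auto
  qed auto
  have "((\<lambda>\<rho>. LINT l|pm. ?f \<rho> l) has_derivative (\<lambda>h. h \<bullet> (LINT l|pm. winner n \<rho> l))) (at \<rho>)"
  proof (rule has_derivative_integral_Lipschitz(1)[where r = 1 and L = "\<lambda>_. real n"])
    have sel: "\<exists>j\<in>{1..n}. winner n \<rho> l = l j \<and> (\<forall>k\<in>{1..n}. k \<noteq> j \<longrightarrow> potential \<rho> (l k) < potential \<rho> (l j))"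
      if d: "\<forall>j\<in>{1..n}. \<forall>k\<in>{1..n}. j \<noteq> k \<longrightarrow> potential \<rho> (l k) \<noteq> potential \<rho> (l j)" for l :: "nat \<Rightarrow> real ^ 'm"
    proof -
      have "?f \<rho> l \<in> (\<lambda>j. potential \<rho> (l j)) ` {1..n}" using n by (intro Max_in) auto
      then obtain j where j: "j \<in> {1..n}" "?f \<rho> l = potential \<rho> (l j)" by auto
      have less: "potential \<rho> (l k) < potential \<rho> (l j)" if "k \<in> {1..n}" "k \<noteq> j" for k
      proof -
        have "potential \<rho> (l k) \<le> ?f \<rho> l" using that by (intro Max_ge) auto
        then show ?thesis using j d that by force
      qed
      have "(\<Prod>k\<in>{1..n} - {i}. indicator {x. potential \<rho> x \<le> potential \<rho> (l i)} (l k)) *\<^sub>R l i = (if i = j then l j else 0)"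
        if i: "i \<in> {1..n}" for i
      proof (cases "i = j")
        case True
        then show ?thesis using less by (auto intro!: prod.neutral simp: indicator_def less_imp_le)
      next
        case False
        then have "(\<Prod>k\<in>{1..n} - {i}. indicator {x. potential \<rho> x \<le> potential \<rho> (l i)} (l k)) = (0::real)"
          using less[OF i] j by (intro prod_zero bexI[of _ j]) (auto simp: indicator_def)
        then show ?thesis using False by simp
      qed
      then have "winner n \<rho> l = (\<Sum>i\<in>{1..n}. if i = j then l j else 0)"
        unfolding winner_def by (intro sum.cong) auto
      then show ?thesis using j less by (auto intro!: bexI[of _ j])
    qed
    show "AE l in pm. norm (winner n \<rho> l) \<le> real n"
      using distinct AE_pm_open
    proof eventually_elim
      case (elim l)
      then obtain j where "j \<in> {1..n}" "winner n \<rho> l = l j" using sel[of l] by auto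
      then have "norm (winner n \<rho> l) \<le> 1" using elim norm_open_simplex[of "l j"] by auto
      then show ?case using n by simp
    qed
    show "AE l in pm. ((\<lambda>\<rho>. ?f \<rho> l) has_derivative (\<lambda>h. h \<bullet> winner n \<rho> l)) (at \<rho>)"
      using distinct
    proof eventually_elim
      case (elim l)
      obtain j where j: "j \<in> {1..n}" "winner n \<rho> l = l j" "\<forall>k\<in>{1..n}. k \<noteq> j \<longrightarrow> potential \<rho> (l k) < potential \<rho> (l j)"
        using sel[OF elim] by auto
      have "((\<lambda>\<rho>. potential \<rho> (l j)) has_derivative (\<lambda>h. h \<bullet> l j + 0)) (at \<rho>)"
        unfolding potential_def
        by (intro has_derivative_add bounded_linear_imp_has_derivative[OF bounded_linear_inner_left] has_derivative_const)
      then show ?case unfolding j(2)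
        using j by (intro Max_differentiable[where j = j]) (auto simp: potential_def intro!: continuous_intros)
    qed
    show "AE l in pm. \<bar>?f p l - ?f \<rho> l\<bar> \<le> real n * norm (p - \<rho>)" for p
      using AE_pm_open
    proof eventually_elim
      case (elim l)
      have "norm (p - \<rho>) \<le> real n * norm (p - \<rho>)" using n mult_right_mono[of 1 "real n" "norm (p - \<rho>)"] by simp
      then show ?case using abs_Max_potential_diff[OF elim, of p \<rho>] by linarith
    qed
    show "integrable pm (\<lambda>_. real n)" by (rule pm.integrable_const)
  qed (use integrable_Max_potential winner_expectation in auto)
  moreover have "F n = (\<lambda>\<rho> :: real ^ 'm. LINT l|pm. ?f \<rho> l)" by (rule ext) (rule F_potential)
  ultimately show ?thesis unfolding winner_expectation(1) by (simp only:)
qed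

lemma upper_volume_prob:
  assumes "l \<in> open_simplex"
  shows "0 \<le> upper_volume \<rho> l" "upper_volume \<rho> (l :: real ^ 'm) \<le> 1"
  unfolding measure_upper_volume[OF assms, symmetric] by auto

text \<open>The gradient in \<open>\<rho>\<close> of a component of the integrand of \<open>gradient\<close>. If \<open>n = 1\<close>, the factor \<open>n - 1\<close> vanishes and the
  truncated exponent does not matter.\<close>

definition hess_integrand :: "'m \<Rightarrow> real ^ 'm \<Rightarrow> real ^ 'm \<Rightarrow> real ^ 'm" where
  "hess_integrand i \<rho> l = (- (real (n - 1) * (1 - upper_volume \<rho> l) ^ (n - 2) * l $ i)) *\<^sub>R upper_gradient \<rho> l"

lemma norm_hess_integrand:
  assumes l: "l \<in> open_simplex"
  shows "norm (hess_integrand i \<rho> l) \<le> real (n - 1) * volume_bound TYPE('m)"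
proof -
  have "\<bar>l $ i\<bar> \<le> 1" using component_le_norm_cart[of l i] norm_unit_simplex[OF open_simplex_subset[OF l]] by linarith
  moreover have "\<bar>(1 - upper_volume \<rho> l) ^ (n - 2)\<bar> \<le> 1"
    using upper_volume_prob[OF l, of \<rho>] by (simp add: power_abs power_le_one)
  ultimately have "\<bar>(1 - upper_volume \<rho> l) ^ (n - 2)\<bar> * \<bar>l $ i\<bar> \<le> 1" by (intro mult_le_one) auto
  then have "real (n - 1) * (\<bar>(1 - upper_volume \<rho> l) ^ (n - 2)\<bar> * \<bar>l $ i\<bar>) \<le> real (n - 1) * 1" by (intro mult_left_mono) auto
  then have "real (n - 1) * (\<bar>(1 - upper_volume \<rho> l) ^ (n - 2)\<bar> * \<bar>l $ i\<bar>) * norm (upper_gradient \<rho> l) \<le> real (n - 1) * volume_bound TYPE('m)"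
    using norm_upper_gradient[OF l, of \<rho>] by (intro mult_mono) auto
  then show ?thesis by (simp add: hess_integrand_def abs_mult mult_ac)
qed

lemma gradient_integrand:
  "AE l in sm. norm ((1 - upper_volume \<rho> l) ^ (n - 1) *\<^sub>R l) \<le> 1"
  "integrable sm (\<lambda>l. (1 - upper_volume \<rho> l) ^ (n - 1) *\<^sub>R l)"
proof -
  show le: "AE l in sm. norm ((1 - upper_volume \<rho> l) ^ (n - 1) *\<^sub>R l) \<le> 1"
    using AE_sm_open
  proof eventually_elim
    case (elim l)
    have "\<bar>(1 - upper_volume \<rho> l) ^ (n - 1)\<bar> \<le> 1"
      using upper_volume_prob[OF elim, of \<rho>] by (simp add: power_abs power_le_one)
    then show ?case using norm_unit_simplex[OF open_simplex_subset[OF elim]] by (simp add: mult_le_one)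
  qed
  have [measurable]: "(\<lambda>l. upper_volume \<rho> l) \<in> borel_measurable sm"
    by (simp add: measurable_cong_sets[OF sets_simplex_measure refl])
  show "integrable sm (\<lambda>l. (1 - upper_volume \<rho> l) ^ (n - 1) *\<^sub>R l)"
    by (rule sm.integrable_const_bound[OF le])
       (auto intro!: borel_measurable_scaleR borel_measurable_power borel_measurable_diff simp: measurable_cong_sets[OF sets_simplex_measure refl])
qed

lemma norm_gradient: "norm (gradient n (\<rho> :: real ^ 'm)) \<le> real n"
proof -
  have "norm (LINT l|sm. (1 - upper_volume \<rho> l) ^ (n - 1) *\<^sub>R l) \<le> (LINT l|sm. 1)"
    by (rule norm_integral_le_dominating[OF sm.integrable_const gradient_integrand(1)])
  then have "norm (LINT l|sm. (1 - upper_volume \<rho> l) ^ (n - 1) *\<^sub>R l) \<le> 1" using sm.prob_space by simp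
  then have "real n * norm (LINT l|sm. (1 - upper_volume \<rho> l) ^ (n - 1) *\<^sub>R l) \<le> real n * 1" by (intro mult_left_mono) auto
  then show ?thesis by (simp add: gradient_def)
qed

lemma norm_hess: "norm (real n *\<^sub>R (LINT l|sm. hess_integrand i \<rho> l)) \<le> real n * (real (n - 1) * volume_bound TYPE('m))"
proof -
  have "AE l in sm. norm (hess_integrand i \<rho> l) \<le> real (n - 1) * volume_bound TYPE('m)"
    using AE_sm_open by eventually_elim (rule norm_hess_integrand)
  from norm_integral_le_dominating[OF sm.integrable_const this]
  show ?thesis using sm.prob_space by (simp add: mult_left_mono)
qed

lemma gradient_C1:
  "((\<lambda>\<rho>. gradient n \<rho> $ i) has_derivative (\<lambda>h. h \<bullet> (real n *\<^sub>R (LINT l|sm. hess_integrand i \<rho> l)))) (at (\<rho> :: real ^ 'm))"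
  "isCont (\<lambda>\<rho>. real n *\<^sub>R (LINT l|sm. hess_integrand i \<rho> l)) \<rho>"
proof -
  let ?L = "real (n - 1) * volume_bound TYPE('m)"
  let ?f = "\<lambda>\<rho> l. (1 - upper_volume \<rho> l) ^ (n - 1) * l $ i"
  have meas [measurable]: "(\<lambda>l. upper_volume \<rho> l) \<in> borel_measurable sm" "(\<lambda>l. upper_gradient \<rho> l) \<in> borel_measurable sm"
    "(\<lambda>l. l $ i) \<in> borel_measurable sm" for \<rho> :: "real ^ 'm"
    by (auto simp: measurable_cong_sets[OF sets_simplex_measure refl] intro!: borel_measurable_continuous_onI continuous_intros)
  have hm: "hess_integrand i \<rho> \<in> borel_measurable sm" for \<rho>
    unfolding hess_integrand_def[abs_def] by measurable
  have comp1: "\<bar>l $ i\<bar> \<le> 1" if "l \<in> open_simplex" for l :: "real ^ 'm"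
    using component_le_norm_cart[of l i] norm_unit_simplex[OF open_simplex_subset[OF that]] by linarith
  have intf: "integrable sm (?f \<rho>)" for \<rho>
  proof (rule sm.integrable_const_bound[where B = 1])
    show "AE l in sm. norm (?f \<rho> l) \<le> 1"
      using AE_sm_open
    proof eventually_elim
      case (elim l)
      have "\<bar>(1 - upper_volume \<rho> l) ^ (n - 1)\<bar> \<le> 1"
        using upper_volume_prob[OF elim, of \<rho>] by (simp add: power_abs power_le_one)
      then show ?case using comp1[OF elim] by (simp add: abs_mult mult_le_one)
    qed
  qed measurable
  have "((\<lambda>\<rho>. LINT l|sm. ?f \<rho> l) has_derivative (\<lambda>h. h \<bullet> (LINT l|sm. hess_integrand i \<rho> l))) (at \<rho>)"
  proof (rule has_derivative_integral_Lipschitz(1)[where r = 1 and L = "\<lambda>_. ?L"])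
    show "AE l in sm. norm (hess_integrand i \<rho> l) \<le> ?L"
      using AE_sm_open by eventually_elim (rule norm_hess_integrand)
    show "AE l in sm. \<bar>?f p l - ?f \<rho> l\<bar> \<le> ?L * norm (p - \<rho>)" for p
      using AE_sm_open
    proof eventually_elim
      case (elim l)
      have "\<bar>(1 - upper_volume p l) ^ (n - 1) - (1 - upper_volume \<rho> l) ^ (n - 1)\<bar>
        \<le> (real (n - 1) * 1 ^ (n - 1 - 1)) * \<bar>(1 - upper_volume p l) - (1 - upper_volume \<rho> l)\<bar>"
        using upper_volume_prob[OF elim] by (intro abs_power_diff_le) auto
      also have "\<dots> \<le> real (n - 1) * (volume_bound TYPE('m) * norm (p - \<rho>))"
        using upper_volume_Lipschitz[OF elim, of p \<rho>] by (auto intro!: mult_left_mono)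
      finally have *: "\<bar>(1 - upper_volume p l) ^ (n - 1) - (1 - upper_volume \<rho> l) ^ (n - 1)\<bar> \<le> ?L * norm (p - \<rho>)" by simp
      have "\<bar>?f p l - ?f \<rho> l\<bar> = \<bar>(1 - upper_volume p l) ^ (n - 1) - (1 - upper_volume \<rho> l) ^ (n - 1)\<bar> * \<bar>l $ i\<bar>"
        by (simp add: abs_mult[symmetric] left_diff_distrib)
      also have "\<dots> \<le> \<bar>(1 - upper_volume p l) ^ (n - 1) - (1 - upper_volume \<rho> l) ^ (n - 1)\<bar> * 1"
        using comp1[OF elim] by (intro mult_left_mono) auto
      finally show ?case using * by linarith
    qed
    show "AE l in sm. ((\<lambda>\<rho>. ?f \<rho> l) has_derivative (\<lambda>h. h \<bullet> hess_integrand i \<rho> l)) (at \<rho>)"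
      using AE_sm_generic[of \<rho>]
    proof eventually_elim
      case (elim l)
      have "((\<lambda>\<rho>. 1 - upper_volume \<rho> l) has_derivative (\<lambda>h. - (h \<bullet> upper_gradient \<rho> l))) (at \<rho>)"
        using has_derivative_diff[OF has_derivative_const upper_volume_C1(1)[OF elim], of 1] by simp
      from has_derivative_mult_left[OF has_derivative_power[OF this, of "n - 1"], of "l $ i"]
      show ?case by (simp add: hess_integrand_def mult_ac numeral_2_eq_2)
    qed
  qed (use intf hm in auto)
  from has_derivative_mult_right[OF this, of "real n"]
  have d: "((\<lambda>\<rho>. real n * (LINT l|sm. ?f \<rho> l)) has_derivative (\<lambda>h. h \<bullet> (real n *\<^sub>R (LINT l|sm. hess_integrand i \<rho> l)))) (at \<rho>)"
    by simp
  have "gradient n \<rho> $ i = real n * (LINT l|sm. ?f \<rho> l)" for \<rho> :: "real ^ 'm"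
    using integral_bounded_linear[OF bounded_linear_vec_nth[of i] gradient_integrand(2)[of \<rho>]] by (simp add: gradient_def)
  then show "((\<lambda>\<rho>. gradient n \<rho> $ i) has_derivative (\<lambda>h. h \<bullet> (real n *\<^sub>R (LINT l|sm. hess_integrand i \<rho> l)))) (at \<rho>)"
    using d by simp
  have "isCont (\<lambda>\<rho>. LINT l|sm. hess_integrand i \<rho> l) \<rho>"
  proof (rule isCont_integral_dominated[where L = "\<lambda>_. ?L"])
    show "AE l in sm. norm (hess_integrand i \<rho> l) \<le> ?L" for \<rho>
      using AE_sm_open by eventually_elim (rule norm_hess_integrand)
    show "AE l in sm. isCont (\<lambda>\<rho>. hess_integrand i \<rho> l) \<rho>"
      using AE_sm_generic[of \<rho>]
    proof eventually_elim
      case (elim l)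
      have "isCont (\<lambda>\<rho>. upper_volume \<rho> l) \<rho>"
        using upper_volume_C1(1)[OF elim] by (rule has_derivative_continuous)
      then show ?case unfolding hess_integrand_def
        using upper_volume_C1(2)[OF elim] by (intro continuous_intros)
    qed
  qed (use hm in auto)
  then show "isCont (\<lambda>\<rho>. real n *\<^sub>R (LINT l|sm. hess_integrand i \<rho> l)) \<rho>" by (intro continuous_intros)
qed

end

text \<open>The global bounds are not part of the regularity of \<open>F n\<close>; they keep its mollifications and their second derivatives
  uniformly bounded on compact sets.\<close>

lemma F_C2_data:
  assumes "n \<ge> 1"
  obtains g :: "'m \<Rightarrow> real ^ 'm \<Rightarrow> real" and H :: "'m \<Rightarrow> real ^ 'm \<Rightarrow> real ^ 'm" and B :: real
  where "\<And>\<rho>. (F n has_derivative (\<lambda>h. h \<bullet> (\<chi> i. g i \<rho>))) (at \<rho>)"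
    and "\<And>i \<rho>. (g i has_derivative (\<lambda>h. h \<bullet> H i \<rho>)) (at \<rho>)"
    and "\<And>i. continuous_on UNIV (H i)"
    and "\<And>\<rho>. norm (\<chi> i. g i \<rho>) \<le> B" and "\<And>i \<rho>. norm (H i \<rho>) \<le> B"
proof (rule that[of "\<lambda>i \<rho>. gradient n \<rho> $ i" "\<lambda>i \<rho>. real n *\<^sub>R (LINT l|simplex_measure. hess_integrand n i \<rho> l)"
        "max (real n) (real n * (real (n - 1) * volume_bound TYPE('m)))"])
  show "(F n has_derivative (\<lambda>h. h \<bullet> (\<chi> i. gradient n \<rho> $ i))) (at \<rho>)" for \<rho> :: "real ^ 'm"
    using F_has_gradient[OF assms, of \<rho>] by simp
  show "norm (\<chi> i. gradient n \<rho> $ i) \<le> max (real n) (real n * (real (n - 1) * volume_bound TYPE('m)))" for \<rho> :: "real ^ 'm"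
    using norm_gradient[OF assms, of \<rho>] by simp
  show "norm (real n *\<^sub>R (LINT l|simplex_measure. hess_integrand n i \<rho> l)) \<le> max (real n) (real n * (real (n - 1) * volume_bound TYPE('m)))"
    for i and \<rho> :: "real ^ 'm"
    using norm_hess[OF assms, of i \<rho>] by simp
qed (use gradient_C1[OF assms] in \<open>blast intro: continuous_at_imp_continuous_on\<close>)+

section \<open>The exterior algebra\<close>

text \<open>Both kinds of generators at once.\<close>

definition gen :: "'m \<times> bool \<Rightarrow> 'm covector" where
  "gen g S = (if S = {g} then 1 else 0)"

lemma dz_gen: "dz j = gen (j, False)" and dzbar_gen: "dzbar j = gen (j, True)"
  by (auto simp: fun_eq_iff dz_def dzbar_def gen_def)

lemma before_linear: "a \<noteq> b \<Longrightarrow> before a b \<longleftrightarrow> \<not> before b a" and before_irrefl: "\<not> before a a"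
  by (cases a; cases b; auto simp: before_def)+

lemma shuffle_sign_union_left:
  assumes "A \<inter> B = {}"
  shows "shuffle_sign (A \<union> B) C = shuffle_sign A C * shuffle_sign B C"
proof -
  have "{(a, b). a \<in> A \<union> B \<and> b \<in> C \<and> before b a} = {(a, b). a \<in> A \<and> b \<in> C \<and> before b a} \<union> {(a, b). a \<in> B \<and> b \<in> C \<and> before b a}"
    by auto
  then have "card {(a, b). a \<in> A \<union> B \<and> b \<in> C \<and> before b a} = card {(a, b). a \<in> A \<and> b \<in> C \<and> before b a} + card {(a, b). a \<in> B \<and> b \<in> C \<and> before b a}"
    by (simp only:) (rule card_Un_disjoint, use assms in auto)
  then show ?thesis by (simp add: shuffle_sign_def power_add)
qed

lemma shuffle_sign_union_right:
  assumes "B \<inter> C = {}"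
  shows "shuffle_sign A (B \<union> C) = shuffle_sign A B * shuffle_sign A C"
proof -
  have "{(a, b). a \<in> A \<and> b \<in> B \<union> C \<and> before b a} = {(a, b). a \<in> A \<and> b \<in> B \<and> before b a} \<union> {(a, b). a \<in> A \<and> b \<in> C \<and> before b a}"
    by auto
  then have "card {(a, b). a \<in> A \<and> b \<in> B \<union> C \<and> before b a} = card {(a, b). a \<in> A \<and> b \<in> B \<and> before b a} + card {(a, b). a \<in> A \<and> b \<in> C \<and> before b a}"
    by (simp only:) (rule card_Un_disjoint, use assms in auto)
  then show ?thesis by (simp add: shuffle_sign_def power_add)
qed

text \<open>Each pair of an element of \<open>A\<close> and an element of \<open>B\<close> is inverted in exactly one of the two orders.\<close>

lemma shuffle_sign_swap:
  assumes "A \<inter> B = {}"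
  shows "shuffle_sign A B * shuffle_sign B A = (- 1) ^ (card A * card B)"
proof -
  let ?X = "{(a, b). a \<in> A \<and> b \<in> B \<and> before b a}" and ?Y = "{(a, b). a \<in> A \<and> b \<in> B \<and> before a b}"
  have lin: "before b a \<longleftrightarrow> \<not> before a b" if "a \<in> A" "b \<in> B" for a b
    using before_linear[of b a] that assms by auto
  have un: "A \<times> B = ?X \<union> ?Y" using lin by auto
  have disj: "?X \<inter> ?Y = {}" using lin by auto
  have "card (A \<times> B) = card ?X + card ?Y"
    unfolding un by (rule card_Un_disjoint[OF _ _ disj]) simp_all
  also have "card ?Y = card {(b, a). b \<in> B \<and> a \<in> A \<and> before a b}"
    by (rule bij_betw_same_card[of prod.swap]) (auto simp: bij_betw_def image_iff)
  finally show ?thesis by (simp add: shuffle_sign_def power_add[symmetric] card_cartesian_product)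
qed

lemma shuffle_sign_square: "shuffle_sign A B * shuffle_sign A B = 1"
  by (simp add: shuffle_sign_def power_add[symmetric] mult_2[symmetric] power_mult)

lemma shuffle_sign_empty [simp]: "shuffle_sign {} B = 1" "shuffle_sign A {} = 1"
  by (simp_all add: shuffle_sign_def)

text \<open>Both sides are sums over the partitions of \<open>S\<close> into three parts, with the sign that counts the inversions between
  different parts.\<close>

lemma wedge_assoc: "wedge (wedge \<alpha> \<beta>) \<gamma> = wedge \<alpha> (wedge \<beta> \<gamma>)"
proof
  fix S :: "('a \<times> bool) set"
  have "wedge (wedge \<alpha> \<beta>) \<gamma> S = (\<Sum>A\<in>Pow S. \<Sum>B\<in>Pow A. shuffle_sign A (S - A) * (shuffle_sign B (A - B) * \<alpha> B * \<beta> (A - B)) * \<gamma> (S - A))"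
    by (simp add: wedge_def sum_distrib_left sum_distrib_right)
  also have "\<dots> = (\<Sum>(A, B)\<in>(SIGMA A:Pow S. Pow A). shuffle_sign A (S - A) * (shuffle_sign B (A - B) * \<alpha> B * \<beta> (A - B)) * \<gamma> (S - A))"
    by (subst sum.Sigma) auto
  also have "\<dots> = (\<Sum>(B, C)\<in>(SIGMA B:Pow S. Pow (S - B)). shuffle_sign B (S - B) * \<alpha> B * (shuffle_sign C (S - B - C) * \<beta> C * \<gamma> (S - B - C)))"
  proof (rule sum.reindex_bij_witness[where i = "\<lambda>(B, C). (B \<union> C, B)" and j = "\<lambda>(A, B). (B, A - B)"])
    fix X assume "X \<in> (SIGMA A:Pow S. Pow A)"
    then obtain A B where X: "X = (A, B)" "B \<subseteq> A" "A \<subseteq> S" by auto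
    define C where "C = A - B"
    define D where "D = S - A"
    have A: "A = B \<union> C" and S: "S - B = C \<union> D" and D: "S - B - C = D" and dis: "B \<inter> C = {}" "C \<inter> D = {}"
      using X by (auto simp: C_def D_def)
    have "shuffle_sign A D * shuffle_sign B C = shuffle_sign B (C \<union> D) * shuffle_sign C D"
      unfolding A by (simp add: shuffle_sign_union_left[OF dis(1)] shuffle_sign_union_right[OF dis(2)])
    then have "shuffle_sign A D * (shuffle_sign B C * \<alpha> B * \<beta> C) * \<gamma> D = shuffle_sign B (C \<union> D) * \<alpha> B * (shuffle_sign C D * \<beta> C * \<gamma> D)"
      by (simp add: mult_ac)
    then show "(case case X of (A, B) \<Rightarrow> (B, A - B) of (B, C) \<Rightarrow> shuffle_sign B (S - B) * \<alpha> B * (shuffle_sign C (S - B - C) * \<beta> C * \<gamma> (S - B - C)))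
      = (case X of (A, B) \<Rightarrow> shuffle_sign A (S - A) * (shuffle_sign B (A - B) * \<alpha> B * \<beta> (A - B)) * \<gamma> (S - A))"
      unfolding X(1) prod.case C_def[symmetric] D D_def[symmetric] by (simp only: S)
  qed auto
  also have "\<dots> = wedge \<alpha> (wedge \<beta> \<gamma>) S"
    by (subst sum.Sigma[symmetric]) (auto simp: wedge_def sum_distrib_left)
  finally show "wedge (wedge \<alpha> \<beta>) \<gamma> S = wedge \<alpha> (wedge \<beta> \<gamma>) S" .
qed

lemma wedge_even_commute:
  assumes "\<And>S. odd (card S) \<Longrightarrow> \<alpha> S = 0"
  shows "wedge \<alpha> \<beta> = wedge \<beta> \<alpha>"
proof
  fix S :: "('a \<times> bool) set"
  have "wedge \<alpha> \<beta> S = (\<Sum>A\<in>Pow S. shuffle_sign (S - A) (S - (S - A)) * \<alpha> (S - A) * \<beta> (S - (S - A)))"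
    unfolding wedge_def by (rule sum.reindex_bij_witness[where i = "\<lambda>A. S - A" and j = "\<lambda>A. S - A"]) (auto simp: double_diff)
  also have "\<dots> = (\<Sum>A\<in>Pow S. shuffle_sign A (S - A) * \<beta> A * \<alpha> (S - A))"
  proof (rule sum.cong[OF refl])
    fix A assume A: "A \<in> Pow S"
    show "shuffle_sign (S - A) (S - (S - A)) * \<alpha> (S - A) * \<beta> (S - (S - A)) = shuffle_sign A (S - A) * \<beta> A * \<alpha> (S - A)"
    proof (cases "even (card (S - A))")
      case True
      then have "shuffle_sign A (S - A) * shuffle_sign (S - A) A = 1" by (subst shuffle_sign_swap) auto
      then have "shuffle_sign (S - A) A = shuffle_sign A (S - A)"
        by (metis (no_types) mult.assoc mult.right_neutral mult.left_neutral shuffle_sign_square)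
      then show ?thesis using A by (simp add: double_diff)
    qed (simp add: assms)
  qed
  also have "\<dots> = wedge \<beta> \<alpha> S" by (simp add: wedge_def)
  finally show "wedge \<alpha> \<beta> S = wedge \<beta> \<alpha> S" .
qed

lemma wedge_scalar: "wedge (scalar c) \<beta> S = c * \<beta> S"
proof -
  have "wedge (scalar c) \<beta> S = (\<Sum>A\<in>Pow S. if A = {} then c * \<beta> S else 0)"
    unfolding wedge_def by (intro sum.cong) (auto simp: scalar_def)
  then show ?thesis by simp
qed

lemma wedge_gen: "wedge (gen g) \<beta> S = (if g \<in> S then shuffle_sign {g} (S - {g}) * \<beta> (S - {g}) else 0)"
proof -
  have "wedge (gen g) \<beta> S = (\<Sum>A\<in>Pow S. if A = {g} then shuffle_sign {g} (S - {g}) * \<beta> (S - {g}) else 0)"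
    unfolding wedge_def by (intro sum.cong) (auto simp: gen_def)
  then show ?thesis by (simp add: sum.delta)
qed

lemma wedge_gen_gen_nonzero:
  assumes "wedge (gen g) (gen h) S \<noteq> 0"
  shows "g \<in> S" "S - {g} = {h}"
proof -
  show "g \<in> S"
  proof (rule ccontr)
    assume "g \<notin> S"
    with assms show False unfolding wedge_gen by (simp only: if_False)
  qed
  show "S - {g} = {h}"
  proof (rule ccontr)
    assume "S - {g} \<noteq> {h}"
    then have "gen h (S - {g}) = 0" unfolding gen_def by (simp only: if_False)
    with assms show False unfolding wedge_gen by (simp only: mult_zero_right if_cancel)
  qed
qed

lemma wedge_gen_swap: "wedge (gen g) (wedge (gen h) \<beta>) S = - wedge (gen h) (wedge (gen g) \<beta>) S"
proof (cases "g \<noteq> h \<and> g \<in> S \<and> h \<in> S")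
  case False
  then show ?thesis by (auto simp: wedge_gen)
next
  case True
  define T where "T = S - {g, h}"
  have TT: "T - {g} = T" "T - {h} = T" by (auto simp: T_def)
  have T: "S - {g} = {h} \<union> T" "S - {h} = {g} \<union> T" "S - {g} - {h} = T" "S - {h} - {g} = T" "{h} \<inter> T = {}" "{g} \<inter> T = {}"
    using True by (auto simp: T_def)
  have "shuffle_sign {g} {h} * shuffle_sign {h} {g} = - 1"
    using True by (subst shuffle_sign_swap) auto
  then have "shuffle_sign {g} {h} = - shuffle_sign {h} {g}"
    by (metis (no_types) minus_mult_left mult.assoc mult.right_neutral mult_minus_right shuffle_sign_square)
  then show ?thesis
    using True unfolding wedge_gen
    by (simp add: T TT shuffle_sign_union_right[OF T(5), simplified] shuffle_sign_union_right[OF T(6), simplified])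
qed

lemma wedge_add_left: "wedge (\<lambda>S. \<alpha> S + \<beta> S) \<gamma> S = wedge \<alpha> \<gamma> S + wedge \<beta> \<gamma> S"
  by (simp add: wedge_def distrib_left distrib_right sum.distrib)

lemma wedge_sum_right: "wedge \<alpha> (\<lambda>S. \<Sum>i\<in>I. f i S) S = (\<Sum>i\<in>I. wedge \<alpha> (f i) S)"
  unfolding wedge_def sum_distrib_left by (rule sum.swap)

lemma wedge_mult_right: "wedge \<alpha> (\<lambda>S. c * \<beta> S) S = c * wedge \<alpha> \<beta> S"
  by (simp add: wedge_def sum_distrib_left mult_ac)

section \<open>The commutative algebra of even forms\<close>

text \<open>Forms of even degree commute, so they form a commutative ring. Powers, products over index sets and determinants of
  forms are then available from ring theory.\<close>

typedef (overloaded) ('m::"{finite,linorder}") even_form = "{\<alpha> :: 'm covector. \<forall>S. odd (card S) \<longrightarrow> \<alpha> S = 0}"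
  morphisms coeff Even
  by (rule exI[of _ "\<lambda>_. 0"]) simp

setup_lifting type_definition_even_form

lemma coeff_odd: "odd (card S) \<Longrightarrow> coeff \<alpha> S = 0"
  using coeff[of \<alpha>] by auto

lemma wedge_even:
  assumes "\<forall>S. odd (card S) \<longrightarrow> \<alpha> S = 0" "\<forall>S. odd (card S) \<longrightarrow> \<beta> S = 0"
  shows "odd (card S) \<Longrightarrow> wedge \<alpha> \<beta> (S :: ('m::{finite,linorder} \<times> bool) set) = 0"
  unfolding wedge_def
proof (rule sum.neutral, rule ballI)
  fix A assume S: "odd (card S)" and A: "A \<in> Pow S"
  have "card S = card A + card (S - A)" using A by (simp add: card_Diff_subset card_mono)
  then have "odd (card A) \<or> odd (card (S - A))" using S by auto
  then show "shuffle_sign A (S - A) * \<alpha> A * \<beta> (S - A) = 0" using assms by auto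
qed

instantiation even_form :: ("{finite,linorder}") comm_ring_1
begin

lift_definition zero_even_form :: "'a even_form" is "\<lambda>_. 0" by simp
lift_definition one_even_form :: "'a even_form" is "scalar 1" by (auto simp: scalar_def)
lift_definition plus_even_form :: "'a even_form \<Rightarrow> 'a even_form \<Rightarrow> 'a even_form" is "\<lambda>\<alpha> \<beta> S. \<alpha> S + \<beta> S" by simp
lift_definition minus_even_form :: "'a even_form \<Rightarrow> 'a even_form \<Rightarrow> 'a even_form" is "\<lambda>\<alpha> \<beta> S. \<alpha> S - \<beta> S" by simp
lift_definition uminus_even_form :: "'a even_form \<Rightarrow> 'a even_form" is "\<lambda>\<alpha> S. - \<alpha> S" by simp
lift_definition times_even_form :: "'a even_form \<Rightarrow> 'a even_form \<Rightarrow> 'a even_form" is wedge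
  using wedge_even by blast

instance
proof
  fix a b c :: "'a even_form"
  show "a * b * c = a * (b * c)" by transfer (rule wedge_assoc)
  show "a * b = b * a" by transfer (rule wedge_even_commute, auto)
  show "1 * a = a" by transfer (auto simp: fun_eq_iff wedge_scalar)
  show "(a + b) * c = a * c + b * c" by transfer (auto simp: fun_eq_iff wedge_add_left)
  show "(0 :: 'a even_form) \<noteq> 1" by transfer (auto simp: fun_eq_iff scalar_def)
qed (transfer, simp add: algebra_simps)+

end

lemma coeff_eqI: "(\<And>S. coeff \<alpha> S = coeff \<beta> S) \<Longrightarrow> \<alpha> = \<beta>"
  by (simp add: coeff_inject[symmetric] fun_eq_iff)

lemma coeff_simps [simp]:
  "coeff 0 S = 0" "coeff (\<alpha> + \<beta>) S = coeff \<alpha> S + coeff \<beta> S" "coeff (- \<alpha>) S = - coeff \<alpha> S"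
  by (transfer, simp)+

lemma coeff_times: "coeff (\<alpha> * \<beta>) = wedge (coeff \<alpha>) (coeff \<beta>)"
  by transfer simp

lemma coeff_one: "coeff 1 = scalar 1"
  by transfer simp

lemma coeff_sum: "coeff (\<Sum>i\<in>I. f i) S = (\<Sum>i\<in>I. coeff (f i) S)"
  by (induction I rule: infinite_finite_induct) auto

lemma wedge_power_coeff: "wedge_power k (coeff \<alpha>) = coeff (\<alpha> ^ k)"
  by (induction k) (simp_all add: coeff_one coeff_times)

lift_definition const :: "complex \<Rightarrow> 'm::{finite,linorder} even_form" is scalar
  by (auto simp: scalar_def)

lemma coeff_const_times [simp]: "coeff (const c * \<alpha>) S = c * coeff \<alpha> S"
  by (simp add: coeff_times const.rep_eq wedge_scalar)

lemma const_simps: "const 0 = 0" "const 1 = 1" "const (a + b) = const a + const b" "const (a * b) = const a * const b"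
  "const (- a) = - const a"
  by (rule coeff_eqI, simp add: const.rep_eq coeff_one, simp add: scalar_def)
     (rule coeff_eqI, simp add: const.rep_eq coeff_one,
      rule coeff_eqI, simp add: const.rep_eq scalar_def,
      rule coeff_eqI, simp add: const.rep_eq scalar_def,
      rule coeff_eqI, simp add: const.rep_eq scalar_def)

lemma const_sum: "const (\<Sum>i\<in>I. f i) = (\<Sum>i\<in>I. const (f i))"
  by (induction I rule: infinite_finite_induct) (simp_all add: const_simps)

lemma const_prod: "const (\<Prod>i\<in>I. f i) = (\<Prod>i\<in>I. const (f i))"
  by (induction I rule: infinite_finite_induct) (simp_all add: const_simps)

lemma const_of_nat: "const (of_nat n) = of_nat n"
  by (induction n) (simp_all add: const_simps)

lift_definition pair :: "'m::{finite,linorder} \<Rightarrow> 'm \<Rightarrow> 'm even_form" is "\<lambda>a b. wedge (dz a) (dzbar b)"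
proof -
  fix a b :: 'm and S :: "('m \<times> bool) set"
  assume odd: "odd (card S)"
  show "wedge (dz a) (dzbar b) S = 0"
  proof (rule ccontr)
    assume "wedge (dz a) (dzbar b) S \<noteq> 0"
    then have "wedge (gen (a, False)) (gen (b, True)) S \<noteq> 0" by (simp add: dz_gen dzbar_gen)
    from wedge_gen_gen_nonzero[OF this] have "card S = 2"
      using card.remove[of S "(a, False)"] by simp
    then show False using odd by simp
  qed
qed

lemma wedge_pair: "wedge (coeff (pair a b)) \<beta> = wedge (dz a) (wedge (dzbar b) \<beta>)"
  by (simp add: pair.rep_eq wedge_assoc)

lemma wedge_uminus_right: "wedge \<alpha> (\<lambda>S. - \<beta> S) S = - wedge \<alpha> \<beta> S"
  using wedge_mult_right[of \<alpha> "- 1" \<beta> S] by simp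

text \<open>Exchanging the two conjugate factors of a product of pairs takes three transpositions of one-forms.\<close>

lemma pair_exchange: "pair a b * pair c d = - (pair a d * pair c b)"
proof (rule coeff_eqI)
  fix S
  let ?w = "\<lambda>g \<beta>. wedge (gen g) \<beta>"
  have sw: "?w g (?w h \<beta>) = (\<lambda>S. - ?w h (?w g \<beta>) S)" for g h and \<beta> :: "'a covector"
    by (rule ext) (rule wedge_gen_swap)
  have neg: "?w g (\<lambda>S. - \<beta> S) = (\<lambda>S. - ?w g \<beta> S)" for g and \<beta> :: "'a covector"
    by (rule ext) (rule wedge_uminus_right)
  have one: "gen g = ?w g (scalar 1)" for g :: "'a \<times> bool"
    by (rule ext) (auto simp: wedge_gen gen_def scalar_def)
  have L: "coeff (pair a b * pair c d) = ?w (a, False) (?w (b, True) (?w (c, False) (?w (d, True) (scalar 1))))" for a b c d :: 'a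
    by (simp add: coeff_times wedge_pair) (simp add: pair.rep_eq dz_gen dzbar_gen one[symmetric])
  have "?w (b, True) (?w (c, False) (?w (d, True) (scalar 1))) = (\<lambda>S. - ?w (d, True) (?w (c, False) (?w (b, True) (scalar 1))) S)"
    by (subst sw[of "(b, True)" "(c, False)"], subst sw[of "(b, True)" "(d, True)"], subst neg,
        subst sw[of "(c, False)" "(d, True)"]) simp
  then show "coeff (pair a b * pair c d) S = coeff (- (pair a d * pair c b)) S"
    by (simp add: L neg)
qed

lemma even_form_double_zero: "\<alpha> = - \<alpha> \<Longrightarrow> \<alpha> = (0 :: 'm::{finite,linorder} even_form)"
proof (rule coeff_eqI)
  fix S assume "\<alpha> = - \<alpha>"
  then have "coeff \<alpha> S = coeff (- \<alpha>) S" by (rule arg_cong[of _ _ "\<lambda>\<alpha>. coeff \<alpha> S"])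
  then show "coeff \<alpha> S = coeff 0 S" by (simp only: coeff_simps) simp
qed

lemma pair_same_left: "pair a b * pair a d = 0"
  by (rule even_form_double_zero) (metis pair_exchange mult.commute)

lemma pair_same_right: "pair a b * pair c b = 0"
  by (rule even_form_double_zero) (rule pair_exchange)

section \<open>Top powers\<close>

lemma power_add_square_zero:
  fixes x s :: "'r::comm_ring_1"
  assumes "x * x = 0"
  shows "(x + s) ^ Suc k = s ^ Suc k + of_nat (Suc k) * x * s ^ k"
proof (induction k)
  case (Suc k)
  have "(x + s) ^ Suc (Suc k) = (x + s) * (s ^ Suc k + of_nat (Suc k) * x * s ^ k)" using Suc by simp
  also have "\<dots> = s ^ Suc (Suc k) + of_nat (Suc (Suc k)) * x * s ^ Suc k + of_nat (Suc k) * (x * x) * s ^ k"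
    by (simp add: algebra_simps)
  finally show ?case using assms by simp
qed (simp add: algebra_simps)

text \<open>In the multinomial expansion only the product of all the elements survives, and it occurs in \<open>fact (card J)\<close> orders.
  The vanishing of the next power is what the induction needs in addition.\<close>

lemma sum_power_square_zero:
  fixes x :: "'i \<Rightarrow> 'r::comm_ring_1"
  assumes "finite J" "\<And>i. i \<in> J \<Longrightarrow> x i * x i = 0"
  shows "(\<Sum>i\<in>J. x i) ^ card J = of_nat (fact (card J)) * (\<Prod>i\<in>J. x i) \<and> (\<Sum>i\<in>J. x i) ^ Suc (card J) = 0"
  using assms
proof (induction J rule: finite_induct)
  case (insert i J)
  let ?s = "\<Sum>i\<in>J. x i"
  have IH: "?s ^ card J = of_nat (fact (card J)) * (\<Prod>i\<in>J. x i)" "?s ^ Suc (card J) = 0" using insert by auto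
  have x: "x i * x i = 0" using insert by auto
  have "(x i + ?s) ^ Suc (card J) = of_nat (Suc (card J)) * x i * ?s ^ card J"
    unfolding power_add_square_zero[OF x] IH(2) by simp
  moreover have "(x i + ?s) ^ Suc (Suc (card J)) = 0"
    unfolding power_add_square_zero[OF x] using IH(2) by simp
  ultimately show ?case using insert IH(1) by (simp add: algebra_simps)
qed simp

text \<open>A transposition of the conjugate factors is an instance of \<open>pair_exchange\<close>, so the sign is that of the permutation.\<close>

lemma prod_pair_permutation:
  assumes "p permutes (UNIV :: 'm::{finite,linorder} set)"
  shows "(\<Prod>a\<in>UNIV. pair a (p a)) = of_int (sign p) * (\<Prod>a\<in>UNIV. pair a (a :: 'm))"
proof -
  have "finite (UNIV :: 'm set)" by simp
  with assms show ?thesis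
  proof (induction rule: permutes_induct)
    case id
    then show ?case by (simp add: sign_id)
  next
    case (swap a b p)
    have p: "bij p" using swap permutes_bij by blast
    define i where "i = inv p a"
    define j where "j = inv p b"
    have ij: "p i = a" "p j = b" "i \<noteq> j" using p swap by (auto simp: i_def j_def bij_is_surj surj_f_inv_f dest: arg_cong[of _ _ p])
    have other: "Transposition.transpose a b (p c) = p c" if "c \<notin> {i, j}" for c
      using that p ij by (metis bij_pointE insertCI transpose_apply_other)
    have split: "(\<Prod>c\<in>UNIV. f c) = f i * f j * (\<Prod>c\<in>UNIV - {i, j}. f c)" for f :: "'m \<Rightarrow> 'm even_form"
      using ij by (subst prod.subset_diff[of "{i, j}"]) (auto simp: mult_ac)
    have eq: "(\<Prod>c\<in>UNIV. pair c ((Transposition.transpose a b \<circ> p) c)) = - (\<Prod>c\<in>UNIV. pair c (p c))"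
    proof -
    have "(\<Prod>c\<in>UNIV. pair c ((Transposition.transpose a b \<circ> p) c)) = pair i b * pair j a * (\<Prod>c\<in>UNIV - {i, j}. pair c (p c))"
      unfolding split using ij other by simp
    also have "\<dots> = - (\<Prod>c\<in>UNIV. pair c (p c))"
      unfolding split using ij pair_exchange[of i b j a] by simp
    finally show ?thesis .
    qed
    have perm: "permutation p"
      unfolding permutation_permutes using swap by (intro exI[of _ UNIV]) simp
    have "- (\<Prod>c\<in>UNIV. pair c (p c)) = of_int (sign (Transposition.transpose a b \<circ> p)) * (\<Prod>a\<in>UNIV. pair a a)"
      using swap by (simp add: sign_compose[OF permutation_swap_id perm] sign_swap_id)
    then show ?case by (rule trans[OF eq])
  qed
qed

text \<open>No sign arises because the two factors of \<open>pair a a\<close> are neighbours in the order of the generators: moving either of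
  them past the other pairs takes the same number of transpositions.\<close>

lemma coeff_prod_diagonal:
  "coeff (\<Prod>a\<in>J. pair a a) S = (if S = J \<times> UNIV then 1 else 0)"
  for J :: "'m::{finite,linorder} set"
proof -
  have "finite J" by simp
  then show ?thesis
  proof (induction J arbitrary: S rule: finite_induct)
    case empty
    then show ?case by (simp add: coeff_one scalar_def)
  next
    case (insert a J)
    let ?g = "(a, False)" and ?h = "(a, True)"
    have c: "coeff (\<Prod>a\<in>insert a J. pair a a) S =
      (if ?g \<in> S \<and> ?h \<in> S then shuffle_sign {?g} (S - {?g}) * shuffle_sign {?h} (S - {?g} - {?h}) *
        (if S - {?g} - {?h} = J \<times> UNIV then 1 else 0) else 0)"
      using insert by (simp add: coeff_times wedge_pair) (simp add: dz_gen dzbar_gen wedge_gen)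
    show ?case
    proof (cases "S = insert a J \<times> UNIV")
      case True
      have J: "S - {?g} - {?h} = J \<times> UNIV" using True insert by auto
      have S: "S - {?g} = {?h} \<union> J \<times> UNIV" "{?h} \<inter> J \<times> UNIV = {}" using True insert by auto
      have emp: "{(x, b). x \<in> {?g} \<and> b \<in> {?h} \<and> before b x} = {}" by (auto simp: before_def)
      have 1: "shuffle_sign {?g} {?h} = 1" unfolding shuffle_sign_def emp by simp
      have "{(x, b). x \<in> {?h} \<and> b \<in> J \<times> UNIV \<and> before b x} = (\<lambda>(x, b). (?h, b)) ` {(x, b). x \<in> {?g} \<and> b \<in> J \<times> UNIV \<and> before b x}"
        using insert by (auto simp: before_def image_iff)
      moreover have "inj_on (\<lambda>(x, b). (?h, b)) {(x, b). x \<in> {?g} \<and> b \<in> J \<times> UNIV \<and> before b x}"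
        by (auto simp: inj_on_def)
      ultimately have "card {(x, b). x \<in> {?h} \<and> b \<in> J \<times> UNIV \<and> before b x} = card {(x, b). x \<in> {?g} \<and> b \<in> J \<times> UNIV \<and> before b x}"
        by (simp only: card_image)
      then have 2: "shuffle_sign {?h} (J \<times> UNIV) = shuffle_sign {?g} (J \<times> UNIV)" by (simp add: shuffle_sign_def)
      have "shuffle_sign {?g} (S - {?g}) * shuffle_sign {?h} (J \<times> UNIV) = 1"
        unfolding S(1) shuffle_sign_union_right[OF S(2)] 1 2 using shuffle_sign_square by simp
      then show ?thesis using True J unfolding c by auto
    next
      case False
      have "S = insert a J \<times> UNIV" if "?g \<in> S" "?h \<in> S" "S - {?g} - {?h} = J \<times> UNIV"
      proof -
        have "S = {?g, ?h} \<union> (S - {?g} - {?h})" using that by auto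
        then show ?thesis unfolding that(3) by (auto simp: UNIV_bool)
      qed
      then have n: "\<not> (?g \<in> S \<and> ?h \<in> S \<and> S - {?g} - {?h} = J \<times> UNIV)" using False by blast
      show ?thesis
      proof (cases "S - {?g} - {?h} = J \<times> UNIV")
        case True
        then have "\<not> (?g \<in> S \<and> ?h \<in> S)" using n by blast
        then show ?thesis unfolding c using False by (simp only: if_False)
      next
        case no: False
        show ?thesis unfolding c if_not_P[OF no] by (simp add: False)
      qed
    qed
  qed
qed

text \<open>The rows of the matrix are elements of square zero, so the power is \<open>fact CARD('m)\<close> times their product. Multiplying the
  rows out, the terms with a repeated column vanish and the others form the Leibniz formula.\<close>

lemma pair_matrix_top_power:
  fixes c :: "complex ^ 'm::{finite,linorder} ^ 'm::{finite,linorder}"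
  shows "(\<Sum>a\<in>UNIV. \<Sum>b\<in>UNIV. const (c $ a $ b) * pair a b) ^ CARD('m)
    = const (fact CARD('m) * det c) * (\<Prod>a\<in>UNIV. pair a a)"
proof -
  let ?x = "\<lambda>a. \<Sum>b\<in>UNIV. const (c $ a $ b) * pair a b"
  have "?x a * ?x a = 0" for a
  proof -
    have "const (c $ a $ b) * pair a b * (const (c $ a $ d) * pair a d) = const (c $ a $ b) * const (c $ a $ d) * (pair a b * pair a d)" for b d
      by (simp only: mult_ac)
    then show ?thesis unfolding sum_product by (simp add: pair_same_left)
  qed
  then have "(\<Sum>a\<in>UNIV. ?x a) ^ CARD('m) = of_nat (fact CARD('m)) * (\<Prod>a\<in>UNIV. ?x a)"
    using sum_power_square_zero[of UNIV ?x] by simp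
  also have "(\<Prod>a\<in>UNIV. ?x a) = (\<Sum>f\<in>UNIV \<rightarrow>\<^sub>E UNIV. \<Prod>a\<in>UNIV. const (c $ a $ f a) * pair a (f a))"
    by (rule prod_sum_PiE) auto
  also have "\<dots> = (\<Sum>f\<in>{p. p permutes UNIV}. \<Prod>a\<in>UNIV. const (c $ a $ f a) * pair a (f a))"
  proof (rule sum.mono_neutral_right)
    show "\<forall>f\<in>(UNIV \<rightarrow>\<^sub>E UNIV) - {p. p permutes UNIV}. (\<Prod>a\<in>UNIV. const (c $ a $ f a) * pair a (f a)) = 0"
    proof
      fix f :: "'m \<Rightarrow> 'm" assume "f \<in> (UNIV \<rightarrow>\<^sub>E UNIV) - {p. p permutes UNIV}"
      then have "\<not> inj f" using finite_UNIV_inj_surj[of f] by (auto simp: bij_def intro: bij_imp_permutes)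
      then obtain i j where ij: "i \<noteq> j" "f i = f j" by (auto simp: inj_def)
      have "(\<Prod>a\<in>UNIV. pair a (f a)) = pair i (f i) * pair j (f j) * (\<Prod>c\<in>UNIV - {i, j}. pair c (f c))"
        using ij by (subst prod.subset_diff[of "{i, j}"]) (auto simp: mult_ac)
      then show "(\<Prod>a\<in>UNIV. const (c $ a $ f a) * pair a (f a)) = 0"
        using ij by (simp add: prod.distrib pair_same_right)
    qed
  qed auto
  also have "\<dots> = (\<Sum>p\<in>{p. p permutes UNIV}. const (of_int (sign p) * (\<Prod>a\<in>UNIV. c $ a $ p a)) * (\<Prod>a\<in>UNIV. pair a a))"
  proof (rule sum.cong[OF refl])
    fix p :: "'m \<Rightarrow> 'm" assume "p \<in> {p. p permutes UNIV}"
    then have "(\<Prod>a\<in>UNIV. pair a (p a)) = of_int (sign p) * (\<Prod>a\<in>UNIV. pair a a)" by (simp add: prod_pair_permutation)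
    moreover have "const (of_int (sign p)) = (of_int (sign p) :: 'm even_form)"
      by (cases rule: sign_cases[of p]) (simp_all add: const_simps)
    ultimately show "(\<Prod>a\<in>UNIV. const (c $ a $ p a) * pair a (p a)) = const (of_int (sign p) * (\<Prod>a\<in>UNIV. c $ a $ p a)) * (\<Prod>a\<in>UNIV. pair a a)"
      by (simp add: prod.distrib const_simps const_prod mult_ac)
  qed
  also have "\<dots> = const (det c) * (\<Prod>a\<in>UNIV. pair a a)"
    by (simp add: det_def const_sum sum_distrib_right)
  finally show ?thesis
    unfolding const_of_nat[symmetric] by (simp add: const_simps mult.assoc)
qed

definition bidegree :: "nat \<Rightarrow> nat \<Rightarrow> 'm::{finite,linorder} covector \<Rightarrow> bool" where
  "bidegree p q \<alpha> \<longleftrightarrow> (\<forall>S. \<alpha> S \<noteq> 0 \<longrightarrow> card {j. (j, False) \<in> S} = p \<and> card {j. (j, True) \<in> S} = q)"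

lemma bidegree_wedge:
  assumes "bidegree p q \<alpha>" "bidegree p' q' \<beta>"
  shows "bidegree (p + p') (q + q') (wedge \<alpha> \<beta>)"
  unfolding bidegree_def
proof (intro allI impI)
  fix S assume "wedge \<alpha> \<beta> S \<noteq> 0"
  then obtain A where A: "A \<subseteq> S" "\<alpha> A \<noteq> 0" "\<beta> (S - A) \<noteq> 0"
    unfolding wedge_def by (metis (no_types, lifting) PowD mult_eq_0_iff sum.neutral)
  have "card {j. (j, b) \<in> S} = card {j. (j, b) \<in> A} + card {j. (j, b) \<in> S - A}" for b
  proof -
    have "{j. (j, b) \<in> S} = {j. (j, b) \<in> A} \<union> {j. (j, b) \<in> S - A}" using A by auto
    then show ?thesis by (simp only:) (rule card_Un_disjoint, auto)
  qed
  then show "card {j. (j, False) \<in> S} = p + p' \<and> card {j. (j, True) \<in> S} = q + q'"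
    using assms A by (auto simp: bidegree_def)
qed

lemma bidegree_pair_combination:
  "bidegree 1 1 (coeff (\<Sum>a\<in>UNIV. \<Sum>b\<in>UNIV. const (c a b) * pair a b))"
  unfolding bidegree_def
proof (intro allI impI)
  fix S assume "coeff (\<Sum>a\<in>UNIV. \<Sum>b\<in>UNIV. const (c a b) * pair a b) S \<noteq> 0"
  then have "(\<Sum>a\<in>UNIV. \<Sum>b\<in>UNIV. c a b * coeff (pair a b) S) \<noteq> 0" by (simp add: coeff_sum)
  then obtain a where "(\<Sum>b\<in>UNIV. c a b * coeff (pair a b) S) \<noteq> 0" by (rule sum.not_neutral_contains_not_neutral)
  then obtain b where "c a b * coeff (pair a b) S \<noteq> 0" by (rule sum.not_neutral_contains_not_neutral)
  then have "coeff (pair a b) S \<noteq> 0" by simp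
  then have "wedge (gen (a, False)) (gen (b, True)) S \<noteq> 0" by (simp add: pair.rep_eq dz_gen dzbar_gen)
  from wedge_gen_gen_nonzero[OF this] have "S = {(a, False), (b, True)}" by blast
  then have "{j. (j, False) \<in> S} = {a}" "{j. (j, True) \<in> S} = {b}" by auto
  then show "card {j. (j, False) \<in> S} = 1 \<and> card {j. (j, True) \<in> S} = 1" by simp
qed

lemma bidegree_power:
  assumes "bidegree 1 1 (coeff \<alpha>)"
  shows "bidegree k k (coeff (\<alpha> ^ k))"
proof (induction k)
  case 0
  then show ?case by (auto simp: bidegree_def coeff_one scalar_def)
next
  case (Suc k)
  then show ?case using bidegree_wedge[OF assms Suc] by (simp add: coeff_times)
qed

section \<open>Calculus of finitely differentiable functions\<close>

lemma has_derivative_frechet: "f differentiable (at x) \<Longrightarrow> (f has_derivative frechet_derivative f (at x)) (at x)"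
  by (simp add: frechet_derivative_works)

lemma frechet_derivative_eq: "(f has_derivative f') (at x) \<Longrightarrow> frechet_derivative f (at x) = f'"
  by (rule frechet_derivative_at[symmetric])

lemma frechet_derivative_cong_open:
  assumes "open S" "x \<in> S" "\<And>y. y \<in> S \<Longrightarrow> f y = g y"
  shows "frechet_derivative f (at x) = frechet_derivative g (at x)"
proof -
  have "(f has_derivative D) (at x) \<longleftrightarrow> (g has_derivative D) (at x)" for D
    using assms has_derivative_transform_within_open[of f D x UNIV S g] has_derivative_transform_within_open[of g D x UNIV S f] by auto
  then show ?thesis by (simp add: frechet_derivative_def)
qed

lemma differentiable_cong_open:
  assumes "open S" "x \<in> S" "\<And>y. y \<in> S \<Longrightarrow> f y = g y" "f differentiable (at x)"
  shows "g differentiable (at x)"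
  using assms has_derivative_transform_within_open[of f _ x UNIV S g] by (auto simp: differentiable_def)

lemma Ck_on_cong:
  assumes "open S" "\<And>x. x \<in> S \<Longrightarrow> f x = g x" "Ck_on k S f"
  shows "Ck_on k S g"
  using assms(2,3)
proof (induction k arbitrary: f g)
  case 0
  then show ?case by (simp cong: continuous_on_cong)
next
  case (Suc k)
  have "Ck_on k S (\<lambda>x. frechet_derivative g (at x) v)" for v
  proof (rule Suc.IH)
    show "Ck_on k S (\<lambda>x. frechet_derivative f (at x) v)" using Suc.prems by simp
    show "frechet_derivative f (at x) v = frechet_derivative g (at x) v" if "x \<in> S" for x
      using frechet_derivative_cong_open[OF assms(1) that Suc.prems(1)] by simp
  qed
  then show ?case using Suc.prems differentiable_cong_open[OF assms(1), of _ f g] by auto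
qed

lemma Ck_on_SucI:
  assumes "open S" "\<And>x. x \<in> S \<Longrightarrow> (f has_derivative f' x) (at x)" "\<And>v. Ck_on k S (\<lambda>x. f' x v)"
  shows "Ck_on (Suc k) S f"
proof -
  have "Ck_on k S (\<lambda>x. frechet_derivative f (at x) v)" for v
    by (rule Ck_on_cong[OF assms(1) _ assms(3)[of v]]) (simp add: frechet_derivative_eq[OF assms(2)])
  then show ?thesis using assms(2) by (auto simp: differentiable_def)
qed

lemma Ck_on_differentiable: "Ck_on (Suc k) S f \<Longrightarrow> x \<in> S \<Longrightarrow> (f has_derivative frechet_derivative f (at x)) (at x)"
  by (simp add: has_derivative_frechet)

lemma Ck_on_SucD: "Ck_on (Suc k) S f \<Longrightarrow> Ck_on k S f"
proof (induction k arbitrary: f)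
  case 0
  then show ?case
    by (auto intro!: continuous_at_imp_continuous_on differentiable_imp_continuous_within)
qed auto

lemma Ck_on_le: "j \<le> k \<Longrightarrow> Ck_on k S f \<Longrightarrow> Ck_on j S f"
  by (induction k) (auto simp: le_Suc_eq dest: Ck_on_SucD simp del: Ck_on.simps)

lemma Ck_on_continuous: "Ck_on k S f \<Longrightarrow> continuous_on S f"
  using Ck_on_le[of 0 k S f] by simp

lemma Ck_on_const: "Ck_on k S (\<lambda>x. c)"
  by (induction k arbitrary: c) (auto simp: frechet_derivative_const)

lemma Ck_on_add:
  assumes "open S" "Ck_on k S f" "Ck_on k S g"
  shows "Ck_on k S (\<lambda>x. f x + g x)"
  using assms(2,3)
proof (induction k arbitrary: f g)
  case (Suc k)
  show ?case
    by (rule Ck_on_SucI[OF assms(1) has_derivative_add[OF Ck_on_differentiable[OF Suc.prems(1)] Ck_on_differentiable[OF Suc.prems(2)]]])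
       (use Suc in auto)
qed (auto intro: continuous_intros)

lemma Ck_on_sum:
  assumes "open S" "\<And>i. i \<in> I \<Longrightarrow> Ck_on k S (f i)"
  shows "Ck_on k S (\<lambda>x. \<Sum>i\<in>I. f i x)"
  using assms(2) by (induction I rule: infinite_finite_induct) (auto intro!: Ck_on_const Ck_on_add[OF assms(1)])

lemma Ck_on_bounded_linear:
  assumes "open S" "bounded_linear L" "Ck_on k S f"
  shows "Ck_on k S (\<lambda>x. L (f x))"
  using assms(3)
proof (induction k arbitrary: f)
  case 0
  then show ?case using assms(2) by (auto intro: bounded_linear.continuous_on)
next
  case (Suc k)
  show ?case
    by (rule Ck_on_SucI[OF assms(1) bounded_linear.has_derivative[OF assms(2) Ck_on_differentiable[OF Suc.prems]]])
       (use Suc in auto)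
qed

lemma Ck_on_mult:
  fixes f g :: "'a::euclidean_space \<Rightarrow> 'b::real_normed_algebra"
  assumes "open S" "Ck_on k S f" "Ck_on k S g"
  shows "Ck_on k S (\<lambda>x. f x * g x)"
  using assms(2,3)
proof (induction k arbitrary: f g)
  case (Suc k)
  show ?case
    by (rule Ck_on_SucI[OF assms(1) has_derivative_mult[OF Ck_on_differentiable[OF Suc.prems(1)] Ck_on_differentiable[OF Suc.prems(2)]]])
       (use Suc.prems Ck_on_SucD[OF Suc.prems(1)] Ck_on_SucD[OF Suc.prems(2)] in \<open>auto intro!: Ck_on_add[OF assms(1)] Suc.IH\<close>)
qed (auto intro: continuous_intros)

lemma Ck_on_linear: "open S \<Longrightarrow> bounded_linear L \<Longrightarrow> Ck_on k S L"
  by (cases k) (auto simp: bounded_linear.continuous_on bounded_linear_imp_has_derivative Ck_on_const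
      intro!: Ck_on_SucI[where f' = "\<lambda>_. L"] linear_continuous_on simp del: Ck_on.simps(2))

lemma Ck_on_real_polynomial:
  assumes "open S" "real_polynomial_function p"
  shows "Ck_on k S p"
  using assms(2)
  by induction (auto intro: Ck_on_linear[OF assms(1)] Ck_on_const Ck_on_add[OF assms(1)] Ck_on_mult[OF assms(1)])

lemma Ck_on_of_real: "open S \<Longrightarrow> Ck_on k S f \<Longrightarrow> Ck_on k S (\<lambda>x. complex_of_real (f x))"
  by (rule Ck_on_bounded_linear[OF _ bounded_linear_of_real])

section \<open>Wirtinger derivatives\<close>

lemma open_torus: "open (torus :: (complex ^ 'm) set)"
proof -
  have eq: "(torus :: (complex ^ 'm) set) = (\<Inter>i\<in>UNIV. {z. z $ i \<noteq> 0})" by (auto simp: torus_def)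
  show ?thesis unfolding eq by (intro open_INT ballI open_Collect_neq continuous_intros) simp
qed

lemma wirt_eq:
  assumes "(f has_derivative f') (at z)"
  shows "wirt j f z = (f' (axis j 1) - \<i> * f' (axis j \<i>)) / 2" "wirt_bar j f z = (f' (axis j 1) + \<i> * f' (axis j \<i>)) / 2"
  by (simp_all add: wirt_def wirt_bar_def frechet_derivative_eq[OF assms])

lemma wirt_cong_open:
  assumes "open S" "z \<in> S" "\<And>y. y \<in> S \<Longrightarrow> f y = g y"
  shows "wirt j f z = wirt j g z" "wirt_bar j f z = wirt_bar j g z"
  using frechet_derivative_cong_open[OF assms] by (simp_all add: wirt_def wirt_bar_def)

lemma wirt_const [simp]: "wirt j (\<lambda>_. c) z = 0" "wirt_bar j (\<lambda>_. c) z = 0"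
  by (simp_all add: wirt_def wirt_bar_def frechet_derivative_const)

lemma wirt_add:
  assumes "f differentiable (at z)" "g differentiable (at z)"
  shows "wirt j (\<lambda>z. f z + g z) z = wirt j f z + wirt j g z" "wirt_bar j (\<lambda>z. f z + g z) z = wirt_bar j f z + wirt_bar j g z"
  unfolding wirt_eq[OF has_derivative_add[OF has_derivative_frechet[OF assms(1)] has_derivative_frechet[OF assms(2)]]]
  by (simp_all add: wirt_def wirt_bar_def field_simps)

lemma wirt_mult:
  assumes "f differentiable (at z)" "g differentiable (at z)"
  shows "wirt j (\<lambda>z. f z * g z) z = wirt j f z * g z + f z * wirt j g z"
    "wirt_bar j (\<lambda>z. f z * g z) z = wirt_bar j f z * g z + f z * wirt_bar j g z"
  unfolding wirt_eq[OF has_derivative_mult[OF has_derivative_frechet[OF assms(1)] has_derivative_frechet[OF assms(2)]]]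
  by (simp_all add: wirt_def wirt_bar_def field_simps)

lemma wirt_cmult:
  assumes "f differentiable (at z)"
  shows "wirt j (\<lambda>z. c * f z) z = c * wirt j f z" "wirt_bar j (\<lambda>z. c * f z) z = c * wirt_bar j f z"
  using wirt_mult[of "\<lambda>_. c" z f j] assms by simp_all

lemma wirt_sum:
  assumes "\<And>i. i \<in> I \<Longrightarrow> f i differentiable (at z)"
  shows "wirt j (\<lambda>z. \<Sum>i\<in>I. f i z) z = (\<Sum>i\<in>I. wirt j (f i) z)" "wirt_bar j (\<lambda>z. \<Sum>i\<in>I. f i z) z = (\<Sum>i\<in>I. wirt_bar j (f i) z)"
  using assms
  by (induction I rule: infinite_finite_induct) (simp_all add: wirt_add differentiable_sum)

lemma Ck_on_wirt:
  assumes "open S" "Ck_on (Suc k) S f"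
  shows "Ck_on k S (wirt j f)" "Ck_on k S (wirt_bar j f)"
proof -
  have D: "Ck_on k S (\<lambda>x. frechet_derivative f (at x) v)" for v using assms by simp
  have eq: "wirt j f = (\<lambda>z. (1/2) * frechet_derivative f (at z) (axis j 1) + (- \<i> / 2) * frechet_derivative f (at z) (axis j \<i>))"
    "wirt_bar j f = (\<lambda>z. (1/2) * frechet_derivative f (at z) (axis j 1) + (\<i> / 2) * frechet_derivative f (at z) (axis j \<i>))"
    by (auto simp: fun_eq_iff wirt_def wirt_bar_def field_simps)
  show "Ck_on k S (wirt j f)" "Ck_on k S (wirt_bar j f)"
    unfolding eq by (intro Ck_on_add Ck_on_mult Ck_on_const D assms(1))+
qed

lemma Ck_on_differentiable1: "Ck_on k S f \<Longrightarrow> 1 \<le> k \<Longrightarrow> x \<in> S \<Longrightarrow> f differentiable (at x)"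
  by (cases k) auto

section \<open>The form \<open>dd\<^sup>c\<close> in terms of pairs of generators\<close>

lemma wedge_gen_wirt:
  assumes "\<And>A. (\<lambda>w. \<beta> w A) differentiable (at z)"
  shows "wirt j (\<lambda>w. wedge (gen g) (\<beta> w) S) z = wedge (gen g) (\<lambda>A. wirt j (\<lambda>w. \<beta> w A) z) S"
proof (cases "g \<in> S")
  case True
  then show ?thesis by (simp add: wedge_gen wirt_cmult[OF assms])
qed (simp add: wedge_gen)

lemma wedge_gen_differentiable:
  assumes "\<And>A. (\<lambda>w. \<beta> w A) differentiable (at z)"
  shows "(\<lambda>w. wedge (gen g) (\<beta> w) S) differentiable (at z)"
  using assms by (cases "g \<in> S") (auto simp: wedge_gen)

text \<open>Multiplication by a generator acts on the coefficients with constant signs and so commutes with Wirtinger derivatives.\<close>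

lemma ddc_pairs:
  assumes "\<And>k A. wirt_bar k (\<lambda>v. \<alpha> v A) differentiable (at z)"
  shows "ddc \<alpha> z S = \<i> / (2 * complex_of_real pi) *
    (\<Sum>a\<in>UNIV. \<Sum>b\<in>UNIV. wedge (coeff (pair a b)) (\<lambda>A. wirt a (wirt_bar b (\<lambda>v. \<alpha> v A)) z) S)"
proof -
  have "del (delbar \<alpha>) z S = (\<Sum>a\<in>UNIV. wedge (dz a) (\<lambda>A. \<Sum>b\<in>UNIV. wedge (dzbar b) (\<lambda>B. wirt a (wirt_bar b (\<lambda>v. \<alpha> v B)) z) A) S)"
    unfolding del_def delbar_def dzbar_gen
    by (simp add: wirt_sum wedge_gen_differentiable wedge_gen_wirt assms)
  then show ?thesis by (simp add: ddc_def wedge_sum_right wedge_pair)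
qed

section \<open>Symmetry of second derivatives\<close>

lemma has_real_derivative_along_line:
  assumes "(f has_derivative D) (at (x + s *\<^sub>R v))"
  shows "((\<lambda>s. f (x + s *\<^sub>R v)) has_real_derivative D v) (at s)"
proof -
  have "((\<lambda>s. x + s *\<^sub>R v) has_derivative (\<lambda>h. h *\<^sub>R v)) (at s)"
    by (auto intro!: derivative_eq_intros)
  from has_derivative_compose[OF this assms]
  have "((\<lambda>s. f (x + s *\<^sub>R v)) has_derivative (\<lambda>h. D (h *\<^sub>R v))) (at s)" .
  moreover have "D (h *\<^sub>R v) = D v * h" for h
    using has_derivative_bounded_linear[OF assms] by (simp add: linear_simps)
  ultimately show ?thesis by (simp add: has_field_derivative_def)
qed

text \<open>The mean value theorem, applied in direction \<open>i\<close> and then in direction \<open>j\<close>.\<close>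

lemma second_difference:
  fixes f :: "real ^ 'm \<Rightarrow> real"
  assumes f: "\<And>x. (f has_derivative (\<lambda>h. h \<bullet> (\<chi> i. g i x))) (at x)"
    and g: "\<And>i x. (g i has_derivative (\<lambda>h. h \<bullet> H i x)) (at x)"
    and t: "0 < t"
  shows "\<exists>p. dist p x \<le> 2 * t \<and> f (x + t *\<^sub>R axis i 1 + t *\<^sub>R axis j 1) - f (x + t *\<^sub>R axis i 1) - f (x + t *\<^sub>R axis j 1) + f x = t * (t * H i p $ j)"
proof -
  let ?i = "axis i 1 :: real ^ 'm" and ?j = "axis j 1 :: real ^ 'm"
  have "\<exists>\<xi>>0. \<xi> < t \<and> (f ((x + t *\<^sub>R ?j) + t *\<^sub>R ?i) - f (x + t *\<^sub>R ?i)) - (f ((x + t *\<^sub>R ?j) + 0 *\<^sub>R ?i) - f (x + 0 *\<^sub>R ?i))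
    = (t - 0) * (g i ((x + t *\<^sub>R ?j) + \<xi> *\<^sub>R ?i) - g i (x + \<xi> *\<^sub>R ?i))"
  proof (rule MVT2[OF t])
    fix s
    show "((\<lambda>s. f ((x + t *\<^sub>R ?j) + s *\<^sub>R ?i) - f (x + s *\<^sub>R ?i)) has_real_derivative
      (g i ((x + t *\<^sub>R ?j) + s *\<^sub>R ?i) - g i (x + s *\<^sub>R ?i))) (at s)"
    proof -
      have "((\<lambda>s. f (y + s *\<^sub>R ?i)) has_real_derivative g i (y + s *\<^sub>R ?i)) (at s)" for y
        using has_real_derivative_along_line[OF f[of "y + s *\<^sub>R ?i"]] by (simp add: inner_axis')
      then show ?thesis by (intro DERIV_diff)
    qed
  qed
  then obtain \<xi> where \<xi>: "0 < \<xi>" "\<xi> < t" and 1: "(f ((x + t *\<^sub>R ?j) + t *\<^sub>R ?i) - f (x + t *\<^sub>R ?i)) - (f (x + t *\<^sub>R ?j) - f x)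
    = t * (g i ((x + t *\<^sub>R ?j) + \<xi> *\<^sub>R ?i) - g i (x + \<xi> *\<^sub>R ?i))"
    by auto
  have "\<exists>\<eta>>0. \<eta> < t \<and> g i ((x + \<xi> *\<^sub>R ?i) + t *\<^sub>R ?j) - g i ((x + \<xi> *\<^sub>R ?i) + 0 *\<^sub>R ?j) = (t - 0) * (H i ((x + \<xi> *\<^sub>R ?i) + \<eta> *\<^sub>R ?j) $ j)"
  proof (rule MVT2[OF t])
    fix s
    show "((\<lambda>s. g i ((x + \<xi> *\<^sub>R ?i) + s *\<^sub>R ?j)) has_real_derivative (H i ((x + \<xi> *\<^sub>R ?i) + s *\<^sub>R ?j) $ j)) (at s)"
      using has_real_derivative_along_line[OF g[of i "(x + \<xi> *\<^sub>R ?i) + s *\<^sub>R ?j"]] by (simp add: inner_axis')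
  qed
  then obtain \<eta> where \<eta>: "0 < \<eta>" "\<eta> < t" and 2: "g i ((x + \<xi> *\<^sub>R ?i) + t *\<^sub>R ?j) - g i (x + \<xi> *\<^sub>R ?i) = t * (H i ((x + \<xi> *\<^sub>R ?i) + \<eta> *\<^sub>R ?j) $ j)"
    by auto
  define p where "p = (x + \<xi> *\<^sub>R ?i) + \<eta> *\<^sub>R ?j"
  have "dist p x = norm (\<xi> *\<^sub>R ?i + \<eta> *\<^sub>R ?j)" by (simp add: p_def dist_norm add.assoc)
  also have "\<dots> \<le> norm (\<xi> *\<^sub>R ?i) + norm (\<eta> *\<^sub>R ?j)" by (rule norm_triangle_ineq)
  also have "\<dots> \<le> 2 * t" using \<xi> \<eta> by (simp add: norm_eq_sqrt_inner inner_axis_axis)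
  finally have "dist p x \<le> 2 * t" .
  moreover have e: "x + t *\<^sub>R ?i + t *\<^sub>R ?j = (x + t *\<^sub>R ?j) + t *\<^sub>R ?i" "(x + t *\<^sub>R ?j) + \<xi> *\<^sub>R ?i = (x + \<xi> *\<^sub>R ?i) + t *\<^sub>R ?j"
    by (simp_all add: add_ac)
  have "f (x + t *\<^sub>R ?i + t *\<^sub>R ?j) - f (x + t *\<^sub>R ?i) - f (x + t *\<^sub>R ?j) + f x = t * (t * H i p $ j)"
    using 1 unfolding e(2) 2 p_def[symmetric] e(1) by linarith
  ultimately show ?thesis by blast
qed

text \<open>The second difference is symmetric in \<open>i\<close> and \<open>j\<close>. Divide it by \<open>t\<^sup>2\<close> and let \<open>t\<close> tend to \<open>0\<close>.\<close>

lemma second_derivative_symmetric: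
  fixes f :: "real ^ 'm \<Rightarrow> real"
  assumes f: "\<And>x. (f has_derivative (\<lambda>h. h \<bullet> (\<chi> i. g i x))) (at x)"
    and g: "\<And>i x. (g i has_derivative (\<lambda>h. h \<bullet> H i x)) (at x)"
    and H: "\<And>i. continuous_on UNIV (H i)"
  shows "H i x $ j = H j x $ i"
proof -
  have "\<exists>p q. dist p x \<le> 2 * t \<and> dist q x \<le> 2 * t \<and> H i p $ j = H j q $ i" if t: "0 < t" for t :: real
  proof -
    obtain p where p: "dist p x \<le> 2 * t" "f (x + t *\<^sub>R axis i 1 + t *\<^sub>R axis j 1) - f (x + t *\<^sub>R axis i 1) - f (x + t *\<^sub>R axis j 1) + f x = t * (t * H i p $ j)"
      using second_difference[OF f g t] by blast
    obtain q where q: "dist q x \<le> 2 * t" "f (x + t *\<^sub>R axis j 1 + t *\<^sub>R axis i 1) - f (x + t *\<^sub>R axis j 1) - f (x + t *\<^sub>R axis i 1) + f x = t * (t * H j q $ i)"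
      using second_difference[OF f g t] by blast
    have e: "x + t *\<^sub>R axis j 1 + t *\<^sub>R axis i 1 = x + t *\<^sub>R axis i 1 + t *\<^sub>R axis j 1" by (simp add: add_ac)
    have "t * (t * H i p $ j) = t * (t * H j q $ i)" using p(2) q(2) unfolding e by linarith
    then show ?thesis using p q t by auto
  qed
  then obtain p q where pq: "\<And>t. 0 < t \<Longrightarrow> dist (p t) x \<le> 2 * t" "\<And>t. 0 < t \<Longrightarrow> dist (q t) x \<le> 2 * t"
    "\<And>t. 0 < t \<Longrightarrow> H i (p t) $ j = H j (q t) $ i"
    by metis
  have "(\<lambda>n. 2 * (1 / real (Suc n))) \<longlonglongrightarrow> 2 * 0" by (intro tendsto_intros LIMSEQ_Suc[OF lim_1_over_n])
  then have lim0: "(\<lambda>n. 2 * (1 / real (Suc n))) \<longlonglongrightarrow> 0" by simp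
  have "norm (dist (p (1 / real (Suc n))) x) \<le> 2 * (1 / real (Suc n))" for n
    using pq(1)[of "1 / real (Suc n)"] by simp
  then have "\<forall>\<^sub>F n in sequentially. norm (dist (p (1 / real (Suc n))) x) \<le> 2 * (1 / real (Suc n))" by (rule always_eventually[OF allI])
  from Lim_null_comparison[OF this lim0] have P: "(\<lambda>n. p (1 / real (Suc n))) \<longlonglongrightarrow> x"
    by (simp only: tendsto_dist_iff[symmetric])
  have "norm (dist (q (1 / real (Suc n))) x) \<le> 2 * (1 / real (Suc n))" for n
    using pq(2)[of "1 / real (Suc n)"] by simp
  then have "\<forall>\<^sub>F n in sequentially. norm (dist (q (1 / real (Suc n))) x) \<le> 2 * (1 / real (Suc n))" by (rule always_eventually[OF allI])
  from Lim_null_comparison[OF this lim0] have Q: "(\<lambda>n. q (1 / real (Suc n))) \<longlonglongrightarrow> x"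
    by (simp only: tendsto_dist_iff[symmetric])
  have "isCont (H k) x" for k using H[of k] by (simp add: continuous_on_eq_continuous_at)
  from tendsto_vec_nth[OF isCont_tendsto_compose[OF this P]] tendsto_vec_nth[OF isCont_tendsto_compose[OF this Q]]
  have "(\<lambda>n. H i (p (1 / real (Suc n))) $ j) \<longlonglongrightarrow> H i x $ j" "(\<lambda>n. H j (q (1 / real (Suc n))) $ i) \<longlonglongrightarrow> H j x $ i" .
  moreover have "H i (p (1 / real (Suc n))) $ j = H j (q (1 / real (Suc n))) $ i" for n by (rule pq) simp
  ultimately show ?thesis using LIMSEQ_unique by fastforce
qed

section \<open>Mollification\<close>

text \<open>One continuous derivative is enough: it turns mollifications of functions of class \<open>C\<^sup>2\<close> into functions of class \<open>C\<^sup>3\<close>.\<close>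

definition bump :: "real ^ 'm \<Rightarrow> real" where "bump t = (max 0 (1 - t \<bullet> t))\<^sup>2"

definition bump_gradient :: "real ^ 'm \<Rightarrow> real ^ 'm" where "bump_gradient t = (- 4 * max 0 (1 - t \<bullet> t)) *\<^sub>R t"

lemma has_derivative_max_square: "((\<lambda>y::real. (max 0 y)\<^sup>2) has_derivative (\<lambda>h. h * (2 * max 0 y))) (at y)"
proof -
  have "((\<lambda>y::real. (max 0 y)\<^sup>2) has_real_derivative 2 * max 0 y) (at y)"
  proof (cases y "0::real" rule: linorder_cases)
    case less
    have "((\<lambda>y::real. 0) has_real_derivative 0) (at y)" by simp
    then have "((\<lambda>y::real. (max 0 y)\<^sup>2) has_real_derivative 0) (at y)"
      by (rule has_field_derivative_transform_within_open[of _ _ _ "{..<0}"]) (use less in \<open>auto simp: max_def\<close>)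
    then show ?thesis using less by (simp add: max_def)
  next
    case greater
    have "((\<lambda>y::real. y\<^sup>2) has_real_derivative 2 * y) (at y)" by (auto intro!: derivative_eq_intros)
    then have "((\<lambda>y::real. (max 0 y)\<^sup>2) has_real_derivative 2 * y) (at y)"
      by (rule has_field_derivative_transform_within_open[of _ _ _ "{0<..}"]) (use greater in \<open>auto simp: max_def\<close>)
    then show ?thesis using greater by (simp add: max_def)
  next
    case equal
    have "((\<lambda>h::real. ((max 0 (0 + h))\<^sup>2 - (max 0 0)\<^sup>2) / h) \<longlongrightarrow> 0) (at 0)"
    proof (rule Lim_null_comparison[where g = "\<lambda>h. \<bar>h\<bar>"])
      have "norm (((max 0 (0 + h))\<^sup>2 - (max 0 0)\<^sup>2) / h) \<le> \<bar>h\<bar>" for h :: real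
        by (cases "h > 0") (auto simp: max_def power2_eq_square)
      then show "\<forall>\<^sub>F h::real in at 0. norm (((max 0 (0 + h))\<^sup>2 - (max 0 0)\<^sup>2) / h) \<le> \<bar>h\<bar>" by (intro always_eventually allI)
      have "((\<lambda>h::real. \<bar>h\<bar>) \<longlongrightarrow> \<bar>0\<bar>) (at 0)" by (intro tendsto_intros)
      then show "((\<lambda>h::real. \<bar>h\<bar>) \<longlongrightarrow> 0) (at 0)" by simp
    qed
    then show ?thesis using equal by (simp add: DERIV_def)
  qed
  then show ?thesis unfolding has_field_derivative_def by (rule has_derivative_eq_rhs) (simp add: fun_eq_iff)
qed

lemma bump_derivative: "(bump has_derivative (\<lambda>h. h \<bullet> bump_gradient t)) (at t)"
proof -
  have "((\<lambda>t. 1 - t \<bullet> t) has_derivative (\<lambda>h. - (2 * (h \<bullet> t)))) (at t)"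
    by (auto intro!: derivative_eq_intros simp: inner_commute)
  from has_derivative_compose[OF this has_derivative_max_square]
  show ?thesis unfolding bump_def[abs_def] bump_gradient_def by (simp add: mult_ac)
qed

lemma bump_continuous: "continuous_on S bump" "continuous_on S bump_gradient"
  unfolding bump_def[abs_def] bump_gradient_def[abs_def] by (intro continuous_intros)+

lemma bump_outside: "t \<notin> cball 0 1 \<Longrightarrow> bump t = 0" "t \<notin> cball 0 1 \<Longrightarrow> bump_gradient t = 0"
proof -
  assume "t \<notin> cball 0 1"
  then have "1 < norm t" by simp
  then have "1 \<le> t \<bullet> t" by (metis less_imp_le one_le_power power2_norm_eq_inner)
  then show "bump t = 0" "bump_gradient t = 0" by (simp_all add: bump_def bump_gradient_def)
qed

lemma bump_bounds: "0 \<le> bump t" "bump t \<le> 1" "norm (bump_gradient t) \<le> 4"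
proof -
  have m: "0 \<le> max 0 (1 - t \<bullet> t)" "max 0 (1 - t \<bullet> t) \<le> 1" by auto
  then show "0 \<le> bump t" "bump t \<le> 1" by (simp_all add: bump_def power_le_one)
  show "norm (bump_gradient t) \<le> 4"
  proof (cases "t \<in> cball 0 1")
    case True
    then show ?thesis using m by (simp add: bump_gradient_def abs_mult mult_le_one)
  qed (simp add: bump_outside)
qed

lemma integrable_compact_support:
  fixes h :: "'a::euclidean_space \<Rightarrow> 'b::{banach, second_countable_topology}"
  assumes "compact K" "continuous_on K h" "\<And>x. x \<notin> K \<Longrightarrow> h x = 0"
  shows "integrable lborel h"
proof -
  have "(\<lambda>x. indicator K x *\<^sub>R h x) = h" using assms(3) by (auto simp: fun_eq_iff indicator_def)
  then show ?thesis using borel_integrable_compact[OF assms(1,2)] by simp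
qed

lemma integrable_cball: "integrable lborel (\<lambda>x::'a::euclidean_space. c * indicator (cball a r) x :: real)"
proof -
  have "emeasure lborel (cball a r) < \<infinity>" by (rule emeasure_bounded_finite[OF bounded_cball])
  then have "integrable lborel (indicator (cball a r) :: 'a \<Rightarrow> real)" by (intro integrable_real_indicator) auto
  then show ?thesis by (rule integrable_mult_right)
qed

definition bump_mass :: "'m::finite itself \<Rightarrow> real" where
  "bump_mass _ = (LINT t::real ^ 'm|lborel. bump t)"

lemma bump_integrable: "integrable lborel bump"
  by (rule integrable_compact_support[of "cball 0 1"]) (auto simp: bump_continuous bump_outside)

lemma bump_mass_pos: "0 < bump_mass TYPE('m::finite)"
proof -
  have "(LINT t::real ^ 'm|lborel. 9/16 * indicator (ball 0 (1/2)) t) \<le> bump_mass TYPE('m)"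
    unfolding bump_mass_def
  proof (rule integral_mono)
    show "integrable lborel (\<lambda>t::real ^ 'm. 9/16 * indicator (ball 0 (1/2)) t :: real)"
      using emeasure_bounded_finite[OF bounded_ball, of "0 :: real ^ 'm" "1/2"]
      by (intro integrable_mult_right integrable_real_indicator) auto
    fix t :: "real ^ 'm"
    show "9/16 * indicator (ball 0 (1/2)) t \<le> bump t"
    proof (cases "t \<in> ball 0 (1/2)")
      case True
      then have "norm t \<le> 1/2" by simp
      then have "t \<bullet> t \<le> (1/2)\<^sup>2" unfolding power2_norm_eq_inner[symmetric] by (intro power_mono) auto
      then have "3/4 \<le> 1 - t \<bullet> t" by (simp add: power2_eq_square)
      then have "3/4 \<le> max 0 (1 - t \<bullet> t)" by (rule max.coboundedI2)
      then have "(3/4)\<^sup>2 \<le> bump t" unfolding bump_def by (rule power_mono) simp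
      then show ?thesis using True by (simp add: power2_eq_square)
    qed (simp add: bump_bounds)
  qed (rule bump_integrable)
  then have "9/16 * measure lborel (ball (0 :: real ^ 'm) (1/2)) \<le> bump_mass TYPE('m)" by simp
  moreover have "0 < measure lborel (ball (0 :: real ^ 'm) (1/2))"
    using content_ball_pos[of "1/2" "0 :: real ^ 'm"] by simp
  ultimately show ?thesis by linarith
qed

definition kernel :: "real ^ 'm \<Rightarrow> real" where "kernel t = bump t / bump_mass TYPE('m)"

definition kernel_gradient :: "real ^ 'm \<Rightarrow> real ^ 'm" where "kernel_gradient t = bump_gradient t /\<^sub>R bump_mass TYPE('m)"

lemma kernel:
  fixes t :: "real ^ 'm"
  shows "0 \<le> kernel t" "t \<notin> cball 0 1 \<Longrightarrow> kernel t = 0" "t \<notin> cball 0 1 \<Longrightarrow> kernel_gradient t = 0"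
    "continuous_on S (kernel :: real ^ 'm \<Rightarrow> real)" "continuous_on S (kernel_gradient :: real ^ 'm \<Rightarrow> _)"
    "(LINT t::real ^ 'm|lborel. kernel t) = 1"
    "norm (kernel_gradient t) \<le> 4 / bump_mass TYPE('m)"
    "((kernel :: real ^ 'm \<Rightarrow> real) has_derivative (\<lambda>h. h \<bullet> kernel_gradient t)) (at t)"
proof -
  note pos = bump_mass_pos[where 'm = 'm]
  show "0 \<le> kernel t" "t \<notin> cball 0 1 \<Longrightarrow> kernel t = 0" "t \<notin> cball 0 1 \<Longrightarrow> kernel_gradient t = 0"
    using pos by (simp_all add: kernel_def kernel_gradient_def bump_outside bump_bounds less_imp_le del: mem_cball)
  show "continuous_on S (kernel :: real ^ 'm \<Rightarrow> real)" "continuous_on S (kernel_gradient :: real ^ 'm \<Rightarrow> _)"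
    unfolding kernel_def[abs_def] kernel_gradient_def[abs_def]
    using pos by (auto intro!: continuous_intros bump_continuous)
  show "(LINT t::real ^ 'm|lborel. kernel t) = 1"
    using pos by (simp add: kernel_def bump_mass_def)
  show "norm (kernel_gradient t) \<le> 4 / bump_mass TYPE('m)"
    using pos bump_bounds(3)[of t] by (simp add: kernel_gradient_def divide_right_mono divide_inverse mult.commute)
  show "((kernel :: real ^ 'm \<Rightarrow> real) has_derivative (\<lambda>h. h \<bullet> kernel_gradient t)) (at t)"
    unfolding kernel_def[abs_def] kernel_gradient_def
    using has_derivative_mult_left[OF bump_derivative, of "inverse (bump_mass TYPE('m))" t] by (simp add: divide_inverse mult.commute)
qed

definition mollify :: "real \<Rightarrow> (real ^ 'm \<Rightarrow> 'b::{banach, second_countable_topology}) \<Rightarrow> real ^ 'm \<Rightarrow> 'b" where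
  "mollify \<epsilon> h x = (LINT t|lborel. kernel t *\<^sub>R h (x + \<epsilon> *\<^sub>R t))"

lemma kernel_integrable: "integrable lborel (kernel :: real ^ 'm \<Rightarrow> real)"
  by (rule integrable_compact_support[of "cball 0 1"]) (auto simp: kernel)

lemma kernel_scaleR_le: "norm v \<le> B \<Longrightarrow> norm (kernel t *\<^sub>R v) \<le> B * kernel t"
  using mult_left_mono[of "norm v" B "kernel t"] kernel(1)[of t] by (simp add: mult.commute)

lemma continuous_shift: "continuous_on UNIV h \<Longrightarrow> continuous_on S (\<lambda>t. h (x + \<epsilon> *\<^sub>R t))"
  for x :: "'a::real_normed_vector"
  by (rule continuous_on_compose2[of UNIV]) (auto intro!: continuous_intros)

lemma mollify_integrable:
  fixes h :: "real ^ 'm \<Rightarrow> 'b::{banach, second_countable_topology}"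
  assumes "continuous_on UNIV h"
  shows "integrable lborel (\<lambda>t. kernel t *\<^sub>R h (x + \<epsilon> *\<^sub>R t))"
  by (rule integrable_compact_support[of "cball 0 1"])
     (auto intro!: continuous_intros kernel continuous_shift assms simp: kernel(2))

lemma Lipschitz_of_bounded_gradient:
  fixes f :: "'a::euclidean_space \<Rightarrow> real"
  assumes "\<And>x. (f has_derivative (\<lambda>h. h \<bullet> G x)) (at x)" "\<And>x. norm (G x) \<le> B"
  shows "\<bar>f x - f y\<bar> \<le> B * norm (x - y)"
proof -
  have "norm (f x - f y) \<le> B * norm (x - y)"
  proof (rule differentiable_bound[of UNIV f "\<lambda>x h. h \<bullet> G x"])
    fix x
    have "\<bar>h \<bullet> G x\<bar> \<le> B * norm h" for h
      using Cauchy_Schwarz_ineq2[of h "G x"] assms(2)[of x] by (metis mult.commute mult_left_mono norm_ge_zero order_trans)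
    then show "onorm (\<lambda>h. h \<bullet> G x) \<le> B"
      by (intro onorm_bound) (auto intro: order_trans[OF norm_ge_zero assms(2)])
  qed (use assms(1) in \<open>auto intro: has_derivative_at_withinI\<close>)
  then show ?thesis by simp
qed

text \<open>The derivative falls on \<open>f\<close>, therefore bounds for \<open>G\<close> carry over to the mollifications.\<close>

lemma mollify_derivative:
  fixes f :: "real ^ 'm \<Rightarrow> real"
  assumes f: "\<And>x. (f has_derivative (\<lambda>h. h \<bullet> G x)) (at x)" and B: "\<And>x. norm (G x) \<le> B"
    and G: "continuous_on UNIV G"
  shows "(mollify \<epsilon> f has_derivative (\<lambda>h. h \<bullet> mollify \<epsilon> G x)) (at x)"
  unfolding mollify_def
proof (rule has_derivative_integral_Lipschitz(1)[where r = 1 and L = "\<lambda>t. B * kernel t"])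
  have cf: "continuous_on UNIV f"
    using f by (meson continuous_at_imp_continuous_on has_derivative_continuous)
  show "integrable lborel (\<lambda>t. kernel t *\<^sub>R f (p + \<epsilon> *\<^sub>R t))" for p by (rule mollify_integrable[OF cf])
  show "(\<lambda>t. kernel t *\<^sub>R G (x + \<epsilon> *\<^sub>R t)) \<in> borel_measurable lborel"
    using mollify_integrable[OF G] by (rule borel_measurable_integrable)
  show "AE t in lborel. norm (kernel t *\<^sub>R G (x + \<epsilon> *\<^sub>R t)) \<le> B * kernel t"
    by (intro AE_I2 kernel_scaleR_le B)
  show "integrable lborel (\<lambda>t. B * kernel t)" by (intro integrable_mult_right kernel_integrable)
  show "AE t in lborel. \<bar>kernel t *\<^sub>R f (p + \<epsilon> *\<^sub>R t) - kernel t *\<^sub>R f (x + \<epsilon> *\<^sub>R t)\<bar> \<le> B * kernel t * norm (p - x)" for p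
  proof (rule AE_I2)
    fix t :: "real ^ 'm"
    have "\<bar>f (p + \<epsilon> *\<^sub>R t) - f (x + \<epsilon> *\<^sub>R t)\<bar> \<le> B * norm (p - x)"
      using Lipschitz_of_bounded_gradient[OF f B, of "p + \<epsilon> *\<^sub>R t" "x + \<epsilon> *\<^sub>R t"] by simp
    then have "kernel t * \<bar>f (p + \<epsilon> *\<^sub>R t) - f (x + \<epsilon> *\<^sub>R t)\<bar> \<le> kernel t * (B * norm (p - x))"
      by (rule mult_left_mono) (rule kernel)
    then show "\<bar>kernel t *\<^sub>R f (p + \<epsilon> *\<^sub>R t) - kernel t *\<^sub>R f (x + \<epsilon> *\<^sub>R t)\<bar> \<le> B * kernel t * norm (p - x)"
      using kernel(1)[of t] by (simp add: right_diff_distrib[symmetric] abs_mult mult_ac)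
  qed
  show "AE t in lborel. ((\<lambda>p. kernel t *\<^sub>R f (p + \<epsilon> *\<^sub>R t)) has_derivative (\<lambda>h. h \<bullet> kernel t *\<^sub>R G (x + \<epsilon> *\<^sub>R t))) (at x)"
  proof (rule AE_I2)
    fix t :: "real ^ 'm"
    have "((\<lambda>p. p + \<epsilon> *\<^sub>R t) has_derivative (\<lambda>h. h)) (at x)" by (auto intro!: derivative_eq_intros)
    from has_derivative_mult_right[OF has_derivative_compose[OF this f], of "kernel t"]
    show "((\<lambda>p. kernel t *\<^sub>R f (p + \<epsilon> *\<^sub>R t)) has_derivative (\<lambda>h. h \<bullet> kernel t *\<^sub>R G (x + \<epsilon> *\<^sub>R t))) (at x)" by simp
  qed
qed simp

lemma scaled_outside_cball: "0 < \<epsilon> \<Longrightarrow> \<epsilon> < norm v \<Longrightarrow> (1 / \<epsilon>) *\<^sub>R v \<notin> cball 0 1"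
  by (simp add: not_le pos_less_divide_eq)

lemma integral_affine:
  fixes h :: "'a::euclidean_space \<Rightarrow> 'b::{banach, second_countable_topology}"
  assumes h: "h \<in> borel_measurable borel" and \<epsilon>: "\<epsilon> > 0"
  shows "(LINT y|lborel. h y) = \<epsilon> ^ DIM('a) *\<^sub>R (LINT t|lborel. h (x + \<epsilon> *\<^sub>R t))"
proof -
  have "(LINT y|lborel. h y) = (LINT y|density (distr lborel borel (\<lambda>t. x + \<epsilon> *\<^sub>R t)) (\<lambda>_. ennreal (\<bar>\<epsilon>\<bar> ^ DIM('a))). h y)"
    using \<epsilon> by (subst lborel_affine[of \<epsilon> x]) auto
  also have "\<dots> = (LINT t|lborel. (\<bar>\<epsilon>\<bar> ^ DIM('a)) *\<^sub>R h (x + \<epsilon> *\<^sub>R t))"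
    using h by (subst integral_density, simp, simp, simp, subst integral_distr) auto
  finally show ?thesis using \<epsilon> by simp
qed

text \<open>The substitution \<open>y = x + \<epsilon> *\<^sub>R t\<close> moves \<open>x\<close> into the kernel, where the derivative falls on the kernel and \<open>h\<close>
  need not be differentiable.\<close>

lemma mollify_kernel_derivative:
  fixes h :: "real ^ 'm \<Rightarrow> real"
  assumes h: "continuous_on UNIV h" and B: "\<And>x. \<bar>h x\<bar> \<le> B" and \<epsilon>: "\<epsilon> > 0"
  defines "T \<equiv> \<lambda>x. (- 1 / \<epsilon>) *\<^sub>R (LINT t|lborel. h (x + \<epsilon> *\<^sub>R t) *\<^sub>R kernel_gradient t)"
  shows "(mollify \<epsilon> h has_derivative (\<lambda>v. v \<bullet> T x)) (at x)" "continuous_on UNIV T"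
proof -
  let ?C = "4 / bump_mass TYPE('m)"
  have B0: "0 \<le> B" using B[of 0] by simp
  have C0: "0 \<le> ?C" using bump_mass_pos[where 'm = 'm] by simp
  have [measurable]: "h \<in> borel_measurable borel" "kernel \<in> borel_measurable (borel :: (real ^ 'm) measure)"
    "kernel_gradient \<in> borel_measurable (borel :: (real ^ 'm) measure)"
    using h kernel(4,5)[of UNIV] by (auto intro: borel_measurable_continuous_onI)
  have inv: "(1 / \<epsilon>) *\<^sub>R ((x + \<epsilon> *\<^sub>R t) - x) = t" for x t :: "real ^ 'm" using \<epsilon> by simp
  have moll: "mollify \<epsilon> h p = (1 / \<epsilon>) ^ CARD('m) * (LINT y|lborel. kernel ((1 / \<epsilon>) *\<^sub>R (y - p)) * h y)" for p
    using \<epsilon> by (subst integral_affine[OF _ \<epsilon>, of _ p]) (auto simp: mollify_def inv power_one_over)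
  have int: "integrable lborel (\<lambda>t. h (p + \<epsilon> *\<^sub>R t) *\<^sub>R kernel_gradient t)" for p
    by (rule integrable_compact_support[of "cball 0 1"])
       (auto intro!: continuous_intros kernel continuous_shift h simp: kernel(3))
  have TT: "T p = (1 / \<epsilon>) ^ CARD('m) *\<^sub>R (LINT y|lborel. (- h y / \<epsilon>) *\<^sub>R kernel_gradient ((1 / \<epsilon>) *\<^sub>R (y - p)))" for p
  proof -
    have "(LINT y|lborel. (- h y / \<epsilon>) *\<^sub>R kernel_gradient ((1 / \<epsilon>) *\<^sub>R (y - p)))
      = \<epsilon> ^ CARD('m) *\<^sub>R (LINT t|lborel. (- 1 / \<epsilon>) *\<^sub>R (h (p + \<epsilon> *\<^sub>R t) *\<^sub>R kernel_gradient t))"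
      by (subst integral_affine[OF _ \<epsilon>, of _ p]) (auto simp: inv)
    also have "(LINT t|lborel. (- 1 / \<epsilon>) *\<^sub>R (h (p + \<epsilon> *\<^sub>R t) *\<^sub>R kernel_gradient t)) = T p"
      unfolding T_def by (rule integral_scaleR_right)
    finally show ?thesis using \<epsilon> by (simp add: power_one_over)
  qed
  have lip: "\<bar>kernel a - kernel b\<bar> \<le> ?C * norm (a - b)" for a b :: "real ^ 'm"
    by (rule Lipschitz_of_bounded_gradient[OF kernel(8) kernel(7)])
  let ?L = "\<lambda>y. (B * ?C / \<epsilon>) * indicator (cball x (1 + \<epsilon>)) y"
  have near: "(1 / \<epsilon>) *\<^sub>R (y - p) \<notin> cball 0 1" if "y \<notin> cball x (1 + \<epsilon>)" "dist p x < 1" for y p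
  proof -
    have "dist x y \<le> dist p x + dist y p" by (metis dist_commute dist_triangle2)
    then have "\<epsilon> < dist y p" using that by simp
    then show ?thesis by (intro scaled_outside_cball[OF \<epsilon>]) (simp add: dist_norm)
  qed
  have "((\<lambda>p. LINT y|lborel. kernel ((1 / \<epsilon>) *\<^sub>R (y - p)) * h y) has_derivative
    (\<lambda>v. v \<bullet> (LINT y|lborel. (- h y / \<epsilon>) *\<^sub>R kernel_gradient ((1 / \<epsilon>) *\<^sub>R (y - x))))) (at x)"
  proof (rule has_derivative_integral_Lipschitz(1)[where r = 1 and L = ?L])
    show "integrable lborel (\<lambda>y. kernel ((1 / \<epsilon>) *\<^sub>R (y - p)) * h y)" for p
    proof (rule integrable_compact_support[of "cball p \<epsilon>"])
      show "continuous_on (cball p \<epsilon>) (\<lambda>y. kernel ((1 / \<epsilon>) *\<^sub>R (y - p)) * h y)"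
        by (intro continuous_intros continuous_on_compose2[OF kernel(4)[of UNIV]] continuous_on_subset[OF h]) auto
      show "kernel ((1 / \<epsilon>) *\<^sub>R (y - p)) * h y = 0" if "y \<notin> cball p \<epsilon>" for y
      proof -
        have "\<epsilon> < norm (y - p)" using that by (simp add: dist_norm norm_minus_commute)
        then show ?thesis using kernel(2)[OF scaled_outside_cball[OF \<epsilon>, of "y - p"]] by simp
      qed
    qed simp
    show "(\<lambda>y. (- h y / \<epsilon>) *\<^sub>R kernel_gradient ((1 / \<epsilon>) *\<^sub>R (y - x))) \<in> borel_measurable lborel" by measurable
    show "AE y in lborel. norm ((- h y / \<epsilon>) *\<^sub>R kernel_gradient ((1 / \<epsilon>) *\<^sub>R (y - x))) \<le> ?L y"
    proof (rule AE_I2)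
      fix y
      show "norm ((- h y / \<epsilon>) *\<^sub>R kernel_gradient ((1 / \<epsilon>) *\<^sub>R (y - x))) \<le> ?L y"
      proof (cases "y \<in> cball x (1 + \<epsilon>)")
        case True
        have "\<bar>h y\<bar> * norm (kernel_gradient ((1 / \<epsilon>) *\<^sub>R (y - x))) \<le> B * ?C"
          using B kernel(7) B0 by (intro mult_mono) auto
        then have "\<bar>h y\<bar> * norm (kernel_gradient ((1 / \<epsilon>) *\<^sub>R (y - x))) / \<epsilon> \<le> B * ?C / \<epsilon>"
          using \<epsilon> by (intro divide_right_mono) auto
        then show ?thesis using True \<epsilon> by simp
      next
        case False
        then show ?thesis using kernel(3)[OF near[OF False, of x]] by simp
      qed
    qed
    show "integrable lborel ?L" by (rule integrable_cball)
    show "AE y in lborel. \<bar>kernel ((1 / \<epsilon>) *\<^sub>R (y - p)) * h y - kernel ((1 / \<epsilon>) *\<^sub>R (y - x)) * h y\<bar> \<le> ?L y * norm (p - x)"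
      if p: "dist p x < 1" for p
    proof (rule AE_I2)
      fix y
      show "\<bar>kernel ((1 / \<epsilon>) *\<^sub>R (y - p)) * h y - kernel ((1 / \<epsilon>) *\<^sub>R (y - x)) * h y\<bar> \<le> ?L y * norm (p - x)"
      proof (cases "y \<in> cball x (1 + \<epsilon>)")
        case True
        have "(1 / \<epsilon>) *\<^sub>R (y - p) - (1 / \<epsilon>) *\<^sub>R (y - x) = (1 / \<epsilon>) *\<^sub>R (x - p)" by (simp add: algebra_simps)
        then have "\<bar>kernel ((1 / \<epsilon>) *\<^sub>R (y - p)) - kernel ((1 / \<epsilon>) *\<^sub>R (y - x))\<bar> \<le> ?C * (norm (p - x) / \<epsilon>)"
          using lip[of "(1 / \<epsilon>) *\<^sub>R (y - p)" "(1 / \<epsilon>) *\<^sub>R (y - x)"] \<epsilon> by (simp add: norm_minus_commute)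
        then have "\<bar>kernel ((1 / \<epsilon>) *\<^sub>R (y - p)) - kernel ((1 / \<epsilon>) *\<^sub>R (y - x))\<bar> * \<bar>h y\<bar> \<le> ?C * (norm (p - x) / \<epsilon>) * B"
          using B C0 \<epsilon> by (intro mult_mono) auto
        moreover have "kernel ((1 / \<epsilon>) *\<^sub>R (y - p)) * h y - kernel ((1 / \<epsilon>) *\<^sub>R (y - x)) * h y
          = (kernel ((1 / \<epsilon>) *\<^sub>R (y - p)) - kernel ((1 / \<epsilon>) *\<^sub>R (y - x))) * h y" by (rule left_diff_distrib[symmetric])
        ultimately have "\<bar>kernel ((1 / \<epsilon>) *\<^sub>R (y - p)) * h y - kernel ((1 / \<epsilon>) *\<^sub>R (y - x)) * h y\<bar> \<le> ?C * (norm (p - x) / \<epsilon>) * B"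
          by (simp only: abs_mult)
        then show ?thesis using True by (simp add: mult_ac)
      next
        case False
        then show ?thesis using kernel(2)[OF near[OF False p]] kernel(2)[OF near[OF False, of x]] by simp
      qed
    qed
    show "AE y in lborel. ((\<lambda>p. kernel ((1 / \<epsilon>) *\<^sub>R (y - p)) * h y) has_derivative
      (\<lambda>v. v \<bullet> (- h y / \<epsilon>) *\<^sub>R kernel_gradient ((1 / \<epsilon>) *\<^sub>R (y - x)))) (at x)"
    proof (rule AE_I2)
      fix y
      have "((\<lambda>p. (1 / \<epsilon>) *\<^sub>R (y - p)) has_derivative (\<lambda>v. (1 / \<epsilon>) *\<^sub>R (0 - v))) (at x)"
        by (intro has_derivative_scaleR_right has_derivative_diff has_derivative_const has_derivative_ident)
      from has_derivative_mult_left[OF has_derivative_compose[OF this kernel(8)], of "h y"]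
      show "((\<lambda>p. kernel ((1 / \<epsilon>) *\<^sub>R (y - p)) * h y) has_derivative
        (\<lambda>v. v \<bullet> (- h y / \<epsilon>) *\<^sub>R kernel_gradient ((1 / \<epsilon>) *\<^sub>R (y - x)))) (at x)"
        by (simp add: mult_ac)
    qed
  qed simp
  from has_derivative_mult_right[OF this, of "(1 / \<epsilon>) ^ CARD('m)"]
  show "(mollify \<epsilon> h has_derivative (\<lambda>v. v \<bullet> T x)) (at x)"
    unfolding moll[abs_def] TT by simp
  show "continuous_on UNIV T"
  proof (intro continuous_at_imp_continuous_on ballI)
    fix q :: "real ^ 'm"
    have "isCont (\<lambda>x. LINT t|lborel. h (x + \<epsilon> *\<^sub>R t) *\<^sub>R kernel_gradient t) q"
    proof (rule isCont_integral_dominated[where L = "\<lambda>t. (B * ?C) * indicator (cball 0 1) t"])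
      show "(\<lambda>t. h (p + \<epsilon> *\<^sub>R t) *\<^sub>R kernel_gradient t) \<in> borel_measurable lborel" for p by measurable
      show "integrable lborel (\<lambda>t :: real ^ 'm. (B * ?C) * indicator (cball 0 1) t)"
        by (rule integrable_cball)
      show "AE t in lborel. norm (h (p + \<epsilon> *\<^sub>R t) *\<^sub>R kernel_gradient t) \<le> (B * ?C) * indicator (cball 0 1) t" for p
      proof (rule AE_I2)
        fix t
        show "norm (h (p + \<epsilon> *\<^sub>R t) *\<^sub>R kernel_gradient t) \<le> (B * ?C) * indicator (cball 0 1) t"
        proof (cases "t \<in> cball 0 1")
          case True
          have "\<bar>h (p + \<epsilon> *\<^sub>R t)\<bar> * norm (kernel_gradient t) \<le> B * ?C"
            using B kernel(7) B0 by (intro mult_mono) auto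
          then show ?thesis using True by simp
        qed (simp add: kernel(3))
      qed
      show "AE t in lborel. isCont (\<lambda>p. h (p + \<epsilon> *\<^sub>R t) *\<^sub>R kernel_gradient t) q"
      proof (rule AE_I2)
        fix t
        have h': "isCont h (q + \<epsilon> *\<^sub>R t)" using h by (simp add: continuous_on_eq_continuous_at)
        have "isCont (\<lambda>p. p + \<epsilon> *\<^sub>R t) q" by (intro continuous_intros)
        from isCont_o2[OF this h'] show "isCont (\<lambda>p. h (p + \<epsilon> *\<^sub>R t) *\<^sub>R kernel_gradient t) q" by (intro continuous_intros)
      qed
    qed
    then show "isCont T q" unfolding T_def by (intro continuous_intros)
  qed
qed

lemma norm_mollify_le:
  assumes "\<And>x. norm (h x) \<le> B"
  shows "norm (mollify \<epsilon> h (x :: real ^ 'm)) \<le> B"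
proof -
  have "norm (mollify \<epsilon> h x) \<le> (LINT t::real ^ 'm|lborel. B * kernel t)"
    unfolding mollify_def
    by (rule norm_integral_le_dominating) (simp_all add: kernel_integrable kernel_scaleR_le assms del: norm_scaleR)
  then show ?thesis by (simp add: kernel(6))
qed

lemma mollify_diff_le:
  assumes "continuous_on UNIV h" "\<And>x y. norm (h x - h y) \<le> B * norm (x - y)" "0 \<le> \<epsilon>" "\<epsilon> \<le> 1" "0 \<le> B"
  shows "norm (mollify \<epsilon> h x - h (x :: real ^ 'm)) \<le> B"
proof -
  have "mollify \<epsilon> h x - h x = (LINT t|lborel. kernel t *\<^sub>R h (x + \<epsilon> *\<^sub>R t)) - (LINT t|lborel. kernel (t :: real ^ 'm) *\<^sub>R h x)"
    by (simp add: mollify_def kernel(6) kernel_integrable)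
  also have "\<dots> = (LINT t|lborel. kernel t *\<^sub>R (h (x + \<epsilon> *\<^sub>R t) - h x))"
    using mollify_integrable[OF assms(1)] kernel_integrable
    by (subst Bochner_Integration.integral_diff[symmetric]) (auto simp: scaleR_diff_right)
  also have "norm \<dots> \<le> (LINT t::real ^ 'm|lborel. B * kernel t)"
  proof (rule norm_integral_le_dominating)
    show "AE t in lborel. norm (kernel t *\<^sub>R (h (x + \<epsilon> *\<^sub>R t) - h x)) \<le> B * kernel t"
    proof (rule AE_I2)
      fix t :: "real ^ 'm"
      show "norm (kernel t *\<^sub>R (h (x + \<epsilon> *\<^sub>R t) - h x)) \<le> B * kernel t"
      proof (cases "t \<in> cball 0 1")
        case True
        have "norm (h (x + \<epsilon> *\<^sub>R t) - h x) \<le> B * (\<epsilon> * norm t)" using assms(2)[of "x + \<epsilon> *\<^sub>R t" x] assms(3) by simp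
        also have "\<dots> \<le> B * 1" using True assms by (intro mult_left_mono mult_le_one) auto
        finally show ?thesis by (intro kernel_scaleR_le) simp
      qed (simp add: kernel(2))
    qed
  qed (simp add: kernel_integrable)
  finally show ?thesis by (simp add: kernel(6))
qed

lemma mollify_tendsto:
  fixes h :: "real ^ 'm \<Rightarrow> 'b::{banach, second_countable_topology}"
  assumes h: "continuous_on UNIV h" and E: "E \<longlonglongrightarrow> 0" "\<And>n. 0 \<le> E n" "\<And>n. E n \<le> 1"
  shows "(\<lambda>n::nat. mollify (E n) h x) \<longlonglongrightarrow> h x"
proof -
  have "compact (h ` cball x 1)" using h by (intro compact_continuous_image continuous_on_subset[OF h]) auto
  then obtain B where B: "\<And>y. y \<in> cball x 1 \<Longrightarrow> norm (h y) \<le> B"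
    using compact_imp_bounded[of "h ` cball x 1"] unfolding bounded_iff by blast
  have "(\<lambda>n. LINT t|lborel. kernel t *\<^sub>R h (x + E n *\<^sub>R t)) \<longlonglongrightarrow> (LINT t|lborel. kernel (t :: real ^ 'm) *\<^sub>R h x)"
  proof (rule integral_dominated_convergence[where w = "\<lambda>t. B * kernel t"])
    show "AE t in lborel. (\<lambda>n. kernel t *\<^sub>R h (x + E n *\<^sub>R t)) \<longlonglongrightarrow> kernel t *\<^sub>R h x"
    proof (rule AE_I2)
      fix t
      have "(\<lambda>n. x + E n *\<^sub>R t) \<longlonglongrightarrow> x + 0 *\<^sub>R t" by (intro tendsto_intros E)
      moreover have "isCont h x" using h by (simp add: continuous_on_eq_continuous_at)
      ultimately show "(\<lambda>n. kernel t *\<^sub>R h (x + E n *\<^sub>R t)) \<longlonglongrightarrow> kernel t *\<^sub>R h x"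
        by (auto intro!: tendsto_intros isCont_tendsto_compose[of x h])
    qed
    show "AE t in lborel. norm (kernel t *\<^sub>R h (x + E n *\<^sub>R t)) \<le> B * kernel t" for n
    proof (rule AE_I2)
      fix t :: "real ^ 'm"
      show "norm (kernel t *\<^sub>R h (x + E n *\<^sub>R t)) \<le> B * kernel t"
      proof (cases "t \<in> cball 0 1")
        case True
        then have "E n * norm t \<le> 1" using E by (intro mult_le_one) auto
        then have "norm (h (x + E n *\<^sub>R t)) \<le> B" using E by (intro B) (simp add: dist_norm)
        then show ?thesis by (rule kernel_scaleR_le)
      qed (simp add: kernel(2))
    qed
    show "(\<lambda>t :: real ^ 'm. kernel t *\<^sub>R h x) \<in> borel_measurable lborel"
      by (intro borel_measurable_scaleR borel_measurable_integrable[OF kernel_integrable]) simp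
  qed (use mollify_integrable[OF h] in \<open>auto intro!: integrable_mult_right kernel_integrable\<close>)
  then show ?thesis by (simp add: mollify_def kernel(6) kernel_integrable)
qed

text \<open>The first and second derivatives of a mollification are mollifications of derivatives, with the same bounds; the third
  one is taken from the kernel.\<close>

lemma C3_approximation:
  fixes f :: "real ^ 'm \<Rightarrow> real"
  assumes f: "\<And>x. (f has_derivative (\<lambda>h. h \<bullet> (\<chi> i. g i x))) (at x)"
    and g: "\<And>i x. (g i has_derivative (\<lambda>h. h \<bullet> H i x)) (at x)"
    and H: "\<And>i. continuous_on UNIV (H i)"
    and gB: "\<And>x. norm (\<chi> i. g i x) \<le> B" and HB: "\<And>i x. norm (H i x) \<le> B"
  obtains fn :: "nat \<Rightarrow> real ^ 'm \<Rightarrow> real" and gn Hn Tn where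
    "\<And>n x. (fn n has_derivative (\<lambda>h. h \<bullet> (\<chi> i. gn n i x))) (at x)"
    "\<And>n i x. (gn n i has_derivative (\<lambda>h. h \<bullet> Hn n i x)) (at x)"
    "\<And>n i j x. ((\<lambda>x. Hn n i x $ j) has_derivative (\<lambda>h. h \<bullet> Tn n i j x)) (at x)"
    "\<And>n i j. continuous_on UNIV (Tn n i j)"
    "\<And>n x. \<bar>fn n x\<bar> \<le> \<bar>f x\<bar> + B" "\<And>n i x. norm (Hn n i x) \<le> B"
    "\<And>x. (\<lambda>n. fn n x) \<longlonglongrightarrow> f x" "\<And>i x. (\<lambda>n. Hn n i x) \<longlonglongrightarrow> H i x"
proof -
  define E where "E n = 1 / real (Suc n)" for n
  have E: "E \<longlonglongrightarrow> 0" "\<And>n. 0 \<le> E n" "\<And>n. E n \<le> 1" "\<And>n. 0 < E n"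
    unfolding E_def using LIMSEQ_Suc[OF lim_1_over_n[where 'a = real]] by auto
  define Tn where "Tn n i j x = (- 1 / E n) *\<^sub>R (LINT t|lborel. (H i (x + E n *\<^sub>R t) $ j) *\<^sub>R kernel_gradient t)" for n i j and x :: "real ^ 'm"
  have B0: "0 \<le> B" using gB[of 0] norm_ge_zero order_trans by blast
  have cg: "continuous_on UNIV (g i)" for i
    using g by (meson continuous_at_imp_continuous_on has_derivative_continuous)
  have cG: "continuous_on UNIV (\<lambda>x. \<chi> i. g i x)" by (intro continuous_on_vec_lambda cg)
  have cf: "continuous_on UNIV f"
    using f by (meson continuous_at_imp_continuous_on has_derivative_continuous)
  have comp: "mollify e (\<lambda>x. G x $ j) x = mollify e G x $ j" if "continuous_on UNIV G" for e x j and G :: "real ^ 'm \<Rightarrow> real ^ 'm"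
    using integral_bounded_linear[OF bounded_linear_vec_nth[of j] mollify_integrable[OF that]] by (simp add: mollify_def)
  show ?thesis
  proof (rule that[of "\<lambda>n. mollify (E n) f" "\<lambda>n i. mollify (E n) (g i)" "\<lambda>n i. mollify (E n) (H i)" Tn])
    fix n i j x
    have "(\<chi> i. mollify (E n) (g i) x) = mollify (E n) (\<lambda>x. \<chi> i. g i x) x"
      using comp[OF cG, of "E n" _ x] by (simp add: vec_eq_iff)
    then show "(mollify (E n) f has_derivative (\<lambda>h. h \<bullet> (\<chi> i. mollify (E n) (g i) x))) (at x)"
      using mollify_derivative[OF f gB cG] by simp
    show "(mollify (E n) (g i) has_derivative (\<lambda>h. h \<bullet> mollify (E n) (H i) x)) (at x)"
      by (rule mollify_derivative[OF g HB H])
    have cH: "continuous_on UNIV (\<lambda>x. H i x $ j)" by (intro continuous_intros H)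
    have bH: "\<bar>H i x $ j\<bar> \<le> B" for x using component_le_norm_cart[of "H i x" j] HB[of i x] by linarith
    show "((\<lambda>x. mollify (E n) (H i) x $ j) has_derivative (\<lambda>h. h \<bullet> Tn n i j x)) (at x)"
      using mollify_kernel_derivative(1)[OF cH bH E(4)] unfolding comp[OF H, symmetric] Tn_def .
    show "continuous_on UNIV (Tn n i j)"
      using mollify_kernel_derivative(2)[OF cH bH E(4)] unfolding Tn_def .
    have "\<bar>mollify (E n) f x - f x\<bar> \<le> B"
      using mollify_diff_le[OF cf _ E(2,3) B0] Lipschitz_of_bounded_gradient[OF f gB] by simp
    then show "\<bar>mollify (E n) f x\<bar> \<le> \<bar>f x\<bar> + B" by linarith
    show "norm (mollify (E n) (H i) x) \<le> B" by (rule norm_mollify_le[OF HB])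
    show "(\<lambda>n. mollify (E n) f x) \<longlonglongrightarrow> f x" by (rule mollify_tendsto[OF cf E(1,2,3)])
    show "(\<lambda>n. mollify (E n) (H i) x) \<longlonglongrightarrow> H i x" by (rule mollify_tendsto[OF H E(1,2,3)])
  qed
qed

section \<open>Functions of the logarithmic coordinates\<close>

lemma has_derivative_vec_lambda:
  fixes f :: "'i::finite \<Rightarrow> 'a::real_normed_vector \<Rightarrow> real"
  assumes "\<And>j. (f j has_derivative f' j) (at x)"
  shows "((\<lambda>x. \<chi> j. f j x) has_derivative (\<lambda>h. \<chi> j. f' j h)) (at x)"
proof -
  have eq: "(\<chi> j. c j) = (\<Sum>j\<in>UNIV. c j *\<^sub>R axis j 1)" for c :: "'i \<Rightarrow> real"
    by (simp add: vec_eq_iff axis_def if_distrib cong: if_cong)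
  show ?thesis unfolding eq by (intro has_derivative_sum has_derivative_scaleR_left assms)
qed

lemma rho_derivative:
  assumes "z \<in> torus"
  shows "(rho has_derivative (\<lambda>h. \<chi> j. 2 * Re (h $ j / z $ j))) (at z)"
proof -
  have "((\<lambda>z. \<chi> j. ln ((cmod (z $ j))\<^sup>2)) has_derivative (\<lambda>h. \<chi> j. 2 * Re (h $ j / z $ j))) (at z)"
  proof (rule has_derivative_vec_lambda)
    fix j
    have nz: "z $ j \<noteq> 0" using assms by (simp add: torus_def)
    have "((\<lambda>z. z $ j \<bullet> z $ j) has_derivative (\<lambda>h. z $ j \<bullet> h $ j + h $ j \<bullet> z $ j)) (at z)"
      by (intro has_derivative_inner bounded_linear.has_derivative[OF bounded_linear_vec_nth has_derivative_ident])
    then have "((\<lambda>z. (cmod (z $ j))\<^sup>2) has_derivative (\<lambda>h. 2 * (z $ j \<bullet> h $ j))) (at z)"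
      by (simp add: power2_norm_eq_inner inner_commute)
    moreover have "(ln has_derivative (\<lambda>h. inverse ((cmod (z $ j))\<^sup>2) * h)) (at ((cmod (z $ j))\<^sup>2))"
      using DERIV_ln[of "(cmod (z $ j))\<^sup>2"] nz by (simp add: has_field_derivative_def)
    ultimately have "((\<lambda>z. ln ((cmod (z $ j))\<^sup>2)) has_derivative (\<lambda>h. inverse ((cmod (z $ j))\<^sup>2) * (2 * (z $ j \<bullet> h $ j)))) (at z)"
      by (rule has_derivative_compose)
    moreover have "inverse ((cmod (z $ j))\<^sup>2) * (2 * (z $ j \<bullet> h $ j)) = 2 * Re (h $ j / z $ j)" for h
      by (simp add: inner_complex_def complex_div_cnj[of "h $ j"] cmod_power2 divide_inverse algebra_simps)
    ultimately show "((\<lambda>z. ln ((cmod (z $ j))\<^sup>2)) has_derivative (\<lambda>h. 2 * Re (h $ j / z $ j))) (at z)" by simp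
  qed
  then show ?thesis by (simp add: rho_def[abs_def])
qed

lemma continuous_rho: "continuous_on torus rho"
  using rho_derivative by (meson continuous_at_imp_continuous_on has_derivative_continuous)

lemma log_function_derivative:
  assumes "z \<in> torus" "\<And>x. (f has_derivative (\<lambda>h. h \<bullet> G x)) (at x)"
  shows "((\<lambda>z. complex_of_real (f (rho z))) has_derivative
    (\<lambda>h. complex_of_real (\<Sum>j\<in>UNIV. 2 * Re (h $ j / z $ j) * G (rho z) $ j))) (at z)"
proof -
  have "((\<lambda>z. f (rho z)) has_derivative (\<lambda>h. (\<chi> j. 2 * Re (h $ j / z $ j)) \<bullet> G (rho z))) (at z)"
    by (rule has_derivative_compose[OF rho_derivative[OF assms(1)] assms(2)])
  from has_derivative_of_real[OF this] show ?thesis by (simp add: inner_vec_def)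
qed

lemma sum_axis_component:
  "(\<Sum>j\<in>UNIV. 2 * Re (axis k c $ j / z $ j) * g j) = 2 * Re (c / z $ k) * g k"
  for z :: "complex ^ 'm" and g :: "'m \<Rightarrow> real"
proof -
  have "(\<Sum>j\<in>UNIV. 2 * Re (axis k c $ j / z $ j) * g j) = (\<Sum>j\<in>UNIV. if j = k then 2 * Re (c / z $ k) * g k else 0)"
    by (intro sum.cong) (auto simp: axis_def)
  then show ?thesis by simp
qed

text \<open>\<open>rho z $ k\<close> is the logarithm of \<open>z $ k * cnj (z $ k)\<close>, with derivatives \<open>1 / z $ k\<close> and \<open>1 / cnj (z $ k)\<close>.\<close>

lemma wirt_log_function:
  assumes z: "z \<in> torus" and f: "\<And>x. (f has_derivative (\<lambda>h. h \<bullet> G x)) (at x)"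
  shows "wirt k (\<lambda>z. complex_of_real (f (rho z))) z = complex_of_real (G (rho z) $ k) * inverse (z $ k)"
    "wirt_bar k (\<lambda>z. complex_of_real (f (rho z))) z = complex_of_real (G (rho z) $ k) * inverse (cnj (z $ k))"
proof -
  define w where "w = inverse (z $ k)"
  have c: "1 / z $ k = w" "\<i> / z $ k = \<i> * w" "inverse (cnj (z $ k)) = cnj w"
    by (simp_all add: w_def divide_inverse)
  show "wirt k (\<lambda>z. complex_of_real (f (rho z))) z = complex_of_real (G (rho z) $ k) * inverse (z $ k)"
    "wirt_bar k (\<lambda>z. complex_of_real (f (rho z))) z = complex_of_real (G (rho z) $ k) * inverse (cnj (z $ k))"
    unfolding wirt_eq[OF log_function_derivative[OF z f]] sum_axis_component c w_def[symmetric]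
    by (simp_all add: complex_eq_iff)
qed

lemma Ck_on_log_function:
  assumes f: "\<And>x. (f has_derivative (\<lambda>h. h \<bullet> G x)) (at x)" and G: "continuous_on UNIV G"
  shows "Ck_on 1 torus (\<lambda>z. complex_of_real (f (rho z)))"
  unfolding One_nat_def
proof (rule Ck_on_SucI[OF open_torus log_function_derivative[OF _ f]])
  fix v
  have "continuous_on torus (\<lambda>z. G (rho z))"
    by (rule continuous_on_compose2[OF G continuous_rho]) auto
  then show "Ck_on 0 torus (\<lambda>z. complex_of_real (\<Sum>j\<in>UNIV. 2 * Re (v $ j / z $ j) * G (rho z) $ j))"
    by (auto intro!: continuous_intros simp: torus_def)
qed

lemma component_derivative:
  "((\<lambda>z. z $ j) has_derivative (\<lambda>h. h $ j)) (at z)" "((\<lambda>z. cnj (z $ j)) has_derivative (\<lambda>h. cnj (h $ j))) (at z)"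
  by (rule bounded_linear.has_derivative[OF bounded_linear_vec_nth has_derivative_ident],
      rule bounded_linear.has_derivative[OF bounded_linear_cnj bounded_linear.has_derivative[OF bounded_linear_vec_nth has_derivative_ident]])

lemma inverse_component_derivative:
  assumes "z \<in> torus"
  shows "((\<lambda>z. inverse (z $ j)) has_derivative (\<lambda>h. - (inverse (z $ j) * h $ j * inverse (z $ j)))) (at z)"
    "((\<lambda>z. inverse (cnj (z $ j))) has_derivative (\<lambda>h. - (inverse (cnj (z $ j)) * cnj (h $ j) * inverse (cnj (z $ j))))) (at z)"
  using assms
  by (intro Deriv.has_derivative_inverse component_derivative; simp add: torus_def)+

lemma wirt_inverse_component:
  assumes "z \<in> torus"
  shows "wirt k (\<lambda>z. inverse (z $ j)) z = (if j = k then - (inverse (z $ j) * inverse (z $ j)) else 0)"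
    "wirt_bar k (\<lambda>z. inverse (z $ j)) z = 0"
    "wirt k (\<lambda>z. inverse (cnj (z $ j))) z = 0"
    "wirt_bar k (\<lambda>z. inverse (cnj (z $ j))) z = (if j = k then - (inverse (cnj (z $ j)) * inverse (cnj (z $ j))) else 0)"
  unfolding wirt_eq[OF inverse_component_derivative(1)[OF assms]] wirt_eq[OF inverse_component_derivative(2)[OF assms]]
  by (auto simp: axis_def field_simps)

lemma Ck_on_inverse_component:
  "Ck_on k torus (\<lambda>z. inverse (z $ j))" "Ck_on k torus (\<lambda>z. inverse (cnj (z $ j)))"
proof (induction k)
  case 0
  {
    case 1
    show ?case by (auto intro!: continuous_intros simp: torus_def)
  next
    case 2
    show ?case by (auto intro!: continuous_intros simp: torus_def)
  }
next
  case (Suc k)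
  {
    case 1
    show ?case
      by (rule Ck_on_SucI[OF open_torus inverse_component_derivative(1)])
         (use Suc in \<open>auto intro!: Ck_on_bounded_linear[OF open_torus bounded_linear_minus[OF bounded_linear_ident]] Ck_on_mult[OF open_torus] Ck_on_const\<close>)
  next
    case 2
    show ?case
      by (rule Ck_on_SucI[OF open_torus inverse_component_derivative(2)])
         (use Suc in \<open>auto intro!: Ck_on_bounded_linear[OF open_torus bounded_linear_minus[OF bounded_linear_ident]] Ck_on_mult[OF open_torus] Ck_on_const\<close>)
  }
qed

section \<open>Integrals of derivatives of compactly supported functions\<close>

lemma continuous_on_zero_extension:
  fixes f :: "'a::t2_space \<Rightarrow> 'b::real_normed_vector"
  assumes "compact K" "K \<subseteq> U" "open U" "continuous_on U f" "\<And>x. x \<notin> K \<Longrightarrow> f x = 0"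
  shows "continuous_on UNIV f"
proof -
  have "continuous_on (- K) f"
    by (rule continuous_on_eq[OF continuous_on_const[of _ 0]]) (use assms(5) in auto)
  moreover have "open (- K)" using assms(1) by (simp add: compact_imp_closed open_Compl)
  ultimately have "continuous_on (U \<union> - K) f" using assms by (intro continuous_on_open_Un) auto
  moreover have "U \<union> - K = UNIV" using assms by auto
  ultimately show ?thesis by simp
qed

lemma frechet_derivative_zero_outside:
  assumes "compact K" "\<And>x. x \<notin> K \<Longrightarrow> f x = 0" "x \<notin> K"
  shows "(f has_derivative (\<lambda>_. 0)) (at x)" "frechet_derivative f (at x) v = 0"
proof -
  have "open (- K)" using assms(1) by (simp add: compact_imp_closed open_Compl)
  then show "(f has_derivative (\<lambda>_. 0)) (at x)"
    by (rule has_derivative_transform_within_open[OF has_derivative_const[of 0]]) (use assms in auto)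
  then show "frechet_derivative f (at x) v = 0" by (simp add: frechet_derivative_eq)
qed

text \<open>The version of the divergence theorem that integration by parts rests on.\<close>

lemma integral_directional_derivative_zero:
  fixes f :: "'a::euclidean_space \<Rightarrow> complex"
  assumes K: "compact K" "K \<subseteq> U" "open U" and f: "Ck_on 1 U f" and zero: "\<And>x. x \<notin> K \<Longrightarrow> f x = 0"
  shows "(LINT x|lborel. frechet_derivative f (at x) v) = 0" "integrable lborel (\<lambda>x. frechet_derivative f (at x) v)"
proof -
  let ?D = "\<lambda>x. frechet_derivative f (at x)"
  have z1: "(f has_derivative (\<lambda>_. 0)) (at x)" and z2: "?D x v = 0" if "x \<notin> K" for x
    using frechet_derivative_zero_outside(1)[OF K(1) _ that, of f] frechet_derivative_zero_outside(2)[OF K(1) _ that, of f v] zero by auto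
  have der: "(f has_derivative ?D x) (at x)" for x
  proof (cases "x \<in> K")
    case True
    then show ?thesis using f K by (intro has_derivative_frechet) auto
  next
    case False
    then show ?thesis using z1[OF False] by (simp add: frechet_derivative_eq)
  qed
  have contD: "continuous_on UNIV (\<lambda>x. ?D x v)"
    by (rule continuous_on_zero_extension[OF K]) (use f z2 in auto)
  have contf: "continuous_on UNIV f"
    by (rule continuous_on_zero_extension[OF K Ck_on_continuous[OF f] zero])
  show "integrable lborel (\<lambda>x. ?D x v)"
    by (rule integrable_compact_support[OF K(1) continuous_on_subset[OF contD]])
       (use z2 in auto)
  have intf: "integrable lborel f"
    by (rule integrable_compact_support[OF K(1) continuous_on_subset[OF contf] zero]) auto
  have shift: "integrable lborel (\<lambda>x. f (x + c))" "(LINT x|lborel. f (x + c)) = (LINT x|lborel. f x)" for c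
  proof -
    have m: "f \<in> borel_measurable borel" using contf by (rule borel_measurable_continuous_onI)
    have "integrable (distr lborel borel ((+) c)) f" using intf by (simp add: lborel_distr_plus)
    then show "integrable lborel (\<lambda>x. f (x + c))" using m by (subst (asm) integrable_distr_eq) (auto simp: add.commute)
    have "(LINT x|lborel. f x) = (LINT x|distr lborel borel ((+) c). f x)" by (simp add: lborel_distr_plus)
    also have "\<dots> = (LINT x|lborel. f (x + c))" using m by (subst integral_distr) (auto simp: add.commute)
    finally show "(LINT x|lborel. f (x + c)) = (LINT x|lborel. f x)" ..
  qed
  obtain R where R: "0 < R" "K \<subseteq> cball 0 R" using compact_imp_bounded[OF K(1)] bounded_subset_ballD[of K 0] by (meson ball_subset_cball order_trans)
  have "compact ((\<lambda>x. ?D x v) ` K)" by (intro compact_continuous_image continuous_on_subset[OF contD] K) auto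
  then obtain B where B: "\<And>x. x \<in> K \<Longrightarrow> norm (?D x v) \<le> B"
    using compact_imp_bounded[of "(\<lambda>x. ?D x v) ` K"] unfolding bounded_iff by blast
  have B': "norm (?D x v) \<le> max B 0" for x
    using B[of x] z2[of x] by (cases "x \<in> K") auto
  define E where "E n = 1 / real (Suc n)" for n
  have E: "0 < E n" "E n \<le> 1" for n by (auto simp: E_def)
  have line: "((\<lambda>s. f (x + s *\<^sub>R v)) has_vector_derivative ?D (x + s *\<^sub>R v) v) (at s)" for x s
  proof -
    have "((\<lambda>s. x + s *\<^sub>R v) has_derivative (\<lambda>h. h *\<^sub>R v)) (at s)" by (auto intro!: derivative_eq_intros)
    from has_derivative_compose[OF this der]
    have "((\<lambda>s. f (x + s *\<^sub>R v)) has_derivative (\<lambda>h. ?D (x + s *\<^sub>R v) (h *\<^sub>R v))) (at s)" .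
    moreover have "?D (x + s *\<^sub>R v) (h *\<^sub>R v) = h *\<^sub>R ?D (x + s *\<^sub>R v) v" for h
      using has_derivative_bounded_linear[OF der] by (simp add: linear_simps)
    ultimately show ?thesis by (simp add: has_vector_derivative_def)
  qed
  have lim: "(\<lambda>n. LINT x|lborel. (f (x + E n *\<^sub>R v) - f x) /\<^sub>R E n) \<longlonglongrightarrow> (LINT x|lborel. ?D x v)"
  proof (rule integral_dominated_convergence[where w = "\<lambda>x. max B 0 * indicator (cball 0 (R + norm v)) x"])
    show "(\<lambda>x. ?D x v) \<in> borel_measurable lborel" using contD by (simp add: borel_measurable_continuous_onI)
    show "(\<lambda>x. (f (x + E n *\<^sub>R v) - f x) /\<^sub>R E n) \<in> borel_measurable lborel" for n
      using shift(1)[of "E n *\<^sub>R v"] intf by (intro borel_measurable_integrable integrable_scaleR_right Bochner_Integration.integrable_diff)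
    show "integrable lborel (\<lambda>x::'a. max B 0 * indicator (cball 0 (R + norm v)) x :: real)"
      by (rule integrable_cball)
    show "AE x in lborel. (\<lambda>n. (f (x + E n *\<^sub>R v) - f x) /\<^sub>R E n) \<longlonglongrightarrow> ?D x v"
    proof (rule AE_I2)
      fix x
      have "((\<lambda>s. (f (x + s *\<^sub>R v) - f x) /\<^sub>R s) \<longlongrightarrow> ?D x v) (at 0)"
      proof -
        have "((\<lambda>s. norm (f (x + s *\<^sub>R v) - f x - s *\<^sub>R ?D x v) / norm s) \<longlongrightarrow> 0) (at 0)"
          using line[of x 0] by (simp add: has_vector_derivative_def has_derivative_at)
        moreover have "\<forall>\<^sub>F s in at 0. norm (f (x + s *\<^sub>R v) - f x - s *\<^sub>R ?D x v) / norm s = norm ((f (x + s *\<^sub>R v) - f x) /\<^sub>R s - ?D x v)"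
          unfolding eventually_at_filter
        proof (intro always_eventually allI impI)
          fix s :: real assume "s \<noteq> 0"
          then have "(f (x + s *\<^sub>R v) - f x) /\<^sub>R s - ?D x v = (f (x + s *\<^sub>R v) - f x - s *\<^sub>R ?D x v) /\<^sub>R s"
            by (simp add: scaleR_diff_right)
          then show "norm (f (x + s *\<^sub>R v) - f x - s *\<^sub>R ?D x v) / norm s = norm ((f (x + s *\<^sub>R v) - f x) /\<^sub>R s - ?D x v)"
            by (simp only: norm_scaleR norm_inverse divide_inverse mult.commute[of "inverse _"] real_norm_def abs_inverse)
        qed
        ultimately have "((\<lambda>s. norm ((f (x + s *\<^sub>R v) - f x) /\<^sub>R s - ?D x v)) \<longlongrightarrow> 0) (at 0)"
          by (rule Lim_transform_eventually)
        then show ?thesis by (simp only: tendsto_norm_zero_iff LIM_zero_iff)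
      qed
      moreover have "filterlim E (at 0) sequentially"
        using LIMSEQ_Suc[OF lim_1_over_n[where 'a = real]] by (auto simp: filterlim_at E_def[abs_def])
      ultimately show "(\<lambda>n. (f (x + E n *\<^sub>R v) - f x) /\<^sub>R E n) \<longlonglongrightarrow> ?D x v" by (rule filterlim_compose)
    qed
    show "AE x in lborel. norm ((f (x + E n *\<^sub>R v) - f x) /\<^sub>R E n) \<le> max B 0 * indicator (cball 0 (R + norm v)) x" for n
    proof (rule AE_I2)
      fix x
      show "norm ((f (x + E n *\<^sub>R v) - f x) /\<^sub>R E n) \<le> max B 0 * indicator (cball 0 (R + norm v)) x"
      proof (cases "x \<in> cball 0 (R + norm v)")
        case True
        have "norm (f (x + E n *\<^sub>R v) - f (x + 0 *\<^sub>R v)) \<le> max B 0 * norm (E n - 0)"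
        proof (rule differentiable_bound[of UNIV "\<lambda>s. f (x + s *\<^sub>R v)" "\<lambda>s h. h *\<^sub>R ?D (x + s *\<^sub>R v) v"])
          fix s :: real
          show "((\<lambda>s. f (x + s *\<^sub>R v)) has_derivative (\<lambda>h. h *\<^sub>R ?D (x + s *\<^sub>R v) v)) (at s within UNIV)"
            using line[of x s] by (simp add: has_vector_derivative_def)
          show "onorm (\<lambda>h. h *\<^sub>R ?D (x + s *\<^sub>R v) v) \<le> max B 0"
            by (rule onorm_bound) (use B'[of "x + s *\<^sub>R v"] in \<open>auto simp: mult.commute intro: mult_left_mono\<close>)
        qed auto
        then have "cmod (f (x + E n *\<^sub>R v) - f x) / E n \<le> max B 0" using E[of n] by (simp add: pos_divide_le_eq)
        moreover have "cmod ((f (x + E n *\<^sub>R v) - f x) /\<^sub>R E n) = cmod (f (x + E n *\<^sub>R v) - f x) / E n"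
          using E[of n] by (simp only: norm_scaleR abs_of_pos positive_imp_inverse_positive divide_inverse mult.commute)
        ultimately show ?thesis using True by simp
      next
        case False
        then have x: "R + norm v < norm x" by simp
        have "norm x \<le> norm (x + E n *\<^sub>R v) + norm (E n *\<^sub>R v)" using norm_triangle_ineq4[of "x + E n *\<^sub>R v" "E n *\<^sub>R v"] by simp
        moreover have "norm (E n *\<^sub>R v) \<le> norm v" using E[of n] mult_right_mono[of "E n" 1 "norm v"] by simp
        ultimately have "R < norm (x + E n *\<^sub>R v)" "R < norm x" using x norm_ge_zero[of v] by linarith+
        then have "x + E n *\<^sub>R v \<notin> K" "x \<notin> K" using R by auto
        then show ?thesis using zero by simp
      qed
    qed
  qed
  have null: "(LINT x|lborel. (f (x + E n *\<^sub>R v) - f x) /\<^sub>R E n) = 0" for n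
    using shift[of "E n *\<^sub>R v"] intf by simp
  have "(\<lambda>n. 0) \<longlonglongrightarrow> (LINT x|lborel. ?D x v)" using lim unfolding null .
  then show "(LINT x|lborel. ?D x v) = 0" by (simp only: LIMSEQ_const_iff)
qed

lemma integral_wirt_zero:
  assumes K: "compact K" "K \<subseteq> torus" and f: "Ck_on 1 torus f" and zero: "\<And>x. x \<notin> K \<Longrightarrow> f x = 0"
  shows "(LINT z|lborel. wirt j f z) = 0" "integrable lborel (wirt j f)"
    "(LINT z|lborel. wirt_bar j f z) = 0" "integrable lborel (wirt_bar j f)"
  using integral_directional_derivative_zero[OF K open_torus f zero]
  by (simp_all add: wirt_def[abs_def] wirt_bar_def[abs_def])

section \<open>The curvature form and its derivatives\<close>

text \<open>The complex Hessian of \<open>z \<mapsto> f (rho z)\<close> if \<open>H i\<close> is the gradient of the \<open>i\<close>-th partial derivative of \<open>f\<close>.\<close>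

definition log_hessian :: "('m \<Rightarrow> real ^ 'm \<Rightarrow> real ^ 'm) \<Rightarrow> 'm \<Rightarrow> 'm \<Rightarrow> complex ^ 'm \<Rightarrow> complex" where
  "log_hessian H a b z = complex_of_real (H b (rho z) $ a) * inverse (z $ a) * inverse (cnj (z $ b))"

text \<open>The form \<open>dd\<^sup>c\<close> of \<open>z \<mapsto> f (rho z)\<close>, see \<open>ddc_function_form\<close>. It is a function of the second derivatives alone, so
  that it can be followed through a limit of Hessians.\<close>

definition curvature :: "('m::{finite,linorder} \<Rightarrow> real ^ 'm::{finite,linorder} \<Rightarrow> real ^ 'm::{finite,linorder}) \<Rightarrow>
    complex ^ 'm::{finite,linorder} \<Rightarrow> 'm even_form" where
  "curvature H z = (\<Sum>a\<in>UNIV. \<Sum>b\<in>UNIV. const (\<i> / (2 * complex_of_real pi) * log_hessian H a b z) * pair a b)"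

lemma Ck_on_coeff_times:
  assumes "\<And>S. Ck_on k torus (\<lambda>z. coeff (X z) S)" "\<And>S. Ck_on k torus (\<lambda>z. coeff (Y z) S)"
  shows "Ck_on k torus (\<lambda>z. coeff (X z * Y z) S)"
  unfolding coeff_times wedge_def
  by (intro Ck_on_sum[OF open_torus] Ck_on_mult[OF open_torus] Ck_on_const assms)

lemma Ck_on_coeff_power:
  assumes "\<And>S. Ck_on k torus (\<lambda>z. coeff (X z) S)"
  shows "Ck_on k torus (\<lambda>z. coeff (X z ^ n) S)"
proof (induction n arbitrary: S)
  case 0
  then show ?case by (simp add: Ck_on_const)
next
  case (Suc n)
  then show ?case unfolding power_Suc by (intro Ck_on_coeff_times assms)
qed

lemma Ck_on_curvature:
  assumes "\<And>a b. Ck_on k torus (log_hessian H a b)"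
  shows "Ck_on k torus (\<lambda>z. coeff (curvature H z) S)"
  unfolding curvature_def coeff_sum coeff_const_times
  by (intro Ck_on_sum[OF open_torus] Ck_on_mult[OF open_torus] Ck_on_const assms)

lemma continuous_log_hessian:
  assumes "\<And>i. continuous_on UNIV (H i)"
  shows "Ck_on 0 torus (log_hessian H a b)"
proof -
  have "continuous_on torus (\<lambda>z. H b (rho z))"
    by (rule continuous_on_compose2[OF assms continuous_rho]) auto
  then show ?thesis
    by (auto simp: log_hessian_def[abs_def] torus_def intro!: continuous_intros)
qed

lemma Ck_on_log_hessian:
  assumes "\<And>i j x. ((\<lambda>x. H i x $ j) has_derivative (\<lambda>h. h \<bullet> T i j x)) (at x)" "\<And>i j. continuous_on UNIV (T i j)"
  shows "Ck_on 1 torus (log_hessian H a b)"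
  unfolding log_hessian_def[abs_def]
  by (intro Ck_on_mult[OF open_torus] Ck_on_inverse_component Ck_on_log_function[OF assms])

text \<open>Common to \<open>wirt\<close> and \<open>wirt_bar\<close>, so that closedness under both operators needs one computation of derivatives.\<close>

locale derivation_at =
  fixes D :: "(complex ^ 'm::{finite,linorder} \<Rightarrow> complex) \<Rightarrow> complex" and z :: "complex ^ 'm::{finite,linorder}"
  assumes const: "\<And>c. D (\<lambda>_. c) = 0"
    and add: "\<And>f g. f differentiable (at z) \<Longrightarrow> g differentiable (at z) \<Longrightarrow> D (\<lambda>z. f z + g z) = D f + D g"
    and mult: "\<And>f g. f differentiable (at z) \<Longrightarrow> g differentiable (at z) \<Longrightarrow> D (\<lambda>z. f z * g z) = D f * g z + f z * D g"
begin

lemma sum: "(\<And>i. i \<in> I \<Longrightarrow> f i differentiable (at z)) \<Longrightarrow> D (\<lambda>z. \<Sum>i\<in>I. f i z) = (\<Sum>i\<in>I. D (f i))"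
  by (induction I rule: infinite_finite_induct) (simp_all add: const add differentiable_sum)

lemma cmult: "f differentiable (at z) \<Longrightarrow> D (\<lambda>z. c * f z) = c * D f"
  using mult[of "\<lambda>_. c" f] by (simp add: const)

lemma cmult_right: "f differentiable (at z) \<Longrightarrow> D (\<lambda>z. c * f z * d) = c * D f * d"
  using mult[of "\<lambda>z. c * f z" "\<lambda>_. d"] by (simp add: const cmult)

definition form_derivative :: "(complex ^ 'm::{finite,linorder} \<Rightarrow> 'm even_form) \<Rightarrow> 'm even_form" where
  "form_derivative X = Even (\<lambda>S. D (\<lambda>w. coeff (X w) S))"

lemma coeff_form_derivative: "coeff (form_derivative X) S = D (\<lambda>w. coeff (X w) S)"
  unfolding form_derivative_def by (subst Even_inverse) (simp_all add: coeff_odd const)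

lemma form_derivative_times:
  assumes "\<And>S. (\<lambda>w. coeff (X w) S) differentiable (at z)" "\<And>S. (\<lambda>w. coeff (Y w) S) differentiable (at z)"
  shows "form_derivative (\<lambda>w. X w * Y w) = form_derivative X * Y z + X z * form_derivative Y"
proof (rule coeff_eqI)
  fix S
  have "D (\<lambda>w. \<Sum>A\<in>Pow S. shuffle_sign A (S - A) * coeff (X w) A * coeff (Y w) (S - A))
    = (\<Sum>A\<in>Pow S. shuffle_sign A (S - A) * D (\<lambda>w. coeff (X w) A) * coeff (Y z) (S - A)
        + shuffle_sign A (S - A) * coeff (X z) A * D (\<lambda>w. coeff (Y w) (S - A)))"
    using assms by (subst sum) (auto simp: mult cmult const)
  then show "coeff (form_derivative (\<lambda>w. X w * Y w)) S = coeff (form_derivative X * Y z + X z * form_derivative Y) S"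
    by (simp add: coeff_form_derivative coeff_times wedge_def sum.distrib)
qed

lemma form_derivative_power:
  assumes X: "\<And>S. (\<lambda>w. coeff (X w) S) differentiable (at z)" and Xn: "\<And>n S. (\<lambda>w. coeff (X w ^ n) S) differentiable (at z)"
  shows "form_derivative (\<lambda>w. X w ^ Suc n) = of_nat (Suc n) * X z ^ n * form_derivative X"
proof (induction n)
  case 0
  then show ?case by simp
next
  case (Suc n)
  have "form_derivative (\<lambda>w. X w ^ Suc (Suc n)) = form_derivative (\<lambda>w. X w * X w ^ Suc n)" by simp
  also have "\<dots> = form_derivative X * X z ^ Suc n + X z * form_derivative (\<lambda>w. X w ^ Suc n)"
    by (rule form_derivative_times[OF X Xn])
  finally show ?case unfolding Suc by (simp add: algebra_simps)
qed

lemma form_derivative_const: "form_derivative (\<lambda>_. \<alpha>) = 0"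
  by (rule coeff_eqI) (simp add: coeff_form_derivative const)

lemma form_derivative_curvature:
  assumes "\<And>a b. log_hessian H a b differentiable (at z)"
  shows "form_derivative (curvature H) = (\<Sum>c\<in>UNIV. \<Sum>d\<in>UNIV. const (\<i> / (2 * complex_of_real pi) * D (log_hessian H c d)) * pair c d)"
proof (rule coeff_eqI)
  fix S
  have "D (\<lambda>w. \<Sum>a\<in>UNIV. \<Sum>b\<in>UNIV. \<i> / (2 * complex_of_real pi) * log_hessian H a b w * coeff (pair a b) S)
    = (\<Sum>a\<in>UNIV. \<Sum>b\<in>UNIV. \<i> / (2 * complex_of_real pi) * D (log_hessian H a b) * coeff (pair a b) S)"
    (is "?L = ?R")
  proof -
    have "?L = (\<Sum>a\<in>UNIV. D (\<lambda>w. \<Sum>b\<in>UNIV. \<i> / (2 * complex_of_real pi) * log_hessian H a b w * coeff (pair a b) S))"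
      by (rule sum) (intro differentiable_sum differentiable_mult assms differentiable_const finite ballI)
    also have "\<dots> = (\<Sum>a\<in>UNIV. \<Sum>b\<in>UNIV. D (\<lambda>w. \<i> / (2 * complex_of_real pi) * log_hessian H a b w * coeff (pair a b) S))"
      by (intro sum.cong refl sum) (intro differentiable_mult assms differentiable_const)
    finally show ?thesis by (simp only: cmult_right[OF assms])
  qed
  then show "coeff (form_derivative (curvature H)) S =
    coeff (\<Sum>c\<in>UNIV. \<Sum>d\<in>UNIV. const (\<i> / (2 * complex_of_real pi) * D (log_hessian H c d)) * pair c d) S"
    by (simp add: coeff_form_derivative curvature_def coeff_sum)
qed

lemma curvature_power_derivative:
  assumes "\<And>S. (\<lambda>w. coeff (curvature H w) S) differentiable (at z)"
    and "\<And>n S. (\<lambda>w. coeff (curvature H w ^ n) S) differentiable (at z)"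
  shows "form_derivative (\<lambda>w. curvature H w ^ k * pair a b)
    = of_nat k * curvature H z ^ (k - 1) * (form_derivative (curvature H) * pair a b)"
proof -
  have "form_derivative (\<lambda>w. curvature H w ^ k * pair a b) = form_derivative (\<lambda>w. curvature H w ^ k) * pair a b"
    by (subst form_derivative_times) (simp_all add: assms form_derivative_const)
  also have "form_derivative (\<lambda>w. curvature H w ^ k) = of_nat k * curvature H z ^ (k - 1) * form_derivative (curvature H)"
    using form_derivative_power[OF assms] form_derivative_const by (cases k) auto
  finally show ?thesis by (simp add: mult.assoc)
qed

end

lemma derivation_wirt: "derivation_at (\<lambda>f. wirt a f z) z" and derivation_wirt_bar: "derivation_at (\<lambda>f. wirt_bar a f z) z"
  by unfold_locales (simp_all add: wirt_add wirt_mult)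

text \<open>Exchanging the names \<open>a\<close> and \<open>c\<close> changes the sign of the products of pairs but not the coefficients.\<close>

lemma antisymmetric_contraction:
  fixes w :: "'m::{finite,linorder} \<Rightarrow> 'm \<Rightarrow> 'm \<Rightarrow> complex"
  assumes "\<And>a c d. w a c d = w c a d"
  shows "(\<Sum>a\<in>UNIV. (\<Sum>c\<in>UNIV. \<Sum>d\<in>UNIV. const (w a c d) * pair c d) * pair a b) = (0 :: 'm::{finite,linorder} even_form)" (is "?X = 0")
proof (rule even_form_double_zero)
  have X: "?X = (\<Sum>a\<in>UNIV. \<Sum>c\<in>UNIV. \<Sum>d\<in>UNIV. const (w a c d) * (pair c d * pair a b))"
    by (simp add: sum_distrib_right mult.assoc)
  also have "\<dots> = (\<Sum>c\<in>UNIV. \<Sum>a\<in>UNIV. \<Sum>d\<in>UNIV. const (w a c d) * (pair c d * pair a b))" by (rule sum.swap)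
  also have "\<dots> = (\<Sum>c\<in>UNIV. \<Sum>a\<in>UNIV. \<Sum>d\<in>UNIV. - (const (w c a d) * (pair a d * pair c b)))"
  proof (intro sum.cong refl)
    fix a c d
    have "pair c d * pair a b = - (pair a d * pair c b :: 'm even_form)" using pair_exchange[of c d a b] by (simp add: mult.commute)
    then show "const (w a c d) * (pair c d * pair a b) = - (const (w c a d) * (pair a d * pair c b))"
      by (simp only: assms[of a c d] mult_minus_right)
  qed
  also have "\<dots> = - ?X" unfolding X by (simp add: sum_negf)
  finally show "?X = - ?X" .
qed

lemma antisymmetric_contraction_bar:
  fixes w :: "'m::{finite,linorder} \<Rightarrow> 'm \<Rightarrow> 'm \<Rightarrow> complex"
  assumes "\<And>b c d. w b c d = w d c b"
  shows "(\<Sum>b\<in>UNIV. (\<Sum>c\<in>UNIV. \<Sum>d\<in>UNIV. const (w b c d) * pair c d) * pair a b) = (0 :: 'm::{finite,linorder} even_form)" (is "?X = 0")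
proof (rule even_form_double_zero)
  have X: "?X = (\<Sum>b\<in>UNIV. \<Sum>d\<in>UNIV. \<Sum>c\<in>UNIV. const (w b c d) * (pair c d * pair a b))"
    unfolding sum_distrib_right mult.assoc by (intro sum.cong refl sum.swap)
  also have "\<dots> = (\<Sum>d\<in>UNIV. \<Sum>b\<in>UNIV. \<Sum>c\<in>UNIV. const (w b c d) * (pair c d * pair a b))" by (rule sum.swap)
  also have "\<dots> = (\<Sum>d\<in>UNIV. \<Sum>b\<in>UNIV. \<Sum>c\<in>UNIV. - (const (w d c b) * (pair c b * pair a d)))"
  proof (intro sum.cong refl)
    fix b c d
    show "const (w b c d) * (pair c d * pair a b) = - (const (w d c b) * (pair c b * pair a d))"
      by (simp only: assms[of b c d] pair_exchange[of c d a b] mult_minus_right)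
  qed
  also have "\<dots> = - ?X" unfolding X by (simp add: sum_negf)
  finally show "?X = - ?X" .
qed

lemma wirt_wirt_bar_log_function:
  fixes f :: "real ^ 'm \<Rightarrow> real"
  assumes z: "z \<in> torus" and f: "\<And>x. (f has_derivative (\<lambda>h. h \<bullet> (\<chi> i. g i x))) (at x)"
    and g: "\<And>i x. (g i has_derivative (\<lambda>h. h \<bullet> H i x)) (at x)" and H: "\<And>i. continuous_on UNIV (H i)"
  shows "wirt a (wirt_bar b (\<lambda>z. complex_of_real (f (rho z)))) z = log_hessian H a b z"
    "wirt_bar b (\<lambda>z. complex_of_real (g a (rho z)) * inverse (z $ a)) z = log_hessian H a b z"
    "wirt_bar b (\<lambda>z. complex_of_real (f (rho z))) differentiable (at z)"
proof -
  have eq: "wirt_bar b (\<lambda>z. complex_of_real (f (rho z))) w = complex_of_real (g b (rho w)) * inverse (cnj (w $ b))" if "w \<in> torus" for w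
    using wirt_log_function(2)[OF that f] by simp
  have d: "(\<lambda>z. complex_of_real (g b (rho z))) differentiable (at z)" for b
    by (rule Ck_on_differentiable1[OF Ck_on_log_function[OF g H] _ z]) simp
  have i: "(\<lambda>z. inverse (cnj (z $ b))) differentiable (at z)" "(\<lambda>z. inverse (z $ b)) differentiable (at z)" for b
    using inverse_component_derivative[OF z] by (auto simp: differentiable_def)
  have "wirt a (wirt_bar b (\<lambda>z. complex_of_real (f (rho z)))) z = wirt a (\<lambda>w. complex_of_real (g b (rho w)) * inverse (cnj (w $ b))) z"
    by (rule wirt_cong_open(1)[OF open_torus z eq])
  also have "\<dots> = log_hessian H a b z"
    by (simp add: wirt_mult(1)[OF d i(1)] wirt_log_function(1)[OF z g] wirt_inverse_component[OF z] log_hessian_def)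
  finally show "wirt a (wirt_bar b (\<lambda>z. complex_of_real (f (rho z)))) z = log_hessian H a b z" .
  have "wirt_bar b (\<lambda>z. complex_of_real (g a (rho z)) * inverse (z $ a)) z = complex_of_real (H a (rho z) $ b) * inverse (cnj (z $ b)) * inverse (z $ a)"
    by (simp add: wirt_mult(2)[OF d i(2)] wirt_log_function(2)[OF z g] wirt_inverse_component[OF z])
  then show "wirt_bar b (\<lambda>z. complex_of_real (g a (rho z)) * inverse (z $ a)) z = log_hessian H a b z"
    using second_derivative_symmetric[OF f g H, of a "rho z" b] by (simp add: log_hessian_def mult_ac)
  show "wirt_bar b (\<lambda>z. complex_of_real (f (rho z))) differentiable (at z)"
    by (rule differentiable_cong_open[OF open_torus z, of "\<lambda>w. complex_of_real (g b (rho w)) * inverse (cnj (w $ b))"])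
       (use eq differentiable_mult[OF d i(1)] in auto)
qed

lemma wedge_scalar_right: "wedge (coeff \<alpha>) (scalar c) S = c * coeff \<alpha> S"
  using wedge_even_commute[of "coeff \<alpha>" "scalar c"] by (simp add: coeff_odd wedge_scalar)

lemma ddc_function_form:
  fixes f :: "real ^ 'm::{finite,linorder} \<Rightarrow> real"
  assumes z: "z \<in> torus" and f: "\<And>x. (f has_derivative (\<lambda>h. h \<bullet> (\<chi> i. g i x))) (at x)"
    and g: "\<And>i x. (g i has_derivative (\<lambda>h. h \<bullet> H i x)) (at x)" and H: "\<And>i. continuous_on UNIV (H i)"
  shows "ddc (function_form (\<lambda>z. f (rho z))) z = coeff (curvature H z)"
proof
  fix S :: "('m \<times> bool) set"
  note L = wirt_wirt_bar_log_function[OF z f g H]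
  have eq: "(\<lambda>v. function_form (\<lambda>z. f (rho z)) v A) = (if A = {} then (\<lambda>v. complex_of_real (f (rho v))) else (\<lambda>v. 0))" for A :: "('m \<times> bool) set"
    by (auto simp: function_form_def scalar_def)
  have "ddc (function_form (\<lambda>z. f (rho z))) z S = \<i> / (2 * complex_of_real pi) *
    (\<Sum>a\<in>UNIV. \<Sum>b\<in>UNIV. wedge (coeff (pair a b)) (\<lambda>A. wirt a (wirt_bar b (\<lambda>v. function_form (\<lambda>z. f (rho z)) v A)) z) S)"
  proof (rule ddc_pairs)
    fix k :: 'm and A :: "('m \<times> bool) set"
    have "wirt_bar k (\<lambda>v. 0) = (\<lambda>z. 0)" by (simp add: fun_eq_iff)
    then show "wirt_bar k (\<lambda>v. function_form (\<lambda>z. f (rho z)) v A) differentiable (at z)"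
      unfolding eq using L(3) by simp
  qed
  also have "\<dots> = \<i> / (2 * complex_of_real pi) * (\<Sum>a\<in>UNIV. \<Sum>b\<in>UNIV. wedge (coeff (pair a b)) (scalar (log_hessian H a b z)) S)"
  proof -
    have "(\<lambda>A. wirt a (wirt_bar b (\<lambda>v. function_form (\<lambda>z. f (rho z)) v A)) z) = scalar (log_hessian H a b z)" for a b
    proof
      fix A :: "('m \<times> bool) set"
      have "wirt_bar b (\<lambda>v. 0) = (\<lambda>z. 0)" by (simp add: fun_eq_iff)
      then show "wirt a (wirt_bar b (\<lambda>v. function_form (\<lambda>z. f (rho z)) v A)) z = scalar (log_hessian H a b z) A"
        unfolding eq scalar_def using L(1) by simp
    qed
    then show ?thesis by simp
  qed
  also have "\<dots> = coeff (curvature H z) S"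
    by (simp add: curvature_def coeff_sum wedge_scalar_right sum_distrib_left mult.assoc)
  finally show "ddc (function_form (\<lambda>z. f (rho z))) z S = coeff (curvature H z) S" .
qed

text \<open>Symmetry of second derivatives, for the derivatives of \<open>f\<close> and for \<open>f\<close> itself.\<close>

lemma third_derivative_symmetric:
  fixes f :: "real ^ 'm \<Rightarrow> real"
  assumes f: "\<And>x. (f has_derivative (\<lambda>h. h \<bullet> (\<chi> i. g i x))) (at x)"
    and g: "\<And>i x. (g i has_derivative (\<lambda>h. h \<bullet> H i x)) (at x)"
    and T: "\<And>i j x. ((\<lambda>x. H i x $ j) has_derivative (\<lambda>h. h \<bullet> T i j x)) (at x)" "\<And>i j. continuous_on UNIV (T i j)"
  shows "T i j x $ k = T i k x $ j" "T i j x $ k = T k j x $ i"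
proof -
  have H: "continuous_on UNIV (H i)" for i
  proof -
    have "continuous_on UNIV (\<lambda>x. \<chi> j. H i x $ j)"
      using T(1) by (intro continuous_on_vec_lambda continuous_at_imp_continuous_on ballI) (meson has_derivative_continuous)
    then show ?thesis by simp
  qed
  have "(g i has_derivative (\<lambda>h. h \<bullet> (\<chi> j. H i x $ j))) (at x)" for i x using g by simp
  from second_derivative_symmetric[OF this T] have 1: "T i j x $ k = T i k x $ j" for i j k .
  have "(\<lambda>x. H i x $ j) = (\<lambda>x. H j x $ i)" for i j
    using second_derivative_symmetric[OF f g H] by auto
  then have "((\<lambda>x. H i x $ j) has_derivative (\<lambda>h. h \<bullet> T j i x)) (at x)" for i j using T(1)[of j i x] by simp
  from has_derivative_unique[OF this T(1)] have "(\<lambda>h. h \<bullet> T j i x) = (\<lambda>h. h \<bullet> T i j x)" for i j .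
  then have 2: "T j i x = T i j x" for i j
    by (metis (no_types) inner_commute vector_eq_rdot fun_cong)
  show "T i j x $ k = T i k x $ j" by (rule 1)
  show "T i j x $ k = T k j x $ i" using 1 2 by metis
qed

lemma wirt_log_hessian:
  assumes z: "z \<in> torus"
    and T: "\<And>i j x. ((\<lambda>x. H i x $ j) has_derivative (\<lambda>h. h \<bullet> T i j x)) (at x)" "\<And>i j. continuous_on UNIV (T i j)"
  shows "wirt a (log_hessian H c d) z = complex_of_real (T d c (rho z) $ a) * inverse (z $ a) * inverse (z $ c) * inverse (cnj (z $ d))
      - (if a = c then complex_of_real (H d (rho z) $ c) * inverse (z $ c) * inverse (z $ c) * inverse (cnj (z $ d)) else 0)"
    "wirt_bar a (log_hessian H c d) z = complex_of_real (T d c (rho z) $ a) * inverse (cnj (z $ a)) * inverse (z $ c) * inverse (cnj (z $ d))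
      - (if a = d then complex_of_real (H d (rho z) $ c) * inverse (z $ c) * inverse (cnj (z $ d)) * inverse (cnj (z $ d)) else 0)"
proof -
  have d: "(\<lambda>z. complex_of_real (H d (rho z) $ c)) differentiable (at z)"
    by (rule Ck_on_differentiable1[OF Ck_on_log_function[OF T] _ z]) simp
  have i: "(\<lambda>z. inverse (cnj (z $ b))) differentiable (at z)" "(\<lambda>z. inverse (z $ b)) differentiable (at z)" for b
    using inverse_component_derivative[OF z] by (auto simp: differentiable_def)
  show "wirt a (log_hessian H c d) z = complex_of_real (T d c (rho z) $ a) * inverse (z $ a) * inverse (z $ c) * inverse (cnj (z $ d))
      - (if a = c then complex_of_real (H d (rho z) $ c) * inverse (z $ c) * inverse (z $ c) * inverse (cnj (z $ d)) else 0)"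
    unfolding log_hessian_def[abs_def]
    unfolding wirt_mult(1)[OF differentiable_mult[OF d i(2)] i(1)] wirt_mult(1)[OF d i(2)] wirt_log_function(1)[OF z T(1)]
      wirt_inverse_component[OF z]
    by (simp add: algebra_simps)
  show "wirt_bar a (log_hessian H c d) z = complex_of_real (T d c (rho z) $ a) * inverse (cnj (z $ a)) * inverse (z $ c) * inverse (cnj (z $ d))
      - (if a = d then complex_of_real (H d (rho z) $ c) * inverse (z $ c) * inverse (cnj (z $ d)) * inverse (cnj (z $ d)) else 0)"
    unfolding log_hessian_def[abs_def]
    unfolding wirt_mult(2)[OF differentiable_mult[OF d i(2)] i(1)] wirt_mult(2)[OF d i(2)] wirt_log_function(2)[OF z T(1)]
      wirt_inverse_component[OF z]
    by (simp add: algebra_simps)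
qed

text \<open>The powers of the curvature form are closed: the third derivatives are symmetric, the products of
  pairs are antisymmetric.\<close>

lemma curvature_power_closed:
  fixes f :: "real ^ 'm::{finite,linorder} \<Rightarrow> real"
  assumes z: "z \<in> torus" and f: "\<And>x. (f has_derivative (\<lambda>h. h \<bullet> (\<chi> i. g i x))) (at x)"
    and g: "\<And>i x. (g i has_derivative (\<lambda>h. h \<bullet> H i x)) (at x)"
    and T: "\<And>i j x. ((\<lambda>x. H i x $ j) has_derivative (\<lambda>h. h \<bullet> T i j x)) (at x)" "\<And>i j. continuous_on UNIV (T i j)"
  shows "(\<Sum>a\<in>UNIV. wirt a (\<lambda>z. coeff (curvature H z ^ k * pair a b) S) z) = 0"
    "(\<Sum>b\<in>UNIV. wirt_bar b (\<lambda>z. coeff (curvature H z ^ k * pair a b) S) z) = 0"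
proof -
  note sym = third_derivative_symmetric[OF f g T]
  have d: "log_hessian H a b differentiable (at z)" for a b
    by (rule Ck_on_differentiable1[OF Ck_on_log_hessian[OF T] _ z]) simp
  have dC: "(\<lambda>w. coeff (curvature H w) S) differentiable (at z)" "(\<lambda>w. coeff (curvature H w ^ n) S) differentiable (at z)" for n S
    by (rule Ck_on_differentiable1[OF _ _ z, of 1], intro Ck_on_curvature Ck_on_coeff_power Ck_on_log_hessian[OF T], simp)+
  have "(\<Sum>a\<in>UNIV. wirt a (\<lambda>z. coeff (curvature H z ^ k * pair a b) S) z)
    = (\<Sum>a\<in>UNIV. coeff (of_nat k * curvature H z ^ (k - 1) *
        ((\<Sum>c\<in>UNIV. \<Sum>d\<in>UNIV. const (\<i> / (2 * complex_of_real pi) * wirt a (log_hessian H c d) z) * pair c d) * pair a b)) S)"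
    using derivation_at.curvature_power_derivative[OF derivation_wirt dC] derivation_at.form_derivative_curvature[OF derivation_wirt d]
    by (simp add: derivation_at.coeff_form_derivative[OF derivation_wirt, symmetric])
  also have "\<dots> = coeff (of_nat k * curvature H z ^ (k - 1) * (\<Sum>a\<in>UNIV.
        (\<Sum>c\<in>UNIV. \<Sum>d\<in>UNIV. const (\<i> / (2 * complex_of_real pi) * wirt a (log_hessian H c d) z) * pair c d) * pair a b)) S"
    by (simp add: coeff_sum[symmetric] sum_distrib_left)
  also have "\<dots> = 0"
  proof -
    have "wirt a (log_hessian H c d) z = wirt c (log_hessian H a d) z" for a c d
      unfolding wirt_log_hessian[OF z T] using sym(1)[of d c "rho z" a] by (auto simp: mult_ac)
    then show ?thesis by (subst antisymmetric_contraction) auto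
  qed
  finally show "(\<Sum>a\<in>UNIV. wirt a (\<lambda>z. coeff (curvature H z ^ k * pair a b) S) z) = 0" .
  have "(\<Sum>b\<in>UNIV. wirt_bar b (\<lambda>z. coeff (curvature H z ^ k * pair a b) S) z)
    = (\<Sum>b\<in>UNIV. coeff (of_nat k * curvature H z ^ (k - 1) *
        ((\<Sum>c\<in>UNIV. \<Sum>d\<in>UNIV. const (\<i> / (2 * complex_of_real pi) * wirt_bar b (log_hessian H c d) z) * pair c d) * pair a b)) S)"
    using derivation_at.curvature_power_derivative[OF derivation_wirt_bar dC] derivation_at.form_derivative_curvature[OF derivation_wirt_bar d]
    by (simp add: derivation_at.coeff_form_derivative[OF derivation_wirt_bar, symmetric])
  also have "\<dots> = coeff (of_nat k * curvature H z ^ (k - 1) * (\<Sum>b\<in>UNIV.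
        (\<Sum>c\<in>UNIV. \<Sum>d\<in>UNIV. const (\<i> / (2 * complex_of_real pi) * wirt_bar b (log_hessian H c d) z) * pair c d) * pair a b)) S"
    by (simp add: coeff_sum[symmetric] sum_distrib_left)
  also have "\<dots> = 0"
  proof -
    have "H i x $ j = H j x $ i" for i j x
    proof -
      have "continuous_on UNIV (\<lambda>x. \<chi> j. H i x $ j)" for i
        using T(1) by (intro continuous_on_vec_lambda continuous_at_imp_continuous_on ballI) (meson has_derivative_continuous)
      then show ?thesis using second_derivative_symmetric[OF f g] by simp
    qed
    then have "wirt_bar b (log_hessian H c d) z = wirt_bar d (log_hessian H c b) z" for b c d
      unfolding wirt_log_hessian[OF z T] using sym(2)[of d c "rho z" b] by (auto simp: mult_ac)
    then show ?thesis by (subst antisymmetric_contraction_bar) auto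
  qed
  finally show "(\<Sum>b\<in>UNIV. wirt_bar b (\<lambda>z. coeff (curvature H z ^ k * pair a b) S) z) = 0" .
qed

section \<open>Integration by parts\<close>

lemma wirt_zero_outside:
  assumes "compact K" "\<And>z. z \<notin> K \<Longrightarrow> f z = 0" "z \<notin> K"
  shows "wirt j f z = 0" "wirt_bar j f z = 0"
  using frechet_derivative_zero_outside(2)[of K f z] assms by (simp_all add: wirt_def wirt_bar_def)

text \<open>The integrand is the divergence of \<open>(\<Sum>b. C a b u \<partial>\<^sub>b f)\<close>, with conjugate derivatives \<open>\<partial>\<^sub>b\<close>, minus the conjugate divergence
  of \<open>(\<Sum>a. C a b f v a)\<close>: derivatives of \<open>C\<close> cancel because \<open>C\<close> is closed, and mixed products of first derivatives
  of \<open>u\<close> and \<open>f\<close> occur in both terms.\<close>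

lemma integration_by_parts:
  fixes C :: "'m::finite \<Rightarrow> 'm \<Rightarrow> complex ^ 'm \<Rightarrow> complex" and u :: "complex ^ 'm \<Rightarrow> complex"
  assumes K: "compact K" "K \<subseteq> torus"
    and f: "Ck_on 2 torus f" "\<And>z. z \<notin> K \<Longrightarrow> f z = 0"
    and C: "\<And>a b. Ck_on 1 torus (C a b)"
    and closed: "\<And>z b. z \<in> torus \<Longrightarrow> (\<Sum>a\<in>UNIV. wirt a (C a b) z) = 0" "\<And>z a. z \<in> torus \<Longrightarrow> (\<Sum>b\<in>UNIV. wirt_bar b (C a b) z) = 0"
    and u: "Ck_on 1 torus u" "\<And>a. Ck_on 1 torus (v a)" "\<And>z a. z \<in> torus \<Longrightarrow> wirt a u z = v a z"
      "\<And>z a b. z \<in> torus \<Longrightarrow> wirt_bar b (v a) z = h a b z"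
  shows "(LINT z|lborel. (\<Sum>a\<in>UNIV. \<Sum>b\<in>UNIV. C a b z * (u z * wirt a (wirt_bar b f) z - f z * h a b z))) = 0"
proof -
  define P where "P a z = (\<Sum>b\<in>UNIV. C a b z * u z * wirt_bar b f z)" for a z
  define Q where "Q b z = (\<Sum>a\<in>UNIV. C a b z * f z * v a z)" for b z
  have f2: "Ck_on (Suc 1) torus f" using f(1) by (simp add: numeral_2_eq_2)
  have f1: "Ck_on 1 torus f" by (rule Ck_on_SucD[OF f2])
  have fb: "Ck_on 1 torus (wirt_bar b f)" for b by (rule Ck_on_wirt[OF open_torus f2])
  have P1: "Ck_on 1 torus (P a)" for a
    unfolding P_def[abs_def] by (intro Ck_on_sum[OF open_torus] Ck_on_mult[OF open_torus] C u fb)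
  have Q1: "Ck_on 1 torus (Q b)" for b
    unfolding Q_def[abs_def] by (intro Ck_on_sum[OF open_torus] Ck_on_mult[OF open_torus] C u f1)
  have P0: "P a z = 0" if "z \<notin> K" for a z
    unfolding P_def using wirt_zero_outside(2)[OF K(1) f(2) that] by simp
  have Q0: "Q b z = 0" if "z \<notin> K" for b z unfolding Q_def using f(2)[OF that] by simp
  have eq: "(\<Sum>a\<in>UNIV. \<Sum>b\<in>UNIV. C a b z * (u z * wirt a (wirt_bar b f) z - f z * h a b z))
    = (\<Sum>a\<in>UNIV. wirt a (P a) z) - (\<Sum>b\<in>UNIV. wirt_bar b (Q b) z)" for z
  proof (cases "z \<in> K")
    case False
    have "wirt_bar b f w = 0" if "w \<notin> K" for b w by (rule wirt_zero_outside(2)[OF K(1) f(2) that])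
    then have "wirt a (wirt_bar b f) z = 0" for a b using wirt_zero_outside(1)[OF K(1) _ False] by blast
    then show ?thesis
      using f(2)[OF False] wirt_zero_outside(1)[OF K(1) P0 False] wirt_zero_outside(2)[OF K(1) Q0 False] by simp
  next
    case True
    then have z: "z \<in> torus" using K by auto
    have d: "C a b differentiable (at z)" "u differentiable (at z)" "v a differentiable (at z)" "f differentiable (at z)"
      "wirt_bar b f differentiable (at z)" for a b
      using Ck_on_differentiable1[OF C order_refl z] Ck_on_differentiable1[OF u(1) order_refl z] Ck_on_differentiable1[OF u(2) order_refl z]
        Ck_on_differentiable1[OF f1 order_refl z] Ck_on_differentiable1[OF fb order_refl z] by auto
    have "wirt a (P a) z = (\<Sum>b\<in>UNIV. (wirt a (C a b) z * u z + C a b z * v a z) * wirt_bar b f z + C a b z * u z * wirt a (wirt_bar b f) z)" for a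
      unfolding P_def[abs_def]
      by (subst wirt_sum(1)) (simp_all add: d differentiable_mult wirt_mult(1) u(3)[OF z])
    moreover have "(\<Sum>a\<in>UNIV. \<Sum>b\<in>UNIV. wirt a (C a b) z * (u z * wirt_bar b f z)) = 0"
      by (subst sum.swap) (simp add: sum_distrib_right[symmetric] closed(1)[OF z])
    ultimately have SP: "(\<Sum>a\<in>UNIV. wirt a (P a) z) = (\<Sum>a\<in>UNIV. \<Sum>b\<in>UNIV. C a b z * v a z * wirt_bar b f z + C a b z * u z * wirt a (wirt_bar b f) z)"
      by (simp add: distrib_right sum.distrib mult.assoc)
    have "wirt_bar b (Q b) z = (\<Sum>a\<in>UNIV. (wirt_bar b (C a b) z * f z + C a b z * wirt_bar b f z) * v a z + C a b z * f z * h a b z)" for b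
      unfolding Q_def[abs_def]
      by (subst wirt_sum(2)) (simp_all add: d differentiable_mult wirt_mult(2) u(4)[OF z])
    moreover have "(\<Sum>b\<in>UNIV. \<Sum>a\<in>UNIV. wirt_bar b (C a b) z * (f z * v a z)) = 0"
      by (subst sum.swap) (simp add: sum_distrib_right[symmetric] closed(2)[OF z])
    ultimately have "(\<Sum>b\<in>UNIV. wirt_bar b (Q b) z) = (\<Sum>b\<in>UNIV. \<Sum>a\<in>UNIV. C a b z * wirt_bar b f z * v a z + C a b z * f z * h a b z)"
      by (simp add: distrib_right sum.distrib mult.assoc)
    then have SQ: "(\<Sum>b\<in>UNIV. wirt_bar b (Q b) z) = (\<Sum>a\<in>UNIV. \<Sum>b\<in>UNIV. C a b z * wirt_bar b f z * v a z + C a b z * f z * h a b z)"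
      by (subst sum.swap)
    show ?thesis unfolding SP SQ sum_subtractf[symmetric]
      by (intro sum.cong refl) (simp add: algebra_simps)
  qed
  note I = integral_wirt_zero[OF K P1 P0] and J = integral_wirt_zero[OF K Q1 Q0]
  show ?thesis
    unfolding eq using I(1,2) J(3,4)
    by (subst Bochner_Integration.integral_diff) (simp_all add: Bochner_Integration.integral_sum)
qed

lemma test_formD:
  assumes "test_form \<phi>"
  obtains K where "compact K" "K \<subseteq> torus" "\<And>z S. z \<notin> K \<Longrightarrow> \<phi> z S = 0" "\<And>k S. Ck_on k torus (\<lambda>z. \<phi> z S)"
  using assms unfolding test_form_def supported_in_def smooth_on_def by metis

lemma ddc_test_form:
  assumes "\<And>k S. Ck_on k torus (\<lambda>z. \<phi> z S)" "z \<in> torus"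
  shows "ddc \<phi> z S = \<i> / (2 * complex_of_real pi) *
    (\<Sum>a\<in>UNIV. \<Sum>b\<in>UNIV. wedge (coeff (pair a b)) (\<lambda>A. wirt a (wirt_bar b (\<lambda>v. \<phi> v A)) z) S)"
  by (rule ddc_pairs, rule Ck_on_differentiable1[OF Ck_on_wirt(2)[OF open_torus assms(1)] order_refl assms(2)])

lemma ddc_outside:
  assumes "compact K" "\<And>z S. z \<notin> K \<Longrightarrow> \<phi> z S = 0" "z \<notin> K"
  shows "ddc \<phi> z S = 0"
proof -
  have w: "wirt_bar b (\<lambda>v. \<phi> v A) w = 0" if "w \<notin> K" for b A w
    by (rule wirt_zero_outside(2)[OF assms(1) _ that]) (rule assms(2))
  have 0: "wedge (dzbar b) (\<lambda>B. wirt_bar b (\<lambda>v. \<phi> v B) w) A = 0" if "w \<notin> K" for b A w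
    by (simp add: wedge_def w[OF that])
  have "delbar \<phi> w A = 0" if "w \<notin> K" for w A unfolding delbar_def using 0[OF that] by simp
  then have "wirt a (\<lambda>w. delbar \<phi> w A) z = 0" for a A
    by (intro wirt_zero_outside(1)[OF assms(1) _ assms(3)])
  then show ?thesis by (simp add: ddc_def del_def wedge_def)
qed

lemma ddc_smooth:
  assumes "\<And>k S. Ck_on k torus (\<lambda>z. \<phi> z S)"
  shows "Ck_on k torus (\<lambda>z. ddc \<phi> z S)"
proof (rule Ck_on_cong[OF open_torus])
  show "\<i> / (2 * complex_of_real pi) *
    (\<Sum>a\<in>UNIV. \<Sum>b\<in>UNIV. wedge (coeff (pair a b)) (\<lambda>A. wirt a (wirt_bar b (\<lambda>v. \<phi> v A)) z) S) = ddc \<phi> z S" if "z \<in> torus" for z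
    by (rule ddc_test_form[OF assms that, symmetric])
  show "Ck_on k torus (\<lambda>z. \<i> / (2 * complex_of_real pi) *
    (\<Sum>a\<in>UNIV. \<Sum>b\<in>UNIV. wedge (coeff (pair a b)) (\<lambda>A. wirt a (wirt_bar b (\<lambda>v. \<phi> v A)) z) S))"
    unfolding wedge_def
    by (intro Ck_on_sum[OF open_torus] Ck_on_mult[OF open_torus] Ck_on_const Ck_on_wirt[OF open_torus] assms)
qed

text \<open>The integrand whose integral measures the failure of \<open>\<alpha>\<^sup>k \<and> u dd\<^sup>c\<phi>\<close> and \<open>\<alpha>\<^sup>k\<^sup>+\<^sup>1 \<and> \<phi>\<close> to have equal integrals.\<close>

definition parts_defect :: "('m::{finite,linorder} \<Rightarrow> real ^ 'm::{finite,linorder} \<Rightarrow> real ^ 'm::{finite,linorder}) \<Rightarrow>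
    (real ^ 'm::{finite,linorder} \<Rightarrow> real) \<Rightarrow> nat \<Rightarrow> 'm dform \<Rightarrow> complex ^ 'm::{finite,linorder} \<Rightarrow> complex" where
  "parts_defect H f k \<phi> z = \<i> / (2 * complex_of_real pi) * (\<Sum>A\<in>Pow UNIV. shuffle_sign A (UNIV - A) *
     (\<Sum>a\<in>UNIV. \<Sum>b\<in>UNIV. coeff (curvature H z ^ k * pair a b) A *
        (complex_of_real (f (rho z)) * wirt a (wirt_bar b (\<lambda>z. \<phi> z (UNIV - A))) z - \<phi> z (UNIV - A) * log_hessian H a b z)))"

lemma sum_swap_double: "(\<Sum>A\<in>I. \<Sum>a\<in>J. \<Sum>b\<in>L. t A a b) = (\<Sum>a\<in>J. \<Sum>b\<in>L. \<Sum>A\<in>I. t A a b)"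
proof -
  have "(\<Sum>A\<in>I. \<Sum>a\<in>J. \<Sum>b\<in>L. t A a b) = (\<Sum>a\<in>J. \<Sum>A\<in>I. \<Sum>b\<in>L. t A a b)" by (rule sum.swap)
  also have "\<dots> = (\<Sum>a\<in>J. \<Sum>b\<in>L. \<Sum>A\<in>I. t A a b)" by (intro sum.cong refl sum.swap)
  finally show ?thesis .
qed

lemma parts_defect:
  assumes \<phi>: "\<And>k S. Ck_on k torus (\<lambda>z. \<phi> z S)" and z: "z \<in> torus"
  shows "wedge (coeff (curvature H z ^ k)) (\<lambda>S. complex_of_real (f (rho z)) * ddc \<phi> z S) UNIV
    - wedge (coeff (curvature H z ^ Suc k)) (\<phi> z) UNIV = parts_defect H f k \<phi> z"
proof -
  let ?c = "\<i> / (2 * complex_of_real pi)" and ?X = "curvature H z ^ k" and ?u = "complex_of_real (f (rho z))"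
  let ?w = "\<lambda>a b A. wirt a (wirt_bar b (\<lambda>v. \<phi> v A)) z"
  have "wedge (coeff ?X) (\<lambda>S. ?u * ddc \<phi> z S) UNIV = ?u * ?c * (\<Sum>a\<in>UNIV. \<Sum>b\<in>UNIV. wedge (coeff (?X * pair a b)) (?w a b) UNIV)"
    unfolding ddc_test_form[OF \<phi> z] wedge_mult_right wedge_sum_right coeff_times wedge_assoc by simp
  moreover have "wedge (coeff (curvature H z ^ Suc k)) (\<phi> z) UNIV
    = ?c * (\<Sum>a\<in>UNIV. \<Sum>b\<in>UNIV. log_hessian H a b z * wedge (coeff (?X * pair a b)) (\<phi> z) UNIV)"
  proof -
    have "curvature H z ^ Suc k = ?X * curvature H z" by (simp add: mult.commute)
    also have "X * curvature H z = (\<Sum>a\<in>UNIV. \<Sum>b\<in>UNIV. const (?c * log_hessian H a b z) * (X * pair a b))" for X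
      by (simp add: curvature_def sum_distrib_left mult_ac)
    finally have "coeff (curvature H z ^ Suc k) A = (\<Sum>a\<in>UNIV. \<Sum>b\<in>UNIV. ?c * log_hessian H a b z * coeff (?X * pair a b) A)" for A
      by (simp add: coeff_sum)
    then have "wedge (coeff (curvature H z ^ Suc k)) (\<phi> z) UNIV = (\<Sum>A\<in>Pow UNIV. \<Sum>a\<in>UNIV. \<Sum>b\<in>UNIV.
        ?c * log_hessian H a b z * (shuffle_sign A (UNIV - A) * coeff (?X * pair a b) A * \<phi> z (UNIV - A)))"
      unfolding wedge_def by (simp add: sum_distrib_left sum_distrib_right mult_ac)
    from trans[OF this sum_swap_double] show ?thesis
      unfolding wedge_def by (simp add: sum_distrib_left mult_ac)
  qed
  moreover have "parts_defect H f k \<phi> z = ?u * ?c * (\<Sum>a\<in>UNIV. \<Sum>b\<in>UNIV. wedge (coeff (?X * pair a b)) (?w a b) UNIV)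
    - ?c * (\<Sum>a\<in>UNIV. \<Sum>b\<in>UNIV. log_hessian H a b z * wedge (coeff (?X * pair a b)) (\<phi> z) UNIV)"
  proof -
    have "parts_defect H f k \<phi> z = (\<Sum>A\<in>Pow UNIV. \<Sum>a\<in>UNIV. \<Sum>b\<in>UNIV.
        ?u * ?c * (shuffle_sign A (UNIV - A) * coeff (?X * pair a b) A * ?w a b (UNIV - A))
      - ?c * log_hessian H a b z * (shuffle_sign A (UNIV - A) * coeff (?X * pair a b) A * \<phi> z (UNIV - A)))"
      unfolding parts_defect_def by (simp add: sum_distrib_left right_diff_distrib mult_ac)
    from trans[OF this sum_swap_double] show ?thesis
      unfolding wedge_def by (simp add: sum_distrib_left sum_subtractf mult_ac)
  qed
  ultimately show ?thesis by simp
qed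

lemma parts_defect_integral_C3:
  fixes f :: "real ^ 'm::{finite,linorder} \<Rightarrow> real"
  assumes f: "\<And>x. (f has_derivative (\<lambda>h. h \<bullet> (\<chi> i. g i x))) (at x)"
    and g: "\<And>i x. (g i has_derivative (\<lambda>h. h \<bullet> H i x)) (at x)"
    and T: "\<And>i j x. ((\<lambda>x. H i x $ j) has_derivative (\<lambda>h. h \<bullet> T i j x)) (at x)" "\<And>i j. continuous_on UNIV (T i j)"
    and K: "compact K" "K \<subseteq> torus" and \<phi>0: "\<And>z S. z \<notin> K \<Longrightarrow> \<phi> z S = 0" and \<phi>: "\<And>k S. Ck_on k torus (\<lambda>z. \<phi> z S)"
  shows "(LINT z|lborel. parts_defect H f k \<phi> z) = 0"
proof -
  have H: "continuous_on UNIV (H i)" for i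
  proof -
    have "continuous_on UNIV (\<lambda>x. \<chi> j. H i x $ j)"
      using T(1) by (intro continuous_on_vec_lambda continuous_at_imp_continuous_on ballI) (meson has_derivative_continuous)
    then show ?thesis by simp
  qed
  have G: "continuous_on UNIV (\<lambda>x. \<chi> i. g i x)"
    using g by (intro continuous_on_vec_lambda continuous_at_imp_continuous_on ballI) (meson has_derivative_continuous)
  define h where "h A z = (\<Sum>a\<in>UNIV. \<Sum>b\<in>UNIV. coeff (curvature H z ^ k * pair a b) A *
        (complex_of_real (f (rho z)) * wirt a (wirt_bar b (\<lambda>z. \<phi> z (UNIV - A))) z - \<phi> z (UNIV - A) * log_hessian H a b z))" for A z
  have C: "Ck_on 1 torus (\<lambda>z. coeff (curvature H z ^ k * pair a b) A)" for a b A
    by (intro Ck_on_coeff_times Ck_on_coeff_power Ck_on_curvature Ck_on_log_hessian[OF T] Ck_on_const)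
  have zero: "(LINT z|lborel. h A z) = 0" for A
    unfolding h_def
  proof (rule integration_by_parts[OF K \<phi> \<phi>0 C, where v = "\<lambda>a z. complex_of_real (g a (rho z)) * inverse (z $ a)"])
    show "Ck_on 1 torus (\<lambda>z. complex_of_real (f (rho z)))" by (rule Ck_on_log_function[OF f G])
    show "Ck_on 1 torus (\<lambda>z. complex_of_real (g a (rho z)) * inverse (z $ a))" for a
      by (intro Ck_on_mult[OF open_torus] Ck_on_inverse_component Ck_on_log_function[OF g H])
  qed (use curvature_power_closed[OF _ f g T] wirt_wirt_bar_log_function(2)[OF _ f g H] wirt_log_function(1)[OF _ f] in auto)
  have int: "integrable lborel (h A)" for A
  proof (rule integrable_compact_support[OF K(1)])
    show "h A z = 0" if "z \<notin> K" for z
    proof -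
      have "wirt_bar b (\<lambda>z. \<phi> z (UNIV - A)) w = 0" if "w \<notin> K" for b w
        by (rule wirt_zero_outside(2)[OF K(1) _ that]) (rule \<phi>0)
      then have "wirt a (wirt_bar b (\<lambda>z. \<phi> z (UNIV - A))) z = 0" for a b
        using wirt_zero_outside(1)[OF K(1) _ that] by blast
      then show ?thesis using \<phi>0[OF that] by (simp add: h_def)
    qed
    have D: "continuous_on torus (wirt a (wirt_bar b (\<lambda>z. \<phi> z (UNIV - A))))" for a b
      by (rule Ck_on_continuous[of 0], intro Ck_on_wirt[OF open_torus] \<phi>)
    have U: "continuous_on torus (\<lambda>z. complex_of_real (f (rho z)))" by (rule Ck_on_continuous[OF Ck_on_log_function[OF f G]])
    have "continuous_on torus (h A)"
      unfolding h_def[abs_def]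
      by (intro continuous_intros D U Ck_on_continuous[OF C] Ck_on_continuous[OF \<phi>[of 0]] Ck_on_continuous[OF continuous_log_hessian[OF H]])
    then show "continuous_on K (h A)" by (rule continuous_on_subset) (rule K)
  qed
  have "(LINT z|lborel. parts_defect H f k \<phi> z) = (LINT z|lborel. \<i> / (2 * complex_of_real pi) * (\<Sum>A\<in>Pow UNIV. shuffle_sign A (UNIV - A) * h A z))"
    by (simp add: parts_defect_def h_def)
  also have "\<dots> = 0" using int zero by simp
  finally show ?thesis .
qed

section \<open>Passage to the limit\<close>

text \<open>The hypotheses of the dominated convergence theorem on a compact set, in a form that is stable under sums and products.\<close>

definition bounded_convergent :: "'z set \<Rightarrow> (nat \<Rightarrow> 'z \<Rightarrow> complex) \<Rightarrow> ('z \<Rightarrow> complex) \<Rightarrow> bool" where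
  "bounded_convergent K X x \<longleftrightarrow> (\<forall>z\<in>K. (\<lambda>n. X n z) \<longlonglongrightarrow> x z) \<and> (\<exists>B. \<forall>n. \<forall>z\<in>K. norm (X n z) \<le> B)"

lemma bounded_convergent_add:
  assumes "bounded_convergent K X x" "bounded_convergent K Y y"
  shows "bounded_convergent K (\<lambda>n z. X n z + Y n z) (\<lambda>z. x z + y z)"
proof -
  obtain B where "\<And>n z. z \<in> K \<Longrightarrow> norm (X n z) \<le> B"
    using assms(1) unfolding bounded_convergent_def by blast
  moreover obtain C where "\<And>n z. z \<in> K \<Longrightarrow> norm (Y n z) \<le> C"
    using assms(2) unfolding bounded_convergent_def by blast
  ultimately have "norm (X n z + Y n z) \<le> B + C" if "z \<in> K" for n z using that by (intro norm_triangle_mono)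
  then show ?thesis using assms by (auto simp: bounded_convergent_def intro!: tendsto_intros exI[of _ "B + C"])
qed

lemma bounded_convergent_mult:
  assumes "bounded_convergent K X x" "bounded_convergent K Y y"
  shows "bounded_convergent K (\<lambda>n z. X n z * Y n z) (\<lambda>z. x z * y z)"
proof -
  obtain B where B: "\<And>n z. z \<in> K \<Longrightarrow> norm (X n z) \<le> B"
    using assms(1) unfolding bounded_convergent_def by blast
  obtain C where C: "\<And>n z. z \<in> K \<Longrightarrow> norm (Y n z) \<le> C"
    using assms(2) unfolding bounded_convergent_def by blast
  have "norm (X n z * Y n z) \<le> B * C" if "z \<in> K" for n z
    unfolding norm_mult using B[OF that, of n] C[OF that, of n] norm_ge_zero[of "X n z"] by (intro mult_mono) (auto intro: order_trans[OF norm_ge_zero])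
  then show ?thesis using assms by (auto simp: bounded_convergent_def intro!: tendsto_intros exI[of _ "B * C"])
qed

lemma bounded_convergent_const:
  assumes "\<And>z. z \<in> K \<Longrightarrow> norm (x z) \<le> B"
  shows "bounded_convergent K (\<lambda>n. x) x"
  using assms by (auto simp: bounded_convergent_def)

lemma bounded_convergent_continuous:
  assumes "compact K" "K \<subseteq> U" "continuous_on U x"
  shows "bounded_convergent K (\<lambda>n. x) x"
proof -
  have "compact (x ` K)" by (intro compact_continuous_image continuous_on_subset[OF assms(3)] assms)
  then obtain B where "\<And>z. z \<in> K \<Longrightarrow> norm (x z) \<le> B"
    using compact_imp_bounded[of "x ` K"] unfolding bounded_iff by blast
  then show ?thesis by (rule bounded_convergent_const)
qed

lemma bounded_convergent_cmult: "bounded_convergent K X x \<Longrightarrow> bounded_convergent K (\<lambda>n z. c * X n z) (\<lambda>z. c * x z)"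
  by (intro bounded_convergent_mult bounded_convergent_const[of K _ "norm c"]) auto

lemma bounded_convergent_sum:
  assumes "\<And>i. i \<in> I \<Longrightarrow> bounded_convergent K (X i) (x i)"
  shows "bounded_convergent K (\<lambda>n z. \<Sum>i\<in>I. X i n z) (\<lambda>z. \<Sum>i\<in>I. x i z)"
  using assms
  by (induction I rule: infinite_finite_induct)
     (auto intro!: bounded_convergent_add bounded_convergent_const[of K "\<lambda>_. 0" 0])

lemma bounded_convergent_coeff_times:
  assumes "\<And>S. bounded_convergent K (\<lambda>n z. coeff (X n z) S) (\<lambda>z. coeff (x z) S)"
    and "\<And>S. bounded_convergent K (\<lambda>n z. coeff (Y n z) S) (\<lambda>z. coeff (y z) S)"
  shows "bounded_convergent K (\<lambda>n z. coeff (X n z * Y n z) S) (\<lambda>z. coeff (x z * y z) S)"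
  unfolding coeff_times wedge_def
  by (intro bounded_convergent_sum bounded_convergent_mult bounded_convergent_cmult assms)

lemma bounded_convergent_coeff_power:
  assumes "\<And>S. bounded_convergent K (\<lambda>n z. coeff (X n z) S) (\<lambda>z. coeff (x z) S)"
  shows "bounded_convergent K (\<lambda>n z. coeff (X n z ^ k) S) (\<lambda>z. coeff (x z ^ k) S)"
proof (induction k arbitrary: S)
  case 0
  show ?case using bounded_convergent_const[of K "\<lambda>_. coeff 1 S" "norm (coeff 1 S)"] by simp
next
  case (Suc k)
  then show ?case unfolding power_Suc by (intro bounded_convergent_coeff_times assms)
qed

lemma bounded_convergent_integral:
  fixes K :: "'a::euclidean_space set"
  assumes K: "compact K" and X: "bounded_convergent K X x" "\<And>n. X n \<in> borel_measurable lborel" "x \<in> borel_measurable lborel"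
    and zero: "\<And>n z. z \<notin> K \<Longrightarrow> X n z = 0" "\<And>z. z \<notin> K \<Longrightarrow> x z = 0"
  shows "(\<lambda>n. LINT z|lborel. X n z) \<longlonglongrightarrow> (LINT z|lborel. x z)"
proof -
  obtain C where C: "\<And>n z. z \<in> K \<Longrightarrow> norm (X n z) \<le> C"
    using X(1) unfolding bounded_convergent_def by blast
  show ?thesis
  proof (rule integral_dominated_convergence[where w = "\<lambda>z. C * indicator K z"])
    have "emeasure lborel K < \<infinity>" by (rule emeasure_compact_finite[OF K])
    then show "integrable lborel (\<lambda>z. C * indicator K z)"
      using K by (intro integrable_mult_right integrable_real_indicator) (auto simp: compact_imp_closed)
    show "AE z in lborel. (\<lambda>n. X n z) \<longlonglongrightarrow> x z"
    proof (rule AE_I2)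
      fix z
      show "(\<lambda>n. X n z) \<longlonglongrightarrow> x z"
        using X(1) zero by (cases "z \<in> K") (auto simp: bounded_convergent_def)
    qed
    show "AE z in lborel. norm (X n z) \<le> C * indicator K z" for n
    proof (rule AE_I2)
      fix z
      show "norm (X n z) \<le> C * indicator K z"
        using C zero by (cases "z \<in> K") auto
    qed
  qed (use X in auto)
qed

lemma bounded_convergent_parts_defect:
  fixes H :: "'m::{finite,linorder} \<Rightarrow> real ^ 'm::{finite,linorder} \<Rightarrow> real ^ 'm::{finite,linorder}"
  assumes K: "compact K" "K \<subseteq> torus" and \<phi>: "\<And>k S. Ck_on k torus (\<lambda>z. \<phi> z S)"
    and f: "continuous_on UNIV f" "\<And>n x. \<bar>fn n x\<bar> \<le> \<bar>f x\<bar> + B" "\<And>x. (\<lambda>n. fn n x) \<longlonglongrightarrow> f x"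
    and H: "\<And>n i x. norm (Hn n i x) \<le> B" "\<And>i x. (\<lambda>n. Hn n i x) \<longlonglongrightarrow> H i x"
  shows "bounded_convergent K (\<lambda>n. parts_defect (Hn n) (fn n) k \<phi>) (parts_defect H f k \<phi>)"
proof -
  have U: "bounded_convergent K (\<lambda>n z. complex_of_real (fn n (rho z))) (\<lambda>z. complex_of_real (f (rho z)))"
  proof -
    have "continuous_on K (\<lambda>z. f (rho z))"
      by (rule continuous_on_compose2[OF f(1) continuous_on_subset[OF continuous_rho K(2)]]) auto
    then have "compact ((\<lambda>z. f (rho z)) ` K)" by (rule compact_continuous_image[OF _ K(1)])
    then obtain C where C: "\<And>z. z \<in> K \<Longrightarrow> \<bar>f (rho z)\<bar> \<le> C"
      using compact_imp_bounded[of "(\<lambda>z. f (rho z)) ` K"] unfolding bounded_iff by auto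
    have "norm (complex_of_real (fn n (rho z))) \<le> C + B" if "z \<in> K" for n z
      using f(2)[of n "rho z"] C[OF that] by simp
    then show ?thesis unfolding bounded_convergent_def using f(3) by (auto intro!: tendsto_of_real)
  qed
  have L: "bounded_convergent K (\<lambda>n. log_hessian (Hn n) a b) (log_hessian H a b)" for a b
  proof -
    have "bounded_convergent K (\<lambda>n z. complex_of_real (Hn n b (rho z) $ a)) (\<lambda>z. complex_of_real (H b (rho z) $ a))"
    proof -
      have "norm (complex_of_real (Hn n b (rho z) $ a)) \<le> B" for n z
        using component_le_norm_cart[of "Hn n b (rho z)" a] H(1)[of n b "rho z"] by simp
      then show ?thesis unfolding bounded_convergent_def using H(2) by (auto intro!: tendsto_of_real tendsto_vec_nth)
    qed
    then show ?thesis
      unfolding log_hessian_def[abs_def]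
      by (intro bounded_convergent_mult bounded_convergent_continuous[OF K] Ck_on_continuous[OF Ck_on_inverse_component(1)[of 0]]
          Ck_on_continuous[OF Ck_on_inverse_component(2)[of 0]])
  qed
  have C: "bounded_convergent K (\<lambda>n z. coeff (curvature (Hn n) z) S) (\<lambda>z. coeff (curvature H z) S)" for S
    unfolding curvature_def coeff_sum coeff_const_times mult.assoc
    by (intro bounded_convergent_sum bounded_convergent_cmult bounded_convergent_mult L bounded_convergent_const[OF order_refl])
  have D: "bounded_convergent K (\<lambda>n. wirt a (wirt_bar b (\<lambda>z. \<phi> z S))) (wirt a (wirt_bar b (\<lambda>z. \<phi> z S)))" for a b S
    by (rule bounded_convergent_continuous[OF K], rule Ck_on_continuous[of 0], intro Ck_on_wirt[OF open_torus] \<phi>)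
  have P: "bounded_convergent K (\<lambda>n z. coeff (curvature (Hn n) z ^ k * pair a b) A) (\<lambda>z. coeff (curvature H z ^ k * pair a b) A)" for a b A
    by (intro bounded_convergent_coeff_times bounded_convergent_coeff_power C bounded_convergent_const[OF order_refl])
  have E: "bounded_convergent K (\<lambda>n z. complex_of_real (fn n (rho z)) * wirt a (wirt_bar b (\<lambda>z. \<phi> z S)) z - \<phi> z S * log_hessian (Hn n) a b z)
    (\<lambda>z. complex_of_real (f (rho z)) * wirt a (wirt_bar b (\<lambda>z. \<phi> z S)) z - \<phi> z S * log_hessian H a b z)" for a b S
  proof -
    have "bounded_convergent K (\<lambda>n z. complex_of_real (fn n (rho z)) * wirt a (wirt_bar b (\<lambda>z. \<phi> z S)) z + (- 1) * (\<phi> z S * log_hessian (Hn n) a b z))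
      (\<lambda>z. complex_of_real (f (rho z)) * wirt a (wirt_bar b (\<lambda>z. \<phi> z S)) z + (- 1) * (\<phi> z S * log_hessian H a b z))"
      by (intro bounded_convergent_add bounded_convergent_cmult bounded_convergent_mult U D L
          bounded_convergent_continuous[OF K] Ck_on_continuous[OF \<phi>[of 0]])
    then show ?thesis by simp
  qed
  show ?thesis
    unfolding parts_defect_def[abs_def]
    by (intro bounded_convergent_cmult bounded_convergent_sum bounded_convergent_mult P E)
qed

lemma parts_defect_outside:
  assumes "compact K" "\<And>z S. z \<notin> K \<Longrightarrow> \<phi> z S = 0" "z \<notin> K"
  shows "parts_defect H f k \<phi> z = 0"
proof -
  have "wirt_bar b (\<lambda>z. \<phi> z S) w = 0" if "w \<notin> K" for b w S
    by (rule wirt_zero_outside(2)[OF assms(1) _ that]) (rule assms(2))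
  then have "wirt a (wirt_bar b (\<lambda>z. \<phi> z S)) z = 0" for a b S
    using wirt_zero_outside(1)[OF assms(1) _ assms(3)] by blast
  then show ?thesis using assms(2)[OF assms(3)] by (simp add: parts_defect_def)
qed

lemma parts_defect_continuous:
  fixes H :: "'m::{finite,linorder} \<Rightarrow> real ^ 'm::{finite,linorder} \<Rightarrow> real ^ 'm::{finite,linorder}"
  assumes \<phi>: "\<And>k S. Ck_on k torus (\<lambda>z. \<phi> z S)" and f: "continuous_on UNIV f" and H: "\<And>i. continuous_on UNIV (H i)"
  shows "continuous_on torus (parts_defect H f k \<phi>)"
proof -
  have D: "continuous_on torus (wirt a (wirt_bar b (\<lambda>z. \<phi> z S)))" for a b S
    by (rule Ck_on_continuous[of 0], intro Ck_on_wirt[OF open_torus] \<phi>)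
  have U: "continuous_on torus (\<lambda>z. complex_of_real (f (rho z)))"
    by (intro continuous_on_of_real continuous_on_compose2[OF f continuous_rho]) auto
  have C: "continuous_on torus (\<lambda>z. coeff (curvature H z ^ k * pair a b) A)" for a b A
    by (rule Ck_on_continuous[of 0], intro Ck_on_coeff_times Ck_on_coeff_power Ck_on_curvature continuous_log_hessian[OF H] Ck_on_const)
  show ?thesis
    unfolding parts_defect_def[abs_def]
    by (intro continuous_intros D U C Ck_on_continuous[OF \<phi>[of 0]] Ck_on_continuous[OF continuous_log_hessian[OF H]])
qed

text \<open>The defect is built from \<open>f\<close> and its second derivatives, both of which converge boundedly along the approximation by
  functions of class \<open>C\<^sup>3\<close>, for which the integral vanishes.\<close>

lemma parts_defect_integral:
  fixes f :: "real ^ 'm::{finite,linorder} \<Rightarrow> real"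
  assumes f: "\<And>x. (f has_derivative (\<lambda>h. h \<bullet> (\<chi> i. g i x))) (at x)"
    and g: "\<And>i x. (g i has_derivative (\<lambda>h. h \<bullet> H i x)) (at x)"
    and H: "\<And>i. continuous_on UNIV (H i)"
    and gB: "\<And>x. norm (\<chi> i. g i x) \<le> B" and HB: "\<And>i x. norm (H i x) \<le> B"
    and K: "compact K" "K \<subseteq> torus" and \<phi>0: "\<And>z S. z \<notin> K \<Longrightarrow> \<phi> z S = 0" and \<phi>: "\<And>k S. Ck_on k torus (\<lambda>z. \<phi> z S)"
  shows "(LINT z|lborel. parts_defect H f k \<phi> z) = 0"
proof -
  obtain fn :: "nat \<Rightarrow> real ^ 'm::{finite,linorder} \<Rightarrow> real" and gn Hn Tn where A:
    "\<And>n x. (fn n has_derivative (\<lambda>h. h \<bullet> (\<chi> i. gn n i x))) (at x)"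
    "\<And>n i x. (gn n i has_derivative (\<lambda>h. h \<bullet> Hn n i x)) (at x)"
    "\<And>n i j x. ((\<lambda>x. Hn n i x $ j) has_derivative (\<lambda>h. h \<bullet> Tn n i j x)) (at x)"
    "\<And>n i j. continuous_on UNIV (Tn n i j)"
    "\<And>n x. \<bar>fn n x\<bar> \<le> \<bar>f x\<bar> + B" "\<And>n i x. norm (Hn n i x) \<le> B"
    "\<And>x. (\<lambda>n. fn n x) \<longlonglongrightarrow> f x" "\<And>i x. (\<lambda>n. Hn n i x) \<longlonglongrightarrow> H i x"
    by (rule C3_approximation[OF f g H gB HB]) blast
  have cont: "continuous_on UNIV f"
    using f by (meson continuous_at_imp_continuous_on has_derivative_continuous)
  have contn: "continuous_on UNIV (fn n)" for n
    using A(1) by (meson continuous_at_imp_continuous_on has_derivative_continuous)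
  have contHn: "continuous_on UNIV (Hn n i)" for n i
  proof -
    have "continuous_on UNIV (\<lambda>x. \<chi> j. Hn n i x $ j)"
      using A(3) by (intro continuous_on_vec_lambda continuous_at_imp_continuous_on ballI) (meson has_derivative_continuous)
    then show ?thesis by simp
  qed
  have bc: "bounded_convergent K (\<lambda>n. parts_defect (Hn n) (fn n) k \<phi>) (parts_defect H f k \<phi>)"
    by (rule bounded_convergent_parts_defect[OF K \<phi> cont A(5,7,6,8)])
  have meas: "parts_defect H' f' k \<phi> \<in> borel_measurable lborel" if "continuous_on UNIV f'" "\<And>i. continuous_on UNIV (H' i)" for H' f'
    using borel_measurable_continuous_onI[OF continuous_on_zero_extension[OF K open_torus parts_defect_continuous[OF \<phi> that] parts_defect_outside[OF K(1) \<phi>0]]]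
    by simp
  have "(\<lambda>n. LINT z|lborel. parts_defect (Hn n) (fn n) k \<phi> z) \<longlonglongrightarrow> (LINT z|lborel. parts_defect H f k \<phi> z)"
    by (rule bounded_convergent_integral[OF K(1) bc meas[OF contn contHn] meas[OF cont H]])
       (simp_all add: parts_defect_outside[OF K(1) \<phi>0])
  moreover have "(LINT z|lborel. parts_defect (Hn n) (fn n) k \<phi> z) = 0" for n
    by (rule parts_defect_integral_C3[OF A(1) A(2) A(3) A(4) K \<phi>0 \<phi>])
  ultimately show ?thesis by (simp add: LIMSEQ_const_iff)
qed

section \<open>Powers of the current\<close>

lemma torus_integral_compact:
  fixes h :: "complex ^ 'm \<Rightarrow> complex"
  assumes "K \<subseteq> torus" "\<And>z. z \<notin> K \<Longrightarrow> h z = 0"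
  shows "(LINT z:torus|lborel. h z) = (LINT z|lborel. h z)"
  unfolding set_lebesgue_integral_def
proof (intro Bochner_Integration.integral_cong refl)
  fix z
  show "indicat_real torus z *\<^sub>R h z = h z" using assms by (cases "z \<in> K") auto
qed

lemma wedge_zero_right: "(\<And>S. \<phi> S = 0) \<Longrightarrow> wedge \<alpha> \<phi> S = 0"
  by (simp add: wedge_def)

lemma form_current_eq:
  assumes "K \<subseteq> torus" "\<And>z S. z \<notin> K \<Longrightarrow> \<phi> z S = 0"
  shows "form_current \<alpha> \<phi> = (-2 * \<i>) ^ CARD('m) * (LINT z|lborel. wedge (\<alpha> z) (\<phi> (z :: complex ^ 'm::{finite,linorder})) UNIV)"
  unfolding form_current_def integral_form_def
  by (subst torus_integral_compact[OF assms(1)]) (simp_all add: wedge_zero_right assms(2))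

lemma form_current_cong:
  assumes "\<And>z. z \<in> torus \<Longrightarrow> \<alpha> z = \<beta> z"
  shows "form_current \<alpha> \<phi> = form_current \<beta> \<phi>"
proof -
  have "(LINT z:torus|lborel. wedge (\<alpha> z) (\<phi> z) UNIV) = (LINT z:torus|lborel. wedge (\<beta> z) (\<phi> z) UNIV)"
    unfolding set_lebesgue_integral_def
    by (intro Bochner_Integration.integral_cong refl) (auto simp: assms indicator_def)
  then show ?thesis by (simp add: form_current_def integral_form_def)
qed

lemma continuous_wedge:
  assumes "\<And>S. continuous_on U (\<lambda>z. \<alpha> z S)" "\<And>S. continuous_on U (\<lambda>z. \<phi> z S)"
  shows "continuous_on U (\<lambda>z. wedge (\<alpha> z) (\<phi> z) S)"
  unfolding wedge_def by (intro continuous_intros assms)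

lemma integrable_wedge:
  assumes K: "compact K" "K \<subseteq> torus" "\<And>z S. z \<notin> K \<Longrightarrow> \<phi> z S = 0"
    and c: "\<And>S. continuous_on torus (\<lambda>z. \<alpha> z S)" "\<And>S. continuous_on torus (\<lambda>z. \<phi> z S)"
  shows "integrable lborel (\<lambda>z. wedge (\<alpha> z) (\<phi> z) UNIV)"
  by (rule integrable_compact_support[OF K(1)])
     (auto simp: wedge_zero_right K(3) intro!: continuous_on_subset[OF continuous_wedge K(2)] c)

lemma continuous_curvature_power:
  assumes "\<And>i. continuous_on UNIV (H i)"
  shows "continuous_on torus (\<lambda>z. coeff (curvature H z ^ k) S)"
  by (rule Ck_on_continuous[of 0], intro Ck_on_coeff_power Ck_on_curvature continuous_log_hessian assms)

text \<open>This is the step from the \<open>k\<close>-th to the next power of the current: \<open>dd\<^sup>c\<close> passes from the test form to \<open>u\<close>.\<close>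

lemma form_current_curvature_step:
  fixes f :: "real ^ 'm::{finite,linorder} \<Rightarrow> real"
  assumes f: "\<And>x. (f has_derivative (\<lambda>h. h \<bullet> (\<chi> i. g i x))) (at x)"
    and g: "\<And>i x. (g i has_derivative (\<lambda>h. h \<bullet> H i x)) (at x)"
    and H: "\<And>i. continuous_on UNIV (H i)"
    and gB: "\<And>x. norm (\<chi> i. g i x) \<le> B" and HB: "\<And>i x. norm (H i x) \<le> B"
    and K: "compact K" "K \<subseteq> torus" and \<phi>0: "\<And>z S. z \<notin> K \<Longrightarrow> \<phi> z S = 0" and \<phi>: "\<And>k S. Ck_on k torus (\<lambda>z. \<phi> z S)"
  shows "form_current (\<lambda>z. coeff (curvature H z ^ k)) (\<lambda>z S. complex_of_real (f (rho z)) * ddc \<phi> z S)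
    = form_current (\<lambda>z. coeff (curvature H z ^ Suc k)) \<phi>"
proof -
  have fc: "continuous_on UNIV f" using f by (meson continuous_at_imp_continuous_on has_derivative_continuous)
  have U: "continuous_on torus (\<lambda>z. complex_of_real (f (rho z)))"
    by (intro continuous_on_of_real continuous_on_compose2[OF fc continuous_rho]) auto
  let ?\<psi> = "\<lambda>z S. complex_of_real (f (rho z)) * ddc \<phi> z S"
  have \<psi>0: "?\<psi> z S = 0" if "z \<notin> K" for z S using ddc_outside[OF K(1) \<phi>0 that] by simp
  have c\<psi>: "continuous_on torus (\<lambda>z. ?\<psi> z S)" for S
    by (intro continuous_intros U Ck_on_continuous[OF ddc_smooth[OF \<phi>, of 0]])
  have c\<phi>: "continuous_on torus (\<lambda>z. \<phi> z S)" for S by (rule Ck_on_continuous[OF \<phi>[of 0]])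
  note C = continuous_curvature_power[OF H]
  have "(LINT z|lborel. wedge (coeff (curvature H z ^ k)) (?\<psi> z) UNIV) - (LINT z|lborel. wedge (coeff (curvature H z ^ Suc k)) (\<phi> z) UNIV)
    = (LINT z|lborel. wedge (coeff (curvature H z ^ k)) (?\<psi> z) UNIV - wedge (coeff (curvature H z ^ Suc k)) (\<phi> z) UNIV)"
    by (rule Bochner_Integration.integral_diff[symmetric, OF integrable_wedge[OF K \<psi>0 C c\<psi>] integrable_wedge[OF K \<phi>0 C c\<phi>]])
  also have "\<dots> = (LINT z|lborel. parts_defect H f k \<phi> z)"
  proof (intro Bochner_Integration.integral_cong refl)
    fix z
    show "wedge (coeff (curvature H z ^ k)) (?\<psi> z) UNIV - wedge (coeff (curvature H z ^ Suc k)) (\<phi> z) UNIV = parts_defect H f k \<phi> z"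
    proof (cases "z \<in> K")
      case True
      then show ?thesis using K(2) by (intro parts_defect[OF \<phi>]) auto
    next
      case False
      then show ?thesis
        using wedge_zero_right[OF \<psi>0[OF False]] wedge_zero_right[of "\<phi> z", OF \<phi>0[OF False]] parts_defect_outside[OF K(1) \<phi>0 False] by simp
    qed
  qed
  also have "\<dots> = 0" by (rule parts_defect_integral[OF f g H gB HB K \<phi>0 \<phi>])
  finally have *: "(LINT z|lborel. wedge (coeff (curvature H z ^ k)) (?\<psi> z) UNIV) = (LINT z|lborel. wedge (coeff (curvature H z ^ Suc k)) (\<phi> z) UNIV)"
    by simp
  have "form_current (\<lambda>z. coeff (curvature H z ^ k)) ?\<psi> = (-2 * \<i>) ^ CARD('m) * (LINT z|lborel. wedge (coeff (curvature H z ^ k)) (?\<psi> z) UNIV)"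
    by (rule form_current_eq[OF K(2) \<psi>0])
  moreover have "form_current (\<lambda>z. coeff (curvature H z ^ Suc k)) \<phi> = (-2 * \<i>) ^ CARD('m) * (LINT z|lborel. wedge (coeff (curvature H z ^ Suc k)) (\<phi> z) UNIV)"
    by (rule form_current_eq[OF K(2) \<phi>0])
  ultimately show ?thesis unfolding * by simp
qed

lemma form_current_uniform_limit:
  assumes \<alpha>: "\<And>S. continuous_on torus (\<lambda>z. \<alpha> z S)" and K: "compact K" "K \<subseteq> torus"
    and \<phi>0: "\<And>i z S. z \<notin> K \<Longrightarrow> \<phi> i z S = 0" and \<phi>: "\<And>i S. continuous_on torus (\<lambda>z. \<phi> i z S)"
    and lim: "\<And>S. uniform_limit UNIV (\<lambda>i z. \<phi> i z S) (\<lambda>z. \<psi> z S) sequentially"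
  shows "(\<lambda>i. form_current \<alpha> (\<phi> i)) \<longlonglongrightarrow> form_current \<alpha> \<psi>"
proof -
  have pt: "(\<lambda>i. \<phi> i z S) \<longlonglongrightarrow> \<psi> z S" for z S by (rule tendsto_uniform_limitI[OF lim]) simp
  have \<psi>0: "\<psi> z S = 0" if "z \<notin> K" for z S using pt[of z S] \<phi>0[OF that] by (simp add: LIMSEQ_const_iff)
  have \<psi>: "continuous_on torus (\<lambda>z. \<psi> z S)" for S
    by (rule uniform_limit_theorem[OF _ uniform_limit_on_subset[OF lim]]) (auto simp: \<phi>)
  \<comment> \<open>a tail of the sequence stays within distance 1 of its limit, which supplies the dominating bound\<close>
  have "\<forall>\<^sub>F i in sequentially. \<forall>S\<in>UNIV. \<forall>z\<in>UNIV. dist (\<phi> i z S) (\<psi> z S) < 1"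
    using uniform_limitD[OF lim, of 1] by (intro eventually_ball_finite) auto
  then obtain N where N: "\<And>i z S. i \<ge> N \<Longrightarrow> dist (\<phi> i z S) (\<psi> z S) < 1"
    unfolding eventually_sequentially by auto
  have bc: "bounded_convergent K (\<lambda>i z. \<phi> (i + N) z S) (\<lambda>z. \<psi> z S)" for S
  proof -
    obtain B where B: "\<And>z. z \<in> K \<Longrightarrow> norm (\<psi> z S) \<le> B"
      using bounded_convergent_continuous[OF K \<psi>[of S]] unfolding bounded_convergent_def by blast
    have "norm (\<phi> (i + N) z S) \<le> B + 1" if "z \<in> K" for i z
      using N[of "i + N" z S] B[OF that] norm_triangle_sub[of "\<phi> (i + N) z S" "\<psi> z S"] by (simp add: dist_norm)
    then show ?thesis unfolding bounded_convergent_def using LIMSEQ_ignore_initial_segment[OF pt] by blast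
  qed
  have meas: "(\<lambda>z. wedge (\<alpha> z) (\<beta> z) UNIV) \<in> borel_measurable lborel"
    if "\<And>z S. z \<notin> K \<Longrightarrow> \<beta> z S = 0" "\<And>S. continuous_on torus (\<lambda>z. \<beta> z S)" for \<beta>
    using borel_measurable_integrable[OF integrable_wedge[where \<alpha> = \<alpha> and \<phi> = \<beta>, OF K that(1) \<alpha> that(2)]] .
  have "(\<lambda>i. LINT z|lborel. wedge (\<alpha> z) (\<phi> (i + N) z) UNIV) \<longlonglongrightarrow> (LINT z|lborel. wedge (\<alpha> z) (\<psi> z) UNIV)"
  proof (rule bounded_convergent_integral[OF K(1) _ meas[OF \<phi>0 \<phi>] meas[OF \<psi>0 \<psi>]])
    show "bounded_convergent K (\<lambda>i z. wedge (\<alpha> z) (\<phi> (i + N) z) UNIV) (\<lambda>z. wedge (\<alpha> z) (\<psi> z) UNIV)"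
      unfolding wedge_def
      by (intro bounded_convergent_sum bounded_convergent_mult bounded_convergent_cmult bc bounded_convergent_continuous[OF K \<alpha>])
  qed (simp_all add: wedge_zero_right \<phi>0 \<psi>0)
  then have "(\<lambda>i. form_current \<alpha> (\<phi> (i + N))) \<longlonglongrightarrow> form_current \<alpha> \<psi>"
    using form_current_eq[where \<phi> = \<psi>, OF K(2) \<psi>0] form_current_eq[where \<phi> = "\<phi> (i + N)" for i, OF K(2) \<phi>0]
    by (simp add: tendsto_mult_left)
  then show ?thesis by (rule LIMSEQ_offset)
qed

text \<open>All approximating sequences give the same limit by dominated convergence. For the definite description to be meaningful
  there must be one; it consists of the products of \<open>\<eta>\<close> with polynomials that converge to \<open>v\<close> uniformly on \<open>K\<close>.\<close>

lemma order0_extension_form_current: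
  fixes v :: "complex ^ 'm::{finite,linorder} \<Rightarrow> real"
  assumes T: "\<And>\<phi>. test_form \<phi> \<Longrightarrow> T \<phi> = form_current \<alpha> \<phi>" and \<alpha>: "\<And>S. continuous_on torus (\<lambda>z. \<alpha> z S)"
    and K: "compact K" "K \<subseteq> torus" and \<eta>0: "\<And>z S. z \<notin> K \<Longrightarrow> \<eta> z S = 0" and \<eta>: "\<And>k S. Ck_on k torus (\<lambda>z. \<eta> z S)"
    and v: "continuous_on torus v"
  shows "order0_extension T (\<lambda>z S. complex_of_real (v z) * \<eta> z S) = form_current \<alpha> (\<lambda>z S. complex_of_real (v z) * \<eta> z S)"
    (is "_ = form_current \<alpha> ?\<psi>")
  unfolding order0_extension_def
proof (rule the_equality)
  show "\<forall>\<phi> K. (\<forall>i. test_form (\<phi> i) \<and> supported_in K (\<phi> i)) \<and> compact K \<and> K \<subseteq> torus \<and>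
     (\<forall>S. uniform_limit UNIV (\<lambda>i z. \<phi> i z S) (\<lambda>z. ?\<psi> z S) sequentially)
     \<longrightarrow> (\<lambda>i. T (\<phi> i)) \<longlonglongrightarrow> form_current \<alpha> ?\<psi>"
  proof (intro allI impI)
    fix \<phi> :: "nat \<Rightarrow> 'm dform" and L
    assume A: "(\<forall>i. test_form (\<phi> i) \<and> supported_in L (\<phi> i)) \<and> compact L \<and> L \<subseteq> torus \<and>
     (\<forall>S. uniform_limit UNIV (\<lambda>i z. \<phi> i z S) (\<lambda>z. ?\<psi> z S) sequentially)"
    have c: "continuous_on torus (\<lambda>z. \<phi> i z S)" for i S
      using A unfolding test_form_def smooth_on_def by (meson Ck_on.simps(1))
    have "(\<lambda>i. form_current \<alpha> (\<phi> i)) \<longlonglongrightarrow> form_current \<alpha> ?\<psi>"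
      using A by (intro form_current_uniform_limit[of \<alpha> L, OF \<alpha> _ _ _ c]) (auto simp: supported_in_def)
    then show "(\<lambda>i. T (\<phi> i)) \<longlonglongrightarrow> form_current \<alpha> ?\<psi>" using A T by simp
  qed
next
  fix c
  assume c: "\<forall>\<phi> K. (\<forall>i. test_form (\<phi> i) \<and> supported_in K (\<phi> i)) \<and> compact K \<and> K \<subseteq> torus \<and>
     (\<forall>S. uniform_limit UNIV (\<lambda>i z. \<phi> i z S) (\<lambda>z. ?\<psi> z S) sequentially)
     \<longrightarrow> (\<lambda>i. T (\<phi> i)) \<longlonglongrightarrow> c"
  have "\<exists>p. real_polynomial_function p \<and> (\<forall>z\<in>K. \<bar>v z - p z\<bar> < inverse (real (Suc i)))" for i
    by (rule Stone_Weierstrass_real_polynomial_function[OF K(1) continuous_on_subset[OF v K(2)]]) auto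
  then obtain p where p: "\<And>i. real_polynomial_function (p i)" "\<And>i z. z \<in> K \<Longrightarrow> \<bar>v z - p i z\<bar> < inverse (real (Suc i))"
    by metis
  let ?\<phi> = "\<lambda>i z S. complex_of_real (p i z) * \<eta> z S"
  have sup: "supported_in K (?\<phi> i)" for i by (simp add: supported_in_def \<eta>0)
  have test: "test_form (?\<phi> i)" for i
    unfolding test_form_def smooth_on_def
    using K sup[of i]
    by (auto intro!: Ck_on_mult[OF open_torus] Ck_on_of_real[OF open_torus] Ck_on_real_polynomial[OF open_torus p(1)] \<eta>)
  have lim: "uniform_limit UNIV (\<lambda>i z. ?\<phi> i z S) (\<lambda>z. ?\<psi> z S) sequentially" for S
  proof (rule uniform_limitI)
    fix e :: real assume e: "e > 0"
    obtain C where C: "\<And>z. z \<in> K \<Longrightarrow> norm (\<eta> z S) \<le> C"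
      using bounded_convergent_continuous[OF K Ck_on_continuous[OF \<eta>[of 0 S]]] unfolding bounded_convergent_def by blast
    have "(\<lambda>i. inverse (real (Suc i)) * C) \<longlonglongrightarrow> 0 * C"
      by (intro tendsto_mult LIMSEQ_inverse_real_of_nat tendsto_const)
    then have "\<forall>\<^sub>F i in sequentially. inverse (real (Suc i)) * C < e"
      using order_tendstoD(2)[of _ "0 * C"] e by auto
    then show "\<forall>\<^sub>F i in sequentially. \<forall>z\<in>UNIV. dist (?\<phi> i z S) (?\<psi> z S) < e"
    proof eventually_elim
      case (elim i)
      show ?case
      proof
        fix z
        show "dist (?\<phi> i z S) (?\<psi> z S) < e"
        proof (cases "z \<in> K")
          case True
          have "dist (?\<phi> i z S) (?\<psi> z S) = \<bar>v z - p i z\<bar> * norm (\<eta> z S)"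
            by (simp add: dist_norm left_diff_distrib[symmetric] norm_mult abs_minus_commute flip: of_real_diff)
          also have "\<dots> \<le> inverse (real (Suc i)) * C"
            using p(2)[OF True, of i] C[OF True] by (intro mult_mono) auto
          finally show ?thesis using elim by simp
        qed (use e \<eta>0 in auto)
      qed
    qed
  qed
  have "(\<lambda>i. T (?\<phi> i)) \<longlonglongrightarrow> c" using c[rule_format, of ?\<phi> K] sup test lim K by blast
  moreover have "(\<lambda>i. T (?\<phi> i)) \<longlonglongrightarrow> form_current \<alpha> ?\<psi>"
  proof -
    have "continuous_on torus (\<lambda>z. ?\<phi> i z S)" for i S
      using test[of i] unfolding test_form_def smooth_on_def by (meson Ck_on.simps(1))
    from form_current_uniform_limit[OF \<alpha> K _ this lim] have "(\<lambda>i. form_current \<alpha> (?\<phi> i)) \<longlonglongrightarrow> form_current \<alpha> ?\<psi>"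
      by (simp add: \<eta>0)
    then show ?thesis using T[OF test] by simp
  qed
  ultimately show "c = form_current \<alpha> ?\<psi>" by (rule LIMSEQ_unique)
qed

lemma ddc_power_curvature:
  fixes f :: "real ^ 'm::{finite,linorder} \<Rightarrow> real"
  assumes f: "\<And>x. (f has_derivative (\<lambda>h. h \<bullet> (\<chi> i. g i x))) (at x)"
    and g: "\<And>i x. (g i has_derivative (\<lambda>h. h \<bullet> H i x)) (at x)"
    and H: "\<And>i. continuous_on UNIV (H i)"
    and gB: "\<And>x. norm (\<chi> i. g i x) \<le> B" and HB: "\<And>i x. norm (H i x) \<le> B"
    and "test_form \<phi>"
  shows "ddc_power (\<lambda>z. f (rho z)) k \<phi> = form_current (\<lambda>z. coeff (curvature H z ^ k)) \<phi>"
  using assms(6)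
proof (induction k arbitrary: \<phi>)
  case 0
  have "wedge (scalar 1) (\<phi> z) = \<phi> z" for z by (simp add: fun_eq_iff wedge_scalar)
  then show ?case by (simp add: form_current_def coeff_one)
next
  case (Suc k)
  obtain K where K: "compact K" "K \<subseteq> torus" and \<phi>0: "\<And>z S. z \<notin> K \<Longrightarrow> \<phi> z S = 0" and \<phi>: "\<And>k S. Ck_on k torus (\<lambda>z. \<phi> z S)"
    by (rule test_formD[OF Suc.prems]) blast
  have fc: "continuous_on UNIV f" using f by (meson continuous_at_imp_continuous_on has_derivative_continuous)
  have v: "continuous_on torus (\<lambda>z. f (rho z))" by (rule continuous_on_compose2[OF fc continuous_rho]) auto
  have "ddc_power (\<lambda>z. f (rho z)) (Suc k) \<phi> = form_current (\<lambda>z. coeff (curvature H z ^ k)) (\<lambda>z S. complex_of_real (f (rho z)) * ddc \<phi> z S)"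
    unfolding ddc_power.simps
    by (rule order0_extension_form_current[OF Suc.IH continuous_curvature_power[OF H] K ddc_outside[OF K(1) \<phi>0] ddc_smooth[OF \<phi>] v])
  also have "\<dots> = form_current (\<lambda>z. coeff (curvature H z ^ Suc k)) \<phi>"
    by (rule form_current_curvature_step[OF f g H gB HB K \<phi>0 \<phi>])
  finally show ?case .
qed

lemma continuous_form_curvature_power:
  assumes "\<And>i. continuous_on UNIV (H i)"
  shows "continuous_form_on torus k k (\<lambda>z. coeff (curvature H z ^ k))"
proof -
  have "bidegree k k (coeff (curvature H z ^ k))" for z
    unfolding curvature_def by (rule bidegree_power[OF bidegree_pair_combination])
  then show ?thesis
    unfolding continuous_form_on_def bidegree_def using continuous_curvature_power[of H, OF assms] by blast
qed

section \<open>The top power\<close>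

lemma det_of_real: "det (\<chi> a b. complex_of_real (M $ a $ b)) = complex_of_real (det M)"
  by (simp add: det_def)

lemma det_scale_rows_columns:
  fixes M :: "'a::comm_ring_1 ^ 'm ^ 'm"
  shows "det (\<chi> a b. x a * M $ a $ b * y b) = (\<Prod>a\<in>UNIV. x a * y a) * det M"
proof -
  have "det (\<chi> a b. x a * M $ a $ b * y b) = det (\<chi> a. x a *s (\<chi> b. M $ a $ b * y b))"
    by (simp add: vector_scalar_mult_def mult.assoc)
  also have "\<dots> = (\<Prod>a\<in>UNIV. x a) * det (\<chi> a b. M $ a $ b * y b)" by (rule det_rows_mul)
  also have "det (\<chi> a b. M $ a $ b * y b) = det (\<chi> b. y b *s (\<chi> a. M $ a $ b))"
    by (subst det_transpose[symmetric]) (simp add: transpose_def vector_scalar_mult_def mult.commute)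
  also have "\<dots> = (\<Prod>b\<in>UNIV. y b) * det (transpose M)" by (simp add: det_rows_mul transpose_def)
  finally show ?thesis by (simp add: prod.distrib mult.assoc)
qed

text \<open>Scaling rows by \<open>1 / z\<^sub>a\<close> and columns by \<open>1 / \<zeta>\<^sub>b\<close>, with \<open>\<zeta>\<close> the conjugate of \<open>z\<close>, takes these factors out of the
  determinant. Each \<open>\<i> / (2 * pi)\<close> meets a factor \<open>-2 * \<i>\<close> of the volume form, leaving \<open>1 / pi\<close>.\<close>

lemma curvature_top:
  fixes M :: "real ^ 'm::{finite,linorder} ^ 'm::{finite,linorder}"
  assumes M: "\<And>a b. H b (rho z) $ a = M $ a $ b"
  shows "(-2 * \<i>) ^ CARD('m) * coeff (curvature H z ^ CARD('m)) UNIV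
    = complex_of_real (fact CARD('m) * det M * (\<Prod>j\<in>UNIV. inverse (pi * (cmod (z $ j))\<^sup>2)))"
proof -
  let ?x = "\<lambda>a. \<i> / (2 * complex_of_real pi) * inverse (z $ a)" and ?y = "\<lambda>b. inverse (cnj (z $ b))"
  let ?c = "(\<chi> a b. ?x a * (\<chi> a b. complex_of_real (M $ a $ b)) $ a $ b * ?y b) :: complex ^ 'm::{finite,linorder} ^ 'm::{finite,linorder}"
  have "curvature H z = (\<Sum>a\<in>UNIV. \<Sum>b\<in>UNIV. const (?c $ a $ b) * pair a b)"
    unfolding curvature_def log_hessian_def M by (simp add: mult_ac)
  then have "coeff (curvature H z ^ CARD('m)) UNIV = fact CARD('m) * det ?c"
    by (simp only: pair_matrix_top_power coeff_const_times coeff_prod_diagonal UNIV_Times_UNIV) simp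
  also have "\<dots> = fact CARD('m) * ((\<Prod>a\<in>UNIV. ?x a * ?y a) * complex_of_real (det M))"
    unfolding det_scale_rows_columns det_of_real ..
  finally have "(-2 * \<i>) ^ CARD('m) * coeff (curvature H z ^ CARD('m)) UNIV
    = fact CARD('m) * complex_of_real (det M) * ((-2 * \<i>) ^ CARD('m) * (\<Prod>a\<in>UNIV. ?x a * ?y a))"
    by (simp add: mult_ac)
  also have "(-2 * \<i>) ^ CARD('m) * (\<Prod>a\<in>UNIV. ?x a * ?y a) = (\<Prod>a\<in>UNIV. -2 * \<i> * (?x a * ?y a))"
    by (simp only: prod.distrib prod_constant power_mult_distrib)
  also have "\<dots> = (\<Prod>a\<in>UNIV. complex_of_real (inverse (pi * (cmod (z $ a))\<^sup>2)))"
  proof (rule prod.cong[OF refl])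
    fix a
    have "complex_of_real ((cmod (z $ a))\<^sup>2) = z $ a * cnj (z $ a)" by (rule complex_norm_square)
    then show "-2 * \<i> * (?x a * ?y a) = complex_of_real (inverse (pi * (cmod (z $ a))\<^sup>2))"
      by (simp add: field_simps flip: of_real_power)
  qed
  finally show ?thesis by (simp add: mult.assoc)
qed

text \<open>The monomials with \<open>m\<close> generators of either kind contain all generators.\<close>

lemma wedge_top:
  fixes \<alpha> :: "'m::{finite,linorder} covector"
  assumes "bidegree CARD('m) CARD('m) \<alpha>"
  shows "wedge \<alpha> \<phi> UNIV = \<alpha> UNIV * \<phi> {}"
proof -
  have zero: "\<alpha> A = 0" if "A \<noteq> UNIV" for A
  proof (rule ccontr)
    assume "\<alpha> A \<noteq> 0"
    then have "card {j. (j, b) \<in> A} = CARD('m)" for b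
      using assms by (cases b) (auto simp: bidegree_def)
    then have "{j. (j, b) \<in> A} = UNIV" for b by (intro card_subset_eq) auto
    then have "A = UNIV" by auto
    with that show False by simp
  qed
  have "wedge \<alpha> \<phi> UNIV = (\<Sum>A\<in>Pow (UNIV :: ('m \<times> bool) set). if A = UNIV then \<alpha> UNIV * \<phi> {} else 0)"
    unfolding wedge_def
  proof (rule sum.cong[OF refl])
    fix A :: "('m \<times> bool) set"
    show "shuffle_sign A (UNIV - A) * \<alpha> A * \<phi> (UNIV - A) = (if A = UNIV then \<alpha> UNIV * \<phi> {} else 0)"
      by (cases "A = UNIV") (simp_all add: zero shuffle_sign_def)
  qed
  then show ?thesis by simp
qed

lemma form_current_curvature_top:
  fixes M :: "real ^ 'm::{finite,linorder} \<Rightarrow> real ^ 'm::{finite,linorder} ^ 'm::{finite,linorder}"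
  assumes M: "\<And>a b \<rho>. H b \<rho> $ a = M \<rho> $ a $ b"
  shows "form_current (\<lambda>z. coeff (curvature H z ^ CARD('m))) \<phi> = (LINT z:torus|lborel.
    complex_of_real (fact CARD('m) * det (M (rho z)) * (\<Prod>j\<in>UNIV. inverse (pi * (cmod (z $ j))\<^sup>2))) * \<phi> z {})"
proof -
  have b: "bidegree CARD('m) CARD('m) (coeff (curvature H z ^ CARD('m)))" for z
    unfolding curvature_def by (rule bidegree_power[OF bidegree_pair_combination])
  have "form_current (\<lambda>z. coeff (curvature H z ^ CARD('m))) \<phi>
    = (LINT z:torus|lborel. (-2 * \<i>) ^ CARD('m) * (coeff (curvature H z ^ CARD('m)) UNIV * \<phi> z {}))"
    unfolding form_current_def integral_form_def wedge_top[OF b] by (rule set_integral_mult_right[symmetric])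
  then show ?thesis unfolding mult.assoc[symmetric] curvature_top[OF M] .
qed

section \<open>Polar coordinates\<close>

lemma prod_Basis_vec:
  fixes f :: "'a::euclidean_space ^ 'm \<Rightarrow> 'b::comm_monoid_mult"
  shows "(\<Prod>b\<in>Basis. f b) = (\<Prod>j\<in>UNIV. \<Prod>b\<in>Basis. f (axis j b))"
proof -
  have B: "(Basis :: ('a ^ 'm) set) = (\<lambda>(j, b). axis j b) ` (UNIV \<times> Basis)"
    by (auto simp: Basis_vec_def)
  have "inj_on (\<lambda>(j, b). axis j b :: 'a ^ 'm) (UNIV \<times> Basis)"
    by (auto simp: inj_on_def axis_eq_axis)
  then have "(\<Prod>b\<in>Basis. f b) = (\<Prod>(j, b)\<in>UNIV \<times> Basis. f (axis j b))"
    unfolding B by (subst prod.reindex) (auto simp: case_prod_beta intro!: prod.cong)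
  then show ?thesis by (simp add: prod.cartesian_product)
qed

lemma emeasure_lborel_box_vec:
  fixes l u :: "'a::euclidean_space ^ 'm"
  shows "emeasure lborel (box l u) = (\<Prod>j\<in>UNIV. emeasure lborel (box (l $ j) (u $ j)))"
proof (cases "\<forall>b\<in>Basis. l \<bullet> b \<le> u \<bullet> b")
  case True
  then have le: "l $ j \<bullet> b \<le> u $ j \<bullet> b" if "b \<in> Basis" for j b
    using that by (force simp: Basis_vec_def inner_axis)
  have "emeasure lborel (box l u) = ennreal (\<Prod>j\<in>UNIV. \<Prod>b\<in>Basis. (u $ j - l $ j) \<bullet> b)"
    using True by (simp add: prod_Basis_vec inner_axis)
  also have "\<dots> = (\<Prod>j\<in>UNIV. ennreal (\<Prod>b\<in>Basis. (u $ j - l $ j) \<bullet> b))"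
    by (rule prod_ennreal[symmetric]) (intro prod_nonneg ballI, simp add: inner_diff_left le)
  also have "\<dots> = (\<Prod>j\<in>UNIV. emeasure lborel (box (l $ j) (u $ j)))"
    using le by simp
  finally show ?thesis .
next
  case False
  then obtain j b where "b \<in> Basis" "\<not> l $ j \<bullet> b \<le> u $ j \<bullet> b"
    by (auto simp: Basis_vec_def inner_axis)
  then have "emeasure lborel (box (l $ j) (u $ j)) = 0" unfolding emeasure_lborel_box_eq by auto
  then have "(\<Prod>j\<in>UNIV. emeasure lborel (box (l $ j) (u $ j))) = 0" by (auto intro!: prod_zero)
  moreover have "emeasure lborel (box l u) = 0" unfolding emeasure_lborel_box_eq if_not_P[OF False] by simp
  ultimately show ?thesis by simp
qed

lemma emeasure_lborel_times:
  fixes A :: "'a::euclidean_space set" and B :: "'b::euclidean_space set"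
  assumes "A \<in> sets borel" "B \<in> sets borel"
  shows "emeasure lborel (A \<times> B) = emeasure lborel A * emeasure lborel B"
  using assms lborel.emeasure_pair_measure_Times[of A lborel B] by (simp add: lborel_prod)

lemma mem_box_vec: "x \<in> box l u \<longleftrightarrow> (\<forall>j. x $ j \<in> box (l $ j) (u $ j))" for x :: "'a::euclidean_space ^ 'm"
  by (auto simp: mem_box Basis_vec_def inner_axis)

lemma lborel_eqI_box:
  fixes M :: "'a::euclidean_space measure"
  assumes "\<And>l u. emeasure M (box l u) = emeasure lborel (box l u)" "sets M = sets borel"
  shows "lborel = M"
  by (rule lborel_eqI) (simp_all add: assms)

text \<open>Regroups the coordinates: \<open>\<rho>\<close> and \<open>\<theta>\<close> form \<open>m\<close> pairs, one for each complex coordinate. Integrals over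
  \<open>\<rho>\<close> and \<open>\<theta>\<close> then factor into integrals over planes.\<close>

definition pair_vectors :: "('m \<Rightarrow> real \<times> real) \<Rightarrow> (real ^ 'm) \<times> (real ^ 'm)" where
  "pair_vectors w = (\<chi> j. fst (w j), \<chi> j. snd (w j))"

lemma measurable_vec_lambda:
  fixes f :: "'m::finite \<Rightarrow> 'x \<Rightarrow> 'a::euclidean_space"
  assumes "\<And>j. f j \<in> borel_measurable M"
  shows "(\<lambda>x. \<chi> j. f j x) \<in> borel_measurable M"
proof -
  have "(\<chi> j. f j x) = (\<Sum>j\<in>UNIV. axis j (f j x))" for x
    by (simp add: vec_eq_iff axis_def)
  moreover have "(\<lambda>x. axis j (f j x) :: 'a ^ 'm) \<in> borel_measurable M" for j
  proof (rule measurable_compose[OF assms borel_measurable_continuous_onI])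
    have "linear (axis j :: 'a \<Rightarrow> 'a ^ 'm)" by (rule linearI) (simp_all add: axis_def vec_eq_iff)
    then show "continuous_on UNIV (axis j :: 'a \<Rightarrow> 'a ^ 'm)" by (intro linear_continuous_on linear_linear[THEN iffD2] | simp add: linear_linear)+
  qed
  ultimately show ?thesis by simp
qed

lemma measurable_pair_vectors: "pair_vectors \<in> measurable (Pi\<^sub>M UNIV (\<lambda>_. lborel)) borel"
proof -
  have "(\<lambda>w. \<chi> j. fst (w j)) \<in> borel_measurable (Pi\<^sub>M UNIV (\<lambda>_. lborel :: (real \<times> real) measure))"
    "(\<lambda>w. \<chi> j. snd (w j)) \<in> borel_measurable (Pi\<^sub>M UNIV (\<lambda>_. lborel :: (real \<times> real) measure))"
    by (intro measurable_vec_lambda measurable_compose[OF measurable_component_singleton[of _ UNIV]];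
        simp add: borel_prod[symmetric])+
  then show ?thesis unfolding pair_vectors_def[abs_def] by (rule borel_measurable_Pair)
qed

lemma lborel_pair_vectors:
  "(lborel :: ((real ^ 'm) \<times> (real ^ 'm)) measure) = distr (Pi\<^sub>M UNIV (\<lambda>_::'m. lborel)) borel pair_vectors"
proof (rule lborel_eqI_box)
  fix l u :: "(real ^ 'm) \<times> (real ^ 'm)"
  interpret product_sigma_finite "\<lambda>_::'m. lborel :: (real \<times> real) measure" ..
  let ?b = "\<lambda>j. box (fst l $ j, snd l $ j) (fst u $ j, snd u $ j)"
  have "pair_vectors -` box l u \<inter> space (Pi\<^sub>M UNIV (\<lambda>_::'m. lborel :: (real \<times> real) measure)) = Pi\<^sub>E UNIV ?b"
    by (auto simp: pair_vectors_def box_prod[of l] box_prod[of "(_, _)"] mem_box_vec space_PiM PiE_iff mem_Times_iff)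
  then have "emeasure (distr (Pi\<^sub>M UNIV (\<lambda>_::'m. lborel)) borel pair_vectors) (box l u) = emeasure (Pi\<^sub>M UNIV (\<lambda>_::'m. lborel)) (Pi\<^sub>E UNIV ?b)"
    by (subst emeasure_distr) (auto intro: measurable_pair_vectors)
  also have "\<dots> = (\<Prod>j\<in>UNIV. emeasure lborel (?b j))" by (rule emeasure_PiM) auto
  also have "\<dots> = (\<Prod>j\<in>UNIV. emeasure lborel (box (fst l $ j) (fst u $ j)) * emeasure lborel (box (snd l $ j) (snd u $ j)))"
    unfolding box_prod[of "(_, _)"] by (simp only: fst_conv snd_conv) (intro prod.cong refl emeasure_lborel_times; simp)
  also have "\<dots> = emeasure lborel (box l u)"
    unfolding box_prod[of l] by (subst emeasure_lborel_times) (simp_all only: borel_open[OF open_box] emeasure_lborel_box_vec prod.distrib)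
  finally show "emeasure (distr (Pi\<^sub>M UNIV (\<lambda>_::'m. lborel)) borel pair_vectors) (box l u) = emeasure lborel (box l u)" .
qed simp

lemma lborel_complex: "(lborel :: complex measure) = distr (lborel :: (real ^ 2) measure) borel (\<lambda>x. Complex (x $ 1) (x $ 2))"
proof (rule lborel_eqI_box)
  fix l u :: complex
  have c: "continuous_on UNIV (\<lambda>x :: real ^ 2. Complex (x $ 1) (x $ 2))" by (intro continuous_intros)
  have "(\<lambda>x :: real ^ 2. Complex (x $ 1) (x $ 2)) -` box l u = box (vector [Re l, Im l]) (vector [Re u, Im u])"
    by (auto simp: mem_box_vec in_box_complex_iff forall_2)
  then have "emeasure (distr (lborel :: (real ^ 2) measure) borel (\<lambda>x. Complex (x $ 1) (x $ 2))) (box l u)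
    = emeasure lborel (box (vector [Re l, Im l] :: real ^ 2) (vector [Re u, Im u]))"
    by (subst emeasure_distr) (auto intro: borel_measurable_continuous_onI[OF c])
  also have "\<dots> = emeasure lborel (box (Re l) (Re u)) * emeasure lborel (box (Im l) (Im u))"
    by (simp add: emeasure_lborel_box_vec UNIV_2)
  also have "\<dots> = emeasure lborel (box l u)"
  proof (cases "Re l \<le> Re u \<and> Im l \<le> Im u")
    case True
    then show ?thesis by (simp add: emeasure_lborel_box_eq Basis_complex_def ennreal_mult)
  qed (auto simp: emeasure_lborel_box_eq Basis_complex_def)
  finally show "emeasure (distr (lborel :: (real ^ 2) measure) borel (\<lambda>x. Complex (x $ 1) (x $ 2))) (box l u) = emeasure lborel (box l u)" .
qed simp

lemma lborel_real_pair: "(lborel :: (real \<times> real) measure) = distr (lborel :: (real ^ 2) measure) borel (\<lambda>x. (x $ 1, x $ 2))"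
proof (rule lborel_eqI_box)
  fix l u :: "real \<times> real"
  have c: "continuous_on UNIV (\<lambda>x :: real ^ 2. (x $ 1, x $ 2))" by (intro continuous_intros)
  have "(\<lambda>x :: real ^ 2. (x $ 1, x $ 2)) -` box l u = box (vector [fst l, snd l]) (vector [fst u, snd u])"
    by (auto simp: mem_box_vec forall_2 box_prod[of l])
  then have "emeasure (distr (lborel :: (real ^ 2) measure) borel (\<lambda>x. (x $ 1, x $ 2))) (box l u)
    = emeasure lborel (box (vector [fst l, snd l] :: real ^ 2) (vector [fst u, snd u]))"
    by (subst emeasure_distr) (auto intro: borel_measurable_continuous_onI[OF c])
  also have "\<dots> = emeasure lborel (box (fst l) (fst u)) * emeasure lborel (box (snd l) (snd u))"
    by (simp add: emeasure_lborel_box_vec UNIV_2)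
  also have "\<dots> = emeasure lborel (box l u)"
    unfolding box_prod[of l] by (rule emeasure_lborel_times[symmetric]) auto
  finally show "emeasure (distr (lborel :: (real ^ 2) measure) borel (\<lambda>x. (x $ 1, x $ 2))) (box l u) = emeasure lborel (box l u)" .
qed simp

definition polar :: "real \<Rightarrow> real \<Rightarrow> complex" where
  "polar r t = exp (complex_of_real (r / 2) + \<i> * complex_of_real t)"

lemma polar_eq: "polar r t = Complex (exp (r / 2) * cos t) (exp (r / 2) * sin t)"
  by (simp add: polar_def complex_eq_iff Re_exp Im_exp)

lemma polar_inj:
  assumes "polar r t = polar r' t'" "0 \<le> t" "t < 2 * pi" "0 \<le> t'" "t' < 2 * pi"
  shows "r = r' \<and> t = t'"
proof -
  have "norm (polar r t) = exp (r / 2)" "norm (polar r' t') = exp (r' / 2)" by (simp_all add: polar_def)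
  then have r: "r = r'" using assms(1) by simp
  have "exp (\<i> * complex_of_real t) = exp (\<i> * complex_of_real t')"
    using assms(1) r by (simp add: polar_def exp_add)
  then obtain n :: int where "\<i> * complex_of_real t = \<i> * complex_of_real t' + (of_int (2 * n) * pi) * \<i>"
    unfolding exp_eq by blast
  then have n: "t = t' + 2 * of_int n * pi" by (simp add: complex_eq_iff)
  have "\<bar>t - t'\<bar> < 2 * pi" using assms by linarith
  moreover have "t - t' = of_int n * (2 * pi)" using n by simp
  ultimately have "\<bar>real_of_int n\<bar> * (2 * pi) < 1 * (2 * pi)" by (simp add: abs_mult)
  then have "\<bar>real_of_int n\<bar> < 1" by (rule mult_right_less_imp_less) simp
  then have "n = 0" by linarith
  with n r show ?thesis by simp
qed

lemma polar_surj:
  assumes "w \<noteq> 0"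
  obtains r t where "w = polar r t" "0 \<le> t" "t < 2 * pi"
proof -
  have "w = polar (2 * ln (norm w)) (Arg2pi w)"
    using assms Arg2pi_eq[of w] by (simp add: polar_def exp_add exp_of_real)
  then show thesis using Arg2pi[of w] by (intro that) auto
qed

text \<open>The Jacobian determinant of polar coordinates is \<open>exp r / 2\<close> if \<open>r\<close> is the logarithm of the squared modulus. The angular
  strip is mapped injectively onto the complement of the origin, a null set.\<close>

lemma polar_area_real:
  fixes Q :: "(real ^ 2) set"
  assumes Q: "Q \<in> sets borel" "bounded Q"
  shows "(\<integral>\<^sup>+ x. ennreal (exp (x $ 1) / 2 * indicator ({0..<2 * pi}) (x $ 2) *
      indicator Q (vector [exp (x $ 1 / 2) * cos (x $ 2), exp (x $ 1 / 2) * sin (x $ 2)] :: real ^ 2)) \<partial>(lborel :: (real ^ 2) measure)) = emeasure lborel Q"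
proof -
  define g :: "real ^ 2 \<Rightarrow> real ^ 2" where "g x = vector [exp (x $ 1 / 2) * cos (x $ 2), exp (x $ 1 / 2) * sin (x $ 2)]" for x
  define g' :: "real ^ 2 \<Rightarrow> real ^ 2 \<Rightarrow> real ^ 2" where
    "g' x h = vector [exp (x $ 1 / 2) * (h $ 1 / 2) * cos (x $ 2) - exp (x $ 1 / 2) * (sin (x $ 2) * h $ 2),
       exp (x $ 1 / 2) * (h $ 1 / 2) * sin (x $ 2) + exp (x $ 1 / 2) * (cos (x $ 2) * h $ 2)]" for x h
  define S :: "(real ^ 2) set" where "S = {x. x $ 2 \<in> {0..<2 * pi}}"
  have g1: "g x $ 1 = exp (x $ 1 / 2) * cos (x $ 2)" "g x $ 2 = exp (x $ 1 / 2) * sin (x $ 2)" for x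
    by (simp_all add: g_def)
  have SB: "S \<in> sets borel"
  proof -
    have "(\<lambda>x :: real ^ 2. x $ 2) -` {0..<2 * pi} \<inter> space borel \<in> sets borel"
      by (rule measurable_sets[OF borel_measurable_continuous_onI]) (auto intro!: continuous_intros)
    then show ?thesis by (simp add: S_def vimage_def)
  qed
  have der: "(g has_derivative g' x) (at x within S)" for x
  proof (rule has_derivative_at_withinI)
    have c: "((\<lambda>x :: real ^ 2. x $ i) has_derivative (\<lambda>h. h $ i)) (at x)" for i
      by (rule bounded_linear_imp_has_derivative) (rule bounded_linear_vec_nth)
    have e: "((\<lambda>x :: real ^ 2. exp (x $ 1 / 2)) has_derivative (\<lambda>h. exp (x $ 1 / 2) * (h $ 1 / 2))) (at x)"
      by (rule has_derivative_eq_rhs[OF has_derivative_exp[OF bounded_linear.has_derivative[OF bounded_linear_divide c]]]) (simp add: fun_eq_iff)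
    have co: "((\<lambda>x :: real ^ 2. cos (x $ 2)) has_derivative (\<lambda>h. - (sin (x $ 2) * h $ 2))) (at x)"
      by (rule has_derivative_eq_rhs[OF has_derivative_cos[OF c]]) (simp add: fun_eq_iff)
    have si: "((\<lambda>x :: real ^ 2. sin (x $ 2)) has_derivative (\<lambda>h. cos (x $ 2) * h $ 2)) (at x)"
      by (rule has_derivative_eq_rhs[OF has_derivative_sin[OF c]]) (simp add: fun_eq_iff)
    have "((\<lambda>x. g x $ 1) has_derivative (\<lambda>h. g' x h $ 1)) (at x)" "((\<lambda>x. g x $ 2) has_derivative (\<lambda>h. g' x h $ 2)) (at x)"
      unfolding g1
      by (rule has_derivative_eq_rhs[OF has_derivative_mult[OF e co]], simp add: fun_eq_iff g'_def)
         (rule has_derivative_eq_rhs[OF has_derivative_mult[OF e si]], simp add: fun_eq_iff g'_def)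
    then have "((\<lambda>x. g x $ i) has_derivative (\<lambda>h. g' x h $ i)) (at x)" for i
      using exhaust_2[of i] by auto
    then have "((\<lambda>x. \<chi> i. g x $ i) has_derivative (\<lambda>h. \<chi> i. g' x h $ i)) (at x)"
      by (rule has_derivative_vec_lambda)
    then show "(g has_derivative g' x) (at x)" by simp
  qed
  have "det (matrix (g' x)) = exp (x $ 1) / 2" for x :: "real ^ 2"
  proof -
    define c s where "c = cos (x $ 2)" and "s = sin (x $ 2)"
    have "c * c + s * s = 1" unfolding c_def s_def by (simp flip: power2_eq_square)
    moreover have "det (matrix (g' x)) = exp (x $ 1 / 2) * exp (x $ 1 / 2) * (c * c + s * s) / 2"
      unfolding det_2 matrix_def g'_def c_def[symmetric] s_def[symmetric] by (simp add: axis_def algebra_simps)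
    ultimately show ?thesis by (simp flip: exp_add)
  qed
  then have det: "\<bar>det (matrix (g' x))\<bar> = exp (x $ 1) / 2" for x by (simp only:) simp
  have gp: "g x = vector [Re (polar (x $ 1) (x $ 2)), Im (polar (x $ 1) (x $ 2))]" for x by (simp add: g_def polar_eq)
  have inj: "inj_on g S"
  proof (rule inj_onI)
    fix x y assume "x \<in> S" "y \<in> S" "g x = g y"
    then have "g x $ 1 = g y $ 1" "g x $ 2 = g y $ 2" by simp_all
    then have "polar (x $ 1) (x $ 2) = polar (y $ 1) (y $ 2)" unfolding g1 polar_eq by simp
    from polar_inj[OF this] \<open>x \<in> S\<close> \<open>y \<in> S\<close> show "x = y" by (auto simp: S_def vec_eq_iff forall_2)
  qed
  have image: "g ` S = - {0}"
  proof
    show "g ` S \<subseteq> - {0}"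
    proof
      fix y assume "y \<in> g ` S"
      then obtain x where y: "y = g x" by auto
      have "polar (x $ 1) (x $ 2) \<noteq> 0" by (simp add: polar_def)
      then show "y \<in> - {0}" unfolding y by (auto simp: vec_eq_iff forall_2 g1 polar_eq complex_eq_iff)
    qed
    show "- {0} \<subseteq> g ` S"
    proof
      fix y :: "real ^ 2" assume "y \<in> - {0}"
      then have "Complex (y $ 1) (y $ 2) \<noteq> 0" by (auto simp: vec_eq_iff forall_2 complex_eq_iff)
      then obtain r t where *: "Complex (y $ 1) (y $ 2) = polar r t" "0 \<le> t" "t < 2 * pi" by (rule polar_surj)
      then have "y = g (vector [r, t])" by (simp add: vec_eq_iff forall_2 g1 polar_eq)
      moreover have "vector [r, t] \<in> S" using * by (simp add: S_def)
      ultimately show "y \<in> g ` S" by blast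
    qed
  qed
  \<comment> \<open>the origin is not in the image of the strip\<close>
  let ?Q = "Q - {0}" and ?v = "vec 1 :: real ^ 1"
  have Qb: "?Q \<in> sets borel" using Q(1) by auto
  have "emeasure lborel ?Q < \<infinity>" by (rule emeasure_bounded_finite) (use Q(2) in \<open>auto intro: bounded_subset\<close>)
  then have int0: "integrable lborel (indicat_real ?Q)" using Qb by (intro integrable_real_indicator) auto
  then have int: "integrable lborel (\<lambda>y. indicat_real ?Q y *\<^sub>R ?v)" by (rule integrable_scaleR_left)
  then have int': "integrable lebesgue (\<lambda>y. indicat_real ?Q y *\<^sub>R ?v)" by (subst integrable_completion) auto
  have eq: "(\<lambda>y. indicat_real (- {0}) y *\<^sub>R (indicat_real ?Q y *\<^sub>R ?v)) = (\<lambda>y. indicat_real ?Q y *\<^sub>R ?v)"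
    by (auto simp: fun_eq_iff indicator_def)
  have I: "(\<lambda>y. indicat_real ?Q y *\<^sub>R ?v) absolutely_integrable_on g ` S"
    unfolding image set_integrable_def eq by (rule int')
  have "integral (g ` S) (\<lambda>y. indicat_real ?Q y *\<^sub>R ?v) = (LINT y:g ` S|lebesgue. indicat_real ?Q y *\<^sub>R ?v)"
    by (rule set_lebesgue_integral_eq_integral(2)[OF I, symmetric])
  also have "\<dots> = (LINT y|lborel. indicat_real ?Q y *\<^sub>R ?v)"
    unfolding image set_lebesgue_integral_def eq using int by (intro integral_completion) auto
  also have "\<dots> = measure lborel ?Q *\<^sub>R ?v"
    using Qb by (subst integral_scaleR_left[OF int0]) simp
  finally have J: "integral (g ` S) (\<lambda>y. indicat_real ?Q y *\<^sub>R ?v) = measure lborel ?Q *\<^sub>R ?v" .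
  have "(\<lambda>x. \<bar>det (matrix (g' x))\<bar> *\<^sub>R (indicat_real ?Q (g x) *\<^sub>R ?v)) absolutely_integrable_on S \<and>
    integral S (\<lambda>x. \<bar>det (matrix (g' x))\<bar> *\<^sub>R (indicat_real ?Q (g x) *\<^sub>R ?v)) = measure lborel ?Q *\<^sub>R ?v"
    using has_absolute_integral_change_of_variables[OF _ der inj, of "\<lambda>y. indicat_real ?Q y *\<^sub>R ?v" "measure lborel ?Q *\<^sub>R ?v"] SB I J
    by auto
  then have K: "(\<lambda>x. (exp (x $ 1) / 2) *\<^sub>R (indicat_real ?Q (g x) *\<^sub>R ?v)) absolutely_integrable_on S"
    "integral S (\<lambda>x. (exp (x $ 1) / 2) *\<^sub>R (indicat_real ?Q (g x) *\<^sub>R ?v)) = measure lborel ?Q *\<^sub>R ?v"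
    unfolding det by auto
  define k where "k x = exp (x $ 1) / 2 * indicator S x * indicator Q (g x)" for x :: "real ^ 2"
  have k: "(indicat_real S x *\<^sub>R ((exp (x $ 1) / 2) *\<^sub>R (indicat_real ?Q (g x) *\<^sub>R ?v))) $ 1 = k x" for x
  proof (cases "x \<in> S")
    case True
    then have "g x \<noteq> 0" using image by auto
    then show ?thesis by (auto simp: k_def indicator_def)
  qed (simp add: k_def)
  have "integrable lebesgue (\<lambda>x. (indicat_real S x *\<^sub>R ((exp (x $ 1) / 2) *\<^sub>R (indicat_real ?Q (g x) *\<^sub>R ?v))) $ 1)"
    by (rule integrable_bounded_linear[OF bounded_linear_vec_nth]) (use K(1) in \<open>simp add: set_integrable_def\<close>)
  then have ki: "integrable lebesgue k" unfolding k .
  have "(LINT x|lebesgue. k x) = (LINT x:S|lebesgue. (exp (x $ 1) / 2) *\<^sub>R (indicat_real ?Q (g x) *\<^sub>R ?v)) $ 1"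
    unfolding set_lebesgue_integral_def k[symmetric]
    by (rule integral_bounded_linear[OF bounded_linear_vec_nth]) (use K(1) in \<open>simp add: set_integrable_def\<close>)
  also have "\<dots> = measure lborel ?Q"
    unfolding set_lebesgue_integral_eq_integral(2)[OF K(1)] K(2) by simp
  finally have kI: "(LINT x|lebesgue. k x) = measure lborel ?Q" .
  have "(\<integral>\<^sup>+ x. ennreal (k x) \<partial>lborel) = (\<integral>\<^sup>+ x. ennreal (k x) \<partial>lebesgue)" by (rule nn_integral_completion[symmetric])
  also have "\<dots> = ennreal (LINT x|lebesgue. k x)" by (rule nn_integral_eq_integral[OF ki]) (simp add: k_def)
  also have "\<dots> = emeasure lborel ?Q"
    unfolding kI using \<open>emeasure lborel ?Q < \<infinity>\<close> by (intro emeasure_eq_ennreal_measure[symmetric]) auto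
  also have "\<dots> = emeasure lborel Q" using Q(1) by (intro emeasure_Diff_null_set) auto
  finally have "(\<integral>\<^sup>+ x. ennreal (k x) \<partial>lborel) = emeasure lborel Q" .
  moreover have "k x = exp (x $ 1) / 2 * indicator {0..<2 * pi} (x $ 2) *
      indicator Q (vector [exp (x $ 1 / 2) * cos (x $ 2), exp (x $ 1 / 2) * sin (x $ 2)] :: real ^ 2)" for x
    by (simp add: k_def S_def g_def indicator_def)
  ultimately show ?thesis by simp
qed

lemma polar_area:
  fixes l u :: complex
  shows "(\<integral>\<^sup>+ p. ennreal (exp (fst p) / 2 * indicator {0..<2 * pi} (snd p) * indicator (box l u) (polar (fst p) (snd p))) \<partial>lborel)
    = emeasure lborel (box l u)"
proof -
  let ?e = "\<lambda>x :: real ^ 2. (x $ 1, x $ 2)" and ?c = "\<lambda>x :: real ^ 2. Complex (x $ 1) (x $ 2)"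
  define Q where "Q = box (vector [Re l, Im l] :: real ^ 2) (vector [Re u, Im u])"
  have Q: "?c x \<in> box l u \<longleftrightarrow> x \<in> Q" for x
    by (auto simp: Q_def mem_box_vec in_box_complex_iff forall_2)
  have ce: "?e \<in> borel_measurable lborel" "?c \<in> borel_measurable lborel"
  proof -
    have "continuous_on UNIV ?e" "continuous_on UNIV ?c" by (intro continuous_intros)+
    then show "?e \<in> borel_measurable lborel" "?c \<in> borel_measurable lborel" by (simp_all add: borel_measurable_continuous_onI)
  qed
  have "(\<lambda>p. ennreal (exp (fst p) / 2 * indicator {0..<2 * pi} (snd p) * indicator (box l u) (polar (fst p) (snd p)))) \<in> borel_measurable (borel :: (real \<times> real) measure)"
  proof -
    have "(\<lambda>p :: real \<times> real. polar (fst p) (snd p)) \<in> borel_measurable borel"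
      by (rule borel_measurable_continuous_onI) (auto simp: polar_def intro!: continuous_intros)
    moreover have "fst \<in> borel_measurable (borel :: (real \<times> real) measure)" "snd \<in> borel_measurable (borel :: (real \<times> real) measure)"
      by (simp_all add: borel_measurable_continuous_onI continuous_on_fst continuous_on_snd)
    ultimately show ?thesis by measurable
  qed
  then have "(\<integral>\<^sup>+ p. ennreal (exp (fst p) / 2 * indicator {0..<2 * pi} (snd p) * indicator (box l u) (polar (fst p) (snd p))) \<partial>lborel)
    = (\<integral>\<^sup>+ x. ennreal (exp (x $ 1) / 2 * indicator {0..<2 * pi} (x $ 2) * indicator (box l u) (polar (x $ 1) (x $ 2))) \<partial>(lborel :: (real ^ 2) measure))"
    by (subst lborel_real_pair, subst nn_integral_distr) (use ce in auto)
  moreover have ind: "indicator (box l u) (polar r t) = (indicator Q (vector [exp (r / 2) * cos t, exp (r / 2) * sin t]) :: real)" for r t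
    using Q[of "vector [exp (r / 2) * cos t, exp (r / 2) * sin t]"] by (simp add: polar_eq indicator_def)
  moreover have "(\<integral>\<^sup>+ x. ennreal (exp (x $ 1) / 2 * indicator {0..<2 * pi} (x $ 2) *
      indicator Q (vector [exp (x $ 1 / 2) * cos (x $ 2), exp (x $ 1 / 2) * sin (x $ 2)])) \<partial>(lborel :: (real ^ 2) measure)) = emeasure lborel Q"
    by (rule polar_area_real) (auto simp: Q_def)
  moreover have "emeasure lborel Q = emeasure lborel (box l u)"
    by (subst lborel_complex, subst emeasure_distr) (use ce Q in \<open>auto simp: vimage_def\<close>)
  ultimately show ?thesis by (simp only: ind)
qed

definition polar_density :: "(real ^ 'm) \<times> (real ^ 'm) \<Rightarrow> real" where
  "polar_density p = (\<Prod>j\<in>UNIV. exp (fst p $ j) / 2 * indicator {0..<2 * pi} (snd p $ j))"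

lemma polar_density_nonneg: "0 \<le> polar_density p"
  by (simp add: polar_density_def prod_nonneg)

lemma torus_point_polar: "torus_point \<rho> \<theta> $ j = polar (\<rho> $ j) (\<theta> $ j)"
  by (simp add: torus_point_def polar_def)

lemma measurable_torus_point: "(\<lambda>p. torus_point (fst p) (snd p)) \<in> borel_measurable borel"
  by (rule borel_measurable_continuous_onI) (auto simp: torus_point_def intro!: continuous_intros)

lemma measurable_polar_density: "polar_density \<in> borel_measurable borel"
proof -
  have m: "(\<lambda>p :: (real ^ 'm) \<times> (real ^ 'm). fst p $ j) \<in> borel_measurable borel" "(\<lambda>p :: (real ^ 'm) \<times> (real ^ 'm). snd p $ j) \<in> borel_measurable borel" for j
    by (rule borel_measurable_continuous_onI, intro continuous_intros)+
  show ?thesis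
    unfolding polar_density_def[abs_def]
    by (intro borel_measurable_prod borel_measurable_times borel_measurable_divide borel_measurable_const
        measurable_compose[OF m(1) borel_measurable_exp] measurable_compose[OF m(2) borel_measurable_indicator]) auto
qed

text \<open>It suffices to compare the measures of boxes. A box is a product of plane boxes, and on these the assertion is
  \<open>polar_area\<close>.\<close>

lemma lborel_torus:
  "(lborel :: (complex ^ 'm) measure) = distr (density lborel (\<lambda>p. ennreal (polar_density p))) borel (\<lambda>p. torus_point (fst p) (snd p))"
  (is "_ = distr ?D borel ?t")
proof (rule lborel_eqI_box)
  fix l u :: "complex ^ 'm"
  interpret product_sigma_finite "\<lambda>_::'m. lborel :: (real \<times> real) measure" ..
  let ?k = "\<lambda>j p. exp (fst p) / 2 * indicator {0..<2 * pi} (snd p) * indicator (box (l $ j) (u $ j)) (polar (fst p) (snd p)) :: real"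
  have mk: "?k j \<in> borel_measurable lborel" for j
  proof -
    have "(\<lambda>p :: real \<times> real. polar (fst p) (snd p)) \<in> borel_measurable borel"
      by (rule borel_measurable_continuous_onI) (auto simp: polar_def intro!: continuous_intros)
    moreover have "fst \<in> borel_measurable (borel :: (real \<times> real) measure)" "snd \<in> borel_measurable (borel :: (real \<times> real) measure)"
      by (simp_all add: borel_measurable_continuous_onI continuous_on_fst continuous_on_snd)
    ultimately show ?thesis by measurable
  qed
  have mt: "?t \<in> measurable lborel borel" "polar_density \<in> borel_measurable (lborel :: ((real ^ 'm) \<times> (real ^ 'm)) measure)"
    using measurable_torus_point measurable_polar_density by auto
  have B: "?t -` box l u \<in> sets lborel" using measurable_sets[OF mt(1), of "box l u"] by simp
  have "emeasure (distr ?D borel ?t) (box l u) = emeasure ?D (?t -` box l u)"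
    by (subst emeasure_distr) (use mt in auto)
  also have "\<dots> = (\<integral>\<^sup>+ p. ennreal (polar_density p) * indicator (?t -` box l u) p \<partial>lborel)"
    by (rule emeasure_density) (use mt B in auto)
  also have "\<dots> = (\<integral>\<^sup>+ p. ennreal (polar_density p * indicator (?t -` box l u) p) \<partial>lborel)"
    by (intro nn_integral_cong) (simp add: indicator_def)
  also have "\<dots> = (\<integral>\<^sup>+ w. ennreal (polar_density (pair_vectors w) * indicator (?t -` box l u) (pair_vectors w)) \<partial>Pi\<^sub>M UNIV (\<lambda>_. lborel))"
    by (subst lborel_pair_vectors, rule nn_integral_distr[OF measurable_pair_vectors])
       (use mt B in \<open>auto intro!: borel_measurable_times borel_measurable_indicator\<close>)
  also have "\<dots> = (\<integral>\<^sup>+ w. (\<Prod>j\<in>UNIV. ennreal (?k j (w j))) \<partial>Pi\<^sub>M UNIV (\<lambda>_. lborel))"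
  proof (intro nn_integral_cong)
    fix w :: "'m \<Rightarrow> real \<times> real"
    have ind: "indicator (?t -` box l u) (pair_vectors w) = (\<Prod>j\<in>UNIV. indicat_real (box (l $ j) (u $ j)) (polar (fst (w j)) (snd (w j))))"
      by (auto simp: indicator_def mem_box_vec torus_point_polar pair_vectors_def intro!: prod_zero)
    have "polar_density (pair_vectors w) * indicator (?t -` box l u) (pair_vectors w) = (\<Prod>j\<in>UNIV. ?k j (w j))"
      unfolding ind polar_density_def prod.distrib[symmetric] by (simp add: pair_vectors_def)
    also have "ennreal \<dots> = (\<Prod>j\<in>UNIV. ennreal (?k j (w j)))" by (rule prod_ennreal[symmetric]) simp
    finally show "ennreal (polar_density (pair_vectors w) * indicator (?t -` box l u) (pair_vectors w)) = (\<Prod>j\<in>UNIV. ennreal (?k j (w j)))" .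
  qed
  also have "\<dots> = (\<Prod>j\<in>UNIV. \<integral>\<^sup>+ p. ennreal (?k j p) \<partial>lborel)"
    by (rule product_nn_integral_prod) (use mk in auto)
  also have "\<dots> = (\<Prod>j\<in>UNIV. emeasure lborel (box (l $ j) (u $ j)))" by (simp only: polar_area)
  also have "\<dots> = emeasure lborel (box l u)" by (rule emeasure_lborel_box_vec[symmetric])
  finally show "emeasure (distr ?D borel ?t) (box l u) = emeasure lborel (box l u)" .
qed simp

lemma integral_polar_coordinates:
  fixes h :: "complex ^ 'm \<Rightarrow> complex"
  assumes "h \<in> borel_measurable borel"
  shows "(LINT z|lborel. h z) = (LINT (\<rho>, \<theta>) : UNIV \<times> angle_domain | lborel. complex_of_real (\<Prod>j\<in>UNIV. exp (\<rho> $ j) / 2) * h (torus_point \<rho> \<theta>))"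
proof -
  have m: "(\<lambda>p. h (torus_point (fst p) (snd p))) \<in> borel_measurable borel"
    by (rule measurable_compose[OF measurable_torus_point assms])
  have "(LINT z|lborel. h z) = (LINT p|density lborel (\<lambda>p. ennreal (polar_density p)). h (torus_point (fst p) (snd p)))"
    by (subst lborel_torus, rule integral_distr) (use measurable_torus_point assms in auto)
  also have "\<dots> = (LINT p|lborel. polar_density p *\<^sub>R h (torus_point (fst p) (snd p)))"
    by (rule integral_density[OF _ _ AE_I2[OF polar_density_nonneg]]) (use m measurable_polar_density in auto)
  also have "\<dots> = (LINT (\<rho>, \<theta>) : UNIV \<times> angle_domain | lborel. complex_of_real (\<Prod>j\<in>UNIV. exp (\<rho> $ j) / 2) * h (torus_point \<rho> \<theta>))"
    unfolding set_lebesgue_integral_def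
  proof (intro Bochner_Integration.integral_cong refl)
    fix p :: "(real ^ 'm) \<times> (real ^ 'm)"
    have ind: "(\<Prod>j\<in>UNIV. indicat_real {0..<2 * pi} (snd p $ j)) = indicator (UNIV \<times> angle_domain) p"
      by (cases p) (auto simp: angle_domain_def indicator_def not_less intro!: prod_zero)
    have "polar_density p = (\<Prod>j\<in>UNIV. exp (fst p $ j) / 2) * indicator (UNIV \<times> angle_domain) p"
      unfolding polar_density_def prod.distrib ind ..
    then show "polar_density p *\<^sub>R h (torus_point (fst p) (snd p)) = indicat_real (UNIV \<times> angle_domain) p *\<^sub>R
      (case p of (\<rho>, \<theta>) \<Rightarrow> complex_of_real (\<Prod>j\<in>UNIV. exp (\<rho> $ j) / 2) * h (torus_point \<rho> \<theta>))"
      by (cases p) (simp add: scaleR_conv_of_real indicator_def)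
  qed
  finally show ?thesis .
qed

section \<open>The Hessian and the density of the top power\<close>

lemma C2_hessian:
  fixes f :: "real ^ 'm \<Rightarrow> real"
  assumes f: "\<And>x. (f has_derivative (\<lambda>h. h \<bullet> (\<chi> i. g i x))) (at x)"
    and g: "\<And>i x. (g i has_derivative (\<lambda>h. h \<bullet> H i x)) (at x)" and H: "\<And>i. continuous_on UNIV (H i)"
  shows "Ck_on 2 UNIV f" "hessian f x $ a $ b = H b x $ a"
proof -
  have "Ck_on (Suc 0) UNIV (g i)" for i
    by (rule Ck_on_SucI[OF open_UNIV g]) (use H in \<open>auto intro!: continuous_intros\<close>)
  then have "Ck_on (Suc (Suc 0)) UNIV f"
    by (intro Ck_on_SucI[OF open_UNIV f]) (auto simp: inner_vec_def intro!: Ck_on_sum Ck_on_mult Ck_on_const simp del: Ck_on.simps)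
  then show "Ck_on 2 UNIV f" by (simp only: numeral_2_eq_2)
  have "partial b f = g b"
    by (rule ext) (simp add: partial_def frechet_derivative_eq[OF f] inner_axis')
  then show "hessian f x $ a $ b = H b x $ a"
    by (simp add: hessian_def partial_def frechet_derivative_eq[OF g] inner_axis')
qed

lemma det_scale: "det (\<chi> i j. M $ i $ j * c) = c ^ CARD('m) * det (M :: 'a::comm_ring_1 ^ 'm ^ 'm)"
  using det_scale_rows_columns[of "\<lambda>_. 1" M "\<lambda>_. c"] by simp

lemma continuous_top_density:
  fixes M :: "real ^ 'm \<Rightarrow> real ^ 'm ^ 'm"
  assumes M: "continuous_on UNIV M"
  shows "continuous_on torus (\<lambda>z. c * det (M (rho z)) * (\<Prod>j\<in>UNIV. inverse (pi * (cmod (z $ j))\<^sup>2)))"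
proof -
  have c: "continuous_on torus (\<lambda>z. M (rho z) $ i $ j)" for i j
    by (intro continuous_intros continuous_on_compose2[OF M continuous_rho]) auto
  have "continuous_on torus (\<lambda>z. det (M (rho z)))"
    unfolding det_def by (intro continuous_on_sum continuous_on_mult continuous_on_prod continuous_on_const c)
  then show ?thesis by (intro continuous_intros) (auto simp: torus_def)
qed

text \<open>On the torus point with coordinates \<open>\<rho>\<close> and \<open>\<theta>\<close> the squared modulus of \<open>z\<^sub>j\<close> is \<open>exp (\<rho> $ j)\<close>, and the Jacobian factor
  \<open>exp (\<rho> $ j) / 2\<close> cancels it up to \<open>1 / (2 * pi)\<close>.\<close>

lemma top_form_polar:
  fixes M :: "real ^ 'm \<Rightarrow> real ^ 'm ^ 'm"
  assumes M: "continuous_on UNIV M" and K: "compact K" "K \<subseteq> torus" "\<And>z. z \<notin> K \<Longrightarrow> \<phi> z = 0" and \<phi>: "continuous_on torus \<phi>"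
  shows "(LINT z:torus|lborel. complex_of_real (c * det (M (rho z)) * (\<Prod>j\<in>UNIV. inverse (pi * (cmod (z $ j))\<^sup>2))) * \<phi> z)
    = (LINT (\<rho>, \<theta>) : UNIV \<times> angle_domain | lborel.
        complex_of_real (c * det (\<chi> i j. M \<rho> $ i $ j / (2 * pi))) * \<phi> (torus_point \<rho> \<theta>))"
proof -
  let ?g = "\<lambda>z. c * det (M (rho z)) * (\<Prod>j\<in>UNIV. inverse (pi * (cmod (z $ j))\<^sup>2))"
  let ?h = "\<lambda>z. complex_of_real (?g z) * \<phi> z"
  have g: "continuous_on torus ?g" by (rule continuous_top_density[OF M])
  have h0: "?h z = 0" if "z \<notin> K" for z using K(3)[OF that] by simp
  have hm: "?h \<in> borel_measurable borel"
    by (rule borel_measurable_continuous_onI[OF continuous_on_zero_extension[OF K(1,2) open_torus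
          continuous_on_mult[OF continuous_on_of_real[OF g] \<phi>] h0]])
  have "(LINT z:torus|lborel. ?h z) = (LINT z|lborel. ?h z)" by (rule torus_integral_compact[OF K(2) h0])
  also have "\<dots> = (LINT (\<rho>, \<theta>) : UNIV \<times> angle_domain | lborel. complex_of_real (\<Prod>j\<in>UNIV. exp (\<rho> $ j) / 2) * ?h (torus_point \<rho> \<theta>))"
    by (rule integral_polar_coordinates[OF hm])
  also have "(\<lambda>(\<rho>, \<theta>). complex_of_real (\<Prod>j\<in>UNIV. exp (\<rho> $ j) / 2) * ?h (torus_point \<rho> \<theta>))
    = (\<lambda>(\<rho>, \<theta>). complex_of_real (c * det (\<chi> i j. M \<rho> $ i $ j / (2 * pi))) * \<phi> (torus_point \<rho> \<theta>))"
  proof (intro ext, clarify)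
    fix \<rho> \<theta> :: "real ^ 'm"
    have n: "(cmod (torus_point \<rho> \<theta> $ j))\<^sup>2 = exp (\<rho> $ j)" for j
      by (simp add: torus_point_def power2_eq_square flip: exp_add)
    have r: "rho (torus_point \<rho> \<theta>) = \<rho>" by (simp add: rho_def n vec_eq_iff)
    have "(\<Prod>j\<in>UNIV. exp (\<rho> $ j) / 2) * ?g (torus_point \<rho> \<theta>)
      = c * det (M \<rho>) * (\<Prod>j\<in>UNIV. exp (\<rho> $ j) / 2 * inverse (pi * exp (\<rho> $ j)))"
      unfolding n r prod.distrib by simp
    also have "(\<Prod>j\<in>(UNIV :: 'm set). exp (\<rho> $ j) / 2 * inverse (pi * exp (\<rho> $ j))) = (inverse (2 * pi)) ^ CARD('m)"
      by (simp add: field_simps)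
    also have "c * det (M \<rho>) * (inverse (2 * pi)) ^ CARD('m) = c * det (\<chi> i j. M \<rho> $ i $ j / (2 * pi))"
      unfolding divide_inverse det_scale by simp
    finally have e: "(\<Prod>j\<in>UNIV. exp (\<rho> $ j) / 2) * ?g (torus_point \<rho> \<theta>) = c * det (\<chi> i j. M \<rho> $ i $ j / (2 * pi))" .
    show "complex_of_real (\<Prod>j\<in>UNIV. exp (\<rho> $ j) / 2) * ?h (torus_point \<rho> \<theta>)
      = complex_of_real (c * det (\<chi> i j. M \<rho> $ i $ j / (2 * pi))) * \<phi> (torus_point \<rho> \<theta>)"
      by (simp only: e[symmetric] of_real_mult mult.assoc)
  qed
  finally show "(LINT z:torus|lborel. ?h z) = (LINT (\<rho>, \<theta>) : UNIV \<times> angle_domain | lborel.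
        complex_of_real (c * det (\<chi> i j. M \<rho> $ i $ j / (2 * pi))) * \<phi> (torus_point \<rho> \<theta>))" .
qed

theorem theorem1:
  fixes n k :: nat and u :: "complex ^ 'm::{finite,linorder} \<Rightarrow> real"
  assumes n: "n \<ge> 1"
    and k: "1 \<le> k" "k \<le> CARD('m)"
    and u: "u = (\<lambda>z. F n (rho z))"
  shows "Ck_on 2 UNIV (F n :: (real, 'm) vec \<Rightarrow> real) \<and>
    continuous_form_on torus k k (\<lambda>z. wedge_power k (ddc (function_form u) z)) \<and>
    (\<forall>\<phi>. test_form \<phi> \<longrightarrow>
       ddc_power u k \<phi> = form_current (\<lambda>z. wedge_power k (ddc (function_form u) z)) \<phi>) \<and>
    (k = CARD('m) \<longrightarrow>
       (\<forall>\<phi>. test_form \<phi> \<longrightarrow>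
          ddc_power u k \<phi> =
            (LINT (\<rho>, \<theta>) : UNIV \<times> angle_domain | lborel.
               complex_of_real (fact CARD('m) *
                  det (\<chi> i j. hessian (F n) \<rho> $ i $ j / (2 * pi)))
               * \<phi> (torus_point \<rho> \<theta>) {})) \<and>
       (\<exists>g :: (complex, 'm) vec \<Rightarrow> real. continuous_on torus g \<and>
          (\<forall>\<phi>. test_form \<phi> \<longrightarrow>
             ddc_power u k \<phi> = (LINT z : torus | lborel. complex_of_real (g z) * \<phi> z {}))))"
proof -
  obtain g :: "'m \<Rightarrow> real ^ 'm::{finite,linorder} \<Rightarrow> real" and H B
    where f: "\<And>x. (F n has_derivative (\<lambda>h. h \<bullet> (\<chi> i. g i x))) (at x)"
      and g: "\<And>i x. (g i has_derivative (\<lambda>h. h \<bullet> H i x)) (at x)"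
      and H: "\<And>i. continuous_on UNIV (H i)"
      and gB: "\<And>x. norm (\<chi> i. g i x) \<le> B" and HB: "\<And>i x. norm (H i x) \<le> B"
    by (rule F_C2_data[OF n]) blast
  note C2 = C2_hessian[OF f g H]
  have power: "wedge_power k (ddc (function_form u) z) = coeff (curvature H z ^ k)" if "z \<in> torus" for z
    unfolding u ddc_function_form[OF that f g H] by (rule wedge_power_coeff)
  have current: "ddc_power u j \<phi> = form_current (\<lambda>z. coeff (curvature H z ^ j)) \<phi>" if "test_form \<phi>" for j \<phi>
    unfolding u by (rule ddc_power_curvature[OF f g H gB HB that])
  have form: "continuous_form_on torus k k (\<lambda>z. wedge_power k (ddc (function_form u) z))"
    using continuous_form_curvature_power[of H k, OF H] unfolding continuous_form_on_def
    by (simp add: power cong: continuous_on_cong)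
  have eq: "ddc_power u k \<phi> = form_current (\<lambda>z. wedge_power k (ddc (function_form u) z)) \<phi>" if "test_form \<phi>" for \<phi>
    unfolding current[OF that] by (rule form_current_cong) (simp add: power)
  have top: "ddc_power u CARD('m) \<phi> = (LINT z:torus|lborel. complex_of_real (fact CARD('m) * det (hessian (F n) (rho z)) *
      (\<Prod>j\<in>UNIV. inverse (pi * (cmod (z $ j))\<^sup>2))) * \<phi> z {})" if "test_form \<phi>" for \<phi>
    unfolding current[OF that] by (rule form_current_curvature_top) (simp add: C2(2))
  have hess: "hessian (F n) = (\<lambda>x. \<chi> a b. H b x $ a)" by (simp add: fun_eq_iff vec_eq_iff C2(2))
  have M: "continuous_on UNIV (hessian (F n) :: real ^ 'm::{finite,linorder} \<Rightarrow> real ^ 'm::{finite,linorder} ^ 'm::{finite,linorder})"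
    unfolding hess by (intro continuous_on_vec_lambda continuous_on_component H)
  have polar: "ddc_power u CARD('m) \<phi> = (LINT (\<rho>, \<theta>) : UNIV \<times> angle_domain | lborel.
      complex_of_real (fact CARD('m) * det (\<chi> i j. hessian (F n) \<rho> $ i $ j / (2 * pi))) * \<phi> (torus_point \<rho> \<theta>) {})"
    if \<phi>: "test_form \<phi>" for \<phi>
  proof -
    obtain K where K: "compact K" "K \<subseteq> torus" and \<phi>0: "\<And>z S. z \<notin> K \<Longrightarrow> \<phi> z S = 0" and \<phi>k: "\<And>k S. Ck_on k torus (\<lambda>z. \<phi> z S)"
      by (rule test_formD[OF \<phi>]) blast
    show ?thesis
      unfolding top[OF \<phi>] by (rule top_form_polar[OF M K \<phi>0 Ck_on_continuous[OF \<phi>k[of 0]]])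
  qed
  have "continuous_on torus (\<lambda>z :: complex ^ 'm::{finite,linorder}. fact CARD('m) * det (hessian (F n) (rho z)) * (\<Prod>j\<in>UNIV. inverse (pi * (cmod (z $ j))\<^sup>2)))"
    by (rule continuous_top_density[OF M])
  then show ?thesis using C2(1) form eq top polar by blast
qed

end
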